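(* Let $n\geqslant 2$ and let $G$ and $G_*$ be two groups of Möbius transformations of the unit ball $\mathbb{B}^n$ onto itself, acting discontinuously on $\mathbb{B}^n$ and not having fixed points in $\mathbb{B}^n$. Let $D$ and $D_*$ be domains in $\mathbb{B}^n/G$ and $\mathbb{B}^n/G_*$, respectively, having compact closures $\overline{D}$ and $\overline{D_*}$. Let $f:D\rightarrow D_*$ be an open discrete almost everywhere differentiable mapping, $f\in ACP^{-1}$, having the $N$- and $N^{-1}$-Luzin properties. Suppose that $\Gamma$ is a family of paths in $D$, and let $f(\Gamma)=\{f\circ\gamma:\gamma\in\Gamma\}$. Then $$M(f(\Gamma))\leqslant\int_D K_I(p,f)\cdot\rho^n(p)\,d\widetilde{h}(p)\qquad\text{for every }\rho\in\mathrm{adm}\,\Gamma.$$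
   Context: Groups and quotient. $\mathbb{B}^n$ is the open unit ball of $\mathbb{R}^n$ with hyperbolic distance $h(x,y)=\log\frac{1+t}{1-t}$, $t=\frac{|x-y|}{\sqrt{|x-y|^2+(1-|x|^2)(1-|y|^2)}}$, which is invariant under Möbius transformations of $\mathbb{B}^n$ onto itself. A group $G$ of such transformations acts discontinuously on $\mathbb{B}^n$ if each $x\in\mathbb{B}^n$ has a neighborhood $U$ with $g(U)\cap U=\varnothing$ for all but finitely many $g\in G$; $G$ has no fixed points in $\mathbb{B}^n$ if $g(a)=a$ with $a\in\mathbb{B}^n$, $g\in G$, is possible only for $g=I$ (identity). $\mathbb{B}^n/G$ is the space of orbits, $\pi:\mathbb{B}^n\to\mathbb{B}^n/G$ the natural projection, and $\widetilde h(p_1,p_2)=\inf_{g_1,g_2\in G}h(g_1(z_1),g_2(z_2))$, where $p_i=\pi(z_i)$. If $G$ is a group of Möbius transformations of $\mathbb{B}^n$, $n\geqslant 2$, onto itself, acting discontinuously on $\mathbb{B}^n$ and not having fixed points in $\mathbb{B}^n$, then $\widetilde h$ is a metric on $\mathbb{B}^n/G$ inducing its topology, $\pi$ is a local homeomorphism, and the local inverses of $\pi$ are charts ("local coordinates") with conformal transition maps. The corresponding objects for $G_*$ are denoted $\pi_*$, $\widetilde{h_*}$. A domain is a nonempty open connected set. Mappings $f:D\to D_*$ are continuous. Measure. For a (measurable) set $A\subset\mathbb{B}^n/G$ its hyperbolic measure, also denoted $\widetilde h(A)$, is $V(P\cap\pi^{-1}(A))$, where $V(E)=\int_E\frac{2^n\,dm(x)}{(1-|x|^2)^n}$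 ($m$ is Lebesgue measure) and $P=\{p\in\mathbb{B}^n: h(p,p_0)<h(p,T(p_0))\ \text{for all } T\in G\setminus\{I\}\}$ is a normal fundamental polyhedron with center $p_0$. Integration with respect to this measure is denoted $d\widetilde h$; "almost everywhere" refers to it. Paths and modulus. A path in $\mathbb{B}^n/G$ is a continuous map of a finite segment, interval or half-interval into $\mathbb{B}^n/G$. The length of $\gamma:[a,b]\to\mathbb{B}^n/G$ is the supremum of $\sum_k\widetilde h(\gamma(t_k),\gamma(t_{k+1}))$ over partitions of $[a,b]$; $\gamma$ is locally rectifiable if every closed subpath has finite length. For a rectifiable path $\gamma$ with arc-length (normal) representation $\gamma^0:[0,l(\gamma)]\to\mathbb{B}^n/G$, $\int_\gamma\rho\,ds_{\widetilde h}=\int_0^{l(\gamma)}\rho(\gamma^0(s))\,ds$; for locally rectifiable $\gamma$ one takes the supremum over closed subpaths. A Borel function $\rho:\mathbb{B}^n/G\to[0,\infty]$ is admissible for a family $\Gamma$ of paths, $\rho\in\mathrm{adm}\,\Gamma$, if $\int_\gamma\rho\,ds_{\widetilde h}\geqslant1$ for each locally rectifiable $\gamma\in\Gamma$; $M(\Gamma)=\inf_{\rho\in\mathrm{adm}\,\Gamma}\int_{\mathbb{B}^n/G}\rho^n\,d\widetilde h$. A property holds for almost all paths if the family of paths for which it fails has modulus zero. Classes of mappings. $f:D\to D_*$ is discrete if $f^{-1}(y)$ consists of isolated points for each $y\in D_*$; open if images of open subsets of $D$ are open. $f$ has the $N$-Luzin property if $\widetilde{h_*}(f(E))=0$ whenever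 $E\subset D$, $\widetilde h(E)=0$; it has the $N^{-1}$-Luzin property if $\widetilde h(f^{-1}(E_* ))=0$ whenever $E_*\subset D_*$, $\widetilde{h_*}(E_* )=0$. Almost everywhere differentiability is understood in local coordinates. For a locally rectifiable path $\gamma$ on an interval $\Delta$ with base point $t_0$ ($t_0=a$ if $\gamma$ is defined on $[a,b]$ or $[a,b)$), $l_\gamma(t)$ is the length of $\gamma|_{[t_0,t]}$ for $t>t_0$, minus the length of $\gamma|_{[t,t_0]}$ for $t<t_0$, and $l_\gamma(t_0)=0$; $\Delta_\gamma=l_\gamma(\Delta)$. If $\widetilde\gamma=f\circ\gamma$ is also locally rectifiable, $L_{\gamma,f}:\Delta_\gamma\to\Delta_{\widetilde\gamma}$ is the unique non-decreasing function with $L_{\gamma,f}(l_\gamma(t))=l_{\widetilde\gamma}(t)$ for all $t\in\Delta$. For $f$ sending no (nonconstant) path to a point, $f\in ACP^{-1}$ means: for almost all paths $\widetilde\gamma$ in $f(D)$, each lift $\gamma$ of $\widetilde\gamma$ (a path in $D$ with $f\circ\gamma=\widetilde\gamma$) is locally rectifiable and $L_{\gamma,f}^{-1}$ is absolutely continuous on all closed segments lying in $\Delta_{\widetilde\gamma}$. Dilatation. For $F$ between domains in $\mathbb{R}^n$, differentiable at $x$, put $l(F'(x))=\min_{|v|=1}|F'(x)v|$, $J(x,F)=\det F'(x)$, and $K_I(x,F)=|J(x,F)|/l(F'(x))^n$ if $J(x,F)\ne0$, $K_I(x,F)=1$ if $F'(x)=0$, $K_I(x,F)=\infty$ otherwise.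 For $f:D\to D_*$, $K_I(p,f)=K_I(\varphi(p),\psi\circ f\circ\varphi^{-1})$, where $\varphi$, $\psi$ are local coordinates (local inverses of $\pi$, $\pi_*$) at $p$ and $f(p)$; this does not depend on the choice. *)

theory Defs
  imports "HOL-Analysis.Analysis" "HOL-Algebra.Bij"
begin

section \<open>Moebius transformations of the unit ball\<close>

text \<open>As in the library's Alexandroff compactification, the one-point compactification of
  \<open>real^'n\<close> is carried by \<open>(real^'n) option\<close>, with \<open>None\<close> as the point at infinity.\<close>

abbreviation unit_ball :: "(real^'n) set"
  where "unit_ball \<equiv> ball 0 1"

definition sphere_reflection :: "real^'n \<Rightarrow> real \<Rightarrow> (real^'n) option \<Rightarrow> (real^'n) option"
  where "sphere_reflection c r z =
    (case z of None \<Rightarrow> Some c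
     | Some x \<Rightarrow> if x = c then None else Some (c + (r / norm (x - c))\<^sup>2 *\<^sub>R (x - c)))"

text \<open>Reflection in the hyperplane \<open>{x. x \<bullet> u = c}\<close>, \<open>u \<noteq> 0\<close>.\<close>

definition hyperplane_reflection :: "real^'n \<Rightarrow> real \<Rightarrow> (real^'n) option \<Rightarrow> (real^'n) option"
  where "hyperplane_reflection u c =
    map_option (\<lambda>x. x - (2 * (x \<bullet> u - c) / (norm u)\<^sup>2) *\<^sub>R u)"

text \<open>Finite compositions of reflections; orientation-reversing maps are included.\<close>

inductive_set moebius_maps :: "((real^'n) option \<Rightarrow> (real^'n) option) set"
  where
    moebius_id: "id \<in> moebius_maps"
  | moebius_sphere: "T \<in> moebius_maps \<Longrightarrow> r > 0 \<Longrightarrow> sphere_reflection c r \<circ> T \<in> moebius_maps"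
  | moebius_hyperplane: "T \<in> moebius_maps \<Longrightarrow> u \<noteq> 0 \<Longrightarrow> hyperplane_reflection u c \<circ> T \<in> moebius_maps"

text \<open>Self-maps of the ball are functions that are \<open>undefined\<close> off the ball; membership in
  \<open>BijGroup unit_ball\<close> contains the requirement that they map the ball onto itself.\<close>

definition moebius_group :: "(real^'n \<Rightarrow> real^'n) set \<Rightarrow> bool"
  where "moebius_group G \<longleftrightarrow>
    subgroup G (BijGroup unit_ball) \<and>
    (\<forall>g\<in>G. \<exists>T\<in>moebius_maps. \<forall>x\<in>unit_ball. T (Some x) = Some (g x))"

definition acts_discontinuously :: "(real^'n \<Rightarrow> real^'n) set \<Rightarrow> bool"
  where "acts_discontinuously G \<longleftrightarrow>
    (\<forall>x\<in>unit_ball. \<exists>U. open U \<and> x \<in> U \<and> U \<subseteq> unit_ball \<and> finite {g \<in> G. g ` U \<inter> U \<noteq> {}})"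

definition no_fixed_points :: "(real^'n \<Rightarrow> real^'n) set \<Rightarrow> bool"
  where "no_fixed_points G \<longleftrightarrow>
    (\<forall>g\<in>G. \<forall>x\<in>unit_ball. g x = x \<longrightarrow> g = \<one>\<^bsub>BijGroup unit_ball\<^esub>)"


section \<open>The orbit space and its metric\<close>

definition orbit_proj :: "(real^'n \<Rightarrow> real^'n) set \<Rightarrow> real^'n \<Rightarrow> (real^'n) set"
  where "orbit_proj G x = (\<lambda>g. g x) ` G"

definition orbit_space :: "(real^'n \<Rightarrow> real^'n) set \<Rightarrow> (real^'n) set topology"
  where "orbit_space G =
    topology (\<lambda>A. A \<subseteq> orbit_proj G ` unit_ball \<and> open {x \<in> unit_ball. orbit_proj G x \<in> A})"

lemma openin_orbit_space:
  "openin (orbit_space G) A \<longleftrightarrow>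
    A \<subseteq> orbit_proj G ` unit_ball \<and> open {x \<in> unit_ball. orbit_proj G x \<in> A}"
proof -
  have "istopology (\<lambda>A. A \<subseteq> orbit_proj G ` unit_ball \<and> open {x \<in> unit_ball. orbit_proj G x \<in> A})"
    unfolding istopology_def
  proof (intro conjI allI impI)
    fix S T
    assume S: "S \<subseteq> orbit_proj G ` unit_ball \<and> open {x \<in> unit_ball. orbit_proj G x \<in> S}"
      and T: "T \<subseteq> orbit_proj G ` unit_ball \<and> open {x \<in> unit_ball. orbit_proj G x \<in> T}"
    have "{x \<in> unit_ball. orbit_proj G x \<in> S \<inter> T} =
        {x \<in> unit_ball. orbit_proj G x \<in> S} \<inter> {x \<in> unit_ball. orbit_proj G x \<in> T}"
      by auto
    then show "open {x \<in> unit_ball. orbit_proj G x \<in> S \<inter> T}"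
      using S T by (simp add: open_Int)
    show "S \<inter> T \<subseteq> orbit_proj G ` unit_ball" using S by blast
  next
    fix \<K>
    assume K: "\<forall>S\<in>\<K>. S \<subseteq> orbit_proj G ` unit_ball \<and> open {x \<in> unit_ball. orbit_proj G x \<in> S}"
    have "{x \<in> unit_ball. orbit_proj G x \<in> \<Union>\<K>} = (\<Union>S\<in>\<K>. {x \<in> unit_ball. orbit_proj G x \<in> S})"
      by auto
    then show "open {x \<in> unit_ball. orbit_proj G x \<in> \<Union>\<K>}"
      using K by (simp only:) (rule open_UN, blast)
    show "\<Union>\<K> \<subseteq> orbit_proj G ` unit_ball" using K by blast
  qed
  then show ?thesis
    by (simp add: orbit_space_def topology_inverse')
qed

lemma topspace_orbit_space: "topspace (orbit_space G) = orbit_proj G ` unit_ball"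
proof
  show "topspace (orbit_space G) \<subseteq> orbit_proj G ` unit_ball"
    using openin_topspace[of "orbit_space G"] unfolding openin_orbit_space by blast
  have "{x \<in> unit_ball. orbit_proj G x \<in> orbit_proj G ` unit_ball} = unit_ball" by auto
  then show "orbit_proj G ` unit_ball \<subseteq> topspace (orbit_space G)"
    by (intro openin_subset) (simp only: openin_orbit_space, simp)
qed

definition hyp_dist :: "real^'n \<Rightarrow> real^'n \<Rightarrow> real"
  where "hyp_dist x y =
    (let t = norm (x - y) / sqrt ((norm (x - y))\<^sup>2 + (1 - (norm x)\<^sup>2) * (1 - (norm y)\<^sup>2))
     in ln ((1 + t) / (1 - t)))"

text \<open>For \<open>p = orbit_proj G z\<close> the points \<open>g z\<close>, \<open>g \<in> G\<close>, are exactly the elements of \<open>p\<close>.\<close>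

definition orbit_dist :: "(real^'n) set \<Rightarrow> (real^'n) set \<Rightarrow> real"
  where "orbit_dist p q = (INF (x, y)\<in>p \<times> q. hyp_dist x y)"


section \<open>Hyperbolic measure\<close>

definition hyp_volume :: "(real^'n) measure"
  where "hyp_volume =
    density (restrict_space lebesgue unit_ball)
      (\<lambda>x. ennreal (2 ^ CARD('n) / (1 - (norm x)\<^sup>2) ^ CARD('n)))"

definition normal_polyhedron :: "(real^'n \<Rightarrow> real^'n) set \<Rightarrow> real^'n \<Rightarrow> (real^'n) set"
  where "normal_polyhedron G p0 =
    {p \<in> unit_ball. \<forall>T \<in> G - {\<one>\<^bsub>BijGroup unit_ball\<^esub>}. hyp_dist p p0 < hyp_dist p (T p0)}"

text \<open>The measurable sets of the orbit space are those with Lebesgue measurable preimage in the ball.\<close>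

definition orbit_measurable_sets :: "(real^'n \<Rightarrow> real^'n) set \<Rightarrow> (real^'n) set set set"
  where "orbit_measurable_sets G =
    {A. A \<subseteq> orbit_proj G ` unit_ball \<and> {x \<in> unit_ball. orbit_proj G x \<in> A} \<in> sets lebesgue}"

definition orbit_measure :: "(real^'n \<Rightarrow> real^'n) set \<Rightarrow> real^'n \<Rightarrow> (real^'n) set measure"
  where "orbit_measure G p0 =
    measure_of (orbit_proj G ` unit_ball) (orbit_measurable_sets G)
      (\<lambda>A. emeasure hyp_volume {x \<in> normal_polyhedron G p0. orbit_proj G x \<in> A})"

lemma sigma_algebra_orbit_measurable_sets:
  "sigma_algebra (orbit_proj G ` unit_ball) (orbit_measurable_sets G)"
  unfolding sigma_algebra_iff2
proof (intro conjI ballI allI impI)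
  show "orbit_measurable_sets G \<subseteq> Pow (orbit_proj G ` unit_ball)"
    by (auto simp: orbit_measurable_sets_def)
  show "{} \<in> orbit_measurable_sets G" by (simp add: orbit_measurable_sets_def)
next
  fix A assume A: "A \<in> orbit_measurable_sets G"
  have eq: "{x \<in> unit_ball. orbit_proj G x \<in> orbit_proj G ` unit_ball - A} =
      unit_ball - {x \<in> unit_ball. orbit_proj G x \<in> A}"
    by auto
  have "unit_ball - {x \<in> unit_ball. orbit_proj G x \<in> A} \<in> sets lebesgue"
    using A by (intro sets.Diff) (auto simp: orbit_measurable_sets_def)
  then show "orbit_proj G ` unit_ball - A \<in> orbit_measurable_sets G"
    unfolding orbit_measurable_sets_def using eq by auto
next
  fix A :: "nat \<Rightarrow> _" assume A: "range A \<subseteq> orbit_measurable_sets G"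
  have eq: "{x \<in> unit_ball. orbit_proj G x \<in> (\<Union>i. A i)} =
      (\<Union>i. {x \<in> unit_ball. orbit_proj G x \<in> A i})"
    by auto
  have "(\<Union>i. {x \<in> unit_ball. orbit_proj G x \<in> A i}) \<in> sets lebesgue"
    using A by (intro sets.countable_UN) (auto simp: orbit_measurable_sets_def)
  moreover have "(\<Union>i. A i) \<subseteq> orbit_proj G ` unit_ball"
    using A by (force simp: orbit_measurable_sets_def)
  ultimately show "(\<Union>i. A i) \<in> orbit_measurable_sets G"
    unfolding orbit_measurable_sets_def using eq by auto
qed

lemma space_orbit_measure: "space (orbit_measure G p0) = orbit_proj G ` unit_ball"
  unfolding orbit_measure_def
  by (rule space_measure_of) (auto simp: orbit_measurable_sets_def)

lemma sets_orbit_measure: "sets (orbit_measure G p0) = orbit_measurable_sets G"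
  unfolding orbit_measure_def
  by (rule sigma_algebra.sets_measure_of_eq[OF sigma_algebra_orbit_measurable_sets])

lemma emeasure_orbit_measure:
  assumes P: "normal_polyhedron G p0 \<in> sets lebesgue" and A: "A \<in> orbit_measurable_sets G"
  shows "emeasure (orbit_measure G p0) A =
    emeasure hyp_volume {x \<in> normal_polyhedron G p0. orbit_proj G x \<in> A}"
  unfolding orbit_measure_def
proof (rule emeasure_measure_of_sigma[OF sigma_algebra_orbit_measurable_sets _ _ A])
  let ?E = "\<lambda>A. {x \<in> normal_polyhedron G p0. orbit_proj G x \<in> A}"
  have meas: "?E A \<in> sets hyp_volume" if "A \<in> orbit_measurable_sets G" for A
  proof -
    have "?E A = normal_polyhedron G p0 \<inter> {x \<in> unit_ball. orbit_proj G x \<in> A}"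
      by (auto simp: normal_polyhedron_def)
    also have "\<dots> \<in> sets lebesgue"
      using P that by (intro sets.Int) (auto simp: orbit_measurable_sets_def)
    finally show ?thesis
      by (auto simp: hyp_volume_def sets_restrict_space_iff normal_polyhedron_def)
  qed
  show "positive (orbit_measurable_sets G) (\<lambda>A. emeasure hyp_volume (?E A))"
    by (simp add: positive_def)
  show "countably_additive (orbit_measurable_sets G) (\<lambda>A. emeasure hyp_volume (?E A))"
  proof (rule countably_additiveI)
    fix A :: "nat \<Rightarrow> _"
    assume A: "range A \<subseteq> orbit_measurable_sets G" and disj: "disjoint_family A"
    have "disjoint_family (\<lambda>i. ?E (A i))"
      using disj by (fastforce simp: disjoint_family_on_def)
    then have "(\<Sum>i. emeasure hyp_volume (?E (A i))) = emeasure hyp_volume (\<Union>i. ?E (A i))"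
      using A meas by (intro suminf_emeasure) auto
    also have "(\<Union>i. ?E (A i)) = ?E (\<Union>i. A i)" by auto
    finally show "(\<Sum>i. emeasure hyp_volume (?E (A i))) = emeasure hyp_volume (?E (\<Union>i. A i))" .
  qed
qed

definition borel_of :: "'a topology \<Rightarrow> 'a measure"
  where "borel_of X = sigma (topspace X) {U. openin X U}"


section \<open>Paths, length and modulus\<close>

text \<open>A path is given by its parameter interval and a function, whose values off the interval are
  irrelevant.\<close>

type_synonym 'a curve = "real set \<times> (real \<Rightarrow> 'a)"

definition param_interval :: "real set \<Rightarrow> bool"
  where "param_interval \<Delta> \<longleftrightarrow>
    (\<exists>a b. a < b \<and> (\<Delta> = {a..b} \<or> \<Delta> = {a<..<b} \<or> \<Delta> = {a..<b} \<or> \<Delta> = {a<..b}))"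

definition paths_in :: "'a topology \<Rightarrow> 'a set \<Rightarrow> 'a curve set"
  where "paths_in X S =
    {(\<Delta>, \<gamma>). param_interval \<Delta> \<and> continuous_map (top_of_set \<Delta>) X \<gamma> \<and> \<gamma> ` \<Delta> \<subseteq> S}"

definition image_family :: "('a \<Rightarrow> 'b) \<Rightarrow> 'a curve set \<Rightarrow> 'b curve set"
  where "image_family f \<Gamma> = {(\<Delta>, f \<circ> \<gamma>) | \<Delta> \<gamma>. (\<Delta>, \<gamma>) \<in> \<Gamma>}"

definition curve_length :: "('a \<Rightarrow> 'a \<Rightarrow> real) \<Rightarrow> (real \<Rightarrow> 'a) \<Rightarrow> real \<Rightarrow> real \<Rightarrow> ennreal"
  where "curve_length d \<gamma> a b =
    (SUP (N, t) \<in> {(N::nat, t). t 0 = a \<and> t N = b \<and> (\<forall>k<N. t k \<le> t (Suc k))}.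
      \<Sum>k<N. ennreal (d (\<gamma> (t k)) (\<gamma> (t (Suc k)))))"

definition locally_rectifiable :: "('a \<Rightarrow> 'a \<Rightarrow> real) \<Rightarrow> 'a curve \<Rightarrow> bool"
  where "locally_rectifiable d c \<longleftrightarrow>
    (case c of (\<Delta>, \<gamma>) \<Rightarrow> \<forall>a b. a \<le> b \<and> {a..b} \<subseteq> \<Delta> \<longrightarrow> curve_length d \<gamma> a b < \<infinity>)"

text \<open>The choice of \<open>t\<close> is immaterial: \<open>\<gamma>\<close> is constant on every interval on which the length
  function is constant.\<close>

definition normal_representation ::
    "('a \<Rightarrow> 'a \<Rightarrow> real) \<Rightarrow> (real \<Rightarrow> 'a) \<Rightarrow> real \<Rightarrow> real \<Rightarrow> real \<Rightarrow> 'a"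
  where "normal_representation d \<gamma> a b s =
    \<gamma> (SOME t. t \<in> {a..b} \<and> curve_length d \<gamma> a t = ennreal s)"

definition segment_integral ::
    "('a \<Rightarrow> 'a \<Rightarrow> real) \<Rightarrow> ('a \<Rightarrow> ennreal) \<Rightarrow> (real \<Rightarrow> 'a) \<Rightarrow> real \<Rightarrow> real \<Rightarrow> ennreal"
  where "segment_integral d \<rho> \<gamma> a b =
    (\<integral>\<^sup>+ s\<in>{0..enn2real (curve_length d \<gamma> a b)}. \<rho> (normal_representation d \<gamma> a b s) \<partial>lborel)"

text \<open>On a closed parameter interval the supremum is attained at the whole path.\<close>

definition curve_integral ::
    "('a \<Rightarrow> 'a \<Rightarrow> real) \<Rightarrow> ('a \<Rightarrow> ennreal) \<Rightarrow> 'a curve \<Rightarrow> ennreal"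
  where "curve_integral d \<rho> c =
    (case c of (\<Delta>, \<gamma>) \<Rightarrow>
      SUP (a, b) \<in> {(a, b). a \<le> b \<and> {a..b} \<subseteq> \<Delta>}. segment_integral d \<rho> \<gamma> a b)"

definition admissible ::
    "(real^'n \<Rightarrow> real^'n) set \<Rightarrow> (real^'n) set curve set \<Rightarrow> ((real^'n) set \<Rightarrow> ennreal) set"
  where "admissible G \<Gamma> =
    {\<rho> \<in> borel_measurable (borel_of (orbit_space G)).
      \<forall>c\<in>\<Gamma>. locally_rectifiable orbit_dist c \<longrightarrow> 1 \<le> curve_integral orbit_dist \<rho> c}"

text \<open>\<open>p0\<close> is the centre of the fundamental polyhedron that defines the measure.\<close>

definition modulus ::
    "(real^'n \<Rightarrow> real^'n) set \<Rightarrow> real^'n \<Rightarrow> (real^'n) set curve set \<Rightarrow> ennreal"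
  where "modulus G p0 \<Gamma> =
    (INF \<rho> \<in> admissible G \<Gamma>. \<integral>\<^sup>+ p. \<rho> p ^ CARD('n) \<partial>orbit_measure G p0)"


section \<open>Classes of mappings\<close>

definition domain_in :: "'a topology \<Rightarrow> 'a set \<Rightarrow> bool"
  where "domain_in X D \<longleftrightarrow> D \<noteq> {} \<and> openin X D \<and> connectedin X D"

definition discrete_mapping :: "'a topology \<Rightarrow> 'a set \<Rightarrow> 'b set \<Rightarrow> ('a \<Rightarrow> 'b) \<Rightarrow> bool"
  where "discrete_mapping X D D' f \<longleftrightarrow>
    (\<forall>y\<in>D'. \<forall>p\<in>{p \<in> D. f p = y}. \<exists>U. openin X U \<and> U \<inter> {p \<in> D. f p = y} = {p})"

definition luzin_N ::
    "(real^'n \<Rightarrow> real^'n) set \<Rightarrow> real^'n \<Rightarrow> (real^'n) set set \<Rightarrow> (real^'n \<Rightarrow> real^'n) set \<Rightarrow> real^'n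
      \<Rightarrow> ((real^'n) set \<Rightarrow> (real^'n) set) \<Rightarrow> bool"
  where "luzin_N G p0 D G' p0' f \<longleftrightarrow>
    (\<forall>E. E \<subseteq> D \<and> E \<in> null_sets (orbit_measure G p0) \<longrightarrow> f ` E \<in> null_sets (orbit_measure G' p0'))"

definition luzin_N_inverse ::
    "(real^'n \<Rightarrow> real^'n) set \<Rightarrow> real^'n \<Rightarrow> (real^'n) set set \<Rightarrow>
      (real^'n \<Rightarrow> real^'n) set \<Rightarrow> real^'n \<Rightarrow> (real^'n) set set
      \<Rightarrow> ((real^'n) set \<Rightarrow> (real^'n) set) \<Rightarrow> bool"
  where "luzin_N_inverse G p0 D G' p0' D' f \<longleftrightarrow>
    (\<forall>E. E \<subseteq> D' \<and> E \<in> null_sets (orbit_measure G' p0') \<longrightarrow>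
      {p \<in> D. f p \<in> E} \<in> null_sets (orbit_measure G p0))"

text \<open>\<open>\<phi>\<close> is a local coordinate at \<open>p\<close>: a local inverse of the projection, defined near \<open>p\<close>.
  In particular the inverse of \<open>\<phi>\<close> is the restriction of \<open>orbit_proj G\<close> to \<open>\<phi> ` V\<close>.\<close>

definition local_coordinate ::
    "(real^'n \<Rightarrow> real^'n) set \<Rightarrow> (real^'n) set \<Rightarrow> ((real^'n) set \<Rightarrow> real^'n) \<Rightarrow> bool"
  where "local_coordinate G p \<phi> \<longleftrightarrow>
    (\<exists>V. openin (orbit_space G) V \<and> p \<in> V \<and> open (\<phi> ` V) \<and> \<phi> ` V \<subseteq> unit_ball \<and>
      homeomorphic_map (subtopology (orbit_space G) V) (top_of_set (\<phi> ` V)) \<phi> \<and>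
      (\<forall>q\<in>V. orbit_proj G (\<phi> q) = q))"

definition differentiable_in_coordinates ::
    "(real^'n \<Rightarrow> real^'n) set \<Rightarrow> (real^'n \<Rightarrow> real^'n) set
      \<Rightarrow> ((real^'n) set \<Rightarrow> (real^'n) set) \<Rightarrow> (real^'n) set \<Rightarrow> bool"
  where "differentiable_in_coordinates G G' f p \<longleftrightarrow>
    (\<exists>\<phi> \<psi>. local_coordinate G p \<phi> \<and> local_coordinate G' (f p) \<psi> \<and>
      (\<psi> \<circ> f \<circ> orbit_proj G) differentiable (at (\<phi> p)))"

text \<open>The value at points of non-differentiability is a mere convention.\<close>

definition inner_dilatation :: "(real^'n \<Rightarrow> real^'n) \<Rightarrow> real^'n \<Rightarrow> ennreal"
  where "inner_dilatation F x =
    (let F' = frechet_derivative F (at x); J = det (matrix F')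
     in if F differentiable (at x) \<and> J \<noteq> 0
          then ennreal (\<bar>J\<bar> / (INF v\<in>sphere 0 1. norm (F' v)) ^ CARD('n))
        else if F differentiable (at x) \<and> F' = (\<lambda>v. 0) then 1
        else \<infinity>)"

definition orbit_inner_dilatation ::
    "(real^'n \<Rightarrow> real^'n) set \<Rightarrow> (real^'n \<Rightarrow> real^'n) set
      \<Rightarrow> ((real^'n) set \<Rightarrow> (real^'n) set) \<Rightarrow> (real^'n) set \<Rightarrow> ennreal"
  where "orbit_inner_dilatation G G' f p =
    (let \<phi> = (SOME \<phi>. local_coordinate G p \<phi>); \<psi> = (SOME \<psi>. local_coordinate G' (f p) \<psi>)
     in inner_dilatation (\<psi> \<circ> f \<circ> orbit_proj G) (\<phi> p))"

definition base_point :: "real set \<Rightarrow> real \<Rightarrow> bool"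
  where "base_point \<Delta> t0 \<longleftrightarrow> t0 \<in> \<Delta> \<and> (\<forall>a\<in>\<Delta>. (\<forall>t\<in>\<Delta>. a \<le> t) \<longrightarrow> t0 = a)"

definition length_function :: "('a \<Rightarrow> 'a \<Rightarrow> real) \<Rightarrow> (real \<Rightarrow> 'a) \<Rightarrow> real \<Rightarrow> real \<Rightarrow> real"
  where "length_function d \<gamma> t0 t =
    (if t0 \<le> t then enn2real (curve_length d \<gamma> t0 t) else - enn2real (curve_length d \<gamma> t t0))"

definition abs_continuous_on_segment :: "real \<Rightarrow> real \<Rightarrow> (real \<Rightarrow> real) \<Rightarrow> bool"
  where "abs_continuous_on_segment c d g \<longleftrightarrow>
    (\<forall>\<epsilon>>0. \<exists>\<delta>>0. \<forall>(N::nat) u v.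
      (\<forall>k<N. c \<le> u k \<and> u k \<le> v k \<and> v k \<le> d) \<and>
      disjoint_family_on (\<lambda>k. {u k<..<v k}) {..<N} \<and>
      (\<Sum>k<N. v k - u k) < \<delta> \<longrightarrow> (\<Sum>k<N. \<bar>g (v k) - g (u k)\<bar>) < \<epsilon>)"

text \<open>The condition imposed on a lift \<open>\<gamma>\<close> of a locally rectifiable \<open>\<gamma>'\<close>. On \<open>\<Delta>\<^sub>\<gamma>\<close>, the image of
  \<open>\<Delta>\<close> under the length function of \<open>\<gamma>\<close>, the map \<open>L\<close> is uniquely determined, and it is injective
  there if \<open>f\<close> sends no nonconstant path to a point.\<close>

definition lift_inverse_abs_continuous ::
    "('a \<Rightarrow> 'a \<Rightarrow> real) \<Rightarrow> ('b \<Rightarrow> 'b \<Rightarrow> real) \<Rightarrow> real set \<Rightarrow> (real \<Rightarrow> 'a) \<Rightarrow> (real \<Rightarrow> 'b) \<Rightarrow> bool"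
  where "lift_inverse_abs_continuous d d' \<Delta> \<gamma> \<gamma>' \<longleftrightarrow>
    (\<forall>t0. base_point \<Delta> t0 \<longrightarrow>
      (\<exists>L. mono_on (length_function d \<gamma> t0 ` \<Delta>) L \<and>
        (\<forall>t\<in>\<Delta>. L (length_function d \<gamma> t0 t) = length_function d' \<gamma>' t0 t) \<and>
        (\<forall>u v. u \<le> v \<and> {u..v} \<subseteq> length_function d' \<gamma>' t0 ` \<Delta> \<longrightarrow>
          abs_continuous_on_segment u v (inv_into (length_function d \<gamma> t0 ` \<Delta>) L))))"

text \<open>The premise that \<open>\<gamma>'\<close> is locally rectifiable, without which \<open>L\<close> is not defined, discards a
  family of modulus zero.\<close>

definition ACP_inverse ::
    "(real^'n \<Rightarrow> real^'n) set \<Rightarrow> (real^'n) set set \<Rightarrow> (real^'n \<Rightarrow> real^'n) set \<Rightarrow> real^'n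
      \<Rightarrow> ((real^'n) set \<Rightarrow> (real^'n) set) \<Rightarrow> bool"
  where "ACP_inverse G D G' p0' f \<longleftrightarrow>
    modulus G' p0'
      {(\<Delta>, \<gamma>') \<in> paths_in (orbit_space G') (f ` D).
        \<not> (locally_rectifiable orbit_dist (\<Delta>, \<gamma>') \<longrightarrow>
            (\<forall>\<gamma>. (\<Delta>, \<gamma>) \<in> paths_in (orbit_space G) D \<and> (\<forall>t\<in>\<Delta>. f (\<gamma> t) = \<gamma>' t) \<longrightarrow>
              locally_rectifiable orbit_dist (\<Delta>, \<gamma>) \<and>
              lift_inverse_abs_continuous orbit_dist orbit_dist \<Delta> \<gamma> \<gamma>'))} = 0"

end

theory Submission
  imports Defs
begin

text \<open>Let \<open>W p\<close> be the upper limit of \<open>d p q / d (f p) (f q)\<close> as \<open>q\<close> tends to \<open>p\<close>, and push \<open>\<rho>\<close>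
  forward to \<open>\<rho>' y\<close>, the supremum of \<open>\<rho> p * W p\<close> over the preimages \<open>p\<close> of \<open>y\<close>. Along a path whose
  inverse length function \<open>L\<^sup>-\<^sup>1\<close> is absolutely continuous, the derivative of \<open>L\<^sup>-\<^sup>1\<close> is at most \<open>W\<close>, so
  the change of parameter shows that the integral of \<open>\<rho>\<close> over the path is at most that of \<open>\<rho>'\<close> over
  its image. The remaining paths form an exceptional family of modulus zero, which
  is absorbed by taking the maximum of \<open>\<rho>'\<close> with a function of small norm that is admissible for it.
  The points where \<open>f\<close> is not differentiable or the Jacobian vanishes have a null image, by
  Lusin's condition and Sard's lemma. On the rest \<open>W\<close> to the power \<open>n\<close> times the hyperbolic Jacobian
  is the inner dilatation, and that set splits into countably many pieces on which \<open>f\<close> is injective,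
  so the change of variables formula bounds the integral of \<open>\<rho>'\<close> to the power \<open>n\<close>.\<close>

section \<open>Moebius transformations preserving the ball\<close>

text \<open>The inequality \<open>\<rho> p * W p \<le> \<rho>' (f p)\<close> must hold at every
  point of \<open>D\<close>, since a path may run inside a null set; so \<open>\<rho>'\<close> is
  infinite on a null set that contains the images of all uncontrolled points. \<open>W\<close>
  bounds chords, not lengths, and no derivative of the inverse length function is formed: the change
  of parameter compares the measure of a set of arc-length values with the integral of the speed
  bound over its preimage, by a gauge partition because that bound may be unbounded. The inner
  dilatation is not known to be measurable, so the right-hand side is a lower integral, reached from
  below through a Borel minorant. The number of preimages is not bounded, so the power of their
  supremum is dominated by a sum over pieces. Quantising \<open>W\<close> by rational constants and
  radii \<open>1 / Suc k\<close> serves twice: it makes \<open>W\<close> Borel and it supplies the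
  pieces.\<close>

text \<open>The weight \<open>spread\<close> replaces \<open>norm (x - y)\<close> on the compactification; up to a positive factor
  in each variable it is the chordal distance, which makes it covariant under all Moebius maps,
  including at infinity.\<close>

fun spread :: "(real^'n) option \<Rightarrow> (real^'n) option \<Rightarrow> real"
  where "spread (Some x) (Some y) = norm (x - y)"
  | "spread None (Some y) = 1"
  | "spread (Some x) None = 1"
  | "spread None None = 0"

lemma norm_inversion_diff:
  fixes x y :: "'a::real_inner"
  assumes "x \<noteq> 0" "y \<noteq> 0"
  shows "norm ((r / norm x)\<^sup>2 *\<^sub>R x - (r / norm y)\<^sup>2 *\<^sub>R y) = r\<^sup>2 * norm (x - y) / (norm x * norm y)"
proof -
  have "(norm ((r / norm x)\<^sup>2 *\<^sub>R x - (r / norm y)\<^sup>2 *\<^sub>R y))\<^sup>2 =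
      (r / norm x)^4 * (x \<bullet> x) - 2 * (r / norm x)\<^sup>2 * (r / norm y)\<^sup>2 * (x \<bullet> y) + (r / norm y)^4 * (y \<bullet> y)"
    unfolding power2_norm_eq_inner by (simp add: algebra_simps inner_commute power4_eq_xxxx power2_eq_square)
  also have "\<dots> = (r\<^sup>2 * norm (x - y) / (norm x * norm y))\<^sup>2"
  proof -
    have "(norm (x - y))\<^sup>2 = (norm x)\<^sup>2 - 2 * (x \<bullet> y) + (norm y)\<^sup>2"
      unfolding power2_norm_eq_inner by (simp add: algebra_simps inner_commute)
    then have R: "(r\<^sup>2 * norm (x - y) / (norm x * norm y))\<^sup>2 =
        r^4 * ((norm x)\<^sup>2 - 2 * (x \<bullet> y) + (norm y)\<^sup>2) / ((norm x)\<^sup>2 * (norm y)\<^sup>2)"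
      by (simp add: power_mult_distrib power_divide)
    show ?thesis
      unfolding R power2_norm_eq_inner[symmetric] using assms
      by (simp add: field_simps power4_eq_xxxx power2_eq_square)
  qed
  finally show ?thesis
    by (rule power2_eq_imp_eq) auto
qed

lemma hyperplane_reflection_dist:
  fixes x y u :: "real^'n"
  assumes "u \<noteq> 0"
  shows "norm ((x - (2 * (x \<bullet> u - c) / (norm u)\<^sup>2) *\<^sub>R u) - (y - (2 * (y \<bullet> u - c) / (norm u)\<^sup>2) *\<^sub>R u)) = norm (x - y)"
proof -
  define k where "k = 2 * ((x - y) \<bullet> u) / (norm u)\<^sup>2"
  have "(x - (2 * (x \<bullet> u - c) / (norm u)\<^sup>2) *\<^sub>R u) - (y - (2 * (y \<bullet> u - c) / (norm u)\<^sup>2) *\<^sub>R u) = (x - y) - k *\<^sub>R u"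
    unfolding k_def by (simp add: algebra_simps inner_diff_left diff_divide_distrib)
  moreover have "(norm ((x - y) - k *\<^sub>R u))\<^sup>2 = (norm (x - y))\<^sup>2"
  proof -
    have "(norm ((x - y) - k *\<^sub>R u))\<^sup>2 = (norm (x - y))\<^sup>2 - 2 * k * ((x - y) \<bullet> u) + k\<^sup>2 * (norm u)\<^sup>2"
      unfolding power2_norm_eq_inner
      by (simp add: inner_diff_left inner_diff_right inner_commute algebra_simps power2_eq_square)
    also have "k\<^sup>2 * (norm u)\<^sup>2 = 2 * k * ((x - y) \<bullet> u)"
      using assms by (simp add: k_def power2_eq_square)
    finally show ?thesis by simp
  qed
  ultimately show ?thesis by (metis norm_ge_zero power2_eq_imp_eq)
qed

lemma spread_sphere_reflection:
  assumes "r > 0"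
  shows "\<exists>\<mu>. (\<forall>z. \<mu> z > 0) \<and> (\<forall>z w. spread (sphere_reflection c r z) (sphere_reflection c r w) = \<mu> z * \<mu> w * spread z w)"
proof -
  \<comment> \<open>The values at the centre and at infinity are forced: the identity has to hold
    for pairs containing these points as well.\<close>
  define \<mu> where "\<mu> z = (case z of None \<Rightarrow> r | Some x \<Rightarrow> if x = c then 1 / r else r / norm (x - c))" for z
  have 1: "\<mu> z > 0" for z using assms by (auto simp: \<mu>_def split: option.split)
  have 2: "spread (sphere_reflection c r z) (sphere_reflection c r w) = \<mu> z * \<mu> w * spread z w" for z w
  proof (cases z; cases w)
    fix x y assume zw: "z = Some x" "w = Some y"
    show ?thesis
    proof (cases "x = c \<or> y = c")
      case True then show ?thesis using assms zw
        by (auto simp: \<mu>_def sphere_reflection_def norm_minus_commute)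
    next
      case False
      then show ?thesis using assms zw norm_inversion_diff[of "x - c" "y - c" r]
        by (simp add: \<mu>_def sphere_reflection_def power2_eq_square)
    qed
  qed (use assms in \<open>auto simp: \<mu>_def sphere_reflection_def power2_eq_square\<close>)
  show ?thesis using 1 2 by blast
qed

text \<open>The factors of a composition multiply along the orbit of a point, so induction over the
  reflections suffices; hyperplane reflections contribute the factor 1.\<close>

lemma spread_moebius:
  assumes "T \<in> moebius_maps"
  shows "\<exists>\<mu>. (\<forall>z. \<mu> z > 0) \<and> (\<forall>z w. spread (T z) (T w) = \<mu> z * \<mu> w * spread z w)"
  using assms
proof induction
  case moebius_id
  show ?case by (rule exI[of _ "\<lambda>_. 1"]) simp
next
  case (moebius_sphere T r c)
  obtain \<mu> where m: "\<forall>z. \<mu> z > 0" "\<forall>z w. spread (T z) (T w) = \<mu> z * \<mu> w * spread z w"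
    using moebius_sphere.IH by blast
  obtain \<nu> where n: "\<forall>z. \<nu> z > 0"
      "\<forall>z w. spread (sphere_reflection c r z) (sphere_reflection c r w) = \<nu> z * \<nu> w * spread z w"
    using spread_sphere_reflection[OF moebius_sphere.hyps(2)] by blast
  show ?case
    by (rule exI[of _ "\<lambda>z. \<nu> (T z) * \<mu> z"]) (use m n in simp)
next
  case (moebius_hyperplane T u c)
  obtain \<mu> where m: "\<forall>z. \<mu> z > 0" "\<forall>z w. spread (T z) (T w) = \<mu> z * \<mu> w * spread z w"
    using moebius_hyperplane.IH by blast
  have "spread (hyperplane_reflection u c z) (hyperplane_reflection u c w) = spread z w" for z w
    using hyperplane_reflection_dist[OF moebius_hyperplane.hyps(2)]
    by (cases z; cases w) (simp_all only: hyperplane_reflection_def spread.simps option.map)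
  then show ?case using m by (intro exI[of _ \<mu>]) simp
qed

text \<open>\<open>m x\<close> is the square root of the linear scale factor of \<open>T\<close> at
  \<open>x\<close>. This two-point identity is all that is kept of a Moebius map: it is stable under
  composition and inversion and no longer mentions the point at infinity.\<close>

definition conformal_ball_map :: "(real^'n \<Rightarrow> real^'n) \<Rightarrow> bool"
  where "conformal_ball_map T \<longleftrightarrow> bij_betw T unit_ball unit_ball \<and>
    (\<exists>m. (\<forall>x\<in>unit_ball. m x > 0) \<and> (\<forall>x\<in>unit_ball. \<forall>y\<in>unit_ball. norm (T x - T y) = m x * m y * norm (x - y)))"

lemma conformal_ball_map_comp:
  assumes "conformal_ball_map S" "conformal_ball_map T"
  shows "conformal_ball_map (S \<circ> T)"
proof -
  obtain m where m: "bij_betw S unit_ball unit_ball" "\<forall>x\<in>unit_ball. m x > 0"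
    "\<forall>x\<in>unit_ball. \<forall>y\<in>unit_ball. norm (S x - S y) = m x * m y * norm (x - y)"
    using assms(1) unfolding conformal_ball_map_def by blast
  obtain k where k: "bij_betw T unit_ball unit_ball" "\<forall>x\<in>unit_ball. k x > 0"
    "\<forall>x\<in>unit_ball. \<forall>y\<in>unit_ball. norm (T x - T y) = k x * k y * norm (x - y)"
    using assms(2) unfolding conformal_ball_map_def by blast
  have T: "T x \<in> unit_ball" if "x \<in> unit_ball" for x using k(1) that by (rule bij_betwE[THEN bspec])
  have "bij_betw (S \<circ> T) unit_ball unit_ball" using k(1) m(1) by (rule bij_betw_trans)
  moreover have "\<forall>x\<in>unit_ball. m (T x) * k x > 0" using m(2) k(2) T by (simp del: mem_ball_0)
  moreover have "\<forall>x\<in>unit_ball. \<forall>y\<in>unit_ball. norm ((S \<circ> T) x - (S \<circ> T) y) = (m (T x) * k x) * (m (T y) * k y) * norm (x - y)"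
    using m(3) k(3) T by (simp del: mem_ball_0)
  ultimately show ?thesis unfolding conformal_ball_map_def by (intro conjI exI[of _ "\<lambda>x. m (T x) * k x"])
qed

lemma conformal_ball_map_inv:
  assumes "conformal_ball_map T" "\<And>x. x \<in> unit_ball \<Longrightarrow> S x \<in> unit_ball \<and> T (S x) = x"
  shows "conformal_ball_map S"
proof -
  obtain m where m: "bij_betw T unit_ball unit_ball" "\<forall>x\<in>unit_ball. m x > 0"
    "\<forall>x\<in>unit_ball. \<forall>y\<in>unit_ball. norm (T x - T y) = m x * m y * norm (x - y)"
    using assms(1) unfolding conformal_ball_map_def by blast
  have ST: "S (T x) = x" if "x \<in> unit_ball" for x
    using that m(1) assms(2) by (metis bij_betw_def bij_betw_apply inj_onD)
  have "bij_betw S unit_ball unit_ball"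
    by (rule bij_betw_byWitness[where f' = T]) (use ST assms(2) m(1) bij_betwE in blast)+
  moreover have "norm (S x - S y) = 1 / m (S x) * (1 / m (S y)) * norm (x - y)"
    if "x \<in> unit_ball" "y \<in> unit_ball" for x y
  proof -
    have "norm (x - y) = m (S x) * m (S y) * norm (S x - S y)"
      using m(3) assms(2)[OF that(1)] assms(2)[OF that(2)] by metis
    moreover have "m (S x) > 0" "m (S y) > 0" using m(2) assms(2) that by blast+
    ultimately show ?thesis by (simp add: field_simps)
  qed
  moreover have "1 / m (S x) > 0" if "x \<in> unit_ball" for x using m(2) assms(2)[OF that] by simp
  ultimately show ?thesis unfolding conformal_ball_map_def by (intro conjI exI[of _ "\<lambda>x. 1 / m (S x)"]) blast+
qed

text \<open>The identity gives a local Lipschitz bound once \<open>m\<close> is bounded near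
  \<open>x\<close>. Since the images lie in the unit ball, comparing \<open>y\<close> with one
  auxiliary point \<open>z\<close> bounds \<open>m y\<close>.\<close>

lemma conformal_ball_map_continuous:
  fixes T :: "real^'n \<Rightarrow> real^'n"
  assumes "conformal_ball_map T"
  shows "continuous_on unit_ball T"
proof -
  obtain m where m: "bij_betw T unit_ball unit_ball" "\<forall>x\<in>unit_ball. m x > 0"
    "\<forall>x\<in>unit_ball. \<forall>y\<in>unit_ball. norm (T x - T y) = m x * m y * norm (x - y)"
    using assms unfolding conformal_ball_map_def by blast
  have T: "norm (T x) < 1" if "norm x < 1" for x using bij_betwE[OF m(1)] that by simp
  have "isCont T x" if x: "x \<in> unit_ball" for x
  proof -
    obtain e where e: "e > 0" "ball x e \<subseteq> unit_ball" using x open_ball openE by blast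
    define u :: "real^'n" where "u = axis (SOME i. True) 1"
    have u: "norm u = 1" by (simp add: u_def)
    \<comment> \<open>At distance \<open>e / 2\<close> from \<open>x\<close>, this point stays at
      least \<open>e / 4\<close> away from every \<open>y\<close> with
      \<open>dist y x < e / 4\<close>.\<close>
    define z where "z = x + (e/2) *\<^sub>R u"
    have xz: "norm (x - z) = e / 2" using u e by (simp add: z_def)
    have z: "z \<in> unit_ball" using e xz by (auto simp: dist_norm subset_eq)
    have mz: "m z > 0" and mx: "m x > 0" using m(2) x z by blast+
    have bd: "norm (T y - T x) \<le> (m x * 8 / (m z * e)) * norm (y - x)" if y: "dist y x < e / 4" for y
    proof -
      have yb: "y \<in> unit_ball" using e y by (auto simp: subset_eq dist_commute)
      have yz: "norm (y - z) \<ge> e / 4"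
        using norm_triangle_ineq[of "x - y" "y - z"] xz y by (simp add: dist_norm norm_minus_commute)
      have "m y * m z * norm (y - z) = norm (T y - T z)" using m(3) yb z by simp
      also have "\<dots> \<le> 2" using T[of y] T[of z] yb z norm_triangle_ineq4[of "T y" "T z"] by simp
      finally have "m y * m z * (e / 4) \<le> 2"
        using yz mz m(2) yb by (smt (verit, best) mult_left_mono mult_pos_pos)
      then have my: "m y \<le> 8 / (m z * e)" using e mz by (simp add: field_simps)
      have "norm (T y - T x) = m y * m x * norm (y - x)" using m(3) yb x by simp
      also have "\<dots> \<le> 8 / (m z * e) * m x * norm (y - x)"
        using my mx by (intro mult_right_mono) auto
      finally show ?thesis by (simp add: ac_simps)
    qed
    have "((\<lambda>y. T y - T x) \<longlongrightarrow> 0) (at x)"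
    proof (rule Lim_null_comparison)
      show "\<forall>\<^sub>F y in at x. norm (T y - T x) \<le> (m x * 8 / (m z * e)) * norm (y - x)"
        unfolding eventually_at using bd e by (intro exI[of _ "e/4"]) auto
      have "((\<lambda>y. (m x * 8 / (m z * e)) * norm (y - x)) \<longlongrightarrow> (m x * 8 / (m z * e)) * norm (x - x)) (at x)"
        by (intro tendsto_intros)
      then show "((\<lambda>y. (m x * 8 / (m z * e)) * norm (y - x)) \<longlongrightarrow> 0) (at x)" by simp
    qed
    then show "isCont T x" unfolding isCont_def by (simp add: LIM_zero_iff)
  qed
  then show ?thesis by (simp add: continuous_at_imp_continuous_on)
qed

lemma conformal_ball_map_inverse_exists:
  fixes T :: "real^'n \<Rightarrow> real^'n"
  assumes "conformal_ball_map T"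
  obtains S where "conformal_ball_map S" "\<And>x. x \<in> unit_ball \<Longrightarrow> S x \<in> unit_ball \<and> T (S x) = x"
    "\<And>x. x \<in> unit_ball \<Longrightarrow> S (T x) = x"
proof -
  let ?S = "inv_into unit_ball T"
  have b: "bij_betw T unit_ball unit_ball" using assms unfolding conformal_ball_map_def by blast
  have 1: "?S x \<in> unit_ball \<and> T (?S x) = x" if "x \<in> unit_ball" for x
    using b that by (metis bij_betw_imp_surj_on f_inv_into_f inv_into_into)
  moreover have "?S (T x) = x" if "x \<in> unit_ball" for x
    using b that by (simp add: bij_betw_def inv_into_f_f del: mem_ball_0)
  ultimately show thesis using that conformal_ball_map_inv[OF assms 1] by blast
qed

text \<open>The points with image in a smaller closed ball form a compact set, the image of that
  ball under the continuous inverse, so they stay away from the sphere.\<close>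

lemma conformal_ball_map_proper:
  fixes T :: "real^'n \<Rightarrow> real^'n"
  assumes T: "conformal_ball_map T" and "e > 0"
  obtains r where "0 < r" "r < 1" "\<And>y. r < norm y \<Longrightarrow> norm y < 1 \<Longrightarrow> norm (T y) > 1 - e"
proof -
  obtain S where S: "conformal_ball_map S" "\<And>x. x \<in> unit_ball \<Longrightarrow> S x \<in> unit_ball \<and> T (S x) = x"
    "\<And>x. x \<in> unit_ball \<Longrightarrow> S (T x) = x"
    using conformal_ball_map_inverse_exists[OF T] by blast
  define K where "K = S ` cball 0 (1 - e)"
  have sub: "cball 0 (1 - e) \<subseteq> (unit_ball :: (real^'n) set)" using \<open>e > 0\<close> by auto
  have "compact K" unfolding K_def
    by (intro compact_continuous_image compact_cball continuous_on_subset[OF conformal_ball_map_continuous[OF S(1)] sub])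
  moreover have "K \<subseteq> unit_ball" unfolding K_def using S(2) sub by blast
  ultimately obtain r where r: "0 < r" "r < 1" "K \<subseteq> cball 0 r"
  proof (cases "K = {}")
    case True then show thesis using that[of "1/2"] by simp
  next
    case False
    obtain k where k: "k \<in> K" "\<And>y. y \<in> K \<Longrightarrow> norm y \<le> norm k"
      using continuous_attains_sup[of K norm] \<open>compact K\<close> False by (auto intro: continuous_intros)
    have "norm k < 1" using k(1) \<open>K \<subseteq> unit_ball\<close> by auto
    then show thesis using that[of "max (1/2) (norm k)"] k(2) by (force simp: subset_eq)
  qed
  have "norm (T y) > 1 - e" if "r < norm y" "norm y < 1" for y
  proof (rule ccontr)
    assume "\<not> norm (T y) > 1 - e"
    then have "S (T y) \<in> K" unfolding K_def by auto
    then show False using S(3)[of y] r that by auto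
  qed
  then show thesis using that r by blast
qed

text \<open>One-sided estimates in the role of the Schwarz lemma, meant to be applied both to a map
  and to its inverse.\<close>

lemma conformal_ball_map_fix0_aux:
  fixes T :: "real^'n \<Rightarrow> real^'n"
  assumes T: "conformal_ball_map T" and T0: "T 0 = 0"
    and m: "\<And>x. x \<in> unit_ball \<Longrightarrow> m x > 0"
      "\<And>x y. x \<in> unit_ball \<Longrightarrow> y \<in> unit_ball \<Longrightarrow> norm (T x - T y) = m x * m y * norm (x - y)"
  shows "m 0 \<ge> 1" and "\<And>x. m 0 = 1 \<Longrightarrow> x \<in> unit_ball \<Longrightarrow> norm (T x) \<le> norm x"
proof -
  have Tb: "norm (T x) < 1" if "norm x < 1" for x
    using T that bij_betwE unfolding conformal_ball_map_def by force
  have m0: "m 0 > 0" using m(1) by simp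
  have Tn: "norm (T x) = m x * m 0 * norm x" if "norm x < 1" for x using m(2)[of x 0] that T0 by simp
  text \<open>In inverted coordinates \<open>x / norm x\<^sup>2\<close> a map fixing \<open>0\<close> is a similarity; testing it on
    nearly antipodal pairs close to the sphere bounds its ratio.\<close>
  have key: "(norm x + r) / (norm x * r * (m 0)\<^sup>2) \<le> 1 / norm (T x) + 1 / norm (T (- (r / norm x) *\<^sub>R x))"
    if x: "x \<noteq> 0" "norm x < 1" and r: "0 < r" "r < 1" for x r
  proof -
    define y where "y = - (r / norm x) *\<^sub>R x"
    have y: "norm y = r" "y \<noteq> 0" using x r by (auto simp: y_def)
    have "x - y = (1 + r / norm x) *\<^sub>R x" by (simp add: y_def algebra_simps)
    then have "norm (x - y) = (1 + r / norm x) * norm x" using x r by (simp only: norm_scaleR) simp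
    then have xy: "norm (x - y) = norm x + r" using x by (simp add: distrib_right)
    have p: "norm (T x) > 0" "norm (T y) > 0" using Tn[of x] Tn[of y] m(1) m0 x y r by auto
    have "norm (T x - T y) = m x * m y * (norm x + r)" using m(2)[of x y] x y r xy by simp
    also have "m x = norm (T x) / (m 0 * norm x)" using Tn[of x] x m0 by (simp add: field_simps)
    also have "m y = norm (T y) / (m 0 * r)" using Tn[of y] y r m0 by (simp add: field_simps)
    finally have "norm (T x) * norm (T y) * ((norm x + r) / (norm x * r * (m 0)\<^sup>2)) = norm (T x - T y)"
      by (simp add: field_simps power2_eq_square)
    also have "\<dots> \<le> norm (T x) + norm (T y)" by (rule norm_triangle_ineq4)
    also have "\<dots> = norm (T x) * norm (T y) * (1 / norm (T x) + 1 / norm (T y))"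
      using p by (simp add: field_simps)
    finally show ?thesis unfolding y_def[symmetric]
      using p by (subst (asm) mult_le_cancel_left_pos) simp_all
  qed
  \<comment> \<open>Properness and \<open>norm (T y) < 1\<close> squeeze \<open>norm (T y)\<close>
    to 1 at the boundary.\<close>
  have lim: "((\<lambda>r. 1 / norm (T (r *\<^sub>R u))) \<longlongrightarrow> 1) (at_left 1)" if u: "norm u = 1" for u
  proof -
    have "((\<lambda>r. norm (T (r *\<^sub>R u))) \<longlongrightarrow> 1) (at_left 1)"
      unfolding tendsto_iff
    proof (intro allI impI)
      fix e :: real assume "e > 0"
      obtain q where q: "0 < q" "q < 1" "\<And>y. q < norm y \<Longrightarrow> norm y < 1 \<Longrightarrow> norm (T y) > 1 - e"
        using conformal_ball_map_proper[OF T \<open>e > 0\<close>] by blast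
      have "dist (norm (T (r *\<^sub>R u))) 1 < e" if "q < r" "r < 1" for r
      proof -
        have "norm (r *\<^sub>R u) = r" using that u q by simp
        then show ?thesis using q(3)[of "r *\<^sub>R u"] Tb[of "r *\<^sub>R u"] that
          by (simp add: dist_real_def abs_if)
      qed
      then show "\<forall>\<^sub>F r in at_left 1. dist (norm (T (r *\<^sub>R u))) 1 < e"
        unfolding eventually_at_left_field using q by blast
    qed
    then show ?thesis using tendsto_divide[OF tendsto_const[of 1], of _ 1] by fastforce
  qed
  have ev: "\<forall>\<^sub>F r::real in at_left 1. 0 < r \<and> r < 1"
    unfolding eventually_at_left_field by (intro exI[of _ 0]) auto
  show "m 0 \<ge> 1"
  proof -
    define u :: "real^'n" where "u = axis (SOME i. True) 1"
    have u: "norm u = 1" "norm (- u) = 1" by (simp_all add: u_def)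
    have "((\<lambda>r. 1 / norm (T (r *\<^sub>R u)) + 1 / norm (T (r *\<^sub>R (-u)))) \<longlongrightarrow> 1 + 1) (at_left 1)"
      by (intro tendsto_add lim u)
    moreover have "((\<lambda>r. (r + r) / (r * r * (m 0)\<^sup>2)) \<longlongrightarrow> (1 + 1) / (1 * 1 * (m 0)\<^sup>2)) (at_left 1)"
      using m0 by (intro tendsto_intros) auto
    ultimately have "(1 + 1) / (1 * 1 * (m 0)\<^sup>2) \<le> 1 + 1"
    proof (rule tendsto_le[OF trivial_limit_at_left_real])
      show "\<forall>\<^sub>F r in at_left 1. (r + r) / (r * r * (m 0)\<^sup>2) \<le> 1 / norm (T (r *\<^sub>R u)) + 1 / norm (T (r *\<^sub>R (-u)))"
        using ev
      proof eventually_elim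
        case (elim r)
        have "r *\<^sub>R u \<noteq> 0" using elim u by auto
        then show ?case using key[of "r *\<^sub>R u" r] elim u by simp
      qed
    qed
    then have "1 \<le> (m 0)\<^sup>2" using m0 by (simp add: field_simps)
    then show ?thesis using m0 power2_le_imp_le[of 1 "m 0"] by simp
  qed
  fix x :: "real^'n" assume m1: "m 0 = 1" and x: "x \<in> unit_ball"
  show "norm (T x) \<le> norm x"
  proof (cases "x = 0")
    case True then show ?thesis using T0 by simp
  next
    case False
    define u where "u = - (1 / norm x) *\<^sub>R x"
    have u: "norm u = 1" using False by (simp add: u_def)
    have p: "norm (T x) > 0" using Tn[of x] m(1)[of x] m0 x False by simp
    have "((\<lambda>r. 1 / norm (T x) + 1 / norm (T (r *\<^sub>R u))) \<longlongrightarrow> 1 / norm (T x) + 1) (at_left 1)"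
      by (intro tendsto_add lim u tendsto_const)
    moreover have "((\<lambda>r. (norm x + r) / (norm x * r * (m 0)\<^sup>2)) \<longlongrightarrow> (norm x + 1) / (norm x * 1 * (m 0)\<^sup>2)) (at_left 1)"
      using m0 False by (intro tendsto_intros) auto
    ultimately have "(norm x + 1) / (norm x * 1 * (m 0)\<^sup>2) \<le> 1 / norm (T x) + 1"
    proof (rule tendsto_le[OF trivial_limit_at_left_real])
      show "\<forall>\<^sub>F r in at_left 1. (norm x + r) / (norm x * r * (m 0)\<^sup>2) \<le> 1 / norm (T x) + 1 / norm (T (r *\<^sub>R u))"
        using ev
      proof eventually_elim
        case (elim r)
        then show ?case using key[of x r] x False by (simp add: u_def)
      qed
    qed
    then show ?thesis using m1 p False by (simp add: field_simps)
  qed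
qed

text \<open>The scale factors at 0 of the map and of its inverse are reciprocal and both at least 1,
  so both equal 1. The norm inequality then holds for both maps, and comparing each point with 0
  makes the scale factor 1 everywhere.\<close>

lemma conformal_ball_map_fix0:
  fixes T :: "real^'n \<Rightarrow> real^'n"
  assumes T: "conformal_ball_map T" and T0: "T 0 = 0"
  shows "\<And>x. x \<in> unit_ball \<Longrightarrow> norm (T x) = norm x"
    and "\<And>x y. x \<in> unit_ball \<Longrightarrow> y \<in> unit_ball \<Longrightarrow> norm (T x - T y) = norm (x - y)"
proof -
  obtain m where m: "bij_betw T unit_ball unit_ball" "\<forall>x\<in>unit_ball. m x > 0"
    "\<forall>x\<in>unit_ball. \<forall>y\<in>unit_ball. norm (T x - T y) = m x * m y * norm (x - y)"
    using T unfolding conformal_ball_map_def by blast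
  obtain S where S: "conformal_ball_map S" "\<And>x. x \<in> unit_ball \<Longrightarrow> S x \<in> unit_ball \<and> T (S x) = x"
    "\<And>x. x \<in> unit_ball \<Longrightarrow> S (T x) = x"
    using conformal_ball_map_inverse_exists[OF T] by blast
  have Tb: "T x \<in> unit_ball" if "x \<in> unit_ball" for x using m(1) that bij_betwE by blast
  have S0: "S 0 = 0" using S(3)[of 0] T0 by simp
  define k where "k x = 1 / m (S x)" for x
  have kpos: "k x > 0" if "x \<in> unit_ball" for x using m(2) S(2)[OF that] by (simp add: k_def)
  have k: "norm (S x - S y) = k x * k y * norm (x - y)" if "x \<in> unit_ball" "y \<in> unit_ball" for x y
  proof -
    have "norm (x - y) = m (S x) * m (S y) * norm (S x - S y)"
      using m(3) S(2)[OF that(1)] S(2)[OF that(2)] by metis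
    moreover have "m (S x) > 0" "m (S y) > 0" using m(2) S(2) that by blast+
    ultimately show ?thesis by (simp add: k_def field_simps)
  qed
  note AT = conformal_ball_map_fix0_aux[OF T T0, of m] and AS = conformal_ball_map_fix0_aux[OF S(1) S0, of k]
  have "m 0 \<ge> 1" using AT(1) m(2,3) by blast
  moreover have "k 0 \<ge> 1" using AS(1) kpos k by blast
  ultimately have m0: "m 0 = 1" and k0: "k 0 = 1" by (auto simp: k_def S0 field_simps)
  show nT: "norm (T x) = norm x" if x: "x \<in> unit_ball" for x
  proof (rule antisym)
    show "norm (T x) \<le> norm x" using AT(2)[of x] m(2,3) m0 x by blast
    have "norm (S (T x)) \<le> norm (T x)" using AS(2)[of "T x"] kpos k k0 Tb[OF x] by blast
    then show "norm x \<le> norm (T x)" using S(3)[OF x] by simp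
  qed
  have mx: "m x = 1" if x: "x \<in> unit_ball" "x \<noteq> 0" for x
    using m(3)[rule_format, of x 0] nT[OF x(1)] x T0 m0 by simp
  show "norm (T x - T y) = norm (x - y)" if "x \<in> unit_ball" "y \<in> unit_ball" for x y
    using m(3) that mx m0 by (cases "x = 0"; cases "y = 0") auto
qed

text \<open>Polarisation shows that \<open>T\<close> preserves inner products. The candidate
  \<open>L\<close> is the linear map that agrees with \<open>T\<close> on halved basis vectors, and
  \<open>T x - L x\<close> has zero norm because all the inner products agree.\<close>

lemma ball_isometry_linear:
  fixes T :: "real^'n \<Rightarrow> real^'n"
  assumes n: "\<And>x. x \<in> unit_ball \<Longrightarrow> norm (T x) = norm x"
    and d: "\<And>x y. x \<in> unit_ball \<Longrightarrow> y \<in> unit_ball \<Longrightarrow> norm (T x - T y) = norm (x - y)"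
  obtains L where "linear L" "\<And>x. x \<in> unit_ball \<Longrightarrow> T x = L x"
proof -
  have i: "T x \<bullet> T y = x \<bullet> y" if "x \<in> unit_ball" "y \<in> unit_ball" for x y
    using n[OF that(1)] n[OF that(2)] d[OF that] by (simp add: dot_norm_neg)
  \<comment> \<open>Basis vectors lie on the sphere, outside the domain, hence the rescaling by one
    half.\<close>
  define B where "B b = 2 *\<^sub>R T ((1/2) *\<^sub>R b)" for b
  define L where "L x = (\<Sum>b\<in>Basis. (x \<bullet> b) *\<^sub>R B b)" for x
  have "linear L" unfolding L_def
    by (rule linearI) (simp_all add: inner_add_left scaleR_add_left sum.distrib scaleR_sum_right)
  have bb: "(1/2) *\<^sub>R b \<in> (unit_ball :: (real^'n) set)" if "b \<in> Basis" for b using that by simp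
  have TB: "T x \<bullet> B b = x \<bullet> b" if "b \<in> Basis" "x \<in> unit_ball" for x b
    using i[OF that(2) bb[OF that(1)]] by (simp add: B_def)
  have BB: "B b \<bullet> B b' = (if b = b' then 1 else 0)" if "b \<in> Basis" "b' \<in> Basis" for b b'
    using i[OF bb[OF that(1)] bb[OF that(2)]] that by (simp add: B_def inner_Basis)
  have "T x = L x" if x: "x \<in> unit_ball" for x
  proof -
    have 1: "T x \<bullet> L x = x \<bullet> x"
      by (subst (2) euclidean_inner) (auto simp: L_def inner_sum_right TB[OF _ x] intro!: sum.cong)
    have 2: "L x \<bullet> L x = x \<bullet> x"
      by (subst (2) euclidean_inner) (auto simp: L_def inner_sum_right inner_sum_left BB if_distrib sum.delta cong: if_cong intro!: sum.cong)
    have "(T x - L x) \<bullet> (T x - L x) = 0"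
      using 1 2 i[OF x x] by (simp add: inner_diff_left inner_diff_right inner_commute)
    then show ?thesis by simp
  qed
  with \<open>linear L\<close> show thesis using that by blast
qed

section \<open>The hyperbolic distance h and its ratio t = tanh (h / 2)\<close>

definition ball_ratio :: "real^'n \<Rightarrow> real^'n \<Rightarrow> real"
  where "ball_ratio x y = norm (x - y) / sqrt ((norm (x - y))\<^sup>2 + (1 - (norm x)\<^sup>2) * (1 - (norm y)\<^sup>2))"

lemma hyp_dist_ratio: "hyp_dist x y = ln ((1 + ball_ratio x y) / (1 - ball_ratio x y))"
  by (simp add: hyp_dist_def ball_ratio_def Let_def)

lemma unit_ball_gap: "x \<in> unit_ball \<Longrightarrow> 1 - (norm x)\<^sup>2 > 0"
  by (simp add: abs_square_less_1)

lemma ball_ratio_bounds: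
  assumes "x \<in> unit_ball" "y \<in> unit_ball"
  shows "0 \<le> ball_ratio x y" "ball_ratio x y < 1"
proof -
  let ?b = "(1 - (norm x)\<^sup>2) * (1 - (norm y)\<^sup>2)"
  have b: "?b > 0" using assms unit_ball_gap by (intro mult_pos_pos) blast+
  then show "0 \<le> ball_ratio x y" by (simp add: ball_ratio_def)
  have "norm (x - y) < sqrt ((norm (x - y))\<^sup>2 + ?b)"
    using b by (intro real_less_rsqrt) simp
  then show "ball_ratio x y < 1" using b unfolding ball_ratio_def
    by (subst divide_less_eq_1_pos) (auto intro: add_nonneg_pos)
qed

lemma ball_ratio_square:
  assumes "x \<in> unit_ball" "y \<in> unit_ball"
  shows "(ball_ratio x y)\<^sup>2 = (norm (x - y))\<^sup>2 / ((norm (x - y))\<^sup>2 + (1 - (norm x)\<^sup>2) * (1 - (norm y)\<^sup>2))"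
proof -
  have "(1 - (norm x)\<^sup>2) * (1 - (norm y)\<^sup>2) > 0" using assms unit_ball_gap by (intro mult_pos_pos) blast+
  then have "(norm (x - y))\<^sup>2 + (1 - (norm x)\<^sup>2) * (1 - (norm y)\<^sup>2) \<ge> 0" by (intro add_nonneg_nonneg) auto
  then show ?thesis by (simp add: ball_ratio_def power_divide)
qed

text \<open>Invariance of |x - y|^2 / ((1 - |x|^2) (1 - |y|^2)), which is the square of sinh (h /
  2), with denominators cleared. In this form it can be differentiated without touching the
  logarithm.\<close>

definition hyp_isometry :: "(real^'n \<Rightarrow> real^'n) \<Rightarrow> bool"
  where "hyp_isometry T \<longleftrightarrow> T ` unit_ball \<subseteq> unit_ball \<and>
    (\<forall>x\<in>unit_ball. \<forall>y\<in>unit_ball. (norm (T x - T y))\<^sup>2 * ((1 - (norm x)\<^sup>2) * (1 - (norm y)\<^sup>2)) =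
       (norm (x - y))\<^sup>2 * ((1 - (norm (T x))\<^sup>2) * (1 - (norm (T y))\<^sup>2)))"

lemma hyp_isometry_hyp_dist:
  assumes T: "hyp_isometry T" and x: "x \<in> unit_ball" and y: "y \<in> unit_ball"
  shows "hyp_dist (T x) (T y) = hyp_dist x y"
proof -
  have Txy: "T x \<in> unit_ball" "T y \<in> unit_ball" using T x y unfolding hyp_isometry_def by blast+
  define a b a' b' where "a = (norm (x - y))\<^sup>2" and "b = (1 - (norm x)\<^sup>2) * (1 - (norm y)\<^sup>2)"
    and "a' = (norm (T x - T y))\<^sup>2" and "b' = (1 - (norm (T x))\<^sup>2) * (1 - (norm (T y))\<^sup>2)"
  have e: "a' * b = a * b'" using T x y unfolding hyp_isometry_def a_def b_def a'_def b'_def by blast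
  have p: "b > 0" "b' > 0" "a \<ge> 0" "a' \<ge> 0"
    unfolding a_def b_def a'_def b'_def using unit_ball_gap[OF x] unit_ball_gap[OF y] unit_ball_gap[OF Txy(1)] unit_ball_gap[OF Txy(2)] by simp_all
  have "a' / (a' + b') = a / (a + b)"
    using p e by (subst frac_eq_eq) (auto simp: algebra_simps)
  then have "(ball_ratio (T x) (T y))\<^sup>2 = (ball_ratio x y)\<^sup>2"
    using ball_ratio_square[OF x y] ball_ratio_square[OF Txy] by (simp add: a_def b_def a'_def b'_def)
  then have "ball_ratio (T x) (T y) = ball_ratio x y"
    using ball_ratio_bounds(1)[OF x y] ball_ratio_bounds(1)[OF Txy] by simp
  then show ?thesis by (simp add: hyp_dist_ratio)
qed

lemma hyp_isometry_comp: "hyp_isometry S \<Longrightarrow> hyp_isometry T \<Longrightarrow> hyp_isometry (S \<circ> T)"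
  unfolding hyp_isometry_def
proof (intro conjI ballI)
  assume S: "S ` unit_ball \<subseteq> unit_ball \<and> (\<forall>x\<in>unit_ball. \<forall>y\<in>unit_ball. (norm (S x - S y))\<^sup>2 * ((1 - (norm x)\<^sup>2) * (1 - (norm y)\<^sup>2)) =
       (norm (x - y))\<^sup>2 * ((1 - (norm (S x))\<^sup>2) * (1 - (norm (S y))\<^sup>2)))"
    and T: "T ` unit_ball \<subseteq> unit_ball \<and> (\<forall>x\<in>unit_ball. \<forall>y\<in>unit_ball. (norm (T x - T y))\<^sup>2 * ((1 - (norm x)\<^sup>2) * (1 - (norm y)\<^sup>2)) =
       (norm (x - y))\<^sup>2 * ((1 - (norm (T x))\<^sup>2) * (1 - (norm (T y))\<^sup>2)))"
  show "(S \<circ> T) ` unit_ball \<subseteq> unit_ball" using S T unfolding image_comp[symmetric] by blast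
  fix x y :: "real^'a" assume x: "x \<in> unit_ball" and y: "y \<in> unit_ball"
  have Txy: "T x \<in> unit_ball" "T y \<in> unit_ball" using T x y by blast+
  define b where "b = (1 - (norm (T x))\<^sup>2) * (1 - (norm (T y))\<^sup>2)"
  have b: "b > 0" unfolding b_def using unit_ball_gap[OF Txy(1)] unit_ball_gap[OF Txy(2)] by simp
  have 1: "(norm (S (T x) - S (T y)))\<^sup>2 * b = (norm (T x - T y))\<^sup>2 * ((1 - (norm (S (T x)))\<^sup>2) * (1 - (norm (S (T y)))\<^sup>2))"
    using S Txy unfolding b_def by blast
  have 2: "(norm (T x - T y))\<^sup>2 * ((1 - (norm x)\<^sup>2) * (1 - (norm y)\<^sup>2)) = (norm (x - y))\<^sup>2 * b"
    using T x y unfolding b_def by blast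
  have "(norm (S (T x) - S (T y)))\<^sup>2 * ((1 - (norm x)\<^sup>2) * (1 - (norm y)\<^sup>2)) * b =
      (norm (x - y))\<^sup>2 * ((1 - (norm (S (T x)))\<^sup>2) * (1 - (norm (S (T y)))\<^sup>2)) * b"
    using 1 2 by algebra
  then show "(norm ((S \<circ> T) x - (S \<circ> T) y))\<^sup>2 * ((1 - (norm x)\<^sup>2) * (1 - (norm y)\<^sup>2)) =
       (norm (x - y))\<^sup>2 * ((1 - (norm ((S \<circ> T) x))\<^sup>2) * (1 - (norm ((S \<circ> T) y))\<^sup>2))"
    using b by simp
qed

text \<open>For \<open>a\<close> other than 0 this is the inversion in the sphere orthogonal to the
  unit sphere that interchanges 0 and \<open>a\<close>; for \<open>a = 0\<close> that sphere
  degenerates and the identity serves instead.\<close>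

lemma ball_inversion_exists:
  fixes a :: "real^'n"
  assumes a: "a \<in> unit_ball"
  obtains \<tau> where "conformal_ball_map \<tau>" "hyp_isometry \<tau>" "\<tau> 0 = a" "\<tau> a = 0"
    "\<And>x. x \<in> unit_ball \<Longrightarrow> \<tau> (\<tau> x) = x" "\<And>x. x \<in> unit_ball \<Longrightarrow> \<tau> differentiable (at x)"
proof (cases "a = 0")
  case True
  have "conformal_ball_map (id :: real^'n \<Rightarrow> real^'n)" unfolding conformal_ball_map_def
    by (intro conjI bij_betw_id exI[of _ "\<lambda>_. 1"]) auto
  moreover have "hyp_isometry (id :: real^'n \<Rightarrow> real^'n)" unfolding hyp_isometry_def by simp
  ultimately show thesis using True that[of id] by (simp add: id_def)
next
  case False
  \<comment> \<open>The centre is the mirror image of \<open>a\<close> in the unit sphere.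
    Orthogonality to the unit sphere, \<open>r\<^sup>2 = (norm c)\<^sup>2 - 1\<close>, is what makes
    the inversion preserve the ball.\<close>
  define c where "c = (1 / (norm a)\<^sup>2) *\<^sub>R a"
  have na: "0 < norm a" "norm a < 1" using a False by auto
  have nc: "norm c = 1 / norm a" using na by (simp add: c_def power2_eq_square)
  then have nc1: "norm c > 1" using na by simp
  define r where "r = sqrt ((norm c)\<^sup>2 - 1)"
  have r2: "r\<^sup>2 = (norm c)\<^sup>2 - 1" and r: "r > 0" using nc1 by (auto simp: r_def power_less_one_iff)
  define \<tau> where "\<tau> x = c + (r / norm (x - c))\<^sup>2 *\<^sub>R (x - c)" for x
  define k where "k x = (r / norm (x - c))\<^sup>2" for x
  have ne: "x \<noteq> c" if "x \<in> unit_ball" for x using that nc1 by auto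
  have kpos: "k x > 0" if "x \<in> unit_ball" for x using ne[OF that] r by (simp add: k_def)
  have gap: "1 - (norm (\<tau> x))\<^sup>2 = k x * (1 - (norm x)\<^sup>2)" if x: "x \<in> unit_ball" for x
  proof -
    have "(norm (\<tau> x))\<^sup>2 = (norm c)\<^sup>2 + 2 * k x * (c \<bullet> (x - c)) + k x * (k x * (norm (x - c))\<^sup>2)"
      unfolding \<tau>_def k_def[symmetric] power2_norm_eq_inner
      by (simp add: inner_add_left inner_add_right inner_commute algebra_simps)
    also have "k x * (norm (x - c))\<^sup>2 = r\<^sup>2" using ne[OF x] by (simp add: k_def power_divide)
    also have "2 * k x * (c \<bullet> (x - c)) = k x * ((norm x)\<^sup>2 - (norm c)\<^sup>2 - (norm (x - c))\<^sup>2)"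
    proof -
      have "2 * (c \<bullet> (x - c)) = (norm x)\<^sup>2 - (norm c)\<^sup>2 - (norm (x - c))\<^sup>2"
        unfolding power2_norm_eq_inner by (simp add: inner_diff_left inner_diff_right inner_commute)
      then show ?thesis by (metis mult.assoc mult.commute)
    qed
    also have "\<dots> = k x * ((norm x)\<^sup>2 - (norm c)\<^sup>2) - r\<^sup>2"
      using \<open>k x * (norm (x - c))\<^sup>2 = r\<^sup>2\<close> by (simp add: algebra_simps)
    finally show ?thesis by (simp add: r2 algebra_simps)
  qed
  have dist: "(norm (\<tau> x - \<tau> y))\<^sup>2 = k x * k y * (norm (x - y))\<^sup>2" if "x \<in> unit_ball" "y \<in> unit_ball" for x y
  proof -
    have "norm (\<tau> x - \<tau> y) = r\<^sup>2 * norm (x - y) / (norm (x - c) * norm (y - c))"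
      using norm_inversion_diff[of "x - c" "y - c" r] ne that by (simp add: \<tau>_def)
    then show ?thesis by (simp add: k_def power_divide power_mult_distrib power2_eq_square[of "r\<^sup>2"])
  qed
  have into: "\<tau> x \<in> unit_ball" if "x \<in> unit_ball" for x
  proof -
    have "1 - (norm (\<tau> x))\<^sup>2 > 0" using gap[OF that] kpos[OF that] unit_ball_gap[OF that] by simp
    then show ?thesis by (simp add: abs_square_less_1)
  qed
  have inv: "\<tau> (\<tau> x) = x" if "x \<in> unit_ball" for x
  proof -
    have 1: "\<tau> x - c = k x *\<^sub>R (x - c)" by (simp add: \<tau>_def k_def)
    have "norm (\<tau> x - c) = k x * norm (x - c)" unfolding 1 using kpos[OF that] by simp
    then have "norm (\<tau> x - c) = r\<^sup>2 / norm (x - c)" using ne[OF that]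
      by (simp add: k_def power2_eq_square)
    then have "k (\<tau> x) = (r / (r\<^sup>2 / norm (x - c)))\<^sup>2" by (simp add: k_def[of "\<tau> x"])
    also have "\<dots> = 1 / k x" using ne[OF that] r by (simp add: k_def power2_eq_square)
    finally have kk: "k (\<tau> x) = 1 / k x" .
    have "\<tau> (\<tau> x) = c + k (\<tau> x) *\<^sub>R (\<tau> x - c)" by (simp only: \<tau>_def[of "\<tau> x"] k_def)
    then have "\<tau> (\<tau> x) = c + (1 / k x) *\<^sub>R (k x *\<^sub>R (x - c))"
      unfolding kk 1 .
    then show ?thesis using kpos[OF that] by simp
  qed
  have iso: "hyp_isometry \<tau>" unfolding hyp_isometry_def
    using into dist gap by (auto simp del: mem_ball_0)
  have bij: "bij_betw \<tau> unit_ball unit_ball"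
    by (rule bij_betw_byWitness[where f' = \<tau>]) (use inv into in blast)+
  have conf: "conformal_ball_map \<tau>" unfolding conformal_ball_map_def
  proof (intro conjI bij exI[of _ "\<lambda>x. sqrt (k x)"] ballI)
    show "0 < sqrt (k x)" if "x \<in> unit_ball" for x using kpos[OF that] by simp
    fix x y :: "real^'n" assume xy: "x \<in> unit_ball" "y \<in> unit_ball"
    have "norm (\<tau> x - \<tau> y) = sqrt (k x * k y * (norm (x - y))\<^sup>2)"
      using dist[OF xy] by (metis norm_ge_zero real_sqrt_unique)
    then show "norm (\<tau> x - \<tau> y) = sqrt (k x) * sqrt (k y) * norm (x - y)"
      by (simp add: real_sqrt_mult)
  qed
  have t0: "\<tau> 0 = a"
  proof -
    have "\<tau> 0 = (1 - r\<^sup>2 / (norm c)\<^sup>2) *\<^sub>R c"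
      by (simp add: \<tau>_def power_divide scaleR_left_diff_distrib)
    also have "1 - r\<^sup>2 / (norm c)\<^sup>2 = (norm a)\<^sup>2" using na by (simp add: r2 nc field_simps)
    finally show ?thesis using na by (simp add: c_def)
  qed
  have ta: "\<tau> a = 0" using inv[of 0] t0 by simp
  have diff: "\<tau> differentiable (at x)" if x: "x \<in> unit_ball" for x
  proof -
    have *: "\<tau> = (\<lambda>x. c + (r\<^sup>2 / ((x - c) \<bullet> (x - c))) *\<^sub>R (x - c))"
      by (auto simp: \<tau>_def power_divide power2_norm_eq_inner)
    have "(x - c) \<bullet> (x - c) \<noteq> 0" using ne[OF x] by simp
    then show ?thesis unfolding *
      by (intro differentiable_add differentiable_const differentiable_scaleR differentiable_divide
          differentiable_inner differentiable_diff differentiable_ident) assumption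
  qed
  show thesis using that conf iso t0 ta inv diff by blast
qed

text \<open>Composing \<open>g\<close> with the inversion that carries 0 to the preimage of 0 gives
  a map fixing 0, which is linear and isometric. So on the ball \<open>g\<close> is an inversion
  followed by a linear isometry, and both claims follow from the properties of the
  inversion.\<close>

lemma conformal_ball_map_hyp_isometry:
  fixes g :: "real^'n \<Rightarrow> real^'n"
  assumes g: "conformal_ball_map g"
  shows "hyp_isometry g" and "\<And>x. x \<in> unit_ball \<Longrightarrow> g differentiable (at x)"
proof -
  obtain S where S: "conformal_ball_map S" "\<And>x. x \<in> unit_ball \<Longrightarrow> S x \<in> unit_ball \<and> g (S x) = x"
    "\<And>x. x \<in> unit_ball \<Longrightarrow> S (g x) = x"
    using conformal_ball_map_inverse_exists[OF g] by blast
  define a where "a = S 0"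
  have a: "a \<in> unit_ball" "g a = 0" using S(2)[of 0] by (auto simp: a_def)
  obtain \<tau> where \<tau>: "conformal_ball_map \<tau>" "hyp_isometry \<tau>" "\<tau> 0 = a" "\<tau> a = 0"
    "\<And>x. x \<in> unit_ball \<Longrightarrow> \<tau> (\<tau> x) = x" "\<And>x. x \<in> unit_ball \<Longrightarrow> \<tau> differentiable (at x)"
    using ball_inversion_exists[OF a(1)] by blast
  define T where "T = g \<circ> \<tau>"
  have cT: "conformal_ball_map T" unfolding T_def by (rule conformal_ball_map_comp[OF g \<tau>(1)])
  have T0: "T 0 = 0" using \<tau>(3) a by (simp add: T_def)
  note fix0 = conformal_ball_map_fix0[OF cT T0]
  obtain L where L: "linear L" "\<And>x. x \<in> unit_ball \<Longrightarrow> T x = L x"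
    using ball_isometry_linear[of T] fix0 by blast
  have tb: "\<tau> x \<in> unit_ball" if "x \<in> unit_ball" for x using \<tau>(2) that unfolding hyp_isometry_def by blast
  have isoT: "hyp_isometry T" unfolding hyp_isometry_def
    using fix0 by (auto simp: subset_eq)
  have gT: "g x = T (\<tau> x)" if "x \<in> unit_ball" for x using \<tau>(5)[OF that] by (simp add: T_def)
  have "hyp_isometry (T \<circ> \<tau>)" by (rule hyp_isometry_comp[OF isoT \<tau>(2)])
  then show "hyp_isometry g" unfolding hyp_isometry_def using gT by (auto simp: subset_eq)
  show "g differentiable (at x)" if x: "x \<in> unit_ball" for x
  proof -
    obtain \<tau>' where t': "(\<tau> has_derivative \<tau>') (at x)" using \<tau>(6)[OF x] unfolding differentiable_def by blast
    have "((\<lambda>x. L (\<tau> x)) has_derivative (\<lambda>h. L (\<tau>' h))) (at x)"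
      using bounded_linear.has_derivative[OF _ t', of L] L(1) linear_conv_bounded_linear by blast
    then have "(g has_derivative (\<lambda>h. L (\<tau>' h))) (at x)"
    proof (rule has_derivative_transform_within_open[OF _ open_ball x])
      fix y :: "real^'n" assume "y \<in> unit_ball" then show "L (\<tau> y) = g y" using gT L(2) tb by metis
    qed
    then show ?thesis by (rule differentiableI)
  qed
qed

lemma hyp_dist_commute: "hyp_dist x y = hyp_dist y x"
  by (simp add: hyp_dist_def norm_minus_commute mult.commute)

lemma hyp_dist_self [simp]: "hyp_dist x x = 0"
  by (simp add: hyp_dist_def)

lemma hyp_dist_zero_left: 
  assumes "y \<in> unit_ball" shows "hyp_dist 0 y = ln ((1 + norm y) / (1 - norm y))"
  by (simp add: hyp_dist_def Let_def)

lemma ln_ratio_bounds: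
  fixes t :: real assumes "0 \<le> t" "t < 1"
  shows "2 * t / (1 + t) \<le> ln ((1 + t) / (1 - t))" "ln ((1 + t) / (1 - t)) \<le> 2 * t / (1 - t)"
proof -
  have "ln ((1 + t) / (1 - t)) \<le> (1 + t) / (1 - t) - 1" using assms by (intro ln_le_minus_one) simp
  also have "\<dots> = 2 * t / (1 - t)" using assms by (simp add: field_simps)
  finally show "ln ((1 + t) / (1 - t)) \<le> 2 * t / (1 - t)" .
  have "ln ((1 - t) / (1 + t)) \<le> (1 - t) / (1 + t) - 1" using assms by (intro ln_le_minus_one) simp
  also have "\<dots> = - (2 * t / (1 + t))" using assms by (simp add: field_simps)
  finally show "2 * t / (1 + t) \<le> ln ((1 + t) / (1 - t))"
    using assms by (simp add: ln_div)
qed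

lemma hyp_dist_nonneg: "x \<in> unit_ball \<Longrightarrow> y \<in> unit_ball \<Longrightarrow> 0 \<le> hyp_dist x y"
  unfolding hyp_dist_ratio using ball_ratio_bounds[of x y] by (intro ln_ge_zero) (auto simp: field_simps)

text \<open>The square root in \<open>ball_ratio\<close> is at most 2, and
  \<open>ln ((1 + t) / (1 - t))\<close> is at least \<open>2 * t / (1 + t)\<close>, hence at least
  \<open>t\<close>; this produces the constant 2.\<close>

lemma norm_le_hyp_dist:
  assumes x: "x \<in> unit_ball" and y: "y \<in> unit_ball"
  shows "norm (x - y) \<le> 2 * hyp_dist x y"
proof -
  let ?A = "(norm (x - y))\<^sup>2 + (1 - (norm x)\<^sup>2) * (1 - (norm y)\<^sup>2)"
  have "?A = 1 - 2 * (x \<bullet> y) + (norm x)\<^sup>2 * (norm y)\<^sup>2"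
    unfolding power2_norm_eq_inner by (simp add: inner_diff_left inner_diff_right inner_commute algebra_simps)
  also have "\<dots> \<le> 1 + 2 * 1 + 1"
  proof (intro add_mono)
    have "\<bar>x \<bullet> y\<bar> \<le> norm x * norm y" by (rule Cauchy_Schwarz_ineq2)
    also have "\<dots> \<le> 1 * 1" using x y by (intro mult_mono) auto
    finally show "1 - 2 * (x \<bullet> y) \<le> 1 + 2 * 1" by linarith
    have "(norm x)\<^sup>2 * (norm y)\<^sup>2 \<le> 1 * 1" using x y by (intro mult_mono power_le_one) auto
    then show "(norm x)\<^sup>2 * (norm y)\<^sup>2 \<le> 1" by simp
  qed
  finally have "sqrt ?A \<le> 2" by (intro real_le_lsqrt) auto
  moreover have "sqrt ?A > 0"
    using unit_ball_gap[OF x] unit_ball_gap[OF y] by (simp add: add_nonneg_pos)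
  ultimately have t: "ball_ratio x y \<ge> norm (x - y) / 2"
    unfolding ball_ratio_def by (intro divide_left_mono) auto
  note b = ball_ratio_bounds[OF x y]
  have "ball_ratio x y \<le> 2 * ball_ratio x y / (1 + ball_ratio x y)"
    using b by (simp add: field_simps mult_left_le)
  also have "\<dots> \<le> hyp_dist x y" unfolding hyp_dist_ratio by (rule ln_ratio_bounds(1)[OF b])
  finally show ?thesis using t by simp
qed

lemma hyp_dist_eq_0: "x \<in> unit_ball \<Longrightarrow> y \<in> unit_ball \<Longrightarrow> hyp_dist x y = 0 \<longleftrightarrow> x = y"
  using norm_le_hyp_dist[of x y] by auto

text \<open>For given norms the distance is largest for opposite points, where the ratio becomes
  \<open>(a + b) / (1 + a * b)\<close>, the addition formula of tanh. There the logarithm splits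
  exactly into the two distances from 0.\<close>

lemma hyp_dist_triangle_0:
  assumes x: "x \<in> unit_ball" and y: "y \<in> unit_ball"
  shows "hyp_dist x y \<le> hyp_dist x 0 + hyp_dist 0 y"
proof -
  define a b where "a = norm x" and "b = norm y"
  have ab: "0 \<le> a" "a < 1" "0 \<le> b" "b < 1" using x y by (auto simp: a_def b_def)
  define B where "B = (1 - a\<^sup>2) * (1 - b\<^sup>2)"
  have B: "B > 0" unfolding B_def a_def b_def using unit_ball_gap[OF x] unit_ball_gap[OF y] by simp
  define s where "s = (a + b) / (1 + a * b)"
  have ab1: "1 + a * b > 0" using ab by (simp add: add_pos_nonneg)
  have "(a + b)\<^sup>2 + B = (1 + a * b)\<^sup>2" unfolding B_def by (simp add: power2_eq_square algebra_simps)
  then have s2: "s\<^sup>2 = (a + b)\<^sup>2 / ((a + b)\<^sup>2 + B)" by (simp add: s_def power_divide)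
  have n: "(norm (x - y))\<^sup>2 \<le> (a + b)\<^sup>2" unfolding a_def b_def by (intro power_mono norm_triangle_ineq4) simp
  have "(ball_ratio x y)\<^sup>2 = (norm (x - y))\<^sup>2 / ((norm (x - y))\<^sup>2 + B)"
    using ball_ratio_square[OF x y] by (simp add: B_def a_def b_def)
  also have "\<dots> \<le> s\<^sup>2" unfolding s2
  proof -
    have this': "(norm (x - y))\<^sup>2 * ((a + b)\<^sup>2 + B) \<le> (a + b)\<^sup>2 * ((norm (x - y))\<^sup>2 + B)"
      using n B by (simp add: algebra_simps)
    show "(norm (x - y))\<^sup>2 / ((norm (x - y))\<^sup>2 + B) \<le> (a + b)\<^sup>2 / ((a + b)\<^sup>2 + B)"
    proof -
      have "(norm (x - y))\<^sup>2 + B > 0" "(a + b)\<^sup>2 + B > 0" using B by (simp_all add: add_nonneg_pos)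
      with this' show ?thesis by (simp only: pos_divide_le_eq times_divide_eq_left pos_le_divide_eq)
    qed
  qed
  finally have t: "ball_ratio x y \<le> s"
    by (rule power2_le_imp_le) (use ab ab1 in \<open>simp add: s_def\<close>)
  have s1: "s < 1"
  proof -
    have "(1 - a) * (1 - b) > 0" using ab by simp
    then show ?thesis using ab1 by (simp add: s_def algebra_simps)
  qed
  have "hyp_dist x y \<le> ln ((1 + s) / (1 - s))" unfolding hyp_dist_ratio
    using t s1 ball_ratio_bounds[OF x y] by (intro ln_mono frac_le) auto
  also have "(1 + s) / (1 - s) = ((1 + a) / (1 - a)) * ((1 + b) / (1 - b))"
  proof -
    have "1 + s = (1 + a) * (1 + b) / (1 + a * b)" "1 - s = (1 - a) * (1 - b) / (1 + a * b)"
      using ab1 by (simp_all add: s_def field_simps)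
    then show ?thesis using ab1 by simp
  qed
  also have "ln \<dots> = ln ((1 + a) / (1 - a)) + ln ((1 + b) / (1 - b))"
    using ab by (intro ln_mult_pos) auto
  also have "\<dots> = hyp_dist x 0 + hyp_dist 0 y"
    using hyp_dist_zero_left[OF x] hyp_dist_zero_left[OF y] by (simp add: hyp_dist_commute[of x 0] a_def b_def)
  finally show ?thesis .
qed

text \<open>An isometry that moves the middle point to 0 reduces this to
  \<open>hyp_dist_triangle_0\<close>.\<close>

lemma hyp_dist_triangle:
  assumes x: "x \<in> unit_ball" and y: "y \<in> unit_ball" and z: "z \<in> unit_ball"
  shows "hyp_dist x z \<le> hyp_dist x y + hyp_dist y z"
proof -
  obtain \<tau> where \<tau>: "hyp_isometry \<tau>" "\<tau> y = 0"
    using ball_inversion_exists[OF y] by metis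
  have t: "\<tau> x \<in> unit_ball" "\<tau> z \<in> unit_ball" using \<tau>(1) x z unfolding hyp_isometry_def by blast+
  show ?thesis
    using hyp_dist_triangle_0[OF t] hyp_isometry_hyp_dist[OF \<tau>(1)] x y z \<tau>(2) by metis
qed

lemma hyp_ball_compact:
  assumes x: "x \<in> unit_ball"
  obtains r where "0 < r" "r < 1" "\<And>y. y \<in> unit_ball \<Longrightarrow> hyp_dist x y \<le> R \<Longrightarrow> norm y \<le> r"
proof -
  define E where "E = exp (R + hyp_dist 0 x)"
  have E: "E > 0" by (simp add: E_def)
  have *: "norm y \<le> (E - 1) / (E + 1)" if y: "y \<in> unit_ball" "hyp_dist x y \<le> R" for y
  proof -
    have "hyp_dist 0 y \<le> R + hyp_dist 0 x"
      using hyp_dist_triangle[of 0 x y] x y by simp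
    then have "exp (ln ((1 + norm y) / (1 - norm y))) \<le> E"
      unfolding hyp_dist_zero_left[OF y(1)] E_def by simp
    then have "(1 + norm y) / (1 - norm y) \<le> E" using y by (subst (asm) exp_ln) (auto intro!: divide_pos_pos add_pos_nonneg)
    then show ?thesis using y E by (simp add: field_simps)
  qed
  have "(E - 1) / (E + 1) < 1" using E by simp
  then show thesis using that[of "max (1/2) ((E - 1) / (E + 1))"] * by (auto simp: le_max_iff_disj)
qed

section \<open>Infinitesimal comparison of hyperbolic and Euclidean distance\<close>

definition conf_factor :: "real^'n \<Rightarrow> real"
  where "conf_factor x = 2 / (1 - (norm x)\<^sup>2)"

lemma conf_factor_pos: "x \<in> unit_ball \<Longrightarrow> conf_factor x > 0"
  using unit_ball_gap[of x] by (simp add: conf_factor_def)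

lemma hyp_dist_limit:
  assumes x: "x \<in> unit_ball"
  shows "((\<lambda>y. hyp_dist x y / norm (x - y)) \<longlongrightarrow> conf_factor x) (at x)"
proof -
  define A where "A y = sqrt ((norm (x - y))\<^sup>2 + (1 - (norm x)\<^sup>2) * (1 - (norm y)\<^sup>2))" for y
  have Ax: "A x = 1 - (norm x)\<^sup>2" "A x > 0"
    using unit_ball_gap[OF x] by (simp_all add: A_def power2_eq_square[symmetric])
  have A: "(A \<longlongrightarrow> A x) (at x)" unfolding A_def by (intro tendsto_intros)
  have t: "((\<lambda>y. ball_ratio x y) \<longlongrightarrow> norm (x - x) / A x) (at x)"
    unfolding ball_ratio_def A_def[symmetric] using Ax by (intro tendsto_intros A) auto
  have ev: "\<forall>\<^sub>F y in at x. y \<in> unit_ball \<and> y \<noteq> x"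
    using eventually_at_in_open[OF open_ball x] by (auto elim: eventually_mono)
  have lo: "((\<lambda>y. 2 / (1 + ball_ratio x y) / A y) \<longlongrightarrow> 2 / (1 + norm (x - x) / A x) / A x) (at x)"
    using Ax by (intro tendsto_intros A t) auto
  have hi: "((\<lambda>y. 2 / (1 - ball_ratio x y) / A y) \<longlongrightarrow> 2 / (1 - norm (x - x) / A x) / A x) (at x)"
    using Ax by (intro tendsto_intros A t) auto
  show ?thesis
  proof (rule tendsto_sandwich)
    show "\<forall>\<^sub>F y in at x. 2 / (1 + ball_ratio x y) / A y \<le> hyp_dist x y / norm (x - y)"
      using ev
    proof eventually_elim
      case (elim y)
      note b = ball_ratio_bounds[OF x conjunct1[OF elim]]
      have "norm (x - y) > 0" using elim by auto
      then have "2 / (1 + ball_ratio x y) / A y = (2 * ball_ratio x y / (1 + ball_ratio x y)) / norm (x - y)"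
        by (simp add: ball_ratio_def A_def[symmetric])
      also have "\<dots> \<le> hyp_dist x y / norm (x - y)"
        unfolding hyp_dist_ratio by (intro divide_right_mono ln_ratio_bounds(1)[OF b]) simp
      finally show ?case .
    qed
    show "\<forall>\<^sub>F y in at x. hyp_dist x y / norm (x - y) \<le> 2 / (1 - ball_ratio x y) / A y"
      using ev
    proof eventually_elim
      case (elim y)
      note b = ball_ratio_bounds[OF x conjunct1[OF elim]]
      have "norm (x - y) > 0" using elim by auto
      then have "2 / (1 - ball_ratio x y) / A y = (2 * ball_ratio x y / (1 - ball_ratio x y)) / norm (x - y)"
        by (simp add: ball_ratio_def A_def[symmetric])
      moreover have "hyp_dist x y / norm (x - y) \<le> \<dots>"
        unfolding hyp_dist_ratio by (intro divide_right_mono ln_ratio_bounds(2)[OF b]) simp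
      ultimately show ?case by simp
    qed
    show "((\<lambda>y. 2 / (1 + ball_ratio x y) / A y) \<longlongrightarrow> conf_factor x) (at x)" using lo Ax by (simp add: conf_factor_def)
    show "((\<lambda>y. 2 / (1 - ball_ratio x y) / A y) \<longlongrightarrow> conf_factor x) (at x)" using hi Ax by (simp add: conf_factor_def)
  qed
qed

lemma hyp_dist_tendsto_0:
  assumes x: "x \<in> unit_ball" and e: "e > 0"
  obtains \<delta> where "\<delta> > 0" "\<And>y. norm (x - y) < \<delta> \<Longrightarrow> y \<in> unit_ball \<and> hyp_dist x y < e"
proof -
  have "((\<lambda>y. hyp_dist x y / norm (x - y) * norm (x - y)) \<longlongrightarrow> conf_factor x * norm (x - x)) (at x)"
    by (intro tendsto_mult hyp_dist_limit[OF x] tendsto_intros)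
  moreover have "\<forall>\<^sub>F y in at x. hyp_dist x y / norm (x - y) * norm (x - y) = hyp_dist x y"
    by (auto simp: eventually_at intro!: exI[of _ 1])
  ultimately have "((\<lambda>y. hyp_dist x y) \<longlongrightarrow> 0) (at x)"
    using Lim_transform_eventually[of "\<lambda>y. hyp_dist x y / norm (x - y) * norm (x - y)" 0 "at x" "\<lambda>y. hyp_dist x y"] by simp
  then have "\<forall>\<^sub>F y in at x. dist (hyp_dist x y) 0 < e" using e by (rule tendstoD)
  moreover have "\<forall>\<^sub>F y in at x. y \<in> unit_ball" using eventually_at_in_open'[OF open_ball x] .
  ultimately have "\<forall>\<^sub>F y in at x. y \<in> unit_ball \<and> hyp_dist x y < e"
    by eventually_elim auto
  then obtain d where "d > 0" "\<And>y. y \<noteq> x \<Longrightarrow> dist y x < d \<Longrightarrow> y \<in> unit_ball \<and> hyp_dist x y < e"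
    unfolding eventually_at by blast
  then have "y \<in> unit_ball \<and> hyp_dist x y < e" if "norm (x - y) < d" for y
    using x e that by (cases "y = x") (auto simp: dist_norm norm_minus_commute)
  with \<open>d > 0\<close> show thesis using that by blast
qed

section \<open>The orbit space as a metric space\<close>

locale deck_group =
  fixes G :: "(real^'n \<Rightarrow> real^'n) set"
  assumes moebius: "moebius_group G" and discont: "acts_discontinuously G" and free: "no_fixed_points G"
begin

abbreviation pr :: "real^'n \<Rightarrow> (real^'n) set" where "pr \<equiv> orbit_proj G"

lemma G_bij: "g \<in> G \<Longrightarrow> bij_betw g unit_ball unit_ball"
  and G_ext: "g \<in> G \<Longrightarrow> g \<in> extensional unit_ball"
  using moebius subgroup.subset unfolding moebius_group_def
  by (fastforce simp: BijGroup_def Bij_def)+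

lemma G_ball: "g \<in> G \<Longrightarrow> x \<in> unit_ball \<Longrightarrow> g x \<in> unit_ball"
  using G_bij bij_betwE by blast

lemma G_id: "\<exists>e\<in>G. \<forall>x\<in>unit_ball. e x = x"
proof -
  have "\<one>\<^bsub>BijGroup unit_ball\<^esub> \<in> G" using moebius subgroup.one_closed unfolding moebius_group_def by blast
  then show ?thesis
    by (intro bexI[of _ "\<one>\<^bsub>BijGroup unit_ball\<^esub>"]) (simp_all add: BijGroup_def del: mem_ball_0)
qed

lemma G_comp:
  assumes "g \<in> G" "h \<in> G" shows "\<exists>k\<in>G. \<forall>x\<in>unit_ball. k x = g (h x)"
proof -
  have sg: "subgroup G (BijGroup unit_ball)" using moebius by (simp add: moebius_group_def)
  have "g \<otimes>\<^bsub>BijGroup unit_ball\<^esub> h \<in> G" by (rule subgroup.m_closed[OF sg assms])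
  moreover have "g \<in> Bij unit_ball" "h \<in> Bij unit_ball" using subgroup.subset[OF sg] assms by (auto simp: BijGroup_def)
  ultimately show ?thesis by (intro bexI[of _ "g \<otimes>\<^bsub>BijGroup unit_ball\<^esub> h"]) (auto simp: BijGroup_def compose_def simp del: mem_ball_0)
qed

lemma G_inv:
  assumes "g \<in> G" shows "\<exists>k\<in>G. \<forall>x\<in>unit_ball. k (g x) = x \<and> g (k x) = x"
proof -
  have sg: "subgroup G (BijGroup unit_ball)" using moebius by (simp add: moebius_group_def)
  have B: "g \<in> Bij unit_ball" using subgroup.subset[OF sg] assms by (auto simp: BijGroup_def)
  have "inv\<^bsub>BijGroup unit_ball\<^esub> g \<in> G" by (rule subgroup.m_inv_closed[OF sg assms])
  then have k: "(\<lambda>x\<in>unit_ball. (inv_into unit_ball g) x) \<in> G" using inv_BijGroup[OF B] by simp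
  have b: "bij_betw g unit_ball unit_ball" by (rule G_bij[OF assms])
  have "(\<lambda>x\<in>unit_ball. (inv_into unit_ball g) x) (g x) = x \<and> g ((\<lambda>x\<in>unit_ball. (inv_into unit_ball g) x) x) = x"
    if "x \<in> unit_ball" for x
    using that b G_ball[OF assms that] bij_betw_inv_into_left[OF b that] bij_betw_inv_into_right[OF b that]
    by (simp del: mem_ball_0)
  then show ?thesis using k by blast
qed

text \<open>The quotient of \<open>g\<close> and \<open>h\<close> fixes \<open>x\<close>, so it is
  the identity. Equality off the ball comes from the extensionality of the group elements.\<close>

lemma G_eqI:
  assumes "g \<in> G" "h \<in> G" "x \<in> unit_ball" "g x = h x" shows "g = h"
proof -
  obtain k where k: "k \<in> G" "\<forall>x\<in>unit_ball. k (h x) = x \<and> h (k x) = x" using G_inv[OF assms(2)] by blast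
  obtain l where l: "l \<in> G" "\<forall>x\<in>unit_ball. l x = k (g x)" using G_comp[OF k(1) assms(1)] by blast
  have "l x = x" using l k assms by simp
  then have "l = \<one>\<^bsub>BijGroup unit_ball\<^esub>" using free l(1) assms(3) unfolding no_fixed_points_def by blast
  then have 1: "l y = y" if "y \<in> unit_ball" for y using that by (simp add: BijGroup_def del: mem_ball_0)
  have "g y = h y" if y: "y \<in> unit_ball" for y
  proof -
    have "k (g y) = y" using 1[OF y] l y by metis
    then show ?thesis using k(2) G_ball[OF assms(1) y] by metis
  qed
  then show ?thesis using extensionalityI[OF G_ext[OF assms(1)] G_ext[OF assms(2)]] by blast
qed

lemma G_fixes: "g \<in> G \<Longrightarrow> x \<in> unit_ball \<Longrightarrow> g x = x \<Longrightarrow> y \<in> unit_ball \<Longrightarrow> g y = y"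
  using G_eqI G_id by metis

text \<open>Between finite points \<open>spread\<close> is the Euclidean distance, so its covariance
  restricts to the required identity.\<close>

lemma G_conformal: assumes "g \<in> G" shows "conformal_ball_map g"
proof -
  obtain T where T: "T \<in> moebius_maps" "\<forall>x\<in>unit_ball. T (Some x) = Some (g x)"
    using moebius assms unfolding moebius_group_def by blast
  obtain \<mu> where \<mu>: "\<forall>z. \<mu> z > 0" "\<forall>z w. spread (T z) (T w) = \<mu> z * \<mu> w * spread z w"
    using spread_moebius[OF T(1)] by blast
  show ?thesis unfolding conformal_ball_map_def
  proof (intro conjI G_bij[OF assms] exI[of _ "\<lambda>x. \<mu> (Some x)"] ballI)
    fix x y :: "real^'n" assume "x \<in> unit_ball" "y \<in> unit_ball"
    then show "norm (g x - g y) = \<mu> (Some x) * \<mu> (Some y) * norm (x - y)"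
      using \<mu>(2)[rule_format, of "Some x" "Some y"] T(2) by simp
  qed (use \<mu>(1) in blast)
qed

lemma G_isometry: "g \<in> G \<Longrightarrow> hyp_isometry g"
  and G_differentiable: "g \<in> G \<Longrightarrow> x \<in> unit_ball \<Longrightarrow> g differentiable (at x)"
  and G_continuous: "g \<in> G \<Longrightarrow> continuous_on unit_ball g"
  using conformal_ball_map_hyp_isometry conformal_ball_map_continuous G_conformal by blast+

lemma G_hyp_dist: "g \<in> G \<Longrightarrow> x \<in> unit_ball \<Longrightarrow> y \<in> unit_ball \<Longrightarrow> hyp_dist (g x) (g y) = hyp_dist x y"
  using hyp_isometry_hyp_dist G_isometry by blast

lemma mem_pr: "y \<in> pr x \<longleftrightarrow> (\<exists>g\<in>G. y = g x)"
  by (auto simp: orbit_proj_def)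

lemma pr_self: "x \<in> unit_ball \<Longrightarrow> x \<in> pr x"
  using G_id unfolding mem_pr by (metis)

lemma pr_eq_iff: assumes x: "x \<in> unit_ball" and y: "y \<in> unit_ball"
  shows "pr x = pr y \<longleftrightarrow> (\<exists>g\<in>G. y = g x)"
proof
  assume "pr x = pr y"
  with pr_self[OF y] have "y \<in> pr x" by simp
  then show "\<exists>g\<in>G. y = g x" by (simp only: mem_pr)
next
  assume "\<exists>g\<in>G. y = g x"
  then obtain g where g: "g \<in> G" "y = g x" by blast
  obtain k where k: "k \<in> G" "\<forall>x\<in>unit_ball. k (g x) = x \<and> g (k x) = x" using G_inv[OF g(1)] by blast
  have ky: "k y = x" using k(2) x g(2) by blast
  have 1: "\<exists>l\<in>G. h x = l y" if h: "h \<in> G" for h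
  proof -
    obtain l where "l \<in> G" "\<forall>x\<in>unit_ball. l x = h (k x)" using G_comp[OF h k(1)] by blast
    then show ?thesis using ky y by (intro bexI[of _ l]) (simp_all del: mem_ball_0)
  qed
  have 2: "\<exists>l\<in>G. h y = l x" if h: "h \<in> G" for h
  proof -
    obtain l where "l \<in> G" "\<forall>x\<in>unit_ball. l x = h (g x)" using G_comp[OF h g(1)] by blast
    then show ?thesis using g(2) x by (intro bexI[of _ l]) (simp_all del: mem_ball_0)
  qed
  have "z \<in> pr x \<longleftrightarrow> z \<in> pr y" for z unfolding mem_pr using 1 2 by auto
  then show "pr x = pr y" by blast
qed

lemma pr_G: "g \<in> G \<Longrightarrow> x \<in> unit_ball \<Longrightarrow> pr (g x) = pr x"
  using pr_eq_iff[OF _ G_ball, of x g x] by (metis G_ball)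

text \<open>A closed hyperbolic ball lies in a compact Euclidean ball, which finitely many of the
  neighbourhoods given by discontinuity cover. If some \<open>h x\<close> lies in such a
  \<open>U\<close>, every \<open>g\<close> with \<open>g x\<close> in \<open>U\<close> yields
  \<open>g\<close> composed with the inverse of \<open>h\<close>, which moves \<open>U\<close> to a
  set meeting \<open>U\<close>; this assignment is injective by freeness.\<close>

lemma orbit_finite:
  assumes x: "x \<in> unit_ball" and y: "y \<in> unit_ball"
  shows "finite {g \<in> G. hyp_dist y (g x) \<le> R}"
proof -
  obtain r where r: "0 < r" "r < 1" "\<And>z. z \<in> unit_ball \<Longrightarrow> hyp_dist y z \<le> R \<Longrightarrow> norm z \<le> r"
    using hyp_ball_compact[OF y] by blast
  have "\<forall>z\<in>cball 0 r. \<exists>U. open U \<and> z \<in> U \<and> finite {g \<in> G. g x \<in> U}"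
  proof
    fix z :: "real^'n" assume "z \<in> cball 0 r"
    then have z: "z \<in> unit_ball" using r by simp
    obtain U where U: "open U" "z \<in> U" "U \<subseteq> unit_ball" "finite {g \<in> G. g ` U \<inter> U \<noteq> {}}"
      using discont z unfolding acts_discontinuously_def by blast
    have "finite {g \<in> G. g x \<in> U}"
    proof (cases "{g \<in> G. g x \<in> U} = {}")
      case True
      show ?thesis unfolding True by simp
    next
      case False
      obtain h where h: "h \<in> G" "h x \<in> U" using False by blast
      obtain k where k: "k \<in> G" "\<forall>x\<in>unit_ball. k (h x) = x \<and> h (k x) = x" using G_inv[OF h(1)] by blast
      have "\<exists>l \<in> {g \<in> G. g ` U \<inter> U \<noteq> {}}. \<forall>x\<in>unit_ball. l x = g (k x)" if g: "g \<in> G" "g x \<in> U" for g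
      proof -
        obtain l where l: "l \<in> G" "\<forall>x\<in>unit_ball. l x = g (k x)" using G_comp[OF g(1) k(1)] by blast
        have "h x \<in> unit_ball" using h U(3) by blast
        then have "l (h x) = g x" using l(2) k(2) x by (simp del: mem_ball_0)
        then have "g x \<in> l ` U \<inter> U" using h g by force
        then show ?thesis using l by blast
      qed
      note ex = this
      define L where "L g = (SOME l. l \<in> {g \<in> G. g ` U \<inter> U \<noteq> {}} \<and> (\<forall>x\<in>unit_ball. l x = g (k x)))" for g
      have L: "L g \<in> {g \<in> G. g ` U \<inter> U \<noteq> {}} \<and> (\<forall>x\<in>unit_ball. L g x = g (k x))" if "g \<in> G" "g x \<in> U" for g
      proof -
        have "\<exists>l. l \<in> {g \<in> G. g ` U \<inter> U \<noteq> {}} \<and> (\<forall>x\<in>unit_ball. l x = g (k x))" using ex[OF that] by blast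
        then show ?thesis unfolding L_def by (rule someI_ex)
      qed
      have "inj_on L {g \<in> G. g x \<in> U}"
      proof (rule inj_onI)
        fix g g' assume g: "g \<in> {g \<in> G. g x \<in> U}" "g' \<in> {g \<in> G. g x \<in> U}" "L g = L g'"
        have hx: "h x \<in> unit_ball" using h U(3) by blast
        have "L g (h x) = g (k (h x))" "L g' (h x) = g' (k (h x))" using L[of g] L[of g'] g(1,2) hx by blast+
        then have "g (k (h x)) = g' (k (h x))" using g(3) by simp
        then show "g = g'" using G_eqI[of g g' x] g k(2) x by simp
      qed
      moreover have "L ` {g \<in> G. g x \<in> U} \<subseteq> {g \<in> G. g ` U \<inter> U \<noteq> {}}" using L by blast
      ultimately show ?thesis using U(4) inj_on_finite by blast
    qed
    then show "\<exists>U. open U \<and> z \<in> U \<and> finite {g \<in> G. g x \<in> U}" using U by blast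
  qed
  from bchoice[OF this] obtain U where
    U: "\<forall>z\<in>cball 0 r. open (U z) \<and> z \<in> U z \<and> finite {g \<in> G. g x \<in> U z}" by blast
  have "compact (cball (0::real^'n) r)" by simp
  moreover have "\<And>z. z \<in> cball 0 r \<Longrightarrow> open (U z)" using U by blast
  moreover have "cball 0 r \<subseteq> (\<Union>z\<in>cball 0 r. U z)" using U by blast
  ultimately obtain C where C: "C \<subseteq> cball 0 r" "finite C" "cball 0 r \<subseteq> (\<Union>z\<in>C. U z)"
    by (rule compactE_image)
  have "{g \<in> G. hyp_dist y (g x) \<le> R} \<subseteq> (\<Union>z\<in>C. {g \<in> G. g x \<in> U z})"
  proof
    fix g assume g: "g \<in> {g \<in> G. hyp_dist y (g x) \<le> R}"
    then have "g x \<in> cball 0 r" using r(3)[of "g x"] G_ball[of g x] x by simp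
    then show "g \<in> (\<Union>z\<in>C. {g \<in> G. g x \<in> U z})" using C g by blast
  qed
  moreover have "finite (\<Union>z\<in>C. {g \<in> G. g x \<in> U z})" using C U by blast
  ultimately show ?thesis by (rule finite_subset)
qed

text \<open>Since the group acts by isometries, the first representative may be kept at
  \<open>x\<close>. Only finitely many translates of \<open>y\<close> are as close to
  \<open>x\<close> as \<open>y\<close> is, so the infimum is a minimum.\<close>

lemma orbit_dist_attained:
  assumes x: "x \<in> unit_ball" and y: "y \<in> unit_ball"
  shows "\<exists>g\<in>G. orbit_dist (pr x) (pr y) = hyp_dist x (g y)"
    and "\<And>g. g \<in> G \<Longrightarrow> orbit_dist (pr x) (pr y) \<le> hyp_dist x (g y)"
proof -
  define V where "V = (\<lambda>g. hyp_dist x (g y)) ` G"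
  have V: "(\<lambda>(a, b). hyp_dist a b) ` (pr x \<times> pr y) = V"
  proof
    show "(\<lambda>(a, b). hyp_dist a b) ` (pr x \<times> pr y) \<subseteq> V"
    proof clarify
      fix a b assume "a \<in> pr x" "b \<in> pr y"
      then obtain g h where g: "g \<in> G" "a = g x" and h: "h \<in> G" "b = h y" using mem_pr by blast
      obtain k where k: "k \<in> G" "\<forall>x\<in>unit_ball. k (g x) = x \<and> g (k x) = x" using G_inv[OF g(1)] by blast
      obtain l where l: "l \<in> G" "\<forall>x\<in>unit_ball. l x = k (h x)" using G_comp[OF k(1) h(1)] by blast
      have ab: "a \<in> unit_ball" "b \<in> unit_ball" using G_ball[OF g(1) x] G_ball[OF h(1) y] g h by auto
      have "hyp_dist a b = hyp_dist (k a) (k b)" using G_hyp_dist[OF k(1) ab] by simp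
      also have "\<dots> = hyp_dist x (l y)" using k(2) l(2) g h x y by simp
      finally show "hyp_dist a b \<in> V" using l(1) by (simp add: V_def)
    qed
    show "V \<subseteq> (\<lambda>(a, b). hyp_dist a b) ` (pr x \<times> pr y)"
    proof (clarsimp simp: V_def)
      fix g assume "g \<in> G"
      moreover have "x \<in> pr x" by (rule pr_self[OF x])
      ultimately show "hyp_dist x (g y) \<in> (\<lambda>(a, b). hyp_dist a b) ` (pr x \<times> pr y)"
        by (intro image_eqI[of _ _ "(x, g y)"]) (auto simp: mem_pr)
    qed
  qed
  define S where "S = {g \<in> G. hyp_dist x (g y) \<le> hyp_dist x y}"
  have fin: "finite S" unfolding S_def by (rule orbit_finite[OF y x])
  obtain e where e: "e \<in> G" "\<forall>x\<in>unit_ball. e x = x" using G_id by blast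
  have "e \<in> S" unfolding S_def using e y by simp
  then have ne: "S \<noteq> {}" by blast
  define g0 where "g0 = arg_min_on (\<lambda>g. hyp_dist x (g y)) S"
  have g0: "g0 \<in> S" unfolding g0_def by (rule arg_min_if_finite(1)[OF fin ne])
  have min: "hyp_dist x (g0 y) \<le> hyp_dist x (g y)" if "g \<in> G" for g
  proof (cases "g \<in> S")
    case True then show ?thesis unfolding g0_def by (rule arg_min_least[OF fin ne])
  next
    case False then show ?thesis using g0 that by (auto simp: S_def)
  qed
  have "Inf V = hyp_dist x (g0 y)"
    by (rule cInf_eq_minimum) (use g0 min in \<open>auto simp: V_def S_def\<close>)
  then have "orbit_dist (pr x) (pr y) = hyp_dist x (g0 y)" by (simp add: orbit_dist_def V)
  then show "\<exists>g\<in>G. orbit_dist (pr x) (pr y) = hyp_dist x (g y)"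
    and "\<And>g. g \<in> G \<Longrightarrow> orbit_dist (pr x) (pr y) \<le> hyp_dist x (g y)"
    using g0 min by (auto simp: S_def)
qed

lemma orbit_dist_le: "x \<in> unit_ball \<Longrightarrow> y \<in> unit_ball \<Longrightarrow> orbit_dist (pr x) (pr y) \<le> hyp_dist x y"
  using orbit_dist_attained(2)[of x y] G_id by fastforce

lemma orbit_dist_metric:
  assumes "p \<in> pr ` unit_ball" "q \<in> pr ` unit_ball"
  shows "0 \<le> orbit_dist p q" "orbit_dist p q = 0 \<longleftrightarrow> p = q" "orbit_dist p q = orbit_dist q p"
    "\<And>s. s \<in> pr ` unit_ball \<Longrightarrow> orbit_dist p s \<le> orbit_dist p q + orbit_dist q s"
proof -
  obtain x y where x: "x \<in> unit_ball" "p = pr x" and y: "y \<in> unit_ball" "q = pr y" using assms by blast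
  obtain g where g: "g \<in> G" "orbit_dist p q = hyp_dist x (g y)"
    using orbit_dist_attained(1)[OF x(1) y(1)] unfolding x(2)[symmetric] y(2)[symmetric] by blast
  have gy: "g y \<in> unit_ball" using G_ball g y by blast
  show nn: "0 \<le> orbit_dist p q" using g hyp_dist_nonneg x gy by simp
  have sym: "orbit_dist (pr a) (pr b) \<le> orbit_dist (pr b) (pr a)" if a: "a \<in> unit_ball" and b: "b \<in> unit_ball" for a b
  proof -
    obtain h where h: "h \<in> G" "orbit_dist (pr b) (pr a) = hyp_dist b (h a)" using orbit_dist_attained(1)[OF b a] by blast
    have "orbit_dist (pr (h a)) (pr b) \<le> hyp_dist (h a) b" by (rule orbit_dist_le[OF G_ball[OF h(1) a] b])
    then show ?thesis using h pr_G[OF h(1) a] hyp_dist_commute by metis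
  qed
  show "orbit_dist p q = orbit_dist q p" using sym[OF x(1) y(1)] sym[OF y(1) x(1)] x y by simp
  show "orbit_dist p q = 0 \<longleftrightarrow> p = q"
  proof
    assume "orbit_dist p q = 0"
    then have "x = g y" using g hyp_dist_eq_0[OF x(1) gy] by simp
    then show "p = q" using pr_G[OF g(1) y(1)] x y by simp
  next
    assume "p = q"
    then show "orbit_dist p q = 0" using orbit_dist_le[OF x(1) x(1)] nn x by simp
  qed
  fix s assume "s \<in> pr ` unit_ball"
  then obtain z where z: "z \<in> unit_ball" "s = pr z" by blast
  obtain h where h: "h \<in> G" "orbit_dist q s = hyp_dist y (h z)" using orbit_dist_attained(1)[OF y(1) z(1)] unfolding y(2)[symmetric] z(2)[symmetric] by blast
  obtain l where l: "l \<in> G" "\<forall>x\<in>unit_ball. l x = g (h x)" using G_comp[OF g(1) h(1)] by blast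
  have hz: "h z \<in> unit_ball" using G_ball h z by blast
  have "orbit_dist p s \<le> hyp_dist x (l z)" using orbit_dist_attained(2)[OF x(1) z(1) l(1)] x z by simp
  also have "\<dots> \<le> hyp_dist x (g y) + hyp_dist (g y) (g (h z))"
    using hyp_dist_triangle[OF x(1) gy, of "g (h z)"] l(2) z(1) G_ball[OF g(1) hz] by simp
  also have "\<dots> = orbit_dist p q + orbit_dist q s" using g h G_hyp_dist[OF g(1) y(1) hz] by simp
  finally show "orbit_dist p s \<le> orbit_dist p q + orbit_dist q s" .
qed

lemma injectivity_radius:
  assumes x: "x \<in> unit_ball"
  obtains r where "r > 0" "\<And>g. g \<in> G \<Longrightarrow> hyp_dist x (g x) < r \<Longrightarrow> g x = x"
proof -
  define S where "S = {g \<in> G. hyp_dist x (g x) \<le> 1 \<and> g x \<noteq> x}"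
  have fin: "finite S" unfolding S_def by (rule finite_subset[OF _ orbit_finite[OF x x, of 1]]) auto
  define r where "r = Min (insert 1 ((\<lambda>g. hyp_dist x (g x)) ` S))"
  have "hyp_dist x (g x) > 0" if "g \<in> S" for g
    using that x G_ball[of g x] hyp_dist_nonneg[of x "g x"] hyp_dist_eq_0[of x "g x"] by (auto simp: S_def less_le)
  then have "r > 0" unfolding r_def using fin by auto
  moreover have "g x = x" if "g \<in> G" "hyp_dist x (g x) < r" for g
  proof (rule ccontr)
    assume "g x \<noteq> x"
    moreover have "r \<le> 1" unfolding r_def using fin by auto
    ultimately have "g \<in> S" using that by (simp add: S_def)
    then have "r \<le> hyp_dist x (g x)" unfolding r_def using fin by auto
    then show False using that by simp
  qed
  ultimately show thesis by (rule that)
qed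

text \<open>Half the injectivity radius is enough: if \<open>y\<close> and \<open>g y\<close> both
  lie within \<open>r / 2\<close> of \<open>x\<close>, then \<open>x\<close> and \<open>g x\<close>
  are less than \<open>r\<close> apart, and \<open>g\<close> is the identity on the ball.\<close>

lemma local_isometry:
  assumes x: "x \<in> unit_ball"
  obtains r where "r > 0"
    "\<And>y. y \<in> unit_ball \<Longrightarrow> hyp_dist x y < r \<Longrightarrow> orbit_dist (pr x) (pr y) = hyp_dist x y"
    "\<And>y z. y \<in> unit_ball \<Longrightarrow> z \<in> unit_ball \<Longrightarrow> hyp_dist x y < r \<Longrightarrow> hyp_dist x z < r \<Longrightarrow> pr y = pr z \<Longrightarrow> y = z"
proof -
  obtain r where r: "r > 0" "\<And>g. g \<in> G \<Longrightarrow> hyp_dist x (g x) < r \<Longrightarrow> g x = x" using injectivity_radius[OF x] by blast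
  have key: "g y = y" if "g \<in> G" "y \<in> unit_ball" "hyp_dist x y < r / 2" "hyp_dist x (g y) < r / 2" for g y
  proof -
    have "hyp_dist x (g x) \<le> hyp_dist x (g y) + hyp_dist (g y) (g x)"
      using that x G_ball by (intro hyp_dist_triangle) blast+
    also have "\<dots> < r" using that x G_hyp_dist[of g y x] hyp_dist_commute[of y x] by simp
    finally have "g x = x" by (rule r(2)[OF that(1)])
    then show ?thesis by (rule G_fixes[OF that(1) x _ that(2)])
  qed
  show thesis
  proof (rule that[of "r/2"])
    show "r / 2 > 0" using r by simp
    fix y assume y: "y \<in> unit_ball" "hyp_dist x y < r / 2"
    obtain g where g: "g \<in> G" "orbit_dist (pr x) (pr y) = hyp_dist x (g y)" using orbit_dist_attained(1)[OF x y(1)] by blast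
    have "hyp_dist x (g y) < r / 2" using g orbit_dist_le[OF x y(1)] y by simp
    then show "orbit_dist (pr x) (pr y) = hyp_dist x y" using g key[OF g(1) y] by simp
  next
    fix y z assume yz: "y \<in> unit_ball" "z \<in> unit_ball" "hyp_dist x y < r / 2" "hyp_dist x z < r / 2" "pr y = pr z"
    then obtain g where g: "g \<in> G" "z = g y" using pr_eq_iff[OF yz(1,2)] by blast
    then show "y = z" using key[OF g(1) yz(1,3)] yz(4) by simp
  qed
qed

text \<open>An orbit near \<open>pr x\<close> has a member near \<open>x\<close>, the one at which
  the distance is attained, and conversely the projection does not increase distances. Hence the
  quotient topology is the metric one.\<close>

lemma openin_orbit_space_metric:
  "openin (orbit_space G) U \<longleftrightarrow> U \<subseteq> pr ` unit_ball \<and>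
    (\<forall>p\<in>U. \<exists>r>0. \<forall>q\<in>pr ` unit_ball. orbit_dist p q < r \<longrightarrow> q \<in> U)"
proof (intro iffI conjI ballI)
  assume o: "openin (orbit_space G) U"
  then show sub: "U \<subseteq> pr ` unit_ball" by (simp add: openin_orbit_space)
  fix p assume "p \<in> U"
  then obtain x where x: "x \<in> unit_ball" "p = pr x" using sub by blast
  have "open {x \<in> unit_ball. pr x \<in> U}" using o by (simp add: openin_orbit_space)
  moreover have "x \<in> {x \<in> unit_ball. pr x \<in> U}" using x \<open>p \<in> U\<close> by simp
  ultimately obtain e where e: "e > 0" "ball x e \<subseteq> {x \<in> unit_ball. pr x \<in> U}" by (rule openE)
  have "q \<in> U" if q: "q \<in> pr ` unit_ball" "orbit_dist p q < e / 2" for q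
  proof -
    obtain y where y: "y \<in> unit_ball" "q = pr y" using q by blast
    obtain g where g: "g \<in> G" "orbit_dist p q = hyp_dist x (g y)" using orbit_dist_attained(1)[OF x(1) y(1)] unfolding x(2)[symmetric] y(2)[symmetric] by blast
    have "norm (x - g y) < e" using norm_le_hyp_dist[OF x(1) G_ball[OF g(1) y(1)]] g q by simp
    then have "g y \<in> {x \<in> unit_ball. pr x \<in> U}" using e(2) by (auto simp: dist_norm)
    then show ?thesis using pr_G g y by simp
  qed
  then show "\<exists>r>0. \<forall>q\<in>pr ` unit_ball. orbit_dist p q < r \<longrightarrow> q \<in> U" using e by (intro exI[of _ "e/2"]) auto
next
  assume a: "U \<subseteq> pr ` unit_ball \<and> (\<forall>p\<in>U. \<exists>r>0. \<forall>q\<in>pr ` unit_ball. orbit_dist p q < r \<longrightarrow> q \<in> U)"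
  have "open {x \<in> unit_ball. pr x \<in> U}"
    unfolding open_dist
  proof
    fix x assume "x \<in> {x \<in> unit_ball. pr x \<in> U}"
    then have x: "x \<in> unit_ball" "pr x \<in> U" by auto
    then obtain r where r: "r > 0" "\<forall>q\<in>pr ` unit_ball. orbit_dist (pr x) q < r \<longrightarrow> q \<in> U" using a by blast
    obtain \<delta> where \<delta>: "\<delta> > 0" "\<And>y. norm (x - y) < \<delta> \<Longrightarrow> y \<in> unit_ball \<and> hyp_dist x y < r"
      using hyp_dist_tendsto_0[OF x(1) r(1)] by blast
    have "y \<in> {x \<in> unit_ball. pr x \<in> U}" if "dist y x < \<delta>" for y
    proof -
      have y: "y \<in> unit_ball" "hyp_dist x y < r" using \<delta>(2)[of y] that by (auto simp: dist_norm norm_minus_commute)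
      then have "orbit_dist (pr x) (pr y) < r" using orbit_dist_le[OF x(1) y(1)] by simp
      then show ?thesis using r y by simp
    qed
    then show "\<exists>e>0. \<forall>y. dist y x < e \<longrightarrow> y \<in> {x \<in> unit_ball. pr x \<in> U}" using \<delta> by blast
  qed
  then show "openin (orbit_space G) U" using a by (simp add: openin_orbit_space)
qed

lemma openin_pr_image:
  assumes "open U" "U \<subseteq> unit_ball" shows "openin (orbit_space G) (pr ` U)"
  unfolding openin_orbit_space_metric
proof (intro conjI ballI)
  show "pr ` U \<subseteq> pr ` unit_ball" using assms by blast
  fix p assume "p \<in> pr ` U"
  then obtain x where x: "x \<in> U" "p = pr x" by blast
  then have xb: "x \<in> unit_ball" using assms by blast
  obtain e where e: "e > 0" "ball x e \<subseteq> U" using assms x openE by blast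
  have "q \<in> pr ` U" if q: "q \<in> pr ` unit_ball" "orbit_dist p q < e / 2" for q
  proof -
    obtain y where y: "y \<in> unit_ball" "q = pr y" using q by blast
    obtain g where g: "g \<in> G" "orbit_dist p q = hyp_dist x (g y)" using orbit_dist_attained(1)[OF xb y(1)] unfolding x(2)[symmetric] y(2)[symmetric] by blast
    have "norm (x - g y) < e" using norm_le_hyp_dist[OF xb G_ball[OF g(1) y(1)]] g q by simp
    then have "g y \<in> U" using e(2) by (auto simp: dist_norm)
    then have "pr (g y) \<in> pr ` U" by (rule imageI)
    then show ?thesis using pr_G[OF g(1) y(1)] y(2) by simp
  qed
  then show "\<exists>r>0. \<forall>q\<in>pr ` unit_ball. orbit_dist p q < r \<longrightarrow> q \<in> pr ` U" using e by (intro exI[of _ "e/2"]) auto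
qed

lemma hyp_dist_continuous: assumes y: "(y :: real^'n) \<in> unit_ball" shows "continuous_on unit_ball (\<lambda>x. hyp_dist x y)"
  unfolding continuous_on_iff
proof (intro ballI allI impI)
  fix x :: "real^'n" and e :: real assume x: "x \<in> unit_ball" and e: "e > 0"
  obtain \<delta> where \<delta>: "\<delta> > 0" "\<And>z. norm (x - z) < \<delta> \<Longrightarrow> z \<in> unit_ball \<and> hyp_dist x z < e"
    by (rule hyp_dist_tendsto_0[OF x e]) blast
  have "dist (hyp_dist z y) (hyp_dist x y) < e" if "z \<in> unit_ball" "dist z x < \<delta>" for z
  proof -
    have "hyp_dist x z < e" using \<delta>(2)[of z] that by (simp add: dist_norm norm_minus_commute)
    then show ?thesis
      using hyp_dist_triangle[OF x that(1) y] hyp_dist_triangle[OF that(1) x y] hyp_dist_commute[of x z]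
      by (simp add: dist_real_def abs_less_iff)
  qed
  then show "\<exists>d>0. \<forall>x'\<in>unit_ball. dist x' x < d \<longrightarrow> dist (hyp_dist x' y) (hyp_dist x y) < e" using \<delta>(1) by (intro exI[of _ \<delta>]) simp
qed

section \<open>The normal fundamental polyhedron\<close>

lemma polyhedron_sub: "normal_polyhedron G p0 \<subseteq> unit_ball"
  by (auto simp: normal_polyhedron_def)

text \<open>Infinitely many strict inequalities may define the polyhedron, but near a given point
  all but finitely many of them hold with room to spare.\<close>

lemma polyhedron_open:
  assumes p0: "p0 \<in> unit_ball" shows "open (normal_polyhedron G p0)"
  unfolding open_dist
proof
  fix x assume x: "x \<in> normal_polyhedron G p0"
  then have xb: "x \<in> unit_ball" using polyhedron_sub by blast
  define R where "R = hyp_dist x p0"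
  \<comment> \<open>If \<open>z\<close> is at distance less than 1 from \<open>x\<close>, then
    \<open>hyp_dist z p0\<close> is below \<open>R + 1\<close>, while
    \<open>hyp_dist x (g p0) > R + 2\<close> gives \<open>hyp_dist z (g p0) > R + 1\<close>. So only
    the members of \<open>S\<close> need attention.\<close>
  define S where "S = {g \<in> G. hyp_dist x (g p0) \<le> R + 2} - {\<one>\<^bsub>BijGroup unit_ball\<^esub>}"
  have fin: "finite S" unfolding S_def using orbit_finite[OF p0 xb] by simp
  define U where "U = unit_ball \<inter> (\<Inter>g\<in>S. {z \<in> unit_ball. hyp_dist z p0 - hyp_dist z (g p0) < 0})"
  have "open U" unfolding U_def
  proof (intro open_Int open_ball open_INT fin ballI)
    fix g assume "g \<in> S"
    then have "g p0 \<in> unit_ball" using G_ball p0 by (auto simp: S_def simp del: mem_ball_0)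
    then have "continuous_on unit_ball (\<lambda>z. hyp_dist z p0 - hyp_dist z (g p0))"
      by (intro continuous_on_diff hyp_dist_continuous p0)
    from continuous_open_preimage[OF this open_ball open_lessThan[of 0]]
    moreover have "{z \<in> unit_ball. hyp_dist z p0 - hyp_dist z (g p0) < 0} =
        unit_ball \<inter> (\<lambda>z. hyp_dist z p0 - hyp_dist z (g p0)) -` {..<0}" by auto
    ultimately show "open {z \<in> unit_ball. hyp_dist z p0 - hyp_dist z (g p0) < 0}" by simp
  qed
  moreover have "x \<in> U" using x xb by (auto simp: U_def S_def normal_polyhedron_def)
  ultimately obtain e where e: "e > 0" "ball x e \<subseteq> U" by (rule openE)
  obtain \<delta> where \<delta>: "\<delta> > 0" "\<And>z. norm (x - z) < \<delta> \<Longrightarrow> z \<in> unit_ball \<and> hyp_dist x z < 1"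
    by (rule hyp_dist_tendsto_0[OF xb zero_less_one]) blast
  have "z \<in> normal_polyhedron G p0" if z: "dist z x < min e \<delta>" for z
  proof -
    have zb: "z \<in> unit_ball" "hyp_dist x z < 1" using \<delta>(2)[of z] z by (auto simp: dist_norm norm_minus_commute)
    have zU: "z \<in> U" using e z by (auto simp: dist_commute)
    have "hyp_dist z p0 < hyp_dist z (g p0)" if g: "g \<in> G - {\<one>\<^bsub>BijGroup unit_ball\<^esub>}" for g
    proof (cases "g \<in> S")
      case True then show ?thesis using zU by (auto simp: U_def)
    next
      case False
      then have "hyp_dist x (g p0) > R + 2" using g by (auto simp: S_def)
      moreover have "hyp_dist x (g p0) \<le> hyp_dist x z + hyp_dist z (g p0)"
        using g p0 xb zb G_ball by (intro hyp_dist_triangle) blast+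
      moreover have "hyp_dist z p0 \<le> hyp_dist z x + R" unfolding R_def
        using p0 xb zb by (intro hyp_dist_triangle) blast+
      ultimately show ?thesis using zb hyp_dist_commute[of x z] by simp
    qed
    then show ?thesis using zb by (auto simp: normal_polyhedron_def)
  qed
  then show "\<exists>e>0. \<forall>y. dist y x < e \<longrightarrow> y \<in> normal_polyhedron G p0"
    using e \<delta> by (intro exI[of _ "min e \<delta>"]) auto
qed

text \<open>If \<open>g\<close> carries one point of the polyhedron to another, the defining
  inequalities for \<open>g\<close> and for its inverse contradict each other.\<close>

lemma polyhedron_inj:
  assumes p0: "p0 \<in> unit_ball" shows "inj_on pr (normal_polyhedron G p0)"
proof (rule inj_onI, rule ccontr)
  fix x y assume x: "x \<in> normal_polyhedron G p0" and y: "y \<in> normal_polyhedron G p0" and e: "pr x = pr y" and ne: "x \<noteq> y"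
  have xb: "x \<in> unit_ball" and yb: "y \<in> unit_ball" using x y polyhedron_sub by blast+
  obtain g where g: "g \<in> G" "y = g x" using pr_eq_iff[OF xb yb] e by blast
  obtain k where k: "k \<in> G" "\<forall>x\<in>unit_ball. k (g x) = x \<and> g (k x) = x" using G_inv[OF g(1)] by blast
  have "k y = x" using k(2) g xb by blast
  have "g \<noteq> \<one>\<^bsub>BijGroup unit_ball\<^esub>" using ne g xb by (auto simp: BijGroup_def)
  then have 1: "hyp_dist y p0 < hyp_dist y (g p0)" using y g(1) by (auto simp: normal_polyhedron_def)
  have "k \<noteq> \<one>\<^bsub>BijGroup unit_ball\<^esub>" using ne \<open>k y = x\<close> yb by (auto simp: BijGroup_def)
  then have 2: "hyp_dist x p0 < hyp_dist x (k p0)" using x k(1) by (auto simp: normal_polyhedron_def)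
  have "hyp_dist y (g p0) = hyp_dist x p0" using G_hyp_dist[OF g(1) xb p0] g by simp
  moreover have "hyp_dist x (k p0) = hyp_dist y p0" using G_hyp_dist[OF k(1) yb p0] \<open>k y = x\<close> by simp
  ultimately show False using 1 2 by simp
qed

end

section \<open>Length of curves\<close>

locale set_metric =
  fixes M :: "'a set" and d :: "'a \<Rightarrow> 'a \<Rightarrow> real"
  assumes nonneg: "x \<in> M \<Longrightarrow> y \<in> M \<Longrightarrow> 0 \<le> d x y"
    and zero: "x \<in> M \<Longrightarrow> y \<in> M \<Longrightarrow> d x y = 0 \<longleftrightarrow> x = y"
    and sym: "x \<in> M \<Longrightarrow> y \<in> M \<Longrightarrow> d x y = d y x"
    and triangle: "x \<in> M \<Longrightarrow> y \<in> M \<Longrightarrow> z \<in> M \<Longrightarrow> d x z \<le> d x y + d y z"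

definition is_partition :: "real \<Rightarrow> real \<Rightarrow> nat \<Rightarrow> (nat \<Rightarrow> real) \<Rightarrow> bool"
  where "is_partition a b N t \<longleftrightarrow> t 0 = a \<and> t N = b \<and> (\<forall>k<N. t k \<le> t (Suc k))"

lemma partition_mono:
  assumes "is_partition a b N t" "i \<le> j" "j \<le> N" shows "t i \<le> t j"
  using assms(2,3)
proof (induction rule: dec_induct)
  case (step k)
  then show ?case using assms(1) unfolding is_partition_def
    by (metis Suc_le_lessD Suc_leD order_trans)
qed simp

lemma partition_in:
  assumes "is_partition a b N t" "k \<le> N" shows "t k \<in> {a..b}"
  using partition_mono[OF assms(1), of 0 k] partition_mono[OF assms(1), of k N] assms
  by (simp add: is_partition_def)

lemma is_partition_trivial: "a \<le> b \<Longrightarrow> is_partition a b 1 (\<lambda>k. if k = 0 then a else b)"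
  by (simp add: is_partition_def)

lemma curve_length_def': "curve_length d \<gamma> a b =
    (SUP (N, t) \<in> {(N, t). is_partition a b N t}. \<Sum>k<N. ennreal (d (\<gamma> (t k)) (\<gamma> (t (Suc k)))))"
  unfolding curve_length_def is_partition_def ..

lemma curve_length_ge: "is_partition a b N t \<Longrightarrow>
    (\<Sum>k<N. ennreal (d (\<gamma> (t k)) (\<gamma> (t (Suc k))))) \<le> curve_length d \<gamma> a b"
  unfolding curve_length_def' by (rule SUP_upper2[where i = "(N, t)"]) auto

lemma curve_length_le:
  assumes "\<And>N t. is_partition a b N t \<Longrightarrow> (\<Sum>k<N. ennreal (d (\<gamma> (t k)) (\<gamma> (t (Suc k))))) \<le> L"
  shows "curve_length d \<gamma> a b \<le> L"
  unfolding curve_length_def' by (rule SUP_least) (use assms in auto)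

lemma chord_le_curve_length: "a \<le> b \<Longrightarrow> ennreal (d (\<gamma> a) (\<gamma> b)) \<le> curve_length d \<gamma> a b"
  using curve_length_ge[OF is_partition_trivial, of a b d \<gamma>] by simp

lemma sum_lessThan_add:
  fixes f :: "nat \<Rightarrow> 'b::comm_monoid_add"
  shows "(\<Sum>k<N + N'. f k) = (\<Sum>k<N. f k) + (\<Sum>k<N'. f (N + k))"
  by (induction N') (simp_all add: ac_simps)

lemma curve_length_superadditive:
  assumes "a \<le> b" "b \<le> c"
  shows "curve_length d \<gamma> a b + curve_length d \<gamma> b c \<le> curve_length d \<gamma> a c"
proof -
  let ?V = "\<lambda>(N, t). \<Sum>k<N. ennreal (d (\<gamma> (t k)) (\<gamma> (t (Suc k))))"
  have key: "?V (N, t) + ?V (N', t') \<le> curve_length d \<gamma> a c"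
    if t: "is_partition a b N t" and t': "is_partition b c N' t'" for N t N' t'
  proof -
    define u where "u k = (if k \<le> N then t k else t' (k - N))" for k
    have u: "is_partition a c (N + N') u"
      unfolding is_partition_def
    proof (intro conjI allI impI)
      show "u 0 = a" using t by (simp add: u_def is_partition_def)
      show "u (N + N') = c" using t t' by (auto simp: u_def is_partition_def)
      fix k assume k: "k < N + N'"
      consider "k < N" | "k = N" | "k > N" by linarith
      then show "u k \<le> u (Suc k)"
      proof cases
        case 1 then show ?thesis using t by (simp add: u_def is_partition_def)
      next
        case 2 then show ?thesis using t t' k by (auto simp: u_def is_partition_def Suc_diff_le dest: spec[of _ 0])
      next
        case 3
        then have "k - N < N'" "Suc k - N = Suc (k - N)" using k by auto
        then show ?thesis using t' 3 by (simp add: u_def is_partition_def)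
      qed
    qed
    have "?V (N + N', u) = ?V (N, u) + (\<Sum>k<N'. ennreal (d (\<gamma> (u (N + k))) (\<gamma> (u (Suc (N + k))))))"
      using sum_lessThan_add[of "\<lambda>k. ennreal (d (\<gamma> (u k)) (\<gamma> (u (Suc k))))" N N'] by simp
    moreover have "?V (N, u) = ?V (N, t)" by (simp add: u_def)
    moreover have "u (N + k) = t' k" for k using t t' by (auto simp: u_def is_partition_def)
    ultimately have "?V (N, t) + ?V (N', t') = ?V (N + N', u)"
      by (simp del: add_Suc_right add: add_Suc_right[symmetric])
    then show ?thesis using curve_length_ge[OF u, of d \<gamma>] by simp
  qed
  have ne: "{(N, t). is_partition a b N t} \<noteq> {}" "{(N, t). is_partition b c N t} \<noteq> {}"
    using is_partition_trivial[OF assms(1)] is_partition_trivial[OF assms(2)] by blast+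
  show ?thesis
    unfolding curve_length_def'[of d \<gamma> a b]
    apply (subst ennreal_SUP_add_left[OF ne(1), symmetric])
    apply (rule SUP_least)
    unfolding curve_length_def'[of d \<gamma> b c]
    apply (subst ennreal_SUP_add_right[OF ne(2)])
    apply (rule SUP_least)
    using key by auto
qed

context set_metric
begin

lemma curve_length_add:
  assumes "a \<le> b" "b \<le> c" and \<gamma>: "\<gamma> ` {a..c} \<subseteq> M"
  shows "curve_length d \<gamma> a c = curve_length d \<gamma> a b + curve_length d \<gamma> b c"
proof (rule antisym[OF curve_length_le curve_length_superadditive[OF assms(1,2)]])
  fix N t assume t: "is_partition a c N t"
  \<comment> \<open>Truncating at \<open>b\<close> from above and from below yields partitions of
    both halves with the same number of cells. At most one cell is genuinely split; every other one
    becomes trivial in one of the two partitions.\<close>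
  define s u where "s k = min (t k) b" and "u k = max (t k) b" for k
  have su: "is_partition a b N s" "is_partition b c N u"
    using t assms(1,2) by (auto simp: is_partition_def s_def u_def min_def max_def)
  have "(\<Sum>k<N. ennreal (d (\<gamma> (t k)) (\<gamma> (t (Suc k))))) \<le>
      (\<Sum>k<N. ennreal (d (\<gamma> (s k)) (\<gamma> (s (Suc k)))) + ennreal (d (\<gamma> (u k)) (\<gamma> (u (Suc k)))))"
  proof (rule sum_mono)
    fix k assume k: "k \<in> {..<N}"
    have tk: "t k \<in> {a..c}" "t (Suc k) \<in> {a..c}" "t k \<le> t (Suc k)" "b \<in> {a..c}"
      using partition_in[OF t] t k assms by (auto simp: is_partition_def)
    then have m: "\<gamma> (t k) \<in> M" "\<gamma> (t (Suc k)) \<in> M" "\<gamma> b \<in> M" using \<gamma> by blast+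
    have "d (\<gamma> (t k)) (\<gamma> (t (Suc k))) \<le> d (\<gamma> (s k)) (\<gamma> (s (Suc k))) + d (\<gamma> (u k)) (\<gamma> (u (Suc k)))"
      using tk m triangle[of "\<gamma> (t k)" "\<gamma> b" "\<gamma> (t (Suc k))"] zero[of "\<gamma> b" "\<gamma> b"] nonneg[of "\<gamma> b" "\<gamma> b"]
      by (auto simp: s_def u_def min_def max_def)
    moreover have "0 \<le> d (\<gamma> (s k)) (\<gamma> (s (Suc k)))" "0 \<le> d (\<gamma> (u k)) (\<gamma> (u (Suc k)))"
      using m nonneg by (auto simp: s_def u_def min_def max_def)
    ultimately show "ennreal (d (\<gamma> (t k)) (\<gamma> (t (Suc k)))) \<le>
        ennreal (d (\<gamma> (s k)) (\<gamma> (s (Suc k)))) + ennreal (d (\<gamma> (u k)) (\<gamma> (u (Suc k))))"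
      by (simp add: ennreal_plus[symmetric] del: ennreal_plus)
  qed
  also have "\<dots> \<le> curve_length d \<gamma> a b + curve_length d \<gamma> b c"
    unfolding sum.distrib by (intro add_mono curve_length_ge su)
  finally show "(\<Sum>k<N. ennreal (d (\<gamma> (t k)) (\<gamma> (t (Suc k))))) \<le> curve_length d \<gamma> a b + curve_length d \<gamma> b c" .
qed

definition curve_continuous :: "real \<Rightarrow> real \<Rightarrow> (real \<Rightarrow> 'a) \<Rightarrow> bool"
  where "curve_continuous a b \<gamma> \<longleftrightarrow> \<gamma> ` {a..b} \<subseteq> M \<and>
    (\<forall>t\<in>{a..b}. \<forall>e>0. \<exists>\<delta>>0. \<forall>s\<in>{a..b}. \<bar>s - t\<bar> < \<delta> \<longrightarrow> d (\<gamma> t) (\<gamma> s) < e)"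

end

section \<open>Rectifiable curves and their arc length parametrisation\<close>

locale rectifiable_curve = set_metric +
  fixes \<gamma> :: "real \<Rightarrow> 'a" and a b :: real
  assumes ab: "a \<le> b" and cont: "curve_continuous a b \<gamma>" and fin: "curve_length d \<gamma> a b < \<infinity>"
begin

definition len :: "real \<Rightarrow> real" where "len t = enn2real (curve_length d \<gamma> a t)"

definition arc :: "real \<Rightarrow> 'a" where "arc s = normal_representation d \<gamma> a b s"

lemma in_M: "t \<in> {a..b} \<Longrightarrow> \<gamma> t \<in> M"
  using cont unfolding curve_continuous_def by blast

lemma sub_finite: "a \<le> s \<Longrightarrow> s \<le> t \<Longrightarrow> t \<le> b \<Longrightarrow> curve_length d \<gamma> s t < \<infinity>"
proof -
  assume st: "a \<le> s" "s \<le> t" "t \<le> b"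
  have "curve_length d \<gamma> s t \<le> curve_length d \<gamma> a s + (curve_length d \<gamma> s t + curve_length d \<gamma> t b)"
    by (simp add: add_increasing add_increasing2)
  also have "\<dots> = curve_length d \<gamma> a b"
    using curve_length_add[of a s b \<gamma>] curve_length_add[of s t b \<gamma>] st in_M by (auto simp: image_subset_iff)
  finally show ?thesis using fin by simp
qed

lemma len_diff: assumes "a \<le> s" "s \<le> t" "t \<le> b"
  shows "curve_length d \<gamma> s t = ennreal (len t - len s)" "len s \<le> len t"
proof -
  have f: "curve_length d \<gamma> a s < \<infinity>" "curve_length d \<gamma> s t < \<infinity>" using sub_finite assms by auto
  have "curve_length d \<gamma> a t = curve_length d \<gamma> a s + curve_length d \<gamma> s t"
    using assms in_M by (intro curve_length_add) (auto simp: image_subset_iff)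
  then have e: "len t = len s + enn2real (curve_length d \<gamma> s t)" using f by (simp add: len_def enn2real_plus)
  then show "len s \<le> len t" by simp
  show "curve_length d \<gamma> s t = ennreal (len t - len s)" using e f by simp
qed

lemma len_a: "len a = 0"
proof -
  have "curve_length d \<gamma> a a = 0"
  proof -
    have "curve_length d \<gamma> a a \<le> 0"
    proof (rule curve_length_le)
      fix N t assume t: "is_partition a a N t"
      have "t k = a" if "k \<le> N" for k using partition_in[OF t that] by simp
      then have "d (\<gamma> (t k)) (\<gamma> (t (Suc k))) = 0" if "k < N" for k
        using that zero[of "\<gamma> a" "\<gamma> a"] in_M ab by simp
      then show "(\<Sum>k<N. ennreal (d (\<gamma> (t k)) (\<gamma> (t (Suc k))))) \<le> 0" by simp
    qed
    then show ?thesis by simp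
  qed
  then show ?thesis by (simp add: len_def)
qed

lemma chord_le_len: assumes "a \<le> s" "s \<le> t" "t \<le> b" shows "d (\<gamma> s) (\<gamma> t) \<le> len t - len s"
  using chord_le_curve_length[OF assms(2), of d \<gamma>] len_diff[OF assms] by simp

lemma partition_approx:
  assumes "e > 0"
  obtains N t where "is_partition a b N t" "(\<Sum>k<N. d (\<gamma> (t k)) (\<gamma> (t (Suc k)))) \<ge> len b - e"
proof -
  have L: "curve_length d \<gamma> a b = ennreal (len b)" using len_diff[of a b] ab len_a by simp
  have "len b \<ge> 0" by (simp add: len_def)
  show thesis
  proof (cases "len b - e \<le> 0")
    case True
    have "0 \<le> d (\<gamma> a) (\<gamma> b)" using nonneg in_M ab by simp
    then show thesis using that[OF is_partition_trivial[OF ab]] True by simp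
  next
    case False
    then have "ennreal (len b - e) < curve_length d \<gamma> a b" using L assms by (simp add: ennreal_lessI)
    then obtain N t where t: "is_partition a b N t"
      "ennreal (len b - e) < (\<Sum>k<N. ennreal (d (\<gamma> (t k)) (\<gamma> (t (Suc k)))))"
      unfolding curve_length_def' less_SUP_iff by auto
    have nn: "0 \<le> d (\<gamma> (t k)) (\<gamma> (t (Suc k)))" if "k < N" for k
      using nonneg in_M partition_in[OF t(1)] that by simp
    have "(\<Sum>k<N. ennreal (d (\<gamma> (t k)) (\<gamma> (t (Suc k))))) = ennreal (\<Sum>k<N. d (\<gamma> (t k)) (\<gamma> (t (Suc k))))"
      using nn by (intro sum_ennreal) simp
    then have "len b - e < (\<Sum>k<N. d (\<gamma> (t k)) (\<gamma> (t (Suc k))))"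
      using t(2) False by (simp add: ennreal_less_iff)
    then show thesis using that[OF t(1)] by simp
  qed
qed

text \<open>Within one cell of a partition that is optimal up to \<open>e\<close>, lengths and chords differ by at
  most \<open>e\<close>.\<close>

lemma len_continuous: "continuous_on {a..b} len"
  unfolding continuous_on_iff
proof (intro ballI allI impI)
  fix t0 e :: real assume t0: "t0 \<in> {a..b}" and e: "e > 0"
  obtain N t where t: "is_partition a b N t" "(\<Sum>k<N. d (\<gamma> (t k)) (\<gamma> (t (Suc k)))) \<ge> len b - e/2"
    using partition_approx[of "e/2"] e by auto
  have cell: "len v - len u \<le> e/2 + d (\<gamma> u) (\<gamma> v)"
    if uv: "u \<in> {a..b}" "v \<in> {a..b}" "u < v" "\<And>k. k \<le> N \<Longrightarrow> \<not> (u < t k \<and> t k < v)" for u v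
  proof -
    define K where "K = {k. k \<le> N \<and> t k \<le> u}"
    have K: "finite K" "0 \<in> K" using t uv by (auto simp: K_def is_partition_def)
    define k where "k = Max K"
    have k: "k \<in> K" unfolding k_def using K by (intro Max_in) auto
    have "k \<noteq> N" using k t(1) uv by (auto simp: K_def is_partition_def)
    then have kN: "k < N" using k by (simp add: K_def)
    have "Suc k \<notin> K" using Max_ge[OF K(1), of "Suc k"] by (auto simp: k_def)
    then have "u < t (Suc k)" using kN by (simp add: K_def)
    then have c: "t k \<le> u" "v \<le> t (Suc k)" using uv(4)[of "Suc k"] kN k by (auto simp: K_def)
    have tk: "t j \<in> {a..b}" if "j \<le> N" for j using partition_in[OF t(1) that] .
    have each: "0 \<le> len (t (Suc j)) - len (t j) - d (\<gamma> (t j)) (\<gamma> (t (Suc j)))" if "j < N" for j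
      using chord_le_len[of "t j" "t (Suc j)"] tk[of j] tk[of "Suc j"] t(1) that by (simp add: is_partition_def)
    have "len (t (Suc k)) - len (t k) - d (\<gamma> (t k)) (\<gamma> (t (Suc k)))
       \<le> (\<Sum>j<N. len (t (Suc j)) - len (t j) - d (\<gamma> (t j)) (\<gamma> (t (Suc j))))"
      using each kN by (intro member_le_sum) auto
    also have "\<dots> = len b - len a - (\<Sum>j<N. d (\<gamma> (t j)) (\<gamma> (t (Suc j))))"
      using t(1) sum_lessThan_telescope[of "\<lambda>j. len (t j)" N]
      by (simp add: sum_subtractf[of "\<lambda>j. len (t (Suc j)) - len (t j)"] is_partition_def)
    also have "\<dots> \<le> e/2" using t(2) len_a by simp
    finally have 1: "len (t (Suc k)) - len (t k) - d (\<gamma> (t k)) (\<gamma> (t (Suc k))) \<le> e/2" .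
    have m: "\<gamma> (t k) \<in> M" "\<gamma> (t (Suc k)) \<in> M" "\<gamma> u \<in> M" "\<gamma> v \<in> M" using in_M tk kN uv by auto
    have "d (\<gamma> (t k)) (\<gamma> (t (Suc k))) \<le> d (\<gamma> (t k)) (\<gamma> u) + (d (\<gamma> u) (\<gamma> v) + d (\<gamma> v) (\<gamma> (t (Suc k))))"
      using triangle[OF m(1,3,2)] triangle[OF m(3,4,2)] by simp
    moreover have "d (\<gamma> (t k)) (\<gamma> u) \<le> len u - len (t k)" "d (\<gamma> v) (\<gamma> (t (Suc k))) \<le> len (t (Suc k)) - len v"
      using chord_le_len[of "t k" u] chord_le_len[of v "t (Suc k)"] c tk[of k] tk[of "Suc k"] kN uv by auto
    ultimately show ?thesis using 1 by linarith
  qed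
  obtain \<delta>0 where \<delta>0: "\<delta>0 > 0" "\<forall>s\<in>{a..b}. \<bar>s - t0\<bar> < \<delta>0 \<longrightarrow> d (\<gamma> t0) (\<gamma> s) < e/2"
    using cont t0 e unfolding curve_continuous_def by (meson half_gt_zero)
  \<comment> \<open>Within \<open>\<delta>\<close> of \<open>t0\<close> there is no partition point
    other than possibly \<open>t0\<close> itself, so the interval between \<open>t0\<close> and
    \<open>s\<close> lies in one cell.\<close>
  define T where "T = (\<lambda>k. \<bar>t k - t0\<bar>) ` {k. k \<le> N \<and> t k \<noteq> t0}"
  define \<delta> where "\<delta> = Min (insert \<delta>0 T)"
  have finT: "finite T" by (simp add: T_def)
  have \<delta>: "\<delta> > 0" "\<delta> \<le> \<delta>0" unfolding \<delta>_def using \<delta>0 finT by (auto simp: T_def)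
  have far: "\<bar>t k - t0\<bar> \<ge> \<delta>" if "k \<le> N" "t k \<noteq> t0" for k
    unfolding \<delta>_def using finT that by (intro Min_le) (auto simp: T_def)
  have "dist (len s) (len t0) < e" if s: "s \<in> {a..b}" "dist s t0 < \<delta>" for s
  proof -
    have ds: "d (\<gamma> t0) (\<gamma> s) < e/2" using \<delta>0 \<delta> s by (auto simp: dist_real_def)
    consider "s = t0" | "s < t0" | "t0 < s" by linarith
    then show ?thesis
    proof cases
      case 2
      have "len t0 - len s \<le> e/2 + d (\<gamma> s) (\<gamma> t0)"
      proof (rule cell[OF s(1) t0 2])
        fix k assume "k \<le> N" then show "\<not> (s < t k \<and> t k < t0)" using far[of k] s 2 by (auto simp: dist_real_def)
      qed
      then show ?thesis using ds len_diff(2)[of s t0] s t0 2 sym[of "\<gamma> s" "\<gamma> t0"] in_M by (auto simp: dist_real_def)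
    next
      case 3
      have "len s - len t0 \<le> e/2 + d (\<gamma> t0) (\<gamma> s)"
      proof (rule cell[OF t0 s(1) 3])
        fix k assume "k \<le> N" then show "\<not> (t0 < t k \<and> t k < s)" using far[of k] s 3 by (auto simp: dist_real_def)
      qed
      then show ?thesis using ds len_diff(2)[of t0 s] s t0 3 by (auto simp: dist_real_def)
    qed (use e in simp)
  qed
  then show "\<exists>d>0. \<forall>x'\<in>{a..b}. dist x' t0 < d \<longrightarrow> dist (len x') (len t0) < e" using \<delta>(1) by blast
qed

lemma len_surj: assumes "s \<in> {0..len b}" obtains t where "t \<in> {a..b}" "len t = s"
  using IVT'[of len a s b] assms ab len_a len_continuous by auto

lemma len_bounds: "t \<in> {a..b} \<Longrightarrow> len t \<in> {0..len b}"
  using len_diff(2)[of a t] len_diff(2)[of t b] len_a by simp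

lemma arc_len: assumes t: "t \<in> {a..b}" shows "arc (len t) = \<gamma> t"
proof -
  have C: "curve_length d \<gamma> a u = ennreal (len u)" if "u \<in> {a..b}" for u
    using len_diff(1)[of a u] that len_a by simp
  have same: "\<gamma> u = \<gamma> v" if uv: "u \<in> {a..b}" "v \<in> {a..b}" "len u = len v" "u \<le> v" for u v
  proof -
    have "d (\<gamma> u) (\<gamma> v) \<le> len v - len u" using chord_le_len[of u v] uv by simp
    then have "d (\<gamma> u) (\<gamma> v) = 0" using uv(3) nonneg[OF in_M[OF uv(1)] in_M[OF uv(2)]] by simp
    then show ?thesis using zero[OF in_M[OF uv(1)] in_M[OF uv(2)]] by simp
  qed
  define u where "u = (SOME u. u \<in> {a..b} \<and> curve_length d \<gamma> a u = ennreal (len t))"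
  have uu: "u \<in> {a..b} \<and> curve_length d \<gamma> a u = ennreal (len t)"
    unfolding u_def by (rule someI[of _ t]) (use C[OF t] t in blast)
  have u: "u \<in> {a..b}" by (rule conjunct1[OF uu])
  have "len t \<ge> 0" using len_bounds[OF t] by simp
  then have "enn2real (ennreal (len t)) = len t" by (rule enn2real_ennreal)
  then have lu: "len u = len t" using conjunct2[OF uu] by (metis len_def)
  have "\<gamma> u = \<gamma> t"
  proof (cases "u \<le> t")
    case True show ?thesis by (rule same[OF u t lu True])
  next
    case False
    then have "t \<le> u" by simp
    then show ?thesis by (rule same[OF t u lu[symmetric], symmetric])
  qed
  then show ?thesis by (simp add: arc_def normal_representation_def u_def)
qed

lemma arc_in_M: "s \<in> {0..len b} \<Longrightarrow> arc s \<in> M"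
  using len_surj arc_len in_M by metis

lemma arc_lipschitz: assumes "s \<in> {0..len b}" "s' \<in> {0..len b}" shows "d (arc s) (arc s') \<le> \<bar>s - s'\<bar>"
proof -
  obtain t where t: "t \<in> {a..b}" "len t = s" using len_surj assms by blast
  obtain t' where t': "t' \<in> {a..b}" "len t' = s'" using len_surj assms by blast
  show ?thesis
    using arc_len[OF t(1)] arc_len[OF t'(1)] t t' chord_le_len[of t t'] chord_le_len[of t' t]
      sym[OF in_M[OF t(1)] in_M[OF t'(1)]] by (cases "t \<le> t'") auto
qed

lemma arc_partition_approx:
  assumes "e > 0"
  obtains N u where "is_partition 0 (len b) N u" "(\<Sum>k<N. d (arc (u k)) (arc (u (Suc k)))) \<ge> len b - e"
proof -
  obtain N t where t: "is_partition a b N t" "(\<Sum>k<N. d (\<gamma> (t k)) (\<gamma> (t (Suc k)))) \<ge> len b - e"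
    using partition_approx[OF assms] .
  have tk: "t k \<in> {a..b}" if "k \<le> N" for k using partition_in[OF t(1) that] .
  have "is_partition 0 (len b) N (\<lambda>k. len (t k))"
    unfolding is_partition_def
  proof (intro conjI allI impI)
    fix k assume "k < N"
    then show "len (t k) \<le> len (t (Suc k))"
      using len_diff(2)[of "t k" "t (Suc k)"] tk[of k] tk[of "Suc k"] t(1) by (simp add: is_partition_def)
  qed (use t(1) len_a in \<open>auto simp: is_partition_def\<close>)
  moreover have "(\<Sum>k<N. d (arc (len (t k))) (arc (len (t (Suc k))))) = (\<Sum>k<N. d (\<gamma> (t k)) (\<gamma> (t (Suc k))))"
  proof (rule sum.cong[OF refl])
    fix k assume "k \<in> {..<N}"
    then have "t k \<in> {a..b}" "t (Suc k) \<in> {a..b}" using tk[of k] tk[of "Suc k"] by auto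
    then show "d (arc (len (t k))) (arc (len (t (Suc k)))) = d (\<gamma> (t k)) (\<gamma> (t (Suc k)))"
      by (simp only: arc_len)
  qed
  ultimately show thesis using t(2) that[of N "\<lambda>k. len (t k)"] by simp
qed

lemma segment_integral_arc: "segment_integral d \<rho> \<gamma> a b = (\<integral>\<^sup>+ s\<in>{0..len b}. \<rho> (arc s) \<partial>lborel)"
  by (simp add: segment_integral_def len_def arc_def)

end

section \<open>Change of parameter by an absolutely continuous function\<close>

text \<open>A null set is covered by non-overlapping intervals of small total length, and a monotone
  \<open>g\<close> maps each of them into the interval between its end values. Absolute continuity
  bounds the total length of these.\<close>

lemma abs_continuous_negligible_image:
  fixes g :: "real \<Rightarrow> real"
  assumes ac: "abs_continuous_on_segment c d g" and mono: "mono_on {c..d} g"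
    and N: "N \<subseteq> {c..d}" "negligible N"
  shows "negligible (g ` N)"
  unfolding negligible_outer
proof (intro allI impI)
  fix e :: real assume e: "e > 0"
  then have e2: "e / 2 > 0" by simp
  obtain \<delta> where \<delta>: "\<delta> > 0" and acd: "\<And>(n::nat) u v. \<lbrakk>\<forall>k<n. c \<le> u k \<and> u k \<le> v k \<and> v k \<le> d;
      disjoint_family_on (\<lambda>k. {u k<..<v k}) {..<n}; (\<Sum>k<n. v k - u k) < \<delta>\<rbrakk> \<Longrightarrow> (\<Sum>k<n. \<bar>g (v k) - g (u k)\<bar>) < e / 2"
    using ac[unfolded abs_continuous_on_segment_def, rule_format, OF e2] by auto
  have Nm: "N \<in> lmeasurable" "measure lebesgue N = 0"
    using N(2) by (simp_all add: negligible_imp_measurable negligible_imp_measure0)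
  have Nc: "N \<subseteq> cbox c d" using N(1) by simp
  have \<delta>2: "\<delta> / 2 > 0" using \<delta> by simp
  obtain \<D> where \<D>: "countable \<D>"
        "\<And>K. K \<in> \<D> \<Longrightarrow> K \<subseteq> cbox c d \<and> K \<noteq> {} \<and> (\<exists>c d. K = cbox c d)"
        "pairwise (\<lambda>A B. interior A \<inter> interior B = {}) \<D>"
        "N \<subseteq> \<Union>\<D>" "\<Union>\<D> \<in> lmeasurable" "measure lebesgue (\<Union>\<D>) \<le> measure lebesgue N + \<delta> / 2"
    by (rule measurable_outer_intervals_bounded[OF Nm(1) Nc \<delta>2]) (rule that; assumption)
  define J where "J K = {g (Inf K)..g (Sup K)}" for K
  have K: "K = {Inf K..Sup K}" "c \<le> Inf K" "Inf K \<le> Sup K" "Sup K \<le> d" if KD: "K \<in> \<D>" for K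
  proof -
    obtain u v where uv: "K = {u..v}" "u \<le> v" "{u..v} \<subseteq> {c..d}" using \<D>(2)[OF KD] by auto
    then show "K = {Inf K..Sup K}" "c \<le> Inf K" "Inf K \<le> Sup K" "Sup K \<le> d" by auto
  qed
  \<comment> \<open>Absolute continuity speaks of finite families only; the uniform bound passes to
    the countable union afterwards.\<close>
  have fin: "measure lebesgue (\<Union>K\<in>F. J K) \<le> e / 2" if F: "F \<subseteq> \<D>" "finite F" for F
  proof -
    obtain h where h: "bij_betw h {..<card F} F" using ex_bij_betw_nat_finite[OF F(2)]
      by (auto simp: lessThan_atLeast0)
    have hF: "h k \<in> \<D>" if "k < card F" for k using h F(1) that by (auto simp: bij_betw_def)
    have conv: "(\<Sum>k<card F. f (h k)) = (\<Sum>K\<in>F. f K)" for f :: "real set \<Rightarrow> real"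
      by (rule sum.reindex_bij_betw[OF h])
    have "(\<Sum>K\<in>F. Sup K - Inf K) = (\<Sum>K\<in>F. measure lebesgue K)"
    proof (rule sum.cong[OF refl])
      fix K assume "K \<in> F"
      then have k: "K \<in> \<D>" using F by blast
      have "measure lebesgue K = measure lebesgue {Inf K..Sup K}" using K(1)[OF k] by simp
      then show "Sup K - Inf K = measure lebesgue K" using K(3)[OF k] by simp
    qed
    also have "\<dots> = measure lebesgue (\<Union>F)"
    proof (rule measure_negligible_finite_Union[symmetric, OF F(2)])
      show "S \<in> lmeasurable" if "S \<in> F" for S using \<D>(2)[of S] that F by auto
      show "pairwise (\<lambda>S T. negligible (S \<inter> T)) F"
      proof (rule pairwiseI)
        fix S T assume ST: "S \<in> F" "T \<in> F" "S \<noteq> T"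
        have "interior (S \<inter> T) = {}" using \<D>(3) ST F(1) by (auto simp: pairwise_def)
        moreover have "convex (S \<inter> T)" using \<D>(2)[of S] \<D>(2)[of T] ST F(1) by (auto intro!: convex_Int convex_box)
        ultimately show "negligible (S \<inter> T)" by (simp add: negligible_convex_interior)
      qed
    qed
    also have "\<dots> \<le> measure lebesgue (\<Union>\<D>)"
    proof (rule measure_mono_fmeasurable[OF _ _ \<D>(5)])
      show "\<Union>F \<subseteq> \<Union>\<D>" using F by blast
      show "\<Union>F \<in> sets lebesgue" 
      proof (intro sets.finite_Union F(2) subsetI)
        fix S assume "S \<in> F"
        then have "S \<in> \<D>" using F(1) by blast
        then obtain u v where "S = cbox u v" using \<D>(2) by blast
        then show "S \<in> sets lebesgue" by simp
      qed
    qed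
    also have "\<dots> < \<delta>" using \<D>(6) Nm(2) \<delta> by simp
    finally have sm: "(\<Sum>k<card F. Sup (h k) - Inf (h k)) < \<delta>" using conv[of "\<lambda>K. Sup K - Inf K"] by simp
    have "(\<Sum>k<card F. \<bar>g (Sup (h k)) - g (Inf (h k))\<bar>) < e / 2"
    proof (rule acd[OF _ _ sm])
      show "\<forall>k<card F. c \<le> Inf (h k) \<and> Inf (h k) \<le> Sup (h k) \<and> Sup (h k) \<le> d" using K hF by blast
      show "disjoint_family_on (\<lambda>k. {Inf (h k)<..<Sup (h k)}) {..<card F}"
        unfolding disjoint_family_on_def
      proof (intro ballI impI)
        fix k l assume kl: "k \<in> {..<card F}" "l \<in> {..<card F}" "k \<noteq> l"
        then have "h k \<noteq> h l" using h by (auto simp: bij_betw_def inj_on_def)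
        then have "interior (h k) \<inter> interior (h l) = {}" using \<D>(3) hF kl by (auto simp: pairwise_def)
        moreover have "interior (h j) = {Inf (h j)<..<Sup (h j)}" if "j < card F" for j
          using K(1)[OF hF[OF that]] interior_atLeastAtMost_real by metis
        ultimately show "{Inf (h k)<..<Sup (h k)} \<inter> {Inf (h l)<..<Sup (h l)} = {}" using kl by auto
      qed
    qed
    then have "(\<Sum>K\<in>F. \<bar>g (Sup K) - g (Inf K)\<bar>) < e / 2" using conv[of "\<lambda>K. \<bar>g (Sup K) - g (Inf K)\<bar>"] by simp
    moreover have "measure lebesgue (\<Union>K\<in>F. J K) \<le> (\<Sum>K\<in>F. measure lebesgue (J K))"
      by (rule measure_UNION_le[OF F(2)]) (simp add: J_def)
    moreover have "(\<Sum>K\<in>F. measure lebesgue (J K)) \<le> (\<Sum>K\<in>F. \<bar>g (Sup K) - g (Inf K)\<bar>)"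
      by (rule sum_mono) (simp add: J_def)
    ultimately show ?thesis by simp
  qed
  have "(\<Union>K\<in>\<D>. J K) \<in> lmeasurable" and "measure lebesgue (\<Union>K\<in>\<D>. J K) \<le> e / 2"
    using fmeasurable_UN_bound[OF \<D>(1), of J lebesgue "e/2"] measure_UN_bound[OF \<D>(1), of J lebesgue "e/2"] fin
    by (auto simp: J_def)
  moreover have "g ` N \<subseteq> (\<Union>K\<in>\<D>. J K)"
  proof
    fix y assume "y \<in> g ` N"
    then obtain x where x: "x \<in> N" "y = g x" by blast
    then obtain K where k: "K \<in> \<D>" "x \<in> K" using \<D>(4) by blast
    then have "Inf K \<le> x" "x \<le> Sup K" using K(1)[OF k(1)] by auto
    then have "y \<in> J K" using K(2-4)[OF k(1)] x(2) by (auto simp: J_def intro!: mono_onD[OF mono])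
    then show "y \<in> (\<Union>K\<in>\<D>. J K)" using k by blast
  qed
  ultimately show "\<exists>T. g ` N \<subseteq> T \<and> T \<in> lmeasurable \<and> measure lebesgue T < e" using e by (intro exI[of _ "\<Union>K\<in>\<D>. J K"]) auto
qed

text \<open>\<open>\<Lambda>\<close> plays the role of the inverse length function, from arc length
  on the image to arc length on the curve, extended to the whole line. The bound
  \<open>speed\<close> concerns chords of the curve, so it says nothing directly about the growth of
  \<open>\<Lambda>\<close>, which measures length.\<close>

locale reparametrized_curve = rectifiable_curve +
  fixes \<Lambda> :: "real \<Rightarrow> real" and L' :: real and \<omega> :: "real \<Rightarrow> ennreal"
  assumes L': "0 \<le> L'" and \<Lambda>_mono: "mono \<Lambda>" and \<Lambda>_cont: "continuous_on UNIV \<Lambda>"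
    and \<Lambda>_0: "\<Lambda> 0 = 0" and \<Lambda>_L': "\<Lambda> L' = len b" and \<Lambda>_range: "\<And>s. \<Lambda> s \<in> {0..len b}"
    and \<Lambda>_lusin: "\<And>N. N \<subseteq> {0..L'} \<Longrightarrow> negligible N \<Longrightarrow> negligible (\<Lambda> ` N)"
    and \<omega>_measurable: "\<omega> \<in> borel_measurable borel"
    and speed: "\<And>s e. s \<in> {0..L'} \<Longrightarrow> \<omega> s < \<infinity> \<Longrightarrow> e > 0 \<Longrightarrow>
      \<exists>\<delta>>0. \<forall>t\<in>{0..L'}. \<bar>t - s\<bar> < \<delta> \<longrightarrow> d (arc (\<Lambda> s)) (arc (\<Lambda> t)) \<le> (enn2real (\<omega> s) + e) * \<bar>t - s\<bar>"
begin

text \<open>Up to \<open>e\<close> the total length is a sum of chords. A chord is estimated by the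
  integral of the speed bound where the curve passes through \<open>A\<close>, and by plain arc
  length elsewhere. The complement of \<open>A\<close> has length
  \<open>len b - measure lborel A\<close>, so after cancelling \<open>len b\<close> the measure of
  \<open>A\<close> is what remains to be bounded.\<close>

lemma arc_set_measure_le:
  assumes A: "A \<in> sets borel" "A \<subseteq> {0..len b}"
  shows "emeasure lborel A \<le> (\<integral>\<^sup>+ s. \<omega> s * indicator {s \<in> {0..L'}. \<Lambda> s \<in> A} s \<partial>lborel)" (is "_ \<le> ?I")
proof (cases "?I = \<infinity>")
  case False
  define r where "r = enn2real ?I"
  have Ir: "?I = ennreal r" "r \<ge> 0" using False by (simp_all add: r_def less_top)
  define E where "E = {s \<in> {0..L'}. \<Lambda> s \<in> A}"
  have \<Lambda>_meas[measurable]: "\<Lambda> \<in> borel_measurable borel" using \<Lambda>_cont by (rule borel_measurable_continuous_onI)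
  note A(1)[measurable] \<omega>_measurable[measurable]
  have E: "E \<in> sets borel" unfolding E_def by measurable
  note E[measurable]
  define N1 where "N1 = {s \<in> E. \<omega> s = \<infinity>}"
  have "AE s in lborel. \<omega> s * indicator E s \<noteq> \<infinity>"
    using False by (intro nn_integral_PInf_AE) (auto simp: E_def)
  then have "{s \<in> E. \<omega> s = \<infinity>} \<in> null_sets lborel"
  proof -
    assume ae: "AE s in lborel. \<omega> s * indicator E s \<noteq> \<infinity>"
    have "{s \<in> E. \<omega> s = \<infinity>} = {s \<in> space lborel. \<not> \<omega> s * indicator E s \<noteq> \<infinity>}"
      by (auto simp: indicator_def split: if_splits)
    moreover have "{s \<in> space lborel. \<not> \<omega> s * indicator E s \<noteq> \<infinity>} \<in> sets lborel" by measurable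
    ultimately show ?thesis using ae by (simp add: AE_iff_null)
  qed
  then have "negligible {s \<in> E. \<omega> s = \<infinity>}" by (simp add: negligible_iff_null_sets null_sets_completionI)
  then have N1: "negligible N1" "N1 \<subseteq> {0..L'}"
    by (auto simp: N1_def E_def)
  have \<Lambda>N1: "negligible (\<Lambda> ` N1)" by (rule \<Lambda>_lusin[OF N1(2,1)])
  define w where "w s = enn2real (\<omega> s) * indicator (E - {s \<in> E. \<omega> s = \<infinity>}) s" for s
  have w0: "w s \<ge> 0" for s by (simp add: w_def)
  have "(\<integral>\<^sup>+ s. ennreal (w s) \<partial>lborel) = ?I"
    unfolding E_def[symmetric]
  proof (rule nn_integral_cong_AE)
    show "AE s in lborel. ennreal (w s) = \<omega> s * indicator E s"
      using \<open>AE s in lborel. \<omega> s * indicator E s \<noteq> \<infinity>\<close>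
      by eventually_elim (auto simp: w_def indicator_def less_top)
  qed
  moreover have "w \<in> borel_measurable borel" unfolding w_def by measurable
  ultimately have wI: "(w has_integral r) UNIV" using nn_integral_has_integral[of w r] Ir w0 by simp
  have w_int: "w integrable_on {s..t}" for s t
    using wI integrable_on_subinterval[of w UNIV s t] by (auto simp: integrable_on_def)
  have "ennreal (measure lborel A) \<le> ennreal r"
  proof (rule ennreal_leI, rule field_le_epsilon)
    fix e0 :: real assume e0: "e0 > 0"
    \<comment> \<open>The errors \<open>e * L'\<close> from the local estimates, \<open>e\<close>
      from the open cover and \<open>e\<close> from the chord approximation add up to
      \<open>e0\<close>.\<close>
    define e where "e = e0 / (L' + 2)"
    have e: "e > 0" using e0 L' by (simp add: e_def)
    define B where "B = ({0..len b} - A) \<union> \<Lambda> ` N1"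
    have lb: "len b \<ge> 0" by (simp add: len_def)
    have Am: "A \<in> sets lebesgue" "A \<in> lmeasurable" using A lmeasurable_cbox[of 0 "len b"]
      by (auto intro: fmeasurableI2)
    have Bm: "B \<in> sets lebesgue" unfolding B_def using Am \<Lambda>N1 by (intro sets.Un sets.Diff) (auto simp: negligible_imp_sets)
    have "measure lebesgue B \<le> measure lebesgue ({0..len b} - A) + measure lebesgue (\<Lambda> ` N1)"
      unfolding B_def using Am \<Lambda>N1 by (intro measure_Un_le) (auto simp: negligible_imp_sets)
    also have "\<dots> = len b - measure lebesgue A"
      using Am A(2) lb \<Lambda>N1 by (subst measurable_measure_Diff) (auto simp: negligible_imp_measure0)
    finally have mB: "measure lebesgue B \<le> len b - measure lborel A" using A(1) by simp
    have Bsub: "B \<subseteq> {0..len b}" unfolding B_def using \<Lambda>_range by auto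
    obtain U where U: "open U" "B \<subseteq> U" "U - B \<in> lmeasurable" "emeasure lebesgue (U - B) < ennreal e"
      by (rule sets_lebesgue_outer_open[OF Bm e])
    have mU: "measure lebesgue (U - B) \<le> e" using U(3,4) e by (simp add: emeasure_eq_measure2 ennreal_less_iff less_imp_le)
    \<comment> \<open>The length of the part of the open cover of \<open>B\<close> passed up to
      \<open>s\<close>. It grows at least as fast as \<open>\<Lambda>\<close> while
      \<open>\<Lambda>\<close> stays in \<open>U\<close>, and in total by at most
      \<open>measure lebesgue B + e\<close>.\<close>
    define \<Theta> where "\<Theta> s = measure lebesgue (U \<inter> {0..\<Lambda> s})" for s
    have UI: "U \<inter> {0..x} \<in> lmeasurable" for x :: real
      by (rule fmeasurableI2[OF lmeasurable_cbox[of 0 x]]) (use U(1) in auto)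
    have \<Theta>_mono: "\<Theta> s \<le> \<Theta> t" if "s \<le> t" for s t
      unfolding \<Theta>_def using UI monoD[OF \<Lambda>_mono that] by (intro measure_mono_fmeasurable) (auto dest: fmeasurableD)
    have \<Theta>_bd: "0 \<le> \<Theta> s" "\<Theta> s \<le> len b - measure lborel A + e" for s
    proof -
      show "0 \<le> \<Theta> s" by (simp add: \<Theta>_def)
      have Bl: "B \<in> lmeasurable" using Bm Bsub lmeasurable_cbox[of 0 "len b"] by (auto intro: fmeasurableI2)
      have "\<Theta> s \<le> measure lebesgue (B \<union> (U - B))" unfolding \<Theta>_def
        using UI U Bl by (intro measure_mono_fmeasurable fmeasurable.Un) (auto dest: fmeasurableD)
      also have "\<dots> \<le> measure lebesgue B + measure lebesgue (U - B)" using Bm U by (intro measure_Un_le) auto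
      finally show "\<Theta> s \<le> len b - measure lborel A + e" using mB mU by simp
    qed
    have \<Theta>_inc: "\<Lambda> t - \<Lambda> s \<le> \<Theta> t - \<Theta> s" if st: "s \<le> t" "{\<Lambda> s..\<Lambda> t} \<subseteq> U" for s t
    proof -
      have l: "0 \<le> \<Lambda> s" "\<Lambda> s \<le> \<Lambda> t" using \<Lambda>_range[of s] monoD[OF \<Lambda>_mono st(1)] by auto
      have "\<Theta> s + (\<Lambda> t - \<Lambda> s) = measure lebesgue (U \<inter> {0..\<Lambda> s}) + measure lebesgue {\<Lambda> s<..\<Lambda> t}"
        using l by (simp add: \<Theta>_def)
      also have "\<dots> = measure lebesgue ((U \<inter> {0..\<Lambda> s}) \<union> {\<Lambda> s<..\<Lambda> t})"
      proof (rule measure_Union[symmetric])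
        have i: "{\<Lambda> s<..\<Lambda> t} \<in> lmeasurable" by (rule fmeasurableI2[OF lmeasurable_cbox[of "\<Lambda> s" "\<Lambda> t"]]) auto
        show "emeasure lebesgue (U \<inter> {0..\<Lambda> s}) \<noteq> \<infinity>" "emeasure lebesgue {\<Lambda> s<..\<Lambda> t} \<noteq> \<infinity>"
          using fmeasurableD2[OF UI[of "\<Lambda> s"]] fmeasurableD2[OF i] by (simp_all only: infinity_ennreal_def not_False_eq_True)
        show "U \<inter> {0..\<Lambda> s} \<in> sets lebesgue" "{\<Lambda> s<..\<Lambda> t} \<in> sets lebesgue"
          using fmeasurableD[OF UI[of "\<Lambda> s"]] fmeasurableD[OF i] .
      qed auto
      also have "\<dots> \<le> \<Theta> t" unfolding \<Theta>_def
        using UI l st by (intro measure_mono_fmeasurable) (auto dest: fmeasurableD)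
      finally show ?thesis by simp
    qed
    define c where "c s = arc (\<Lambda> s)" for s
    have cM: "c s \<in> M" for s unfolding c_def by (rule arc_in_M[OF \<Lambda>_range])
    have c\<Lambda>: "d (c s) (c t) \<le> \<Lambda> t - \<Lambda> s" if "s \<le> t" for s t
      using arc_lipschitz[OF \<Lambda>_range[of s] \<Lambda>_range[of t]] monoD[OF \<Lambda>_mono that] by (simp add: c_def)
    \<comment> \<open>The two-sided form, with \<open>s\<close> between \<open>u\<close> and
      \<open>v\<close>, is what a tagged partition needs: \<open>s\<close> will be the tag of the
      cell \<open>{u..v}\<close>.\<close>
    define P where "P s \<delta> \<longleftrightarrow> \<delta> > 0 \<and> (\<forall>u v. 0 \<le> u \<longrightarrow> u \<le> s \<longrightarrow> s \<le> v \<longrightarrow> v \<le> L' \<longrightarrow> \<bar>u - s\<bar> < \<delta> \<longrightarrow> \<bar>v - s\<bar> < \<delta> \<longrightarrow>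
        d (c u) (c v) \<le> (v - u) * w s + (e * (v - u) + (\<Theta> v - \<Theta> u)))" for s \<delta>
    have exP: "\<exists>\<delta>. P s \<delta>" for s
    proof (cases "s \<in> E - N1")
      case True
      then have s: "s \<in> {0..L'}" "\<omega> s < \<infinity>" by (auto simp: N1_def E_def less_top)
      have ws: "w s = enn2real (\<omega> s)" using True by (simp add: w_def N1_def)
      obtain \<delta> where \<delta>: "\<delta> > 0" "\<And>t. t \<in> {0..L'} \<Longrightarrow> \<bar>t - s\<bar> < \<delta> \<Longrightarrow> d (c s) (c t) \<le> (w s + e) * \<bar>t - s\<bar>"
        using speed[OF s e] unfolding c_def[symmetric] ws by blast
      have "P s \<delta>" unfolding P_def
      proof (intro conjI \<delta>(1) allI impI)
        fix u v assume uv: "0 \<le> u" "u \<le> s" "s \<le> v" "v \<le> L'" "\<bar>u - s\<bar> < \<delta>" "\<bar>v - s\<bar> < \<delta>"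
        have "d (c u) (c v) \<le> d (c s) (c u) + d (c s) (c v)"
          using triangle[of "c u" "c s" "c v", OF cM cM cM] sym[of "c u" "c s", OF cM cM] by simp
        also have "\<dots> \<le> (w s + e) * (s - u) + (w s + e) * (v - s)"
          using \<delta>(2)[of u] \<delta>(2)[of v] uv by (intro add_mono) auto
        also have "\<dots> = (v - u) * w s + e * (v - u)" by (simp add: algebra_simps)
        also have "\<dots> \<le> (v - u) * w s + (e * (v - u) + (\<Theta> v - \<Theta> u))" using \<Theta>_mono[of u v] uv by simp
        finally show "d (c u) (c v) \<le> (v - u) * w s + (e * (v - u) + (\<Theta> v - \<Theta> u))" .
      qed
      then show ?thesis by blast
    next
      case False
      show ?thesis
      proof (cases "s \<in> {0..L'}")
        case sL: True
        \<comment> \<open>Near such an \<open>s\<close> the values of \<open>\<Lambda>\<close> stay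
          inside the open cover, so arc length itself is a sufficient bound for the chords.\<close>
        have "\<Lambda> s \<in> B" unfolding B_def using False sL \<Lambda>_range[of s] by (auto simp: E_def)
        then obtain \<eta> where \<eta>: "\<eta> > 0" "ball (\<Lambda> s) \<eta> \<subseteq> U" using U(1,2) openE by blast
        have "isCont \<Lambda> s" using \<Lambda>_cont by (simp add: continuous_on_eq_continuous_at)
        then obtain \<delta> where \<delta>: "\<delta> > 0" "\<And>t. dist t s < \<delta> \<Longrightarrow> dist (\<Lambda> t) (\<Lambda> s) < \<eta>"
          using \<eta>(1) unfolding continuous_at_eps_delta by blast
        have "P s \<delta>" unfolding P_def
        proof (intro conjI \<delta>(1) allI impI)
          fix u v assume uv: "0 \<le> u" "u \<le> s" "s \<le> v" "v \<le> L'" "\<bar>u - s\<bar> < \<delta>" "\<bar>v - s\<bar> < \<delta>"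
          have "\<Lambda> u \<in> ball (\<Lambda> s) \<eta>" "\<Lambda> v \<in> ball (\<Lambda> s) \<eta>"
            using \<delta>(2)[of u] \<delta>(2)[of v] uv by (auto simp: dist_real_def abs_minus_commute)
          then have "{\<Lambda> u..\<Lambda> v} \<subseteq> ball (\<Lambda> s) \<eta>" by (auto simp: dist_real_def)
          then have "{\<Lambda> u..\<Lambda> v} \<subseteq> U" using \<eta>(2) by (rule subset_trans)
          then have "d (c u) (c v) \<le> \<Theta> v - \<Theta> u" using c\<Lambda>[of u v] \<Theta>_inc[of u v] uv by simp
          moreover have "0 \<le> (v - u) * w s" "0 \<le> e * (v - u)" using uv e w0[of s] by simp_all
          ultimately show "d (c u) (c v) \<le> (v - u) * w s + (e * (v - u) + (\<Theta> v - \<Theta> u))" by linarith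
        qed
        then show ?thesis by blast
      next
        case False
        then have "P s 1" unfolding P_def by auto
        then show ?thesis by blast
      qed
    qed
    define D where "D s = (SOME \<delta>. P s \<delta>)" for s
    have PD: "P s (D s)" for s unfolding D_def by (rule someI_ex[OF exP])
    define \<Phi> where "\<Phi> s = integral {0..s} w + (e * s + \<Theta> s)" for s
    have claim: "d (c s1) (c s2) \<le> \<Phi> s2 - \<Phi> s1" if s12: "0 \<le> s1" "s1 \<le> s2" "s2 \<le> L'" for s1 s2
    proof (rule field_le_epsilon)
      fix e2 :: real assume e2: "e2 > 0"
      \<comment> \<open>The function \<open>w\<close> may be unbounded, so its Riemann sums are
        controlled by a gauge, which is intersected with the neighbourhoods where the local estimate
        holds.\<close>
      have "(w has_integral integral {s1..s2} w) {s1..s2}" using w_int by (rule integrable_integral)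
      then obtain \<gamma>g where g: "gauge \<gamma>g" "\<And>\<D>. \<D> tagged_division_of {s1..s2} \<Longrightarrow> \<gamma>g fine \<D> \<Longrightarrow>
         norm (sum (\<lambda>(x,k). measure lborel k *\<^sub>R w x) \<D> - integral {s1..s2} w) < e2"
        unfolding has_integral_real using e2 by meson
      define \<gamma>h where "\<gamma>h s = ball s (D s) \<inter> \<gamma>g s" for s
      have "gauge (\<lambda>s. ball s (D s))" by (rule gauge_ball_dependent) (use PD in \<open>auto simp: P_def\<close>)
      then have "gauge \<gamma>h" unfolding \<gamma>h_def by (rule gauge_Int[OF _ g(1)])
      then obtain p where p: "p tagged_division_of {s1..s2}" "\<gamma>h fine p" by (rule fine_division_exists_real)
      have "\<gamma>g fine p" using p(2) unfolding fine_def \<gamma>h_def by blast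
      from g(2)[OF p(1) this] have R: "(\<Sum>(x,k)\<in>p. measure lborel k *\<^sub>R w x) \<le> integral {s1..s2} w + e2" by (simp add: abs_less_iff)
      \<comment> \<open>Measuring from the fixed point \<open>c s1\<close> turns the chord into a
        telescoping sum, whose increments the triangle inequality bounds by the local
        chords.\<close>
      define \<phi> where "\<phi> s = d (c s1) (c s)" for s
      define \<psi> where "\<psi> s = e * s + \<Theta> s" for s
      have "\<phi> s2 - \<phi> s1 = (\<Sum>(x,k)\<in>p. \<phi> (Sup k) - \<phi> (Inf k))"
        using additive_tagged_division_1[OF s12(2) p(1), of \<phi>] by simp
      also have "\<dots> \<le> (\<Sum>(x,k)\<in>p. measure lborel k *\<^sub>R w x + (\<psi> (Sup k) - \<psi> (Inf k)))"
      proof (rule sum_mono, clarify)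
        fix x k assume xk: "(x, k) \<in> p"
        obtain u v where k: "k = {u..v}" using tagged_division_ofD(4)[OF p(1) xk] by auto
        have x: "x \<in> k" "k \<subseteq> {s1..s2}" using tagged_division_ofD(2,3)[OF p(1) xk] by auto
        have uv: "u \<le> x" "x \<le> v" using x k by auto
        have kb: "k \<subseteq> ball x (D x)" using p(2) xk unfolding fine_def \<gamma>h_def by blast
        have "u \<in> k" "v \<in> k" using uv k by auto
        then have "u \<in> ball x (D x)" "v \<in> ball x (D x)" using kb by blast+
        then have "\<bar>u - x\<bar> < D x" "\<bar>v - x\<bar> < D x" by (auto simp: dist_real_def abs_minus_commute)
        moreover have "s1 \<le> u" "v \<le> s2" using x(2) k uv by auto
        ultimately have "d (c u) (c v) \<le> (v - u) * w x + (e * (v - u) + (\<Theta> v - \<Theta> u))"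
          using PD[of x] uv s12 unfolding P_def by auto
        moreover have "\<phi> v - \<phi> u \<le> d (c u) (c v)" unfolding \<phi>_def using triangle[of "c s1" "c u" "c v", OF cM cM cM] by simp
        ultimately show "\<phi> (Sup k) - \<phi> (Inf k) \<le> measure lborel k *\<^sub>R w x + (\<psi> (Sup k) - \<psi> (Inf k))"
          using uv by (simp add: k \<psi>_def algebra_simps)
      qed
      also have "\<dots> = (\<Sum>(x,k)\<in>p. measure lborel k *\<^sub>R w x) + (\<Sum>(x,k)\<in>p. \<psi> (Sup k) - \<psi> (Inf k))"
        by (simp add: sum.distrib[symmetric] case_prod_beta)
      also have "(\<Sum>(x,k)\<in>p. \<psi> (Sup k) - \<psi> (Inf k)) = \<psi> s2 - \<psi> s1"
        by (rule additive_tagged_division_1[OF s12(2) p(1)])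
      finally have "\<phi> s2 - \<phi> s1 \<le> integral {s1..s2} w + e2 + (\<psi> s2 - \<psi> s1)" using R by simp
      moreover have "\<phi> s1 = 0" unfolding \<phi>_def using zero[of "c s1" "c s1", OF cM cM] by simp
      moreover have "integral {0..s1} w + integral {s1..s2} w = integral {0..s2} w"
        using s12 w_int by (intro Henstock_Kurzweil_Integration.integral_combine) auto
      ultimately show "d (c s1) (c s2) \<le> \<Phi> s2 - \<Phi> s1 + e2" unfolding \<Phi>_def \<phi>_def \<psi>_def by linarith
    qed
    have \<Phi>_bd: "0 \<le> \<Phi> s" "\<Phi> s \<le> r + (e * L' + (len b - measure lborel A + e))" if s: "0 \<le> s" "s \<le> L'" for s
    proof -
      have "0 \<le> integral {0..s} w" using w0 w_int by (intro integral_nonneg) auto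
      then show "0 \<le> \<Phi> s" unfolding \<Phi>_def using \<Theta>_bd(1)[of s] e s by (intro add_nonneg_nonneg) auto
      have "integral {0..s} w \<le> integral UNIV w"
        using w0 w_int wI by (intro integral_subset_le) (auto simp: integrable_on_def)
      then have "integral {0..s} w \<le> r" using integral_unique[OF wI] by simp
      then show "\<Phi> s \<le> r + (e * L' + (len b - measure lborel A + e))"
        unfolding \<Phi>_def using \<Theta>_bd(2)[of s] e s by (intro add_mono) (auto intro: mult_left_mono)
    qed
    obtain N u where u: "is_partition 0 (len b) N u" "(\<Sum>k<N. d (arc (u k)) (arc (u (Suc k)))) \<ge> len b - e"
      by (rule arc_partition_approx[OF e])
    \<comment> \<open>A right inverse of \<open>\<Lambda>\<close>. It depends on the value alone,
      which makes it monotone along the partition although \<open>\<Lambda>\<close> may have flat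
      pieces.\<close>
    define \<sigma> where "\<sigma> x = (SOME s. 0 \<le> s \<and> s \<le> L' \<and> \<Lambda> s = x)" for x
    have \<sigma>: "0 \<le> \<sigma> x" "\<sigma> x \<le> L'" "\<Lambda> (\<sigma> x) = x" if "x \<in> {0..len b}" for x
    proof -
      have "\<exists>s. 0 \<le> s \<and> s \<le> L' \<and> \<Lambda> s = x"
        using IVT'[of \<Lambda> 0 x L'] that L' \<Lambda>_0 \<Lambda>_L' continuous_on_subset[OF \<Lambda>_cont] by auto
      from someI_ex[OF this] show "0 \<le> \<sigma> x" "\<sigma> x \<le> L'" "\<Lambda> (\<sigma> x) = x" unfolding \<sigma>_def by blast+
    qed
    have uin: "u k \<in> {0..len b}" if "k \<le> N" for k by (rule partition_in[OF u(1) that])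
    have "len b - e \<le> (\<Sum>k<N. d (arc (u k)) (arc (u (Suc k))))" by (rule u(2))
    also have "\<dots> \<le> (\<Sum>k<N. \<Phi> (\<sigma> (u (Suc k))) - \<Phi> (\<sigma> (u k)))"
    proof (rule sum_mono)
      fix k assume "k \<in> {..<N}"
      then have k: "u k \<in> {0..len b}" "u (Suc k) \<in> {0..len b}" "u k \<le> u (Suc k)"
        using uin[of k] uin[of "Suc k"] u(1) by (auto simp: is_partition_def)
      have "\<sigma> (u k) \<le> \<sigma> (u (Suc k))"
      proof (rule ccontr)
        assume "\<not> \<sigma> (u k) \<le> \<sigma> (u (Suc k))"
        then have lt: "\<sigma> (u (Suc k)) < \<sigma> (u k)" by simp
        then have "\<Lambda> (\<sigma> (u (Suc k))) \<le> \<Lambda> (\<sigma> (u k))" using \<Lambda>_mono by (simp add: monoD)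
        then have "u (Suc k) = u k" using \<sigma>(3)[OF k(1)] \<sigma>(3)[OF k(2)] k(3) by simp
        then show False using lt by simp
      qed
      from claim[OF \<sigma>(1)[OF k(1)] this \<sigma>(2)[OF k(2)]]
      show "d (arc (u k)) (arc (u (Suc k))) \<le> \<Phi> (\<sigma> (u (Suc k))) - \<Phi> (\<sigma> (u k))"
        unfolding c_def \<sigma>(3)[OF k(1)] \<sigma>(3)[OF k(2)] .
    qed
    also have "\<dots> = \<Phi> (\<sigma> (u N)) - \<Phi> (\<sigma> (u 0))" by (rule sum_lessThan_telescope)
    also have "\<dots> \<le> r + (e * L' + (len b - measure lborel A + e))"
      using \<Phi>_bd(2)[OF \<sigma>(1,2)[OF uin[of N]]] \<Phi>_bd(1)[OF \<sigma>(1,2)[OF uin[of 0]]] by simp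
    finally have "measure lborel A \<le> r + e * (L' + 2)" by (simp add: algebra_simps)
    also have "e * (L' + 2) = e0" using L' by (simp add: e_def)
    finally show "measure lborel A \<le> r + e0" .
  qed
  moreover have "emeasure lborel A \<noteq> \<infinity>"
  proof -
    have "emeasure lborel A \<le> emeasure lborel {0..len b}" using A by (intro emeasure_mono) auto
    also have "\<dots> < \<infinity>" using lmeasurable_cbox by (simp add: emeasure_lborel_Icc_eq)
    finally show ?thesis by simp
  qed
  ultimately show ?thesis using Ir by (simp add: emeasure_eq_ennreal_measure)
qed simp

text \<open>The inequality for sets is an inequality between two measures on the line, length on
  \<open>{0..len b}\<close> and the image under \<open>\<Lambda>\<close> of the measure with density
  \<open>\<omega>\<close> on \<open>{0..L'}\<close>; it carries over to integrals of nonnegative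
  functions.\<close>

lemma nn_integral_arc_le:
  assumes h: "h \<in> borel_measurable borel"
  shows "(\<integral>\<^sup>+ u\<in>{0..len b}. h u \<partial>lborel) \<le> (\<integral>\<^sup>+ s\<in>{0..L'}. h (\<Lambda> s) * \<omega> s \<partial>lborel)"
proof -
  have \<Lambda>_meas[measurable]: "\<Lambda> \<in> borel_measurable borel" using \<Lambda>_cont by (rule borel_measurable_continuous_onI)
  note h[measurable] \<omega>_measurable[measurable]
  define \<mu> where "\<mu> = density lborel (indicator {0..len b} :: real \<Rightarrow> ennreal)"
  define \<nu> where "\<nu> = distr (density lborel (\<lambda>s. \<omega> s * indicator {0..L'} s)) borel \<Lambda>"
  have sets: "sets \<mu> = sets \<nu>" by (simp add: \<mu>_def \<nu>_def)
  have "\<mu> \<le> \<nu>"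
  proof (rule le_measure[THEN iffD2, OF sets], intro ballI)
    fix A assume "A \<in> sets \<mu>"
    then have A[measurable]: "A \<in> sets borel" by (simp add: \<mu>_def)
    have "emeasure \<mu> A = emeasure lborel ({0..len b} \<inter> A)"
      unfolding \<mu>_def by (subst emeasure_density) (auto simp: indicator_inter_arith[symmetric] nn_integral_indicator)
    also have "\<dots> \<le> (\<integral>\<^sup>+ s. \<omega> s * indicator {s \<in> {0..L'}. \<Lambda> s \<in> {0..len b} \<inter> A} s \<partial>lborel)"
      by (rule arc_set_measure_le) auto
    also have "\<dots> = emeasure \<nu> A" using measurable_sets[OF \<Lambda>_meas A]
      unfolding \<nu>_def using \<Lambda>_range
      by (subst emeasure_distr, simp, simp, subst emeasure_density) (auto intro!: nn_integral_cong simp: indicator_def)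
    finally show "emeasure \<mu> A \<le> emeasure \<nu> A" .
  qed
  then have "(\<integral>\<^sup>+ u. h u \<partial>\<mu>) \<le> (\<integral>\<^sup>+ u. h u \<partial>\<nu>)" by (rule nn_integral_mono_measure[OF sets])
  moreover have "(\<integral>\<^sup>+ u. h u \<partial>\<mu>) = (\<integral>\<^sup>+ u\<in>{0..len b}. h u \<partial>lborel)"
    unfolding \<mu>_def by (subst nn_integral_density) (auto simp: mult.commute)
  moreover have "(\<integral>\<^sup>+ u. h u \<partial>\<nu>) = (\<integral>\<^sup>+ s\<in>{0..L'}. h (\<Lambda> s) * \<omega> s \<partial>lborel)"
    unfolding \<nu>_def by (subst nn_integral_distr, simp, simp, subst nn_integral_density) (auto intro!: nn_integral_cong simp: ac_simps)
  ultimately show ?thesis by simp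
qed

end

section \<open>Transfer of path integrals from a lift to its image\<close>

lemma abs_continuous_on_segmentD:
  assumes "abs_continuous_on_segment c d g" "\<epsilon> > 0"
  obtains \<delta> where "\<delta> > 0" "\<And>u v. c \<le> u \<Longrightarrow> u \<le> v \<Longrightarrow> v \<le> d \<Longrightarrow> v - u < \<delta> \<Longrightarrow> \<bar>g v - g u\<bar> < \<epsilon>"
proof -
  obtain \<delta> where \<delta>: "\<delta> > 0" and ac: "\<And>(n::nat) u v. \<lbrakk>\<forall>k<n. c \<le> u k \<and> u k \<le> v k \<and> v k \<le> d;
      disjoint_family_on (\<lambda>k. {u k<..<v k}) {..<n}; (\<Sum>k<n. v k - u k) < \<delta>\<rbrakk> \<Longrightarrow> (\<Sum>k<n. \<bar>g (v k) - g (u k)\<bar>) < \<epsilon>"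
    using assms(1)[unfolded abs_continuous_on_segment_def, rule_format, OF assms(2)] by auto
  have "\<bar>g v - g u\<bar> < \<epsilon>" if "c \<le> u" "u \<le> v" "v \<le> d" "v - u < \<delta>" for u v
    using ac[of 1 "\<lambda>_. u" "\<lambda>_. v"] that by (simp add: disjoint_family_on_def)
  then show thesis using that \<delta> by blast
qed

lemma abs_continuous_on_segment_shift:
  assumes "abs_continuous_on_segment c d g"
  shows "abs_continuous_on_segment 0 (d - c) (\<lambda>s. g (s + c) - m)"
  unfolding abs_continuous_on_segment_def
proof (intro allI impI)
  fix \<epsilon> :: real assume "\<epsilon> > 0"
  then obtain \<delta> where \<delta>: "\<delta> > 0" and ac: "\<And>(n::nat) u v. \<lbrakk>\<forall>k<n. c \<le> u k \<and> u k \<le> v k \<and> v k \<le> d;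
      disjoint_family_on (\<lambda>k. {u k<..<v k}) {..<n}; (\<Sum>k<n. v k - u k) < \<delta>\<rbrakk> \<Longrightarrow> (\<Sum>k<n. \<bar>g (v k) - g (u k)\<bar>) < \<epsilon>"
    using assms(1)[unfolded abs_continuous_on_segment_def, rule_format, of \<epsilon>] by auto
  have key: "(\<Sum>k<n. \<bar>g (v k + c) - m0 - (g (u k + c) - m0)\<bar>) < \<epsilon>"
    if h: "\<forall>k<n. 0 \<le> u k \<and> u k \<le> v k \<and> v k \<le> d - c" "disjoint_family_on (\<lambda>k. {u k<..<v k}) {..<n}"
      "(\<Sum>k<n. v k - u k) < \<delta>" for n :: nat and u v and m0 :: real
  proof -
    have "disjoint_family_on (\<lambda>k. {u k + c<..<v k + c}) {..<n}"
      unfolding disjoint_family_on_def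
    proof (intro ballI impI)
      fix i j assume "i \<in> {..<n}" "j \<in> {..<n}" "i \<noteq> j"
      then have e: "{u i<..<v i} \<inter> {u j<..<v j} = {}" using h(2) by (auto simp: disjoint_family_on_def)
      have "x - c \<in> {u i<..<v i} \<inter> {u j<..<v j}" if "x \<in> {u i + c<..<v i + c} \<inter> {u j + c<..<v j + c}" for x
        using that by auto
      then show "{u i + c<..<v i + c} \<inter> {u j + c<..<v j + c} = {}" using e by blast
    qed
    then show ?thesis using ac[of n "\<lambda>k. u k + c" "\<lambda>k. v k + c"] h by (simp add: algebra_simps)
  qed
  show "\<exists>\<delta>>0. \<forall>(n::nat) u v. (\<forall>k<n. 0 \<le> u k \<and> u k \<le> v k \<and> v k \<le> d - c) \<and>
      disjoint_family_on (\<lambda>k. {u k<..<v k}) {..<n} \<and> (\<Sum>k<n. v k - u k) < \<delta> \<longrightarrow>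
      (\<Sum>k<n. \<bar>g (v k + c) - m - (g (u k + c) - m)\<bar>) < \<epsilon>"
  proof (intro exI[of _ \<delta>] conjI allI impI \<delta>)
    fix n :: nat and u v
    assume h: "(\<forall>k<n. 0 \<le> u k \<and> u k \<le> v k \<and> v k \<le> d - c) \<and>
      disjoint_family_on (\<lambda>k. {u k<..<v k}) {..<n} \<and> (\<Sum>k<n. v k - u k) < \<delta>"
    show "(\<Sum>k<n. \<bar>g (v k + c) - m - (g (u k + c) - m)\<bar>) < \<epsilon>"
      by (rule key[OF conjunct1[OF h] conjunct1[OF conjunct2[OF h]] conjunct2[OF conjunct2[OF h]]])
  qed
qed

text \<open>In its arc length the image curve is 1-Lipschitz, so the lift reparametrised by
  \<open>g\<close> has chordal speed at most \<open>W\<close>. The change of parameter then bounds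
  the integral of \<open>\<rho>\<close> by that of \<open>\<rho>\<close> times \<open>W\<close> over
  the arc length of the image, and \<open>\<rho>'\<close> dominates this product pointwise.\<close>

lemma nn_integral_lift_le:
  fixes f :: "'a \<Rightarrow> 'b" and W \<rho> :: "'a \<Rightarrow> ennreal" and \<rho>' :: "'b \<Rightarrow> ennreal"
  assumes cv: "rectifiable_curve M d \<gamma> a b" and cv': "rectifiable_curve M' d' \<gamma>' a b"
    and lift: "\<And>t. t \<in> {a..b} \<Longrightarrow> \<gamma>' t = f (\<gamma> t)" and D: "\<And>t. t \<in> {a..b} \<Longrightarrow> \<gamma> t \<in> D"
    and g: "abs_continuous_on_segment 0 (rectifiable_curve.len d' \<gamma>' a b) g"
      "\<And>t. t \<in> {a..b} \<Longrightarrow> g (rectifiable_curve.len d' \<gamma>' a t) = rectifiable_curve.len d \<gamma> a t"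
    and W: "\<And>p e. p \<in> D \<Longrightarrow> W p < \<infinity> \<Longrightarrow> e > 0 \<Longrightarrow>
      \<exists>\<eta>>0. \<forall>q\<in>D. d p q < \<eta> \<longrightarrow> d p q \<le> (enn2real (W p) + e) * d' (f p) (f q)"
    and meas: "\<And>c :: real \<Rightarrow> 'a. \<lbrakk>\<And>s. c s \<in> D; \<And>s e. e > 0 \<Longrightarrow> \<exists>\<eta>>0. \<forall>t. \<bar>t - s\<bar> < \<eta> \<longrightarrow> d (c s) (c t) < e\<rbrakk>
        \<Longrightarrow> (\<lambda>s. W (c s)) \<in> borel_measurable borel \<and> (\<lambda>s. \<rho> (c s)) \<in> borel_measurable borel"
    and le: "\<And>p. p \<in> D \<Longrightarrow> \<rho> p * W p \<le> \<rho>' (f p)"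
  shows "segment_integral d \<rho> \<gamma> a b \<le> segment_integral d' \<rho>' \<gamma>' a b"
proof -
  interpret X: rectifiable_curve M d \<gamma> a b by (rule cv)
  interpret Y: rectifiable_curve M' d' \<gamma>' a b by (rule cv')
  define L' where "L' = Y.len b"
  have L'0: "0 \<le> L'" by (simp add: L'_def Y.len_def)
  \<comment> \<open>Clamping extends everything to the whole real line, where continuity and Borel
    measurability are required.\<close>
  define cl where "cl s = max 0 (min L' s)" for s :: real
  have cl: "cl s \<in> {0..L'}" "\<And>t. \<bar>cl s - cl t\<bar> \<le> \<bar>s - t\<bar>" "s \<in> {0..L'} \<Longrightarrow> cl s = s" for s
    using L'0 by (auto simp: cl_def)
  define \<Lambda> where "\<Lambda> s = g (cl s)" for s
  \<comment> \<open>The function \<open>\<tau>\<close> itself may jump, but the composite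
    \<open>X.len (\<tau> s)\<close> is the continuous \<open>\<Lambda> s\<close>.\<close>
  obtain \<tau> where \<tau>: "\<And>s. \<tau> s \<in> {a..b} \<and> Y.len (\<tau> s) = cl s"
  proof -
    have "\<exists>t. t \<in> {a..b} \<and> Y.len t = cl s" for s using Y.len_surj[of "cl s"] cl(1)[of s] by (auto simp: L'_def)
    then show thesis using that[of "\<lambda>s. SOME t. t \<in> {a..b} \<and> Y.len t = cl s"] someI_ex by (metis (mono_tags, lifting))
  qed
  have \<Lambda>\<tau>: "\<Lambda> s = X.len (\<tau> s)" for s unfolding \<Lambda>_def using g(2)[of "\<tau> s"] \<tau>[of s] by simp
  have \<Lambda>_arc: "X.arc (\<Lambda> s) = \<gamma> (\<tau> s)" "Y.arc (cl s) = f (\<gamma> (\<tau> s))" for s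
    using X.arc_len[of "\<tau> s"] Y.arc_len[of "\<tau> s"] \<tau>[of s] lift[of "\<tau> s"] by (simp_all add: \<Lambda>\<tau>)
  have mono: "mono \<Lambda>"
  proof (rule monoI)
    fix s t :: real assume st: "s \<le> t"
    show "\<Lambda> s \<le> \<Lambda> t"
    proof (cases "cl s = cl t")
      case True then show ?thesis by (simp add: \<Lambda>_def)
    next
      case False
      then have lt: "Y.len (\<tau> s) < Y.len (\<tau> t)" using \<tau> st by (auto simp: cl_def)
      have "\<tau> s \<le> \<tau> t"
      proof (rule ccontr)
        assume "\<not> \<tau> s \<le> \<tau> t"
        then have "Y.len (\<tau> t) \<le> Y.len (\<tau> s)" using Y.len_diff(2)[of "\<tau> t" "\<tau> s"] \<tau>[of s] \<tau>[of t] by simp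
        then show False using lt by simp
      qed
      then show ?thesis using X.len_diff(2)[of "\<tau> s" "\<tau> t"] \<tau>[of s] \<tau>[of t] by (simp add: \<Lambda>\<tau>)
    qed
  qed
  have \<Lambda>_unif: "\<exists>\<delta>>0. \<forall>s t. \<bar>t - s\<bar> < \<delta> \<longrightarrow> \<bar>\<Lambda> t - \<Lambda> s\<bar> < e" if e: "e > 0" for e
  proof -
    obtain \<delta> where \<delta>: "\<delta> > 0" "\<And>u v. 0 \<le> u \<Longrightarrow> u \<le> v \<Longrightarrow> v \<le> L' \<Longrightarrow> v - u < \<delta> \<Longrightarrow> \<bar>g v - g u\<bar> < e"
      using abs_continuous_on_segmentD[OF g(1)[folded L'_def] e] by blast
    have "\<bar>\<Lambda> t - \<Lambda> s\<bar> < e" if "\<bar>t - s\<bar> < \<delta>" for s t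
    proof -
      have "\<bar>cl t - cl s\<bar> < \<delta>" using cl(2)[of t s] that by simp
      then show ?thesis using \<delta>(2)[of "cl s" "cl t"] \<delta>(2)[of "cl t" "cl s"] cl(1)[of s] cl(1)[of t]
        by (cases "cl s \<le> cl t") (auto simp: \<Lambda>_def abs_minus_commute)
    qed
    then show ?thesis using \<delta>(1) by blast
  qed
  have \<Lambda>_range: "\<Lambda> s \<in> {0..X.len b}" for s using X.len_bounds[of "\<tau> s"] \<tau>[of s] by (simp add: \<Lambda>\<tau>)
  have \<Lambda>_at: "\<Lambda> (Y.len t) = X.len t" if "t \<in> {a..b}" for t
    using g(2)[OF that] cl(3) Y.len_bounds[OF that] by (simp add: \<Lambda>_def L'_def)
  define c where "c s = X.arc (\<Lambda> s)" for s
  have cD: "c s \<in> D" for s using D[of "\<tau> s"] \<tau>[of s] by (simp add: c_def \<Lambda>_arc)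
  have fc: "f (c s) = Y.arc (cl s)" for s by (simp add: c_def \<Lambda>_arc)
  have c_cont: "\<exists>\<eta>>0. \<forall>t. \<bar>t - s\<bar> < \<eta> \<longrightarrow> d (c s) (c t) < e" if e: "e > 0" for s e
  proof -
    obtain \<delta> where \<delta>: "\<delta> > 0" "\<forall>s t. \<bar>t - s\<bar> < \<delta> \<longrightarrow> \<bar>\<Lambda> t - \<Lambda> s\<bar> < e" using \<Lambda>_unif[OF e] by blast
    have "d (c s) (c t) < e" if "\<bar>t - s\<bar> < \<delta>" for t
    proof -
      have "\<bar>\<Lambda> t - \<Lambda> s\<bar> < e" using \<delta>(2) that by blast
      then show ?thesis
        using X.arc_lipschitz[OF \<Lambda>_range[of s] \<Lambda>_range[of t]] by (simp add: c_def abs_minus_commute)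
    qed
    then show ?thesis using \<delta>(1) by blast
  qed
  interpret R: reparametrized_curve M d \<gamma> a b \<Lambda> L' "\<lambda>s. W (c s)"
  proof unfold_locales
    show "0 \<le> L'" "mono \<Lambda>" "\<And>s. \<Lambda> s \<in> {0..X.len b}" by (rule L'0, rule mono, rule \<Lambda>_range)
    show "continuous_on UNIV \<Lambda>" unfolding continuous_on_iff
    proof (intro ballI allI impI)
      fix s e :: real assume "e > 0"
      then obtain \<delta> where "\<delta> > 0" "\<forall>s t. \<bar>t - s\<bar> < \<delta> \<longrightarrow> \<bar>\<Lambda> t - \<Lambda> s\<bar> < e" using \<Lambda>_unif by blast
      then show "\<exists>\<delta>>0. \<forall>x'\<in>UNIV. dist x' s < \<delta> \<longrightarrow> dist (\<Lambda> x') (\<Lambda> s) < e" by (auto simp: dist_real_def)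
    qed
    show "\<Lambda> 0 = 0" using \<Lambda>_at[of a] X.ab X.len_a Y.len_a by simp
    show "\<Lambda> L' = X.len b" using \<Lambda>_at[of b] X.ab by (simp add: L'_def)
    show "negligible (\<Lambda> ` N)" if N: "N \<subseteq> {0..L'}" "negligible N" for N
    proof -
      have "g s = \<Lambda> s" if "s \<in> {0..L'}" for s using cl(3)[OF that] by (simp add: \<Lambda>_def)
      then have "mono_on {0..L'} g" using mono by (auto simp: mono_on_def mono_def)
      from abs_continuous_negligible_image[OF g(1)[folded L'_def] this N]
      have "negligible (g ` N)" .
      moreover have "\<Lambda> ` N = g ` N" using N(1) cl(3) by (force simp: \<Lambda>_def image_iff)
      ultimately show ?thesis by simp
    qed
    show "(\<lambda>s. W (c s)) \<in> borel_measurable borel" using meas[of c] cD c_cont by blast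
    show "\<exists>\<delta>>0. \<forall>t\<in>{0..L'}. \<bar>t - s\<bar> < \<delta> \<longrightarrow> d (X.arc (\<Lambda> s)) (X.arc (\<Lambda> t)) \<le> (enn2real (W (c s)) + e) * \<bar>t - s\<bar>"
      if s: "s \<in> {0..L'}" "W (c s) < \<infinity>" "e > 0" for s e
    proof -
      obtain \<eta> where \<eta>: "\<eta> > 0" "\<forall>q\<in>D. d (c s) q < \<eta> \<longrightarrow> d (c s) q \<le> (enn2real (W (c s)) + e) * d' (f (c s)) (f q)"
        using W[OF cD s(2,3)] by blast
      obtain \<delta> where \<delta>: "\<delta> > 0" "\<forall>t. \<bar>t - s\<bar> < \<delta> \<longrightarrow> d (c s) (c t) < \<eta>" using c_cont[OF \<eta>(1), of s] by blast
      have "d (c s) (c t) \<le> (enn2real (W (c s)) + e) * \<bar>t - s\<bar>" if t: "t \<in> {0..L'}" "\<bar>t - s\<bar> < \<delta>" for t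
      proof -
        have "d (c s) (c t) \<le> (enn2real (W (c s)) + e) * d' (f (c s)) (f (c t))" using \<eta>(2) \<delta>(2) t(2) cD by blast
        also have "\<dots> \<le> (enn2real (W (c s)) + e) * \<bar>t - s\<bar>"
        proof (rule mult_left_mono)
          have "d' (Y.arc s) (Y.arc t) \<le> \<bar>s - t\<bar>" using Y.arc_lipschitz s(1) t(1) by (simp add: L'_def)
          then show "d' (f (c s)) (f (c t)) \<le> \<bar>t - s\<bar>" using fc[of s] fc[of t] cl(3)[OF s(1)] cl(3)[OF t(1)] by simp
        qed (use s(3) in \<open>simp add: add_nonneg_nonneg\<close>)
        finally show ?thesis .
      qed
      then show ?thesis unfolding c_def[symmetric] using \<delta>(1) by blast
    qed
  qed
  define clX where "clX u = max 0 (min (X.len b) u)" for u :: real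
  have X0: "0 \<le> X.len b" by (simp add: X.len_def)
  have clX: "clX u \<in> {0..X.len b}" "\<And>v. \<bar>clX u - clX v\<bar> \<le> \<bar>u - v\<bar>" "u \<in> {0..X.len b} \<Longrightarrow> clX u = u" for u
    using X0 by (auto simp: clX_def)
  have arcD: "X.arc (clX u) \<in> D" for u
  proof -
    obtain t where "t \<in> {a..b}" "X.len t = clX u" using X.len_surj[OF clX(1)] by blast
    then show ?thesis using X.arc_len[of t] D[of t] by simp
  qed
  have "(\<lambda>u. \<rho> (X.arc (clX u))) \<in> borel_measurable borel"
  proof (rule meas[THEN conjunct2], rule arcD)
    fix s e :: real assume e: "e > 0"
    have "d (X.arc (clX s)) (X.arc (clX t)) < e" if "\<bar>t - s\<bar> < e" for t
      using X.arc_lipschitz[OF clX(1)[of s] clX(1)[of t]] clX(2)[of s t] that by simp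
    then show "\<exists>\<eta>>0. \<forall>t. \<bar>t - s\<bar> < \<eta> \<longrightarrow> d (X.arc (clX s)) (X.arc (clX t)) < e" using e by blast
  qed
  from R.nn_integral_arc_le[OF this]
  have "(\<integral>\<^sup>+ u\<in>{0..X.len b}. \<rho> (X.arc (clX u)) \<partial>lborel) \<le> (\<integral>\<^sup>+ s\<in>{0..L'}. \<rho> (X.arc (clX (\<Lambda> s))) * W (c s) \<partial>lborel)" .
  moreover have "(\<integral>\<^sup>+ u\<in>{0..X.len b}. \<rho> (X.arc (clX u)) \<partial>lborel) = segment_integral d \<rho> \<gamma> a b"
    unfolding X.segment_integral_arc by (intro nn_integral_cong) (auto simp: indicator_def clX(3))
  moreover have "(\<integral>\<^sup>+ s\<in>{0..L'}. \<rho> (X.arc (clX (\<Lambda> s))) * W (c s) \<partial>lborel) \<le> (\<integral>\<^sup>+ s\<in>{0..L'}. \<rho>' (Y.arc s) \<partial>lborel)"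
  proof (rule nn_integral_mono)
    fix s
    show "\<rho> (X.arc (clX (\<Lambda> s))) * W (c s) * indicator {0..L'} s \<le> \<rho>' (Y.arc s) * indicator {0..L'} s"
    proof (cases "s \<in> {0..L'}")
      case True
      then have "f (c s) = Y.arc s" using fc[of s] cl(3)[OF True] by simp
      then show ?thesis using le[OF cD, of s] True clX(3)[OF \<Lambda>_range] by (simp add: c_def)
    qed simp
  qed
  ultimately show ?thesis unfolding Y.segment_integral_arc L'_def by simp
qed

context set_metric
begin

lemma length_function_diff:
  assumes sub: "{min t0 s..max t0 t} \<subseteq> \<Delta>" and st: "s \<le> t" and M: "\<gamma> ` \<Delta> \<subseteq> M"
    and rect: "locally_rectifiable d (\<Delta>, \<gamma>)"
  shows "length_function d \<gamma> t0 t - length_function d \<gamma> t0 s = enn2real (curve_length d \<gamma> s t)"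
proof -
  have fin: "curve_length d \<gamma> u v < \<infinity>" if "u \<le> v" "{u..v} \<subseteq> \<Delta>" for u v
    using rect that by (auto simp: locally_rectifiable_def)
  have add: "enn2real (curve_length d \<gamma> u w) = enn2real (curve_length d \<gamma> u v) + enn2real (curve_length d \<gamma> v w)"
    if "u \<le> v" "v \<le> w" "{u..w} \<subseteq> \<Delta>" for u v w
  proof -
    have "\<gamma> ` {u..w} \<subseteq> M" using that M by blast
    moreover have "{u..v} \<subseteq> \<Delta>" "{v..w} \<subseteq> \<Delta>" using that by auto
    ultimately show ?thesis using curve_length_add[OF that(1,2)] fin that by (simp add: enn2real_plus)
  qed
  consider "t0 \<le> s" | "s < t0" "t0 \<le> t" | "t < t0" using st by linarith
  then show ?thesis
  proof cases
    case 1 then show ?thesis using add[of t0 s t] sub st by (simp add: length_function_def min_def max_def)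
  next
    case 2 then show ?thesis using add[of s t0 t] sub st by (simp add: length_function_def min_def max_def)
  next
    case 3 then show ?thesis using add[of s t t0] sub st by (simp add: length_function_def min_def max_def)
  qed
qed

end

lemma param_interval_convex: "param_interval \<Delta> \<Longrightarrow> x \<in> \<Delta> \<Longrightarrow> y \<in> \<Delta> \<Longrightarrow> {x..y} \<subseteq> \<Delta>"
  by (auto simp: param_interval_def)

lemma base_point_exists: assumes "param_interval \<Delta>" shows "\<exists>t0. base_point \<Delta> t0"
proof -
  obtain a b where ab: "a < b" and \<Delta>: "\<Delta> = {a..b} \<or> \<Delta> = {a<..<b} \<or> \<Delta> = {a..<b} \<or> \<Delta> = {a<..b}"
    using assms by (auto simp: param_interval_def)
  show ?thesis
  proof (cases "a \<in> \<Delta>")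
    case True
    then have "base_point \<Delta> a" using ab \<Delta> unfolding base_point_def by fastforce
    then show ?thesis by blast
  next
    case False
    define m where "m = (a + b) / 2"
    have m: "m \<in> \<Delta>" using ab \<Delta> by (auto simp: m_def)
    have "\<exists>t\<in>\<Delta>. t < x" if "x \<in> \<Delta>" for x
    proof -
      have "a < x" using that False \<Delta> by fastforce
      then have "(a + x) / 2 \<in> \<Delta>" "(a + x) / 2 < x" using that False \<Delta> by auto
      then show ?thesis by blast
    qed
    then have "base_point \<Delta> m" using m unfolding base_point_def by (meson not_le)
    then show ?thesis by blast
  qed
qed

text \<open>The definition speaks of \<open>inv_into\<close> for some \<open>L\<close> relative to a
  base point. This is a true inverse because \<open>L\<close> is injective: where the image length
  stands still the image is constant, so the lift is constant by \<open>light\<close>. Shifting both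
  lengths to the start \<open>a\<close> of the segment gives \<open>g\<close>.\<close>

lemma lift_inverse_parametrization:
  assumes X: "set_metric M d" and Y: "set_metric M' d'"
    and \<Delta>: "param_interval \<Delta>" "a \<le> b" "{a..b} \<subseteq> \<Delta>"
    and M: "\<gamma> ` \<Delta> \<subseteq> M" "\<gamma>' ` \<Delta> \<subseteq> M'"
    and rect: "locally_rectifiable d (\<Delta>, \<gamma>)" "locally_rectifiable d' (\<Delta>, \<gamma>')"
    and cont': "\<And>u v. u \<le> v \<Longrightarrow> {u..v} \<subseteq> \<Delta> \<Longrightarrow> set_metric.curve_continuous M' d' u v \<gamma>'"
    and light: "\<And>u v. u \<le> v \<Longrightarrow> {u..v} \<subseteq> \<Delta> \<Longrightarrow> (\<And>t. t \<in> {u..v} \<Longrightarrow> \<gamma>' t = \<gamma>' u) \<Longrightarrow> (\<And>t. t \<in> {u..v} \<Longrightarrow> \<gamma> t = \<gamma> u)"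
    and AC: "lift_inverse_abs_continuous d d' \<Delta> \<gamma> \<gamma>'"
  obtains g where "abs_continuous_on_segment 0 (enn2real (curve_length d' \<gamma>' a b)) g"
    "\<And>t. t \<in> {a..b} \<Longrightarrow> g (enn2real (curve_length d' \<gamma>' a t)) = enn2real (curve_length d \<gamma> a t)"
proof -
  interpret X: set_metric M d by (rule X)
  interpret Y: set_metric M' d' by (rule Y)
  obtain t0 where t0: "base_point \<Delta> t0" using base_point_exists[OF \<Delta>(1)] by blast
  then have t0\<Delta>: "t0 \<in> \<Delta>" by (simp add: base_point_def)
  define l l' where "l = length_function d \<gamma> t0" and "l' = length_function d' \<gamma>' t0"
  obtain L where L: "\<forall>t\<in>\<Delta>. L (l t) = l' t"
    "\<forall>u v. u \<le> v \<and> {u..v} \<subseteq> l' ` \<Delta> \<longrightarrow> abs_continuous_on_segment u v (inv_into (l ` \<Delta>) L)"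
    using AC t0 unfolding lift_inverse_abs_continuous_def l_def l'_def by blast
  have sub: "{min t0 s..max t0 t} \<subseteq> \<Delta>" if "s \<in> \<Delta>" "t \<in> \<Delta>" for s t
    using that t0\<Delta> by (intro param_interval_convex[OF \<Delta>(1)]) (auto simp: min_def max_def)
  have ld: "l t - l s = enn2real (curve_length d \<gamma> s t)" if "s \<in> \<Delta>" "t \<in> \<Delta>" "s \<le> t" for s t
    unfolding l_def by (rule X.length_function_diff[OF sub that(3) M(1) rect(1)]) (use that in auto)
  have ld': "l' t - l' s = enn2real (curve_length d' \<gamma>' s t)" if "s \<in> \<Delta>" "t \<in> \<Delta>" "s \<le> t" for s t
    unfolding l'_def by (rule Y.length_function_diff[OF sub that(3) M(2) rect(2)]) (use that in auto)
  have key: "l s = l t" if st: "s \<in> \<Delta>" "t \<in> \<Delta>" "s \<le> t" "l' s = l' t" for s t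
  proof -
    have st\<Delta>: "{s..t} \<subseteq> \<Delta>" by (rule param_interval_convex[OF \<Delta>(1) st(1,2)])
    have c': "\<gamma>' u = \<gamma>' s" if u: "u \<in> {s..t}" for u
    proof -
      have u\<Delta>: "u \<in> \<Delta>" using u st\<Delta> by blast
      have "enn2real (curve_length d' \<gamma>' s u) = l' u - l' s" using ld'[OF st(1) u\<Delta>] u by simp
      moreover have "l' u \<le> l' t" using ld'[OF u\<Delta> st(2)] u by (smt (verit, best) enn2real_nonneg atLeastAtMost_iff)
      ultimately have "enn2real (curve_length d' \<gamma>' s u) \<le> 0" using st(4) by simp
      then have "enn2real (curve_length d' \<gamma>' s u) = 0" using enn2real_nonneg[of "curve_length d' \<gamma>' s u"] by linarith
      moreover have "{s..u} \<subseteq> \<Delta>" using u st\<Delta> by auto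
      then have "curve_length d' \<gamma>' s u < \<infinity>" using rect(2) u by (auto simp: locally_rectifiable_def)
      ultimately have "curve_length d' \<gamma>' s u = 0" by (auto simp: enn2real_eq_0_iff)
      then have "ennreal (d' (\<gamma>' s) (\<gamma>' u)) = 0" using chord_le_curve_length[of s u d' \<gamma>'] u by simp
      moreover have m: "\<gamma>' s \<in> M'" "\<gamma>' u \<in> M'" using M(2) st(1) u\<Delta> by blast+
      ultimately have "d' (\<gamma>' s) (\<gamma>' u) = 0" using Y.nonneg[OF m] by simp
      then show ?thesis using Y.zero[OF m] by simp
    qed
    have c: "\<gamma> u = \<gamma> s" if "u \<in> {s..t}" for u by (rule light[OF st(3) st\<Delta> _ that]) (rule c')
    have "curve_length d \<gamma> s t \<le> 0"
    proof (rule curve_length_le)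
      fix N u assume u: "is_partition s t N u"
      have "d (\<gamma> (u k)) (\<gamma> (u (Suc k))) = 0" if "k < N" for k
      proof -
        have "\<gamma> (u k) = \<gamma> s" "\<gamma> (u (Suc k)) = \<gamma> s" 
          by (rule c[OF partition_in[OF u]], use that in simp)+
        then show ?thesis using X.zero[of "\<gamma> s" "\<gamma> s"] M(1) st(1) by (simp add: image_subset_iff)
      qed
      then show "(\<Sum>k<N. ennreal (d (\<gamma> (u k)) (\<gamma> (u (Suc k))))) \<le> 0" by simp
    qed
    then show ?thesis using ld[OF st(1,2,3)] by simp
  qed
  have inj: "inj_on L (l ` \<Delta>)"
  proof (rule inj_onI)
    fix x y assume "x \<in> l ` \<Delta>" "y \<in> l ` \<Delta>" "L x = L y"
    then obtain s t where st: "s \<in> \<Delta>" "x = l s" "t \<in> \<Delta>" "y = l t" "l' s = l' t" using L(1) by force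
    show "x = y"
    proof (cases "s \<le> t")
      case True then show ?thesis using key[OF st(1,3) True st(5)] st by simp
    next
      case False
      then have "t \<le> s" by simp
      from key[OF st(3,1) this st(5)[symmetric]] show ?thesis using st by simp
    qed
  qed
  have inv: "inv_into (l ` \<Delta>) L (l' t) = l t" if "t \<in> \<Delta>" for t
    using inv_into_f_f[OF inj, of "l t"] L(1) that by simp
  have a\<Delta>: "a \<in> \<Delta>" and b\<Delta>: "b \<in> \<Delta>" using \<Delta>(2,3) by auto
  interpret YC: rectifiable_curve M' d' \<gamma>' a b
    by unfold_locales (use \<Delta> cont' rect(2) in \<open>auto simp: locally_rectifiable_def\<close>)
  have "{l' a..l' b} \<subseteq> l' ` \<Delta>"
  proof
    fix s assume s: "s \<in> {l' a..l' b}"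
    have "l' b - l' a = YC.len b" using ld'[OF a\<Delta> b\<Delta> \<Delta>(2)] by (simp add: YC.len_def)
    then obtain t where t: "t \<in> {a..b}" "YC.len t = s - l' a" using YC.len_surj[of "s - l' a"] s by auto
    then have t\<Delta>: "t \<in> \<Delta>" using \<Delta>(3) by blast
    have "l' t - l' a = YC.len t" using ld'[OF a\<Delta> t\<Delta>] t by (simp add: YC.len_def)
    then show "s \<in> l' ` \<Delta>" using t t\<Delta> by (intro image_eqI[of _ _ t]) auto
  qed
  moreover have "l' a \<le> l' b" using ld'[OF a\<Delta> b\<Delta> \<Delta>(2)] enn2real_nonneg[of "curve_length d' \<gamma>' a b"] by linarith
  ultimately have "abs_continuous_on_segment (l' a) (l' b) (inv_into (l ` \<Delta>) L)" using L(2) by blast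
  then have "abs_continuous_on_segment 0 (l' b - l' a) (\<lambda>s. inv_into (l ` \<Delta>) L (s + l' a) - l a)"
    by (rule abs_continuous_on_segment_shift)
  moreover have "inv_into (l ` \<Delta>) L (enn2real (curve_length d' \<gamma>' a t) + l' a) - l a = enn2real (curve_length d \<gamma> a t)"
    if "t \<in> {a..b}" for t
  proof -
    have t: "t \<in> \<Delta>" "a \<le> t" using that \<Delta>(3) by auto
    have "enn2real (curve_length d' \<gamma>' a t) + l' a = l' t" using ld'[OF a\<Delta> t] by simp
    then show ?thesis using inv[OF t(1)] ld[OF a\<Delta> t] by simp
  qed
  ultimately show thesis using that ld'[OF a\<Delta> b\<Delta> \<Delta>(2)] by simp
qed

section \<open>Change of variables over an arbitrary finite index type\<close>

text \<open>The library proves Sard's lemma and the area inequality for well-ordered index types only.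
  Every finite type has a well-ordered copy, and relabelling coordinates preserves Lebesgue measure
  and determinants.\<close>

typedef 'a wo_copy = "UNIV :: 'a set" morphisms of_wo to_wo ..

lemma of_wo_to_wo [simp]: "of_wo (to_wo x) = x" and to_wo_of_wo [simp]: "to_wo (of_wo y) = y"
  by (simp_all add: to_wo_inverse of_wo_inverse)

lemma bij_of_wo: "bij of_wo" and bij_to_wo: "bij to_wo"
  by (rule o_bij[of to_wo], simp_all add: fun_eq_iff) (rule o_bij[of of_wo], simp_all add: fun_eq_iff)

instance wo_copy :: (finite) finite
proof
  have "(UNIV :: 'a wo_copy set) = range to_wo" by (rule bij_is_surj[OF bij_to_wo, symmetric])
  then show "finite (UNIV :: 'a wo_copy set)" by (rule ssubst) (rule finite_imageI[OF finite])
qed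

definition wo_rank :: "'a::finite \<Rightarrow> nat" where "wo_rank = (SOME h. inj h)"

lemma inj_wo_rank: "inj wo_rank"
proof -
  have "\<exists>h :: 'a \<Rightarrow> nat. inj h"
    using ex_bij_betw_finite_nat[of "UNIV :: 'a set"] by (auto simp: bij_betw_def)
  then show ?thesis unfolding wo_rank_def by (rule someI_ex)
qed

instantiation wo_copy :: (finite) wellorder
begin

definition less_eq_wo_copy :: "'a wo_copy \<Rightarrow> 'a wo_copy \<Rightarrow> bool"
  where "less_eq_wo_copy x y \<longleftrightarrow> wo_rank (of_wo x) \<le> wo_rank (of_wo y)"

definition less_wo_copy :: "'a wo_copy \<Rightarrow> 'a wo_copy \<Rightarrow> bool"
  where "less_wo_copy x y \<longleftrightarrow> wo_rank (of_wo x) < wo_rank (of_wo y)"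

instance
proof
  fix x y z :: "'a wo_copy" and P
  show "x < y \<longleftrightarrow> x \<le> y \<and> \<not> y \<le> x" "x \<le> x" "x \<le> y \<or> y \<le> x"
    by (auto simp: less_eq_wo_copy_def less_wo_copy_def)
  show "x \<le> z" if "x \<le> y" "y \<le> z" using that by (simp add: less_eq_wo_copy_def)
  show "x = y" if "x \<le> y" "y \<le> x"
    using that inj_wo_rank bij_of_wo by (auto simp: less_eq_wo_copy_def of_wo_inject dest!: injD[OF inj_wo_rank])
  show "P x" if "\<And>x. (\<And>y. y < x \<Longrightarrow> P y) \<Longrightarrow> P x"
    using that unfolding less_wo_copy_def by (rule measure_induct_rule[of "\<lambda>x. wo_rank (of_wo x)"])
qed

end

definition relabel :: "real^'n::finite \<Rightarrow> real^('n wo_copy)" where "relabel x = (\<chi> i. x $ of_wo i)"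
definition unlabel :: "real^('n::finite wo_copy) \<Rightarrow> real^'n" where "unlabel y = (\<chi> i. y $ to_wo i)"

lemma unlabel_relabel [simp]: "unlabel (relabel x) = x" and relabel_unlabel [simp]: "relabel (unlabel y) = y"
  by (simp_all add: relabel_def unlabel_def vec_eq_iff)

lemma linear_relabel: "linear relabel" and linear_unlabel: "linear unlabel"
  by (auto intro!: linearI simp: relabel_def unlabel_def vec_eq_iff)

lemma box_cart_emeasure:
  fixes l u :: "real^'n"
  assumes "\<And>i. l $ i \<le> u $ i" shows "emeasure lborel (box l u) = (\<Prod>i\<in>UNIV. ennreal (u $ i - l $ i))"
proof -
  have "emeasure lborel (box l u) = ennreal (\<Prod>b\<in>Basis. (u - l) \<bullet> b)"
    using assms by (intro emeasure_lborel_box) (auto simp: Basis_vec_def inner_axis)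
  also have "(\<Prod>b\<in>Basis. (u - l) \<bullet> b) = (\<Prod>i\<in>UNIV. (u - l) \<bullet> axis i 1)"
    by (simp add: Basis_vec_def prod.UNION_disjoint axis_eq_axis prod.reindex inj_on_def) 
  finally show ?thesis using assms by (simp add: inner_axis prod_ennreal)
qed

lemma borel_unlabel [measurable]: "unlabel \<in> borel_measurable borel"
  and borel_relabel [measurable]: "relabel \<in> borel_measurable borel"
  by (intro borel_measurable_continuous_onI linear_continuous_on linear_unlabel[unfolded linear_conv_bounded_linear]
      linear_relabel[unfolded linear_conv_bounded_linear])+

lemma lborel_unlabel: "distr lborel borel unlabel = (lborel :: (real^'n::finite) measure)"
proof (rule lborel_eqI[symmetric])
  fix l u :: "real^'n" assume le: "\<And>b. b \<in> Basis \<Longrightarrow> l \<bullet> b \<le> u \<bullet> b"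
  have lu: "l $ i \<le> u $ i" for i using le[of "axis i 1"] by (simp add: inner_axis axis_in_Basis_iff)
  have "unlabel -` box l u = box (relabel l) (relabel u)"
    by (auto simp: mem_box_cart relabel_def unlabel_def) (metis of_wo_to_wo to_wo_of_wo)+
  moreover have "unlabel \<in> borel_measurable borel"
    by (intro borel_measurable_continuous_onI linear_continuous_on linear_unlabel[unfolded linear_conv_bounded_linear])
  ultimately have "emeasure (distr lborel borel unlabel) (box l u) = emeasure lborel (box (relabel l) (relabel u))"
    by (simp add: emeasure_distr)
  also have "\<dots> = (\<Prod>i\<in>UNIV. ennreal (u $ of_wo i - l $ of_wo i))"
    using lu by (subst box_cart_emeasure) (auto simp: relabel_def)
  also have "\<dots> = (\<Prod>i\<in>UNIV. ennreal (u $ i - l $ i))"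
    by (rule prod.reindex_bij_betw[OF bij_of_wo])
  also have "\<dots> = emeasure lborel (box l u)" using lu by (simp add: box_cart_emeasure)
  also have "\<dots> = ennreal (\<Prod>b\<in>Basis. (u - l) \<bullet> b)"
    using le by (rule emeasure_lborel_box)
  finally show "emeasure (distr lborel borel unlabel) (box l u) = ennreal (\<Prod>b\<in>Basis. (u - l) \<bullet> b)" .
qed simp

lemma lborel_relabel: "distr lborel borel relabel = (lborel :: (real^('n::finite wo_copy)) measure)"
proof -
  have "distr lborel borel relabel = distr (distr lborel borel unlabel) borel (relabel :: real^'n \<Rightarrow> _)"
    by (simp add: lborel_unlabel)
  also have "\<dots> = distr lborel borel (relabel \<circ> unlabel)" by (rule distr_distr) simp_all
  also have "\<dots> = lborel" by (simp add: comp_def distr_id2)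
  finally show ?thesis .
qed

lemma lebesgue_distr:
  fixes X :: "'a::euclidean_space \<Rightarrow> 'b::euclidean_space"
  assumes X: "X \<in> borel_measurable borel" and d: "distr lborel borel X = lborel"
  shows "distr lebesgue lebesgue X = lebesgue" "X \<in> measurable lebesgue lebesgue"
proof -
  have m: "X \<in> measurable lborel lborel" using X by simp
  have m': "X \<in> measurable lebesgue lborel" by (rule measurable_completion[OF m])
  have d': "distr lebesgue lborel X = lborel"
    unfolding distr_completion[OF m] using d by (metis distr_cong sets_lborel)
  show "distr lebesgue lebesgue X = lebesgue"
    using completion.completion_distr_eq[OF m'] unfolding d' by simp
  show "X \<in> measurable lebesgue lebesgue"
    by (rule completion.measurable_completion2[OF m']) (simp add: d')
qed

lemmas lebesgue_unlabel = lebesgue_distr(1)[OF borel_unlabel lborel_unlabel]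
  and measurable_unlabel = lebesgue_distr(2)[OF borel_unlabel lborel_unlabel]
  and measurable_relabel = lebesgue_distr(2)[OF borel_relabel lborel_relabel]

lemma relabel_image: "relabel ` S = unlabel -` S" and unlabel_image: "unlabel ` T = relabel -` T"
  by force+

lemma lebesgue_relabel_image:
  assumes "S \<in> sets lebesgue"
  shows "relabel ` S \<in> sets lebesgue" "emeasure lebesgue (relabel ` S) = emeasure lebesgue S"
proof -
  show "relabel ` S \<in> sets lebesgue" unfolding relabel_image using measurable_sets[OF measurable_unlabel assms] by simp
  show "emeasure lebesgue (relabel ` S) = emeasure lebesgue S"
    unfolding relabel_image by (subst (2) lebesgue_unlabel[symmetric]) (simp add: emeasure_distr measurable_unlabel assms)
qed

lemma lebesgue_unlabel_image: "T \<in> sets lebesgue \<Longrightarrow> unlabel ` T \<in> sets lebesgue"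
  unfolding unlabel_image using measurable_sets[OF measurable_relabel] by auto

text \<open>Induction over transpositions: conjugating a transposition by a bijection gives a
  transposition again.\<close>

lemma sign_relabel:
  fixes p :: "'n::finite \<Rightarrow> 'n"
  assumes "p permutes UNIV" shows "sign (to_wo \<circ> p \<circ> of_wo) = sign p" "(to_wo \<circ> p \<circ> of_wo) permutes UNIV"
proof -
  show "(to_wo \<circ> p \<circ> of_wo) permutes UNIV"
    by (rule bij_imp_permutes) (auto intro!: bij_comp permutes_bij[OF assms] bij_of_wo bij_to_wo simp del: comp_apply)
  have "sign (to_wo \<circ> p \<circ> of_wo) = sign p \<and> permutation (to_wo \<circ> p \<circ> of_wo) \<and> permutation p"
    using assms finite
  proof (induction p rule: permutes_induct)
    case id
    then show ?case by (simp add: comp_def id_def[symmetric])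
  next
    case (swap a b p)
    have e: "to_wo \<circ> (Transposition.transpose a b \<circ> p) \<circ> of_wo =
        Transposition.transpose (to_wo a) (to_wo b) \<circ> (to_wo \<circ> p \<circ> of_wo)"
      by (auto simp: fun_eq_iff Transposition.transpose_def) (metis of_wo_to_wo)+
    have "to_wo a \<noteq> to_wo b" using swap by (metis of_wo_to_wo)
    moreover have "permutation (Transposition.transpose a b)"
      "permutation (Transposition.transpose (to_wo a) (to_wo b))" by (rule permutation_swap_id)+
    ultimately show ?case unfolding e using swap
      by (simp only: sign_compose sign_swap_id permutation_compose if_False simp_thms)
  qed
  then show "sign (to_wo \<circ> p \<circ> of_wo) = sign p" by blast
qed

lemma det_relabel:
  fixes A :: "real^'n^'n::finite"
  shows "det (\<chi> i j. A $ of_wo i $ of_wo j) = det A"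
proof -
  have "det A = (\<Sum>p\<in>{p. p permutes UNIV}. of_int (sign p) * (\<Prod>i\<in>UNIV. A $ i $ p i))" by (simp add: det_def)
  also have "\<dots> = (\<Sum>q\<in>{q. q permutes UNIV}. of_int (sign q) * (\<Prod>i\<in>UNIV. A $ of_wo i $ of_wo (q i)))"
  proof (rule sum.reindex_bij_witness[where j = "\<lambda>p. to_wo \<circ> p \<circ> of_wo" and i = "\<lambda>q. of_wo \<circ> q \<circ> to_wo"])
    fix p :: "'n \<Rightarrow> 'n" assume p: "p \<in> {p. p permutes UNIV}"
    show "of_wo \<circ> (to_wo \<circ> p \<circ> of_wo) \<circ> to_wo = p" by (simp add: fun_eq_iff)
    show "to_wo \<circ> p \<circ> of_wo \<in> {q. q permutes UNIV}" using sign_relabel(2) p by auto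
    have "(\<Prod>i\<in>UNIV. A $ of_wo i $ of_wo ((to_wo \<circ> p \<circ> of_wo) i)) = (\<Prod>i\<in>UNIV. A $ i $ p i)"
      using prod.reindex_bij_betw[OF bij_of_wo, of "\<lambda>i. A $ i $ p i"] by simp
    then show "of_int (sign (to_wo \<circ> p \<circ> of_wo)) * (\<Prod>i\<in>UNIV. A $ of_wo i $ of_wo ((to_wo \<circ> p \<circ> of_wo) i)) =
        of_int (sign p) * (\<Prod>i\<in>UNIV. A $ i $ p i)" using sign_relabel(1)[of p] p by simp
  next
    fix q :: "'n wo_copy \<Rightarrow> 'n wo_copy" assume q: "q \<in> {q. q permutes UNIV}"
    show "to_wo \<circ> (of_wo \<circ> q \<circ> to_wo) \<circ> of_wo = q" by (simp add: fun_eq_iff)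
    show "of_wo \<circ> q \<circ> to_wo \<in> {q. q permutes UNIV}"
      unfolding mem_Collect_eq
    proof (rule bij_imp_permutes)
      have "q permutes UNIV" using q by simp
      then show "bij (of_wo \<circ> q \<circ> to_wo)" by (intro bij_comp permutes_bij[of q UNIV] bij_of_wo bij_to_wo)
    qed simp
  qed
  finally show ?thesis by (simp add: det_def)
qed

lemma det_conj_relabel:
  fixes A :: "real^'n::finite \<Rightarrow> real^'n"
  shows "det (matrix (relabel \<circ> A \<circ> unlabel)) = det (matrix A)"
proof -
  have u: "unlabel (axis j 1) = axis (of_wo j) (1::real)" for j :: "'n wo_copy"
    by (auto simp: unlabel_def vec_eq_iff axis_def)
  have "matrix (relabel \<circ> A \<circ> unlabel) = (\<chi> i j. matrix A $ of_wo i $ of_wo j)"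
    by (simp add: matrix_def vec_eq_iff u relabel_def)
  then show ?thesis by (simp add: det_relabel)
qed

lemma has_derivative_relabel:
  assumes "(f has_derivative f') (at x within S)"
  shows "((relabel \<circ> f \<circ> unlabel) has_derivative (relabel \<circ> f' \<circ> unlabel)) (at (relabel x) within relabel ` S)"
proof -
  have bl: "bounded_linear (relabel :: real^'n \<Rightarrow> _)" "bounded_linear (unlabel :: _ \<Rightarrow> real^'n)"
    using linear_relabel linear_unlabel by (simp_all add: linear_conv_bounded_linear)
  have "((f \<circ> unlabel) has_derivative (f' \<circ> unlabel)) (at (relabel x) within relabel ` S)"
    by (rule diff_chain_within) (use assms bounded_linear_imp_has_derivative[OF bl(2)] in \<open>simp_all add: image_comp\<close>)
  then show ?thesis
    using bounded_linear.has_derivative[OF bl(1)] by (fastforce simp: comp_def)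
qed

section \<open>Sard's lemma and the area inequality\<close>

lemma sard_square:
  fixes f :: "real^'n::finite \<Rightarrow> real^'n"
  assumes "\<And>x. x \<in> S \<Longrightarrow> (f has_derivative f' x) (at x within S)" "\<And>x. x \<in> S \<Longrightarrow> det (matrix (f' x)) = 0"
  shows "negligible (f ` S)"
proof -
  let ?g = "relabel \<circ> f \<circ> unlabel"
  have "negligible (?g ` (relabel ` S))"
  proof (rule baby_Sard[OF order_refl])
    fix y assume "y \<in> relabel ` S"
    then obtain x where x: "x \<in> S" "y = relabel x" by blast
    show "(?g has_derivative (relabel \<circ> f' (unlabel y) \<circ> unlabel)) (at y within relabel ` S)"
      using has_derivative_relabel[OF assms(1)[OF x(1)]] x by simp
    show "rank (matrix (relabel \<circ> f' (unlabel y) \<circ> unlabel)) < CARD('n wo_copy)"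
      using assms(2)[OF x(1)] x unfolding det_eq_0_rank[symmetric] det_conj_relabel by simp
  qed
  then have "relabel ` (f ` S) \<in> null_sets lebesgue" by (simp add: negligible_iff_null_sets image_comp comp_def)
  moreover from this have "unlabel ` (relabel ` (f ` S)) \<in> sets lebesgue" by (intro lebesgue_unlabel_image) auto
  moreover have "unlabel ` (relabel ` (f ` S)) = f ` S" by (simp add: image_comp comp_def)
  ultimately show ?thesis using lebesgue_relabel_image(2)[of "f ` S"] by (simp add: negligible_iff_null_sets null_sets_def)
qed

text \<open>The estimate for integrable Jacobians is applied to the relabelled map; if the integral
  is infinite, the last claim is trivial.\<close>

lemma area_inequality:
  fixes f :: "real^'n::finite \<Rightarrow> real^'n"
  assumes S: "S \<in> sets lebesgue" and f: "\<And>x. x \<in> S \<Longrightarrow> (f has_derivative f' x) (at x within S)"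
  shows "(\<lambda>x. indicator S x * ennreal \<bar>det (matrix (f' x))\<bar>) \<in> borel_measurable lebesgue" (is ?A)
    and "f ` S \<in> sets lebesgue" (is ?B)
    and "emeasure lebesgue (f ` S) \<le> (\<integral>\<^sup>+ x. indicator S x * ennreal \<bar>det (matrix (f' x))\<bar> \<partial>lebesgue)" (is ?C)
proof -
  have dS: "f differentiable_on S" using f by (auto simp: differentiable_on_def intro: differentiableI)
  show B: ?B by (rule differentiable_image_in_sets_lebesgue[OF S order_refl dS])
  let ?g = "relabel \<circ> f \<circ> unlabel" and ?S = "relabel ` S"
  define g' where "g' y = relabel \<circ> f' (unlabel y) \<circ> unlabel" for y
  have dg: "(?g has_derivative g' y) (at y within ?S)" if "y \<in> ?S" for y
    using that has_derivative_relabel[OF f] by (auto simp: g'_def)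
  have detg: "det (matrix (g' y)) = det (matrix (f' (unlabel y)))" for y by (simp add: g'_def det_conj_relabel)
  note S' = lebesgue_relabel_image[OF S]
  define h where "h y = indicator ?S y * \<bar>det (matrix (g' y))\<bar>" for y
  have "(\<lambda>y. det (matrix (g' y))) \<in> borel_measurable (lebesgue_on ?S)"
    by (rule borel_measurable_det_Jacobian[OF S'(1) dg])
  then have "(\<lambda>y. \<bar>det (matrix (g' y))\<bar>) \<in> borel_measurable (lebesgue_on ?S)" by (rule borel_measurable_abs)
  then have hm: "h \<in> borel_measurable lebesgue" unfolding h_def
    using S'(1) by (subst (asm) borel_measurable_restrict_space_iff) (auto simp: mult.commute)
  have ind: "indicator ?S (relabel x) = (indicator S x :: real)" for x
    by (auto simp: indicator_def) (metis image_iff unlabel_relabel)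
  have hx: "ennreal (h (relabel x)) = indicator S x * ennreal \<bar>det (matrix (f' x))\<bar>" for x
    unfolding h_def detg ind by (simp add: indicator_def)
  have "(\<lambda>x. ennreal (h (relabel x))) \<in> borel_measurable lebesgue"
    using measurable_compose[OF measurable_relabel hm[THEN measurable_compose[OF _ measurable_ennreal]]] by simp
  then show A: ?A unfolding hx .
  have int: "(\<integral>\<^sup>+ y. ennreal (h y) \<partial>lebesgue) = (\<integral>\<^sup>+ x. indicator S x * ennreal \<bar>det (matrix (f' x))\<bar> \<partial>lebesgue)"
  proof -
    have "(\<integral>\<^sup>+ x. indicator S x * ennreal \<bar>det (matrix (f' x))\<bar> \<partial>lebesgue) = (\<integral>\<^sup>+ y. ennreal (h (relabel (unlabel y))) \<partial>lebesgue)"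
      using A unfolding hx[symmetric]
      by (subst lebesgue_unlabel[symmetric], subst nn_integral_distr[OF measurable_unlabel]) (simp_all add: lebesgue_unlabel)
    then show ?thesis by simp
  qed
  show ?C
  proof (cases "(\<integral>\<^sup>+ x. indicator S x * ennreal \<bar>det (matrix (f' x))\<bar> \<partial>lebesgue) = \<infinity>")
    case False
    define r where "r = enn2real (\<integral>\<^sup>+ y. ennreal (h y) \<partial>lebesgue)"
    have r: "(\<integral>\<^sup>+ y. ennreal (h y) \<partial>lebesgue) = ennreal r" "0 \<le> r" using False int by (simp_all add: r_def less_top)
    have "(h has_integral r) UNIV"
      by (rule has_integral_iff_nn_integral_lebesgue[THEN iffD2]) (use r hm in \<open>auto simp: h_def\<close>)
    moreover have "h = (\<lambda>y. if y \<in> ?S then \<bar>det (matrix (g' y))\<bar> else 0)" by (auto simp: h_def)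
    ultimately have I: "((\<lambda>y. \<bar>det (matrix (g' y))\<bar>) has_integral r) ?S" by (simp add: has_integral_restrict_UNIV)
    then have io: "(\<lambda>y. \<bar>det (matrix (g' y))\<bar>) integrable_on ?S" by (rule has_integral_integrable)
    have "?g ` ?S \<in> lmeasurable" by (rule measurable_differentiable_image[OF S'(1) dg io])
    moreover have "measure lebesgue (?g ` ?S) \<le> r"
      using measure_differentiable_image[OF S'(1) dg io] integral_unique[OF I] by simp
    ultimately have "emeasure lebesgue (?g ` ?S) \<le> ennreal r" by (simp add: emeasure_eq_measure2 ennreal_leI)
    moreover have "?g ` ?S = relabel ` (f ` S)" by (simp add: image_comp comp_def)
    ultimately show ?thesis using lebesgue_relabel_image(2)[OF B] r int by simp
  qed simp
qed

text \<open>Injectivity makes the measure of the image of \<open>C \<inter> A\<close> a measure in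
  \<open>A\<close>, namely an image measure under \<open>g\<close>. The area inequality compares it
  on every Borel set with the measure whose density is the Jacobian, hence also on integrals of
  \<open>h\<close>. The part \<open>N\<close> costs nothing because its image is null.\<close>

lemma nn_integral_injective_image_le:
  fixes F g :: "real^'n::finite \<Rightarrow> real^'n"
  assumes g: "\<And>x. x \<in> C \<Longrightarrow> g (F x) = x" and C: "C \<in> sets borel" and FC: "F ` C \<in> sets borel"
    and gm: "g \<in> borel_measurable (restrict_space borel (F ` C))"
    and N: "N \<in> sets lebesgue" "negligible (F ` N)" "N \<subseteq> C"
    and der: "\<And>x. x \<in> C - N \<Longrightarrow> (F has_derivative F' x) (at x within C - N)"
    and h: "h \<in> borel_measurable borel"
  shows "(\<integral>\<^sup>+ y. indicator (F ` C) y * h (g y) \<partial>lebesgue) \<le>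
    (\<integral>\<^sup>+ x. indicator (C - N) x * ennreal \<bar>det (matrix (F' x))\<bar> * h x \<partial>lebesgue)"
proof -
  have CN: "C - N \<in> sets lebesgue" using C N by auto
  have J: "(\<lambda>x. indicator (C - N) x * ennreal \<bar>det (matrix (F' x))\<bar>) \<in> borel_measurable lebesgue"
    by (rule area_inequality(1)[OF CN der])
  define j where "j x = indicator (C - N) x * ennreal \<bar>det (matrix (F' x))\<bar>" for x
  note J = J[folded j_def]
  define g1 where "g1 y = (if y \<in> F ` C then g y else 0)" for y
  have g1: "g1 \<in> borel_measurable borel" unfolding g1_def
    by (rule measurable_If_restrict_space_iff[THEN iffD2]) (use FC gm in auto)
  have g1m: "g1 \<in> measurable lebesgue borel" using measurable_completion[of g1 lborel borel] g1 by simp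
  define \<mu> where "\<mu> = distr (density lebesgue (indicator (F ` C))) borel g1"
  define \<nu> where "\<nu> = distr (density lebesgue j) borel (\<lambda>x. x)"
  have idm: "(\<lambda>x. x) \<in> measurable lebesgue (borel :: (real^'n) measure)"
    by (rule measurableI) auto
  have FCl: "F ` C \<in> sets lebesgue" using FC by simp
  have sets: "sets \<mu> = sets \<nu>" by (simp add: \<mu>_def \<nu>_def)
  have "\<mu> \<le> \<nu>"
  proof (rule le_measure[THEN iffD2, OF sets], intro ballI)
    fix A assume "A \<in> sets \<mu>"
    then have A: "A \<in> sets borel" by (simp add: \<mu>_def)
    have pre: "g1 -` A \<in> sets lebesgue" using measurable_sets[OF g1m A] by simp
    have mA: "F ` ((C - N) \<inter> A) \<in> sets lebesgue"
      by (rule area_inequality(2)) (use CN A der in \<open>auto intro: has_derivative_subset\<close>)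
    have "emeasure \<mu> A = (\<integral>\<^sup>+ y. indicator (F ` C) y * indicator (g1 -` A) y \<partial>lebesgue)"
      unfolding \<mu>_def using g1m A pre FCl by (subst emeasure_distr, simp, simp, subst emeasure_density) auto
    also have "\<dots> = emeasure lebesgue (F ` C \<inter> g1 -` A)"
      using pre FCl by (simp add: indicator_inter_arith[symmetric])
    also have "F ` C \<inter> g1 -` A = F ` (C \<inter> A)" using g by (auto simp: g1_def)
    also have "emeasure lebesgue (F ` (C \<inter> A)) \<le> emeasure lebesgue (F ` ((C - N) \<inter> A) \<union> F ` N)"
      using N(3) mA negligible_imp_sets[OF N(2)] by (intro emeasure_mono sets.Un) blast+
    also have "\<dots> \<le> emeasure lebesgue (F ` ((C - N) \<inter> A)) + emeasure lebesgue (F ` N)"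
      by (rule emeasure_subadditive[OF mA negligible_imp_sets[OF N(2)]])
    also have "emeasure lebesgue (F ` N) = 0" using N(2) by (simp add: negligible_iff_null_sets null_sets_def)
    also have "emeasure lebesgue (F ` ((C - N) \<inter> A)) + 0 \<le>
        (\<integral>\<^sup>+ x. indicator ((C - N) \<inter> A) x * ennreal \<bar>det (matrix (F' x))\<bar> \<partial>lebesgue)"
    proof -
      have "(F has_derivative F' x) (at x within (C - N) \<inter> A)" if "x \<in> (C - N) \<inter> A" for x
        by (rule has_derivative_subset[OF der]) (use that in auto)
      moreover have "(C - N) \<inter> A \<in> sets lebesgue" using CN A by auto
      ultimately show ?thesis using area_inequality(3)[of "(C - N) \<inter> A" F F'] by simp
    qed
    also have "\<dots> = (\<integral>\<^sup>+ x. j x * indicator A x \<partial>lebesgue)"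
      by (intro nn_integral_cong) (auto simp: j_def indicator_def)
    also have "\<dots> = emeasure \<nu> A"
      unfolding \<nu>_def using A J idm by (subst emeasure_distr, simp, simp, subst emeasure_density) auto
    finally show "emeasure \<mu> A \<le> emeasure \<nu> A" .
  qed
  then have "(\<integral>\<^sup>+ y. h y \<partial>\<mu>) \<le> (\<integral>\<^sup>+ x. h x \<partial>\<nu>)" by (rule nn_integral_mono_measure[OF sets])
  moreover have "(\<integral>\<^sup>+ y. h y \<partial>\<mu>) = (\<integral>\<^sup>+ y. indicator (F ` C) y * h (g y) \<partial>lebesgue)"
  proof -
    have "(\<lambda>y. h (g1 y)) \<in> borel_measurable lebesgue" using measurable_compose[OF g1m h] .
    then have "(\<integral>\<^sup>+ y. h y \<partial>\<mu>) = (\<integral>\<^sup>+ y. indicator (F ` C) y * h (g1 y) \<partial>lebesgue)"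
      unfolding \<mu>_def using g1m h FCl by (subst nn_integral_distr, simp, simp, subst nn_integral_density) auto
    also have "\<dots> = (\<integral>\<^sup>+ y. indicator (F ` C) y * h (g y) \<partial>lebesgue)"
      by (intro nn_integral_cong) (auto simp: g1_def indicator_def)
    finally show ?thesis .
  qed
  moreover have "(\<integral>\<^sup>+ x. h x \<partial>\<nu>) = (\<integral>\<^sup>+ x. j x * h x \<partial>lebesgue)"
  proof -
    have "h \<in> borel_measurable lebesgue" using measurable_compose[OF idm h] by simp
    then show ?thesis
      unfolding \<nu>_def using idm h J by (subst nn_integral_distr, simp, simp, subst nn_integral_density) auto
  qed
  ultimately show ?thesis by (simp add: j_def)
qed

section \<open>Integration over the orbit space\<close>

lemma openin_borel_of: "openin X U \<Longrightarrow> U \<in> sets (borel_of X)"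
  unfolding borel_of_def by (simp add: openin_subset subset_Pow_Union sets_measure_of Pow_def Collect_mono)

lemma space_borel_of: "space (borel_of X) = topspace X"
  unfolding borel_of_def by (rule space_measure_of) (auto dest: openin_subset)

lemma measurable_borel_ofI:
  assumes "\<And>x. x \<in> space N \<Longrightarrow> f x \<in> topspace X" "\<And>U. openin X U \<Longrightarrow> f -` U \<inter> space N \<in> sets N"
  shows "f \<in> measurable N (borel_of X)"
  unfolding borel_of_def by (rule measurable_measure_of) (use assms in \<open>auto dest: openin_subset\<close>)

context deck_group
begin

abbreviation BO :: "(real^'n) set measure" where "BO \<equiv> borel_of (orbit_space G)"

lemma space_BO: "space BO = pr ` unit_ball"
  by (simp add: space_borel_of topspace_orbit_space)

lemma pr_measurable: "pr \<in> measurable (restrict_space borel unit_ball) BO"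
proof (rule measurable_borel_ofI)
  show "pr x \<in> topspace (orbit_space G)" if "x \<in> space (restrict_space borel unit_ball)" for x
    using that by (simp add: topspace_orbit_space space_restrict_space del: mem_ball_0)
  fix U assume "openin (orbit_space G) U"
  then have "open {x \<in> unit_ball. pr x \<in> U}" by (simp add: openin_orbit_space)
  moreover have "{x \<in> unit_ball. pr x \<in> U} = pr -` U \<inter> unit_ball" by blast
  ultimately have "pr -` U \<inter> unit_ball \<in> sets borel" by simp
  then show "pr -` U \<inter> space (restrict_space borel unit_ball) \<in> sets (restrict_space borel unit_ball)"
    by (subst sets_restrict_space_iff) (auto simp: space_restrict_space)
qed

lemma BO_preimage:
  assumes "A \<in> sets BO" shows "{x \<in> unit_ball. pr x \<in> A} \<in> sets borel"
proof -
  have "pr -` A \<inter> space (restrict_space borel unit_ball) \<in> sets (restrict_space borel unit_ball)"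
    by (rule measurable_sets[OF pr_measurable assms])
  moreover have "pr -` A \<inter> space (restrict_space borel unit_ball) = {x \<in> unit_ball. pr x \<in> A}"
    by (auto simp: space_restrict_space)
  ultimately show ?thesis by (subst (asm) sets_restrict_space_iff) auto
qed

lemma BO_orbit_measurable: "A \<in> sets BO \<Longrightarrow> A \<in> orbit_measurable_sets G"
  using BO_preimage[of A] sets.sets_into_space[of A BO] unfolding orbit_measurable_sets_def space_BO by simp

lemma borel_measurable_orbit:
  fixes h :: "(real^'n) set \<Rightarrow> ennreal"
  assumes "h \<in> borel_measurable BO" shows "h \<in> borel_measurable (orbit_measure G p0)"
proof (rule measurableI)
  fix A :: "ennreal set" assume A: "A \<in> sets borel"
  have "h -` A \<inter> space BO \<in> sets BO" by (rule measurable_sets[OF assms A])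
  then show "h -` A \<inter> space (orbit_measure G p0) \<in> sets (orbit_measure G p0)"
    unfolding sets_orbit_measure space_orbit_measure space_BO[symmetric] by (rule BO_orbit_measurable)
qed simp

lemma continuous_curve_measurable:
  fixes c :: "real \<Rightarrow> (real^'n) set"
  assumes c: "\<And>s. c s \<in> pr ` unit_ball"
    and cont: "\<And>s e. e > 0 \<Longrightarrow> \<exists>\<eta>>0. \<forall>t. \<bar>t - s\<bar> < \<eta> \<longrightarrow> orbit_dist (c s) (c t) < e"
  shows "c \<in> measurable borel BO"
proof (rule measurable_borel_ofI)
  show "c x \<in> topspace (orbit_space G)" for x using c by (simp add: topspace_orbit_space)
  fix U assume U: "openin (orbit_space G) U"
  have "open (c -` U)" unfolding open_dist
  proof
    fix s assume "s \<in> c -` U"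
    then have "c s \<in> U" by simp
    then obtain r where r: "r > 0" "\<forall>q\<in>pr ` unit_ball. orbit_dist (c s) q < r \<longrightarrow> q \<in> U"
      using U unfolding openin_orbit_space_metric by blast
    obtain \<eta> where \<eta>: "\<eta> > 0" "\<forall>t. \<bar>t - s\<bar> < \<eta> \<longrightarrow> orbit_dist (c s) (c t) < r" using cont[OF r(1)] by blast
    have "t \<in> c -` U" if "dist t s < \<eta>" for t
    proof -
      have "orbit_dist (c s) (c t) < r" using \<eta>(2) that by (simp add: dist_real_def)
      then show ?thesis using r(2) c[of t] by blast
    qed
    then show "\<exists>e>0. \<forall>y. dist y s < e \<longrightarrow> y \<in> c -` U" using \<eta>(1) by blast
  qed
  then show "c -` U \<inter> space borel \<in> sets borel" by simp
qed

end

locale polyhedral_group = deck_group G for G :: "(real^'n \<Rightarrow> real^'n) set" +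
  fixes p0 :: "real^'n"
  assumes p0: "p0 \<in> unit_ball"
begin

abbreviation P :: "(real^'n) set" where "P \<equiv> normal_polyhedron G p0"

abbreviation OM :: "(real^'n) set measure" where "OM \<equiv> orbit_measure G p0"

definition sec :: "(real^'n) set \<Rightarrow> real^'n" where "sec = inv_into P pr"

lemma P_open: "open P" and P_sub: "P \<subseteq> unit_ball" and P_inj: "inj_on pr P"
  using polyhedron_open[OF p0] polyhedron_sub polyhedron_inj[OF p0] .

lemma sec_pr: "x \<in> P \<Longrightarrow> sec (pr x) = x"
  by (simp add: sec_def inv_into_f_f[OF P_inj])

lemma sec_in: "q \<in> pr ` P \<Longrightarrow> sec q \<in> P \<and> pr (sec q) = q"
  by (auto simp: sec_pr)

lemma prP_open: "openin (orbit_space G) (pr ` P)"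
  by (rule openin_pr_image[OF P_open P_sub])

lemma prP_BO: "pr ` P \<in> sets BO"
  by (rule openin_borel_of[OF prP_open])

lemma sec_measurable:
  assumes h: "h \<in> borel_measurable borel"
  shows "(\<lambda>q. if q \<in> pr ` P then h (sec q) else k) \<in> borel_measurable BO"
proof (rule measurable_If_restrict_space_iff[THEN iffD2])
  show "{x \<in> space BO. x \<in> pr ` P} \<in> sets BO"
  proof -
    have "{x \<in> space BO. x \<in> pr ` P} = pr ` P" using P_sub unfolding space_BO by blast
    then show ?thesis using prP_BO by simp
  qed
  have "sec \<in> borel_measurable (restrict_space BO {x. x \<in> pr ` P})"
  proof (rule borel_measurableI)
    fix V :: "(real^'n) set" assume "open V"
    have sp: "space (restrict_space BO {x. x \<in> pr ` P}) = pr ` P"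
      using P_sub by (auto simp: space_restrict_space space_BO)
    have "sec -` V \<inter> pr ` P = pr ` (P \<inter> V)" using sec_pr by force
    moreover have "pr ` (P \<inter> V) \<in> sets BO"
      by (intro openin_borel_of openin_pr_image open_Int P_open \<open>open V\<close>) (use P_sub in blast)
    moreover have "pr ` P \<inter> pr ` unit_ball = pr ` P" using P_sub by blast
    ultimately show "sec -` V \<inter> space (restrict_space BO {x. x \<in> pr ` P}) \<in> sets (restrict_space BO {x. x \<in> pr ` P})"
      unfolding sp using prP_BO by (subst sets_restrict_space_iff) (auto simp: space_BO Collect_mem_eq intro: sets.Int)
  qed
  from measurable_compose[OF this h]
  show "(\<lambda>x. h (sec x)) \<in> borel_measurable (restrict_space BO {x. x \<in> pr ` P}) \<and>
      (\<lambda>x. k) \<in> borel_measurable (restrict_space BO {x. \<not> x \<in> pr ` P})" by simp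
qed

lemma P_lebesgue: "P \<in> sets lebesgue"
  using P_open by simp

lemma emeasure_OM: "A \<in> orbit_measurable_sets G \<Longrightarrow> emeasure OM A = emeasure hyp_volume {x \<in> P. pr x \<in> A}"
  by (rule emeasure_orbit_measure[OF P_lebesgue])

lemma hyp_volume_density: "hyp_volume =
    density (restrict_space lebesgue unit_ball) (\<lambda>x::real^'n. ennreal (conf_factor x ^ CARD('n)))"
  by (simp add: hyp_volume_def conf_factor_def power_divide)

lemma conf_factor_measurable: "conf_factor \<in> borel_measurable borel"
  unfolding conf_factor_def[abs_def] by measurable

lemma conf_factor_lebesgue [measurable]: "(\<lambda>x::real^'n. ennreal (conf_factor x ^ CARD('n))) \<in> borel_measurable lebesgue"
proof -
  have "(\<lambda>x::real^'n. ennreal (conf_factor x ^ CARD('n))) \<in> borel_measurable lborel"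
    using conf_factor_measurable by measurable
  then show ?thesis by (rule measurable_completion)
qed

lemma pr_hyp_measurable: "pr \<in> measurable hyp_volume OM"
proof (rule measurableI)
  show "pr x \<in> space OM" if "x \<in> space hyp_volume" for x
    using that by (simp add: space_orbit_measure hyp_volume_def space_restrict_space del: mem_ball_0)
  fix A assume A: "A \<in> sets OM"
  then have "{x \<in> unit_ball. pr x \<in> A} \<in> sets lebesgue" by (simp add: sets_orbit_measure orbit_measurable_sets_def)
  moreover have "pr -` A \<inter> space hyp_volume = {x \<in> unit_ball. pr x \<in> A}"
    by (auto simp: hyp_volume_def space_restrict_space)
  ultimately show "pr -` A \<inter> space hyp_volume \<in> sets hyp_volume"
    by (simp add: hyp_volume_def) (subst sets_restrict_space_iff, auto)
qed

lemma P_hyp: "P \<in> sets hyp_volume"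
  using P_sub P_lebesgue unfolding hyp_volume_def by (simp, subst sets_restrict_space_iff) auto

text \<open>Writing the measure on orbits as an image measure reduces integrals over the orbit space
  to Lebesgue integrals over \<open>P\<close>.\<close>

lemma OM_distr: "OM = distr (density hyp_volume (indicator P)) OM pr"
proof (rule measure_eqI)
  fix A assume A: "A \<in> sets OM"
  have m: "pr -` A \<inter> space hyp_volume \<in> sets hyp_volume" by (rule measurable_sets[OF pr_hyp_measurable A])
  have "emeasure (distr (density hyp_volume (indicator P)) OM pr) A = emeasure (density hyp_volume (indicator P)) (pr -` A \<inter> space hyp_volume)"
    using A pr_hyp_measurable by (subst emeasure_distr) auto
  also have "\<dots> = (\<integral>\<^sup>+ x. indicator P x * indicator (pr -` A \<inter> space hyp_volume) x \<partial>hyp_volume)"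
    using P_hyp m by (subst emeasure_density) auto
  also have "\<dots> = emeasure hyp_volume (P \<inter> (pr -` A \<inter> space hyp_volume))"
    using P_hyp m by (simp add: indicator_inter_arith[symmetric])
  also have "P \<inter> (pr -` A \<inter> space hyp_volume) = {x \<in> P. pr x \<in> A}"
    using P_sub by (auto simp: hyp_volume_def space_restrict_space)
  finally show "emeasure OM A = emeasure (distr (density hyp_volume (indicator P)) OM pr) A"
    using A by (simp add: emeasure_OM sets_orbit_measure)
qed simp

lemma nn_integral_OM:
  assumes h: "h \<in> borel_measurable BO"
  shows "(\<integral>\<^sup>+ q. h q \<partial>OM) = (\<integral>\<^sup>+ x. indicator P x * (h (pr x) * ennreal (conf_factor x ^ CARD('n))) \<partial>lebesgue)"
proof -
  have hm: "h \<in> borel_measurable OM" by (rule borel_measurable_orbit[OF h])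
  have hp: "(\<lambda>x. h (pr x)) \<in> borel_measurable hyp_volume" using measurable_compose[OF pr_hyp_measurable hm] .
  have "(\<lambda>x. indicator P x * h (pr x)) \<in> borel_measurable hyp_volume" using hp P_hyp by measurable
  then have ip': "(\<lambda>x. indicator P x * h (pr x)) \<in> borel_measurable (restrict_space lebesgue unit_ball)"
    by (simp add: hyp_volume_def)
  have "(\<integral>\<^sup>+ q. h q \<partial>OM) = (\<integral>\<^sup>+ q. h q \<partial>distr (density hyp_volume (indicator P)) OM pr)"
    using OM_distr by simp
  also have "\<dots> = (\<integral>\<^sup>+ x. h (pr x) \<partial>density hyp_volume (indicator P))"
    using pr_hyp_measurable hm by (subst nn_integral_distr) auto
  also have "\<dots> = (\<integral>\<^sup>+ x. indicator P x * h (pr x) \<partial>hyp_volume)"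
    using hp P_hyp by (subst nn_integral_density) auto
  also have "\<dots> = (\<integral>\<^sup>+ x. ennreal (conf_factor x ^ CARD('n)) * (indicator P x * h (pr x)) \<partial>restrict_space lebesgue unit_ball)"
    unfolding hyp_volume_density using ip' conf_factor_lebesgue
    by (subst nn_integral_density) (auto intro: measurable_restrict_space1)
  also have "\<dots> = (\<integral>\<^sup>+ x. ennreal (conf_factor x ^ CARD('n)) * (indicator P x * h (pr x)) * indicator unit_ball x \<partial>lebesgue)"
    by (subst nn_integral_restrict_space) auto
  also have "\<dots> = (\<integral>\<^sup>+ x. indicator P x * (h (pr x) * ennreal (conf_factor x ^ CARD('n))) \<partial>lebesgue)"
    using P_sub by (intro nn_integral_cong) (auto simp: indicator_def mult.commute)
  finally show ?thesis .
qed

text \<open>The hyperbolic density is positive on \<open>P\<close>, so hyperbolic and Lebesgue null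
  sets agree there.\<close>

lemma null_OM:
  assumes A: "A \<in> orbit_measurable_sets G"
  shows "A \<in> null_sets OM \<longleftrightarrow> negligible {x \<in> P. pr x \<in> A}"
proof -
  have S: "{x \<in> P. pr x \<in> A} = P \<inter> {x \<in> unit_ball. pr x \<in> A}" using P_sub by auto
  have Sl: "{x \<in> P. pr x \<in> A} \<in> sets lebesgue"
    unfolding S using A P_lebesgue by (auto simp: orbit_measurable_sets_def)
  have Sr: "{x \<in> P. pr x \<in> A} \<in> sets (restrict_space lebesgue unit_ball)"
    using Sl P_sub by (subst sets_restrict_space_iff) auto
  have "A \<in> null_sets OM \<longleftrightarrow> emeasure hyp_volume {x \<in> P. pr x \<in> A} = 0"
    using A by (simp add: null_sets_def sets_orbit_measure emeasure_OM)
  also have "\<dots> \<longleftrightarrow> {x \<in> P. pr x \<in> A} \<in> null_sets hyp_volume"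
    using Sr by (simp add: null_sets_def hyp_volume_def)
  also have "\<dots> \<longleftrightarrow> (AE x in restrict_space lebesgue unit_ball. x \<in> {x \<in> P. pr x \<in> A} \<longrightarrow> ennreal (conf_factor x ^ CARD('n)) = 0)"
    unfolding hyp_volume_density
    using Sr by (subst null_sets_density_iff) (auto intro: measurable_restrict_space1)
  also have "\<dots> \<longleftrightarrow> (AE x in restrict_space lebesgue unit_ball. x \<notin> {x \<in> P. pr x \<in> A})"
  proof -
    have "conf_factor x ^ CARD('n) > 0" if "x \<in> P" for x using conf_factor_pos[of x] that P_sub by auto
    then have "ennreal (conf_factor x ^ CARD('n)) \<noteq> 0" if "x \<in> P" for x
      using that by (simp add: ennreal_eq_0_iff not_le)
    then have "(x \<in> {x \<in> P. pr x \<in> A} \<longrightarrow> ennreal (conf_factor x ^ CARD('n)) = 0) \<longleftrightarrow> x \<notin> {x \<in> P. pr x \<in> A}" for x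
      by blast
    then show ?thesis by simp
  qed
  also have "\<dots> \<longleftrightarrow> {x \<in> P. pr x \<in> A} \<in> null_sets (restrict_space lebesgue unit_ball)"
    using Sr by (simp add: AE_iff_null_sets)
  also have "\<dots> \<longleftrightarrow> negligible {x \<in> P. pr x \<in> A}"
    using P_sub by (subst null_sets_restrict_space) (auto simp: negligible_iff_null_sets)
  finally show ?thesis .
qed

text \<open>The measure only sees the open polyhedron, so a measurable set of orbits that miss it is
  null.\<close>

lemma off_polyhedron_null:
  assumes "openin (orbit_space G) D" shows "D - pr ` P \<in> null_sets OM"
proof -
  have "D - pr ` P \<in> sets BO" using openin_borel_of[OF assms] prP_BO by auto
  moreover have "{x \<in> P. pr x \<in> D - pr ` P} = {}" by auto
  ultimately show ?thesis by (simp only: null_OM[OF BO_orbit_measurable] negligible_empty)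
qed

end

section \<open>Conformal invariance of the inner dilatation\<close>

lemma hyp_dist_near:
  assumes z: "z \<in> unit_ball" and e: "e > 0"
  obtains \<delta> where "\<delta> > 0" "\<And>y. norm (z - y) < \<delta> \<Longrightarrow> y \<in> unit_ball \<and>
    (conf_factor z - e) * norm (z - y) \<le> hyp_dist z y \<and> hyp_dist z y \<le> (conf_factor z + e) * norm (z - y)"
proof -
  have "\<forall>\<^sub>F y in at z. dist (hyp_dist z y / norm (z - y)) (conf_factor z) < e"
    by (rule tendstoD[OF hyp_dist_limit[OF z] e])
  moreover have "\<forall>\<^sub>F y in at z. y \<in> unit_ball" using eventually_at_in_open'[OF open_ball z] .
  ultimately have "\<forall>\<^sub>F y in at z. y \<in> unit_ball \<and> dist (hyp_dist z y / norm (z - y)) (conf_factor z) < e"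
    by eventually_elim auto
  then obtain \<delta> where \<delta>: "\<delta> > 0" "\<And>y. y \<noteq> z \<Longrightarrow> dist y z < \<delta> \<Longrightarrow>
      y \<in> unit_ball \<and> dist (hyp_dist z y / norm (z - y)) (conf_factor z) < e"
    unfolding eventually_at by blast
  show thesis
  proof (rule that[OF \<delta>(1)])
    fix y assume y: "norm (z - y) < \<delta>"
    show "y \<in> unit_ball \<and> (conf_factor z - e) * norm (z - y) \<le> hyp_dist z y \<and> hyp_dist z y \<le> (conf_factor z + e) * norm (z - y)"
    proof (cases "y = z")
      case True then show ?thesis using z by simp
    next
      case False
      then have n: "norm (z - y) > 0" by simp
      have y2: "y \<in> unit_ball" "dist (hyp_dist z y / norm (z - y)) (conf_factor z) < e"
        using \<delta>(2)[OF False] y by (auto simp: dist_norm norm_minus_commute)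
      have "conf_factor z - e \<le> hyp_dist z y / norm (z - y)" "hyp_dist z y / norm (z - y) \<le> conf_factor z + e"
        using y2(2) by (auto simp: dist_real_def abs_less_iff)
      then show ?thesis using n y2(1) by (simp only: pos_le_divide_eq pos_divide_le_eq simp_thms)
    qed
  qed
qed

text \<open>Dividing by \<open>c\<close> leaves an orthogonal map, whose determinant is 1 or
  -1.\<close>

lemma det_conformal:
  fixes A :: "real^'n \<Rightarrow> real^'n"
  assumes A: "linear A" and c: "c > 0" and n: "\<And>v. norm (A v) = c * norm v"
  shows "\<bar>det (matrix A)\<bar> = c ^ CARD('n)"
proof -
  define Q where "Q v = (1 / c) *\<^sub>R A v" for v
  have "linear Q" unfolding Q_def using A by (intro linear_compose_scale_right)
  moreover have "norm (Q v) = norm v" for v using c n[of v] by (simp add: Q_def)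
  ultimately have "orthogonal_transformation Q" by (simp add: orthogonal_transformation)
  then have "orthogonal_matrix (matrix Q)" by (simp add: orthogonal_transformation_matrix)
  then have dQ: "\<bar>det (matrix Q)\<bar> = 1" using det_orthogonal_matrix[of "matrix Q"] by auto
  have "A = (*\<^sub>R) c \<circ> Q" using c by (auto simp: Q_def fun_eq_iff)
  then have "matrix A = matrix ((*\<^sub>R) c) ** matrix Q"
    using matrix_compose[OF \<open>linear Q\<close>, of "(*\<^sub>R) c"] by (simp add: linear_scaleR)
  then show ?thesis using dQ c by (simp add: det_mul abs_mult det_matrix_scaleR power_abs)
qed

text \<open>Put \<open>y = x + t *\<^sub>R v\<close> in the defining identity, divide by the square
  of \<open>t\<close> and let \<open>t\<close> tend to 0.\<close>

lemma hyp_isometry_derivative_norm: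
  fixes T :: "real^'n \<Rightarrow> real^'n"
  assumes T: "hyp_isometry T" and x: "x \<in> unit_ball" and d: "(T has_derivative T') (at x)"
  shows "norm (T' v) = conf_factor x / conf_factor (T x) * norm v"
proof -
  have Tb: "T y \<in> unit_ball" if "y \<in> unit_ball" for y using T that unfolding hyp_isometry_def by blast
  define k where "k y = 1 - (norm y)\<^sup>2" for y :: "real^'n"
  have kpos: "k y > 0" if "y \<in> unit_ball" for y using unit_ball_gap[OF that] by (simp add: k_def)
  interpret bl: bounded_linear T' using d by (rule has_derivative_bounded_linear)
  have lim: "((\<lambda>t. (T (x + t *\<^sub>R v) - T x) /\<^sub>R t) \<longlongrightarrow> T' v) (at 0)"
  proof -
    have "((\<lambda>t. x + t *\<^sub>R v) has_derivative (\<lambda>t. t *\<^sub>R v)) (at 0)" by (auto intro!: derivative_eq_intros)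
    moreover have "(T has_derivative T') (at (x + 0 *\<^sub>R v))" using d by simp
    ultimately have "((\<lambda>t. T (x + t *\<^sub>R v)) has_derivative (\<lambda>t. T' (t *\<^sub>R v))) (at 0)"
      by (rule has_derivative_compose)
    then have "((\<lambda>t. norm (T (x + t *\<^sub>R v) - T x - T' (t *\<^sub>R v)) / norm t) \<longlongrightarrow> 0) (at (0::real))"
      by (simp add: has_derivative_at)
    moreover have "\<forall>\<^sub>F t in at 0. norm (T (x + t *\<^sub>R v) - T x - T' (t *\<^sub>R v)) / norm t =
        norm ((T (x + t *\<^sub>R v) - T x) /\<^sub>R t - T' v)"
    proof (rule eventually_mono[OF eventually_neq_at_within[of 0]])
      fix t :: real assume t: "t \<noteq> 0"
      have "(T (x + t *\<^sub>R v) - T x) /\<^sub>R t - T' v = (T (x + t *\<^sub>R v) - T x - T' (t *\<^sub>R v)) /\<^sub>R t"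
        using t by (simp add: bl.scaleR algebra_simps)
      then show "norm (T (x + t *\<^sub>R v) - T x - T' (t *\<^sub>R v)) / norm t = norm ((T (x + t *\<^sub>R v) - T x) /\<^sub>R t - T' v)"
        by (simp add: divide_inverse mult.commute)
    qed
    ultimately have "((\<lambda>t. norm ((T (x + t *\<^sub>R v) - T x) /\<^sub>R t - T' v)) \<longlongrightarrow> 0) (at 0)"
      by (rule Lim_transform_eventually)
    then show ?thesis by (rule LIM_zero_cancel[OF tendsto_norm_zero_cancel])
  qed
  have cT: "isCont T x" using d by (rule has_derivative_continuous)
  have line: "((\<lambda>t. x + t *\<^sub>R v) \<longlongrightarrow> x) (at 0)"
    by (rule tendsto_eq_intros | simp)+
  have ev: "\<forall>\<^sub>F t in at (0::real). x + t *\<^sub>R v \<in> unit_ball \<and> t \<noteq> 0"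
    by (rule eventually_conj[OF topological_tendstoD[OF line open_ball x] eventually_neq_at_within])
  have "((\<lambda>t. (norm v)\<^sup>2 * (k (T x) * k (T (x + t *\<^sub>R v))) / (k x * k (x + t *\<^sub>R v))) \<longlongrightarrow>
      (norm v)\<^sup>2 * (k (T x) * k (T x)) / (k x * k x)) (at 0)"
    using kpos[OF x] isCont_tendsto_compose[OF cT line] line unfolding k_def by (intro tendsto_intros) auto
  moreover have "\<forall>\<^sub>F t in at 0. (norm v)\<^sup>2 * (k (T x) * k (T (x + t *\<^sub>R v))) / (k x * k (x + t *\<^sub>R v)) =
      (norm ((T (x + t *\<^sub>R v) - T x) /\<^sub>R t))\<^sup>2"
    using ev
  proof eventually_elim
    case (elim t)
    define y where "y = x + t *\<^sub>R v"
    have y: "y \<in> unit_ball" "t \<noteq> 0" using elim by (simp_all add: y_def)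
    have "(norm (T x - T y))\<^sup>2 * (k x * k y) = (norm (x - y))\<^sup>2 * (k (T x) * k (T y))"
      using T x y(1) unfolding hyp_isometry_def k_def by blast
    moreover have "(norm (x - y))\<^sup>2 = t\<^sup>2 * (norm v)\<^sup>2" by (simp add: y_def power_mult_distrib)
    ultimately have "(norm (T x - T y))\<^sup>2 = t\<^sup>2 * (norm v)\<^sup>2 * (k (T x) * k (T y)) / (k x * k y)"
      using kpos[OF x] kpos[OF y(1)] by (simp add: field_simps)
    moreover have "(norm ((T y - T x) /\<^sub>R t))\<^sup>2 = (norm (T x - T y))\<^sup>2 / t\<^sup>2"
      by (simp add: power_mult_distrib norm_minus_commute divide_inverse power_inverse mult.commute)
    ultimately show ?case unfolding y_def[symmetric] using y(2) by simp
  qed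
  ultimately have "((\<lambda>t. (norm ((T (x + t *\<^sub>R v) - T x) /\<^sub>R t))\<^sup>2) \<longlongrightarrow> (norm v)\<^sup>2 * (k (T x) * k (T x)) / (k x * k x)) (at 0)"
    by (rule Lim_transform_eventually)
  moreover have "((\<lambda>t. (norm ((T (x + t *\<^sub>R v) - T x) /\<^sub>R t))\<^sup>2) \<longlongrightarrow> (norm (T' v))\<^sup>2) (at 0)"
    by (intro tendsto_intros lim)
  ultimately have "(norm (T' v))\<^sup>2 = (norm v)\<^sup>2 * (k (T x) * k (T x)) / (k x * k x)"
    by (rule tendsto_unique[OF at_neq_bot, rotated])
  also have "\<dots> = (k (T x) / k x * norm v)\<^sup>2" by (simp add: power_mult_distrib power_divide power2_eq_square)
  finally have "norm (T' v) = k (T x) / k x * norm v"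
    by (rule power2_eq_imp_eq) (use kpos[OF x] kpos[OF Tb[OF x]] in \<open>auto intro!: mult_nonneg_nonneg divide_nonneg_pos\<close>)
  moreover have "conf_factor x / conf_factor (T x) = k (T x) / k x"
    unfolding conf_factor_def k_def[symmetric] by simp
  ultimately show ?thesis by simp
qed

section \<open>Derivatives of group elements and local coordinates\<close>

context deck_group
begin

lemma G_derivative:
  assumes g: "g \<in> G" and x: "x \<in> unit_ball"
  obtains g' where "(g has_derivative g') (at x)"
    "\<bar>det (matrix g')\<bar> = (conf_factor x / conf_factor (g x)) ^ CARD('n)"
proof -
  obtain g' where g': "(g has_derivative g') (at x)" using G_differentiable[OF g x] unfolding differentiable_def by blast
  have "\<bar>det (matrix g')\<bar> = (conf_factor x / conf_factor (g x)) ^ CARD('n)"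
    by (rule det_conformal[OF has_derivative_linear[OF g'] _ hyp_isometry_derivative_norm[OF G_isometry[OF g] x g']])
       (use conf_factor_pos[OF x] conf_factor_pos[OF G_ball[OF g x]] in simp)
  then show thesis using that g' by blast
qed

lemma lift_near:
  assumes x: "x \<in> unit_ball" and e: "e > 0"
  obtains r where "r > 0" "\<And>q. q \<in> pr ` unit_ball \<Longrightarrow> orbit_dist (pr x) q < r \<Longrightarrow>
    \<exists>y\<in>unit_ball. q = pr y \<and> norm (x - y) < e \<and> orbit_dist (pr x) q = hyp_dist x y"
proof (rule that[of "e / 2"])
  show "e / 2 > 0" using e by simp
  fix q assume q: "q \<in> pr ` unit_ball" "orbit_dist (pr x) q < e / 2"
  then obtain y where y: "y \<in> unit_ball" "q = pr y" by blast
  obtain g where g: "g \<in> G" "orbit_dist (pr x) (pr y) = hyp_dist x (g y)" using orbit_dist_attained(1)[OF x y(1)] by blast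
  have gy: "g y \<in> unit_ball" by (rule G_ball[OF g(1) y(1)])
  have "norm (x - g y) < e" using norm_le_hyp_dist[OF x gy] g(2) q(2) y(2) by simp
  then show "\<exists>y\<in>unit_ball. q = pr y \<and> norm (x - y) < e \<and> orbit_dist (pr x) q = hyp_dist x y"
    using gy g(2) y(2) pr_G[OF g(1) y(1)] by (intro bexI[of _ "g y"]) auto
qed

lemma local_coordinateD:
  assumes "local_coordinate G p \<phi>"
  shows "p \<in> pr ` unit_ball" "\<phi> p \<in> unit_ball" "pr (\<phi> p) = p"
    "\<And>e. e > 0 \<Longrightarrow> \<exists>r>0. \<forall>q\<in>pr ` unit_ball. orbit_dist p q < r \<longrightarrow> \<phi> q \<in> unit_ball \<and> pr (\<phi> q) = q \<and> norm (\<phi> p - \<phi> q) < e"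
proof -
  obtain V where V: "openin (orbit_space G) V" "p \<in> V" "open (\<phi> ` V)" "\<phi> ` V \<subseteq> unit_ball"
    "homeomorphic_map (subtopology (orbit_space G) V) (top_of_set (\<phi> ` V)) \<phi>" "\<forall>q\<in>V. pr (\<phi> q) = q"
    using assms unfolding local_coordinate_def by blast
  have Vs: "V \<subseteq> pr ` unit_ball" using V(1) by (simp add: openin_orbit_space)
  show "p \<in> pr ` unit_ball" "\<phi> p \<in> unit_ball" "pr (\<phi> p) = p" using V Vs by blast+
  fix e :: real assume e: "e > 0"
  have "continuous_map (subtopology (orbit_space G) V) (top_of_set (\<phi> ` V)) \<phi>"
    by (rule homeomorphic_imp_continuous_map[OF V(5)])
  moreover have "openin (top_of_set (\<phi> ` V)) (\<phi> ` V \<inter> ball (\<phi> p) e)" by (intro openin_open_Int open_ball)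
  ultimately have "openin (subtopology (orbit_space G) V)
      {q \<in> topspace (subtopology (orbit_space G) V). \<phi> q \<in> \<phi> ` V \<inter> ball (\<phi> p) e}"
    by (rule openin_continuous_map_preimage)
  then have o: "openin (orbit_space G) {q \<in> topspace (subtopology (orbit_space G) V). \<phi> q \<in> \<phi> ` V \<inter> ball (\<phi> p) e}"
    using V(1) openin_trans_full by blast
  have ts: "topspace (subtopology (orbit_space G) V) = V" using Vs by (auto simp: topspace_orbit_space)
  have pin: "p \<in> {q \<in> topspace (subtopology (orbit_space G) V). \<phi> q \<in> \<phi> ` V \<inter> ball (\<phi> p) e}"
    unfolding ts using V(2) e by simp
  obtain r where r: "r > 0" "\<forall>q\<in>pr ` unit_ball. orbit_dist p q < r \<longrightarrow>
      q \<in> {q \<in> topspace (subtopology (orbit_space G) V). \<phi> q \<in> \<phi> ` V \<inter> ball (\<phi> p) e}"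
    using o[unfolded openin_orbit_space_metric, THEN conjunct2, rule_format, OF pin] by blast
  have "\<phi> q \<in> unit_ball \<and> pr (\<phi> q) = q \<and> norm (\<phi> p - \<phi> q) < e" if "q \<in> pr ` unit_ball" "orbit_dist p q < r" for q
  proof -
    have "q \<in> V" "\<phi> q \<in> ball (\<phi> p) e" using r(2) that unfolding ts by blast+
    then show ?thesis using V(4,6) by (auto simp: dist_norm)
  qed
  then show "\<exists>r>0. \<forall>q\<in>pr ` unit_ball. orbit_dist p q < r \<longrightarrow> \<phi> q \<in> unit_ball \<and> pr (\<phi> q) = q \<and> norm (\<phi> p - \<phi> q) < e"
    using r(1) by blast
qed

lemma openin_preimage_near:
  assumes "openin (orbit_space G) U" "x \<in> unit_ball" "pr x \<in> U"
  obtains \<delta> where "\<delta> > 0" "\<And>y. norm (x - y) < \<delta> \<Longrightarrow> y \<in> unit_ball \<and> pr y \<in> U"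
proof -
  have "open {x \<in> unit_ball. pr x \<in> U}" using assms by (simp add: openin_orbit_space)
  moreover have "x \<in> {x \<in> unit_ball. pr x \<in> U}" using assms by simp
  ultimately obtain e where e: "e > 0" "ball x e \<subseteq> {x \<in> unit_ball. pr x \<in> U}" by (rule openE)
  show thesis by (rule that[OF e(1)]) (use e(2) in \<open>auto simp: dist_norm subset_eq\<close>)
qed

end

section \<open>The upper limit W and its measurability\<close>

locale lift_setting = X: polyhedral_group G p0 + Y: polyhedral_group G' p0'
  for G :: "(real^'n \<Rightarrow> real^'n) set" and p0 and G' :: "(real^'n \<Rightarrow> real^'n) set" and p0' +
  fixes D :: "(real^'n) set set" and f :: "(real^'n) set \<Rightarrow> (real^'n) set"
  assumes D_open: "openin (orbit_space G) D"
    and f_in: "\<And>p. p \<in> D \<Longrightarrow> f p \<in> orbit_proj G' ` unit_ball"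
    and f_cont: "\<And>p e. p \<in> D \<Longrightarrow> e > 0 \<Longrightarrow> \<exists>\<delta>>0. \<forall>q\<in>D. orbit_dist p q < \<delta> \<longrightarrow> orbit_dist (f p) (f q) < e"
begin

lemma D_sub: "D \<subseteq> X.pr ` unit_ball"
  using D_open by (simp add: openin_orbit_space)

text \<open>The condition behind the upper limit, quantised by a radius \<open>1 / Suc k\<close> and
  a rational constant. Countably many such sets describe \<open>W\<close>, and on a part of one of
  them with diameter below \<open>1 / Suc k\<close> equal images force equal points.\<close>

definition expansion_set :: "nat \<Rightarrow> rat \<Rightarrow> (real^'n) set set"
  where "expansion_set k c = {p \<in> D. \<forall>q\<in>D. orbit_dist p q < 1 / Suc k \<longrightarrow> orbit_dist p q \<le> real_of_rat c * orbit_dist (f p) (f q)}"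

text \<open>\<open>W p\<close> is the upper limit of \<open>d p q / d (f p) (f q)\<close> as \<open>q\<close> tends to \<open>p\<close>; in local coordinates,
  at a point of differentiability with nonzero Jacobian, it is the reciprocal of the hyperbolic \<open>l(F'(x))\<close>.\<close>

definition W :: "(real^'n) set \<Rightarrow> ennreal"
  where "W p = (INF (k, c) \<in> UNIV. if 0 < c \<and> p \<in> expansion_set k c then ennreal (real_of_rat c) else \<infinity>)"

lemma W_near:
  assumes p: "p \<in> D" "W p < \<infinity>" "e > 0"
  shows "\<exists>\<eta>>0. \<forall>q\<in>D. orbit_dist p q < \<eta> \<longrightarrow> orbit_dist p q \<le> (enn2real (W p) + e) * orbit_dist (f p) (f q)"
proof -
  have "W p < W p + ennreal e" using p by (cases "W p") (auto simp: ennreal_plus[symmetric] ennreal_less_iff simp del: ennreal_plus)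
  then obtain k c where kc: "(if 0 < c \<and> p \<in> expansion_set k c then ennreal (real_of_rat c) else \<infinity>) < W p + ennreal e"
    unfolding W_def[of p] INF_less_iff by auto
  then have c: "0 < c" "p \<in> expansion_set k c" "ennreal (real_of_rat c) < W p + ennreal e" by (auto split: if_splits)
  have "W p = ennreal (enn2real (W p))" using p by simp
  then have "ennreal (real_of_rat c) < ennreal (enn2real (W p) + e)" using c(3) p(3) by (simp add: ennreal_plus)
  then have cl: "real_of_rat c \<le> enn2real (W p) + e" using c(1) by (simp add: ennreal_less_iff)
  have "orbit_dist p q \<le> (enn2real (W p) + e) * orbit_dist (f p) (f q)" if "q \<in> D" "orbit_dist p q < 1 / Suc k" for q
  proof -
    have "orbit_dist p q \<le> real_of_rat c * orbit_dist (f p) (f q)" using c(2) that by (simp add: expansion_set_def)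
    also have "\<dots> \<le> (enn2real (W p) + e) * orbit_dist (f p) (f q)"
      using cl Y.orbit_dist_metric(1)[OF f_in[OF p(1)] f_in[OF that(1)]] by (rule mult_right_mono)
    finally show ?thesis .
  qed
  then show ?thesis by (intro exI[of _ "1 / Suc k"]) simp
qed

lemma W_le:
  assumes p: "p \<in> D" and C: "C \<ge> 0"
    and near: "\<And>e. e > 0 \<Longrightarrow> \<exists>\<eta>>0. \<forall>q\<in>D. orbit_dist p q < \<eta> \<longrightarrow> orbit_dist p q \<le> (C + e) * orbit_dist (f p) (f q)"
  shows "W p \<le> ennreal C"
proof (rule ennreal_le_epsilon)
  fix e :: real assume e: "e > 0"
  obtain c where c: "C + e / 2 < real_of_rat c" "real_of_rat c < C + e" using of_rat_dense[of "C + e/2" "C + e"] e by auto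
  have "e / 2 > 0" using e by simp
  from near[OF this] obtain \<eta> where \<eta>: "\<eta> > 0" "\<forall>q\<in>D. orbit_dist p q < \<eta> \<longrightarrow> orbit_dist p q \<le> (C + e / 2) * orbit_dist (f p) (f q)" by blast
  obtain k where k: "1 / Suc k < \<eta>" using \<eta>(1) nat_approx_posE by metis
  have "p \<in> expansion_set k c" unfolding expansion_set_def
  proof (intro CollectI conjI p ballI impI)
    fix q assume q: "q \<in> D" "orbit_dist p q < 1 / Suc k"
    then have "orbit_dist p q \<le> (C + e / 2) * orbit_dist (f p) (f q)" using \<eta>(2) k by simp
    also have "\<dots> \<le> real_of_rat c * orbit_dist (f p) (f q)"
      using c Y.orbit_dist_metric(1)[OF f_in[OF p] f_in[OF q(1)]] by (intro mult_right_mono) auto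
    finally show "orbit_dist p q \<le> real_of_rat c * orbit_dist (f p) (f q)" .
  qed
  moreover have "0 < c" using c C e by (metis add_nonneg_pos half_gt_zero order_less_trans zero_less_of_rat_iff)
  ultimately have "W p \<le> ennreal (real_of_rat c)"
    unfolding W_def by (intro INF_lower2[of "(k, c)"]) auto
  also have "\<dots> \<le> ennreal C + ennreal e" using c C e by (simp add: ennreal_plus[symmetric] ennreal_leI del: ennreal_plus)
  finally show "W p \<le> ennreal C + ennreal e" .
qed

text \<open>Failure of the bound is witnessed by a strict inequality for some \<open>q\<close>, and
  since \<open>f\<close> is continuous the same \<open>q\<close> is a witness for all nearby
  points.\<close>

lemma D_minus_expansion_set_open:
  "openin (orbit_space G) (D - expansion_set k c)" if "0 < c"
  unfolding X.openin_orbit_space_metric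
proof (intro conjI ballI)
  show "D - expansion_set k c \<subseteq> X.pr ` unit_ball" using D_sub by blast
  fix p assume "p \<in> D - expansion_set k c"
  then have p: "p \<in> D" "p \<notin> expansion_set k c" by auto
  then obtain q where q: "q \<in> D" "orbit_dist p q < 1 / Suc k" "orbit_dist p q > real_of_rat c * orbit_dist (f p) (f q)"
    unfolding expansion_set_def by auto
  \<comment> \<open>The first entry keeps \<open>q\<close> within the radius. The second is half of
    the gap, because moving \<open>p\<close> changes both sides of the inequality, each by less than
    \<open>e\<close>.\<close>
  define e where "e = min (1 / Suc k - orbit_dist p q) ((orbit_dist p q - real_of_rat c * orbit_dist (f p) (f q)) / 2)"
  have e: "e > 0" using q by (simp add: e_def)
  have c0: "real_of_rat c > 0" using that by simp
  then have "e / real_of_rat c > 0" using e by simp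
  from f_cont[OF p(1) this] obtain \<delta> where \<delta>: "\<delta> > 0" "\<forall>p'\<in>D. orbit_dist p p' < \<delta> \<longrightarrow> orbit_dist (f p) (f p') < e / real_of_rat c" by blast
  obtain r where r: "r > 0" "\<forall>p'\<in>X.pr ` unit_ball. orbit_dist p p' < r \<longrightarrow> p' \<in> D"
    using D_open[unfolded X.openin_orbit_space_metric] p(1) by blast
  have "p' \<in> D - expansion_set k c" if p': "p' \<in> X.pr ` unit_ball" "orbit_dist p p' < min r (min \<delta> e)" for p'
  proof -
    have "orbit_dist p p' < r" using p'(2) by simp
    then have p'D: "p' \<in> D" using r(2) p'(1) by blast
    have M: "p \<in> X.pr ` unit_ball" "q \<in> X.pr ` unit_ball" using p q D_sub by blast+
    have M': "f p \<in> Y.pr ` unit_ball" "f q \<in> Y.pr ` unit_ball" "f p' \<in> Y.pr ` unit_ball" using f_in p q p'D by blast+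
    have pp': "orbit_dist p p' < e" using p' by simp
    have "orbit_dist (f p) (f p') < e / real_of_rat c" using \<delta>(2) p'D p' by simp
    then have fpp': "real_of_rat c * orbit_dist (f p) (f p') < e" using c0 by (simp add: pos_less_divide_eq mult.commute)
    have s: "orbit_dist p' p = orbit_dist p p'" by (rule X.orbit_dist_metric(3)[OF p'(1) M(1)])
    have s': "orbit_dist (f p') (f p) = orbit_dist (f p) (f p')" by (rule Y.orbit_dist_metric(3)[OF M'(3,1)])
    have t1: "orbit_dist p' q \<le> orbit_dist p p' + orbit_dist p q"
      using X.orbit_dist_metric(4)[OF p'(1) M(1,2)] s by simp
    have t2: "orbit_dist p q \<le> orbit_dist p p' + orbit_dist p' q" by (rule X.orbit_dist_metric(4)[OF M(1) p'(1) M(2)])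
    have "orbit_dist (f p') (f q) \<le> orbit_dist (f p) (f p') + orbit_dist (f p) (f q)"
      using Y.orbit_dist_metric(4)[OF M'(3,1,2)] s' by simp
    then have "real_of_rat c * orbit_dist (f p') (f q) \<le> real_of_rat c * orbit_dist (f p) (f p') + real_of_rat c * orbit_dist (f p) (f q)"
      using c0 by (metis distrib_left less_imp_le mult_left_mono)
    moreover have "e \<le> (orbit_dist p q - real_of_rat c * orbit_dist (f p) (f q)) / 2" unfolding e_def by (rule min.cobounded2)
    then have "e + e \<le> orbit_dist p q - real_of_rat c * orbit_dist (f p) (f q)" by (simp add: le_divide_eq)
    ultimately have "real_of_rat c * orbit_dist (f p') (f q) < orbit_dist p' q" using t2 fpp' pp' by simp
    moreover have "e \<le> 1 / Suc k - orbit_dist p q" unfolding e_def by (rule min.cobounded1)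
    then have "orbit_dist p' q < 1 / Suc k" using t1 pp' by linarith
    ultimately show ?thesis using p'D q(1) unfolding expansion_set_def by auto
  qed
  then show "\<exists>r>0. \<forall>q\<in>X.pr ` unit_ball. orbit_dist p q < r \<longrightarrow> q \<in> D - expansion_set k c"
    using r \<delta> e by (intro exI[of _ "min r (min \<delta> e)"]) auto
qed

lemma W_measurable: "W \<in> borel_measurable X.BO"
proof -
  have D: "D \<in> sets X.BO" by (rule openin_borel_of[OF D_open])
  have "(\<lambda>p. if 0 < c \<and> p \<in> expansion_set k c then ennreal (real_of_rat c) else \<infinity>) \<in> borel_measurable X.BO" for k c
  proof (cases "0 < c")
    case True
    have "D - (D - expansion_set k c) \<in> sets X.BO"
      by (intro sets.Diff D openin_borel_of D_minus_expansion_set_open True)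
    moreover have "D - (D - expansion_set k c) = expansion_set k c" by (auto simp: expansion_set_def)
    ultimately have "expansion_set k c \<in> sets X.BO" by simp
    then show ?thesis using True by simp
  qed simp
  then show ?thesis unfolding W_def[abs_def] case_prod_beta
    by (intro borel_measurable_INF) (auto simp: case_prod_beta)
qed

text \<open>Near a point \<open>hyp_dist\<close> is Euclidean distance times the conformal factor up
  to an error \<open>t\<close>, and differentiability makes \<open>\<Phi>\<close> expand by at least
  \<open>l - t\<close>. The quotient of distances is then at most
  \<open>(a + t) / ((b - t) * (l - t))\<close>, which tends to \<open>a / (b * l)\<close> as
  \<open>t\<close> tends to 0.\<close>

lemma W_le_derivative:
  assumes z: "z \<in> unit_ball" "X.pr z \<in> D"
    and \<Phi>: "\<delta>0 > 0" "\<And>y. norm (z - y) < \<delta>0 \<Longrightarrow> \<Phi> y \<in> unit_ball \<and> Y.pr (\<Phi> y) = f (X.pr y)"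
    and der: "(\<Phi> has_derivative \<Phi>') (at z)" and l: "l > 0" "\<And>v. l * norm v \<le> norm (\<Phi>' v)"
  shows "W (X.pr z) \<le> ennreal (conf_factor z / (conf_factor (\<Phi> z) * l))"
proof (rule W_le[OF z(2)])
  have w: "\<Phi> z \<in> unit_ball" "Y.pr (\<Phi> z) = f (X.pr z)" using \<Phi>(2)[of z] \<Phi>(1) by auto
  define a b where "a = conf_factor z" and "b = conf_factor (\<Phi> z)"
  have ab: "a > 0" "b > 0" using conf_factor_pos z w by (auto simp: a_def b_def)
  show "0 \<le> conf_factor z / (conf_factor (\<Phi> z) * l)" using ab l by (simp add: a_def b_def)
  fix e :: real assume e: "e > 0"
  have "((\<lambda>t. (a + t) / ((b - t) * (l - t))) \<longlongrightarrow> (a + 0) / ((b - 0) * (l - 0))) (at_right 0)"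
    using ab l by (intro tendsto_intros) auto
  then have "\<forall>\<^sub>F t in at_right 0. dist ((a + t) / ((b - t) * (l - t))) (a / (b * l)) < e"
    using tendstoD[OF _ e] by fastforce
  moreover have "\<forall>\<^sub>F t in at_right (0::real). t \<in> {0<..<min b l}" by (rule eventually_at_right_real) (use ab l in simp)
  ultimately have "\<forall>\<^sub>F t in at_right 0. dist ((a + t) / ((b - t) * (l - t))) (a / (b * l)) < e \<and> t \<in> {0<..<min b l}"
    by (rule eventually_conj)
  then obtain t where t: "dist ((a + t) / ((b - t) * (l - t))) (a / (b * l)) < e" "0 < t" "t < b" "t < l"
    using eventually_happens[of _ "at_right (0::real)"] trivial_limit_at_right_real by fastforce
  obtain \<delta>1 where \<delta>1: "\<delta>1 > 0" "\<And>y. norm (z - y) < \<delta>1 \<Longrightarrow> y \<in> unit_ball \<and>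
    (a - t) * norm (z - y) \<le> hyp_dist z y \<and> hyp_dist z y \<le> (a + t) * norm (z - y)"
    using hyp_dist_near[OF z(1) t(2)] unfolding a_def by blast
  obtain \<delta>2 where \<delta>2: "\<delta>2 > 0" "\<And>y. norm (\<Phi> z - y) < \<delta>2 \<Longrightarrow> y \<in> unit_ball \<and>
    (b - t) * norm (\<Phi> z - y) \<le> hyp_dist (\<Phi> z) y \<and> hyp_dist (\<Phi> z) y \<le> (b + t) * norm (\<Phi> z - y)"
    using hyp_dist_near[OF w(1) t(2)] unfolding b_def by blast
  \<comment> \<open>On the image side the projection preserves distances from
    \<open>\<Phi> z\<close> nearby, so the orbit distance is a distance in the ball; on the source
    side a nearest representative will be chosen instead.\<close>
  obtain r' where r': "r' > 0" "\<And>y. y \<in> unit_ball \<Longrightarrow> hyp_dist (\<Phi> z) y < r' \<Longrightarrow>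
      orbit_dist (Y.pr (\<Phi> z)) (Y.pr y) = hyp_dist (\<Phi> z) y"
    by (rule Y.local_isometry[OF w(1)]) (rule that)
  obtain \<delta>3 where \<delta>3: "\<delta>3 > 0" "\<And>y. norm (\<Phi> z - y) < \<delta>3 \<Longrightarrow> y \<in> unit_ball \<and> hyp_dist (\<Phi> z) y < r'"
    using hyp_dist_tendsto_0[OF w(1) r'(1)] by blast
  have "isCont \<Phi> z" using der by (rule has_derivative_continuous)
  moreover have "min \<delta>2 \<delta>3 > 0" using \<delta>2 \<delta>3 by simp
  ultimately obtain \<delta>4 where \<delta>4: "\<delta>4 > 0" "\<And>y. dist y z < \<delta>4 \<Longrightarrow> dist (\<Phi> y) (\<Phi> z) < min \<delta>2 \<delta>3"
    unfolding continuous_at_eps_delta by blast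
  obtain \<delta>5 where \<delta>5: "\<delta>5 > 0" "\<And>y. norm (y - z) < \<delta>5 \<Longrightarrow> norm (\<Phi> y - \<Phi> z - \<Phi>' (y - z)) \<le> t * norm (y - z)"
    using der t(2) unfolding has_derivative_at_alt by blast
  define \<delta> where "\<delta> = Min {\<delta>0, \<delta>1, \<delta>4, \<delta>5}"
  have \<delta>: "\<delta> > 0" "\<delta> \<le> \<delta>0" "\<delta> \<le> \<delta>1" "\<delta> \<le> \<delta>4" "\<delta> \<le> \<delta>5" using \<Phi>(1) \<delta>1(1) \<delta>4(1) \<delta>5(1) by (auto simp: \<delta>_def)
  obtain r where r: "r > 0" "\<And>q. q \<in> X.pr ` unit_ball \<Longrightarrow> orbit_dist (X.pr z) q < r \<Longrightarrow>
    \<exists>y\<in>unit_ball. q = X.pr y \<and> norm (z - y) < \<delta> \<and> orbit_dist (X.pr z) q = hyp_dist z y"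
    using X.lift_near[OF z(1) \<delta>(1)] by blast
  have "orbit_dist (X.pr z) q \<le> (conf_factor z / (conf_factor (\<Phi> z) * l) + e) * orbit_dist (f (X.pr z)) (f q)"
    if q: "q \<in> D" "orbit_dist (X.pr z) q < r" for q
  proof -
    obtain y where y: "y \<in> unit_ball" "q = X.pr y" "norm (z - y) < \<delta>" "orbit_dist (X.pr z) q = hyp_dist z y"
      using r(2)[of q] q D_sub by blast
    have y1: "hyp_dist z y \<le> (a + t) * norm (z - y)" using \<delta>1(2)[of y] y(3) \<delta> by simp
    have y0: "Y.pr (\<Phi> y) = f q" using \<Phi>(2)[of y] y \<delta> by simp
    have "dist (\<Phi> y) (\<Phi> z) < min \<delta>2 \<delta>3" using \<delta>4(2)[of y] y(3) \<delta> by (simp add: dist_norm norm_minus_commute)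
    then have n2: "norm (\<Phi> z - \<Phi> y) < \<delta>2" "norm (\<Phi> z - \<Phi> y) < \<delta>3" by (simp_all add: dist_norm norm_minus_commute)
    have fd: "orbit_dist (f (X.pr z)) (f q) = hyp_dist (\<Phi> z) (\<Phi> y)"
      using r'(2)[of "\<Phi> y"] \<delta>3(2)[OF n2(2)] w(2) y0 by simp
    have b1: "(b - t) * norm (\<Phi> z - \<Phi> y) \<le> hyp_dist (\<Phi> z) (\<Phi> y)" using \<delta>2(2)[OF n2(1)] by blast
    have "norm (\<Phi> y - \<Phi> z - \<Phi>' (y - z)) \<le> t * norm (y - z)" using \<delta>5(2)[of y] y(3) \<delta> by (simp add: norm_minus_commute)
    moreover have "norm (\<Phi>' (y - z)) \<le> norm (\<Phi> y - \<Phi> z) + norm (\<Phi> y - \<Phi> z - \<Phi>' (y - z))"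
      using norm_triangle_ineq4[of "\<Phi> y - \<Phi> z" "\<Phi> y - \<Phi> z - \<Phi>' (y - z)"] by simp
    ultimately have "(l - t) * norm (z - y) \<le> norm (\<Phi> z - \<Phi> y)"
      using l(2)[of "y - z"] by (simp add: norm_minus_commute algebra_simps)
    then have "(b - t) * ((l - t) * norm (z - y)) \<le> hyp_dist (\<Phi> z) (\<Phi> y)"
      using b1 t by (meson diff_ge_0_iff_ge less_imp_le mult_left_mono order_trans)
    then have n: "norm (z - y) \<le> hyp_dist (\<Phi> z) (\<Phi> y) / ((b - t) * (l - t))"
      using t by (simp add: pos_le_divide_eq mult.commute mult.left_commute)
    have "hyp_dist z y \<le> (a + t) * (hyp_dist (\<Phi> z) (\<Phi> y) / ((b - t) * (l - t)))"
      using y1 n ab t by (smt (verit, best) mult_left_mono)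
    also have "\<dots> = (a + t) / ((b - t) * (l - t)) * hyp_dist (\<Phi> z) (\<Phi> y)" by simp
    also have "\<dots> \<le> (a / (b * l) + e) * hyp_dist (\<Phi> z) (\<Phi> y)"
    proof (rule mult_right_mono)
      show "(a + t) / ((b - t) * (l - t)) \<le> a / (b * l) + e" using t(1) by (simp add: dist_real_def abs_less_iff)
      show "0 \<le> hyp_dist (\<Phi> z) (\<Phi> y)" using hyp_dist_nonneg[OF w(1)] \<delta>3(2)[OF n2(2)] by blast
    qed
    finally show ?thesis using y(4) fd by (simp add: a_def b_def)
  qed
  then show "\<exists>\<eta>>0. \<forall>q\<in>D. orbit_dist (X.pr z) q < \<eta> \<longrightarrow>
      orbit_dist (X.pr z) q \<le> (conf_factor z / (conf_factor (\<Phi> z) * l) + e) * orbit_dist (f (X.pr z)) (f q)"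
    using r(1) by blast
qed

end

section \<open>The lift F between the two polyhedra\<close>

context lift_setting
begin

text \<open>The sections over the open polyhedra serve as one fixed pair of charts, so that
  derivatives and integrals live on a single open subset of the ball.\<close>

definition \<Omega> :: "(real^'n) set"
  where "\<Omega> = {x \<in> X.P. X.pr x \<in> D \<and> f (X.pr x) \<in> Y.pr ` Y.P}"

definition F :: "real^'n \<Rightarrow> real^'n"
  where "F x = Y.sec (f (X.pr x))"

lemma F_lift: assumes "x \<in> \<Omega>" shows "F x \<in> Y.P" "Y.pr (F x) = f (X.pr x)"
  using assms Y.sec_in unfolding \<Omega>_def F_def by auto

lemma \<Omega>_sub: "\<Omega> \<subseteq> X.P" "x \<in> \<Omega> \<Longrightarrow> x \<in> unit_ball" "x \<in> \<Omega> \<Longrightarrow> X.pr x \<in> D" "x \<in> \<Omega> \<Longrightarrow> F x \<in> unit_ball"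
  using X.P_sub Y.P_sub F_lift(1)[of x] by (auto simp: \<Omega>_def simp del: mem_ball_0)

lemma f_pr_near:
  assumes x: "x \<in> unit_ball" "X.pr x \<in> D" and e: "e > 0"
  obtains \<delta> where "\<delta> > 0" "\<And>y. norm (x - y) < \<delta> \<Longrightarrow>
    y \<in> unit_ball \<and> X.pr y \<in> D \<and> orbit_dist (f (X.pr x)) (f (X.pr y)) < e"
proof -
  obtain \<eta> where \<eta>: "\<eta> > 0" "\<forall>q\<in>D. orbit_dist (X.pr x) q < \<eta> \<longrightarrow> orbit_dist (f (X.pr x)) (f q) < e"
    using f_cont[OF x(2) e] by blast
  obtain \<delta>1 where \<delta>1: "\<delta>1 > 0" "\<And>y. norm (x - y) < \<delta>1 \<Longrightarrow> y \<in> unit_ball \<and> X.pr y \<in> D"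
    by (rule X.openin_preimage_near[OF D_open x]) (rule that)
  obtain \<delta>2 where \<delta>2: "\<delta>2 > 0" "\<And>y. norm (x - y) < \<delta>2 \<Longrightarrow> y \<in> unit_ball \<and> hyp_dist x y < \<eta>"
    by (rule hyp_dist_tendsto_0[OF x(1) \<eta>(1)]) (rule that)
  show thesis
  proof (rule that[of "min \<delta>1 \<delta>2"])
    show "min \<delta>1 \<delta>2 > 0" using \<delta>1 \<delta>2 by simp
    fix y assume y: "norm (x - y) < min \<delta>1 \<delta>2"
    then have y1: "y \<in> unit_ball" "X.pr y \<in> D" and y2: "hyp_dist x y < \<eta>" using \<delta>1(2)[of y] \<delta>2(2)[of y] by auto
    have "orbit_dist (X.pr x) (X.pr y) < \<eta>" using X.orbit_dist_le[OF x(1) y1(1)] y2 by simp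
    then show "y \<in> unit_ball \<and> X.pr y \<in> D \<and> orbit_dist (f (X.pr x)) (f (X.pr y)) < e" using \<eta>(2) y1 by blast
  qed
qed

lemma F_near:
  assumes x: "x \<in> \<Omega>" and e: "e > 0"
  obtains \<delta> where "\<delta> > 0" "\<And>y. norm (x - y) < \<delta> \<Longrightarrow> y \<in> \<Omega> \<and> norm (F x - F y) < e"
proof -
  obtain \<eta> where \<eta>: "\<eta> > 0" "ball (F x) \<eta> \<subseteq> Y.P" using Y.P_open F_lift(1)[OF x] openE by blast
  have "min e \<eta> > 0" using e \<eta> by simp
  then obtain r where r: "r > 0" "\<And>q. q \<in> Y.pr ` unit_ball \<Longrightarrow> orbit_dist (Y.pr (F x)) q < r \<Longrightarrow>
    \<exists>y\<in>unit_ball. q = Y.pr y \<and> norm (F x - y) < min e \<eta> \<and> orbit_dist (Y.pr (F x)) q = hyp_dist (F x) y"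
    by (rule Y.lift_near[OF \<Omega>_sub(4)[OF x]]) (rule that)
  obtain \<delta>1 where \<delta>1: "\<delta>1 > 0" "\<And>y. norm (x - y) < \<delta>1 \<Longrightarrow>
    y \<in> unit_ball \<and> X.pr y \<in> D \<and> orbit_dist (f (X.pr x)) (f (X.pr y)) < r"
    by (rule f_pr_near[OF \<Omega>_sub(2,3)[OF x] r(1)]) (rule that)
  have "x \<in> X.P" using x \<Omega>_sub(1) by blast
  then obtain \<delta>2 where \<delta>2: "\<delta>2 > 0" "ball x \<delta>2 \<subseteq> X.P" using X.P_open openE by blast
  show thesis
  proof (rule that[of "min \<delta>1 \<delta>2"])
    show "min \<delta>1 \<delta>2 > 0" using \<delta>1 \<delta>2 by simp
    fix y assume y: "norm (x - y) < min \<delta>1 \<delta>2"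
    have yP: "y \<in> X.P" using \<delta>2(2) y by (auto simp: dist_norm)
    have y1: "X.pr y \<in> D" "orbit_dist (Y.pr (F x)) (f (X.pr y)) < r" using \<delta>1(2)[of y] y F_lift(2)[OF x] by auto
    obtain v where v: "v \<in> unit_ball" "f (X.pr y) = Y.pr v" "norm (F x - v) < min e \<eta>"
      using r(2)[OF f_in[OF y1(1)] y1(2)] by blast
    have vP: "v \<in> Y.P" using \<eta>(2) v(3) by (auto simp: dist_norm)
    have "F y = v" unfolding F_def v(2) by (rule Y.sec_pr[OF vP])
    moreover have "y \<in> \<Omega>" unfolding \<Omega>_def using yP y1(1) v(2) vP by blast
    ultimately show "y \<in> \<Omega> \<and> norm (F x - F y) < e" using v(3) by simp
  qed
qed

lemma \<Omega>_open: "open \<Omega>"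
  unfolding open_dist
proof
  fix x assume "x \<in> \<Omega>"
  then obtain \<delta> where \<delta>: "\<delta> > 0" "\<And>y. norm (x - y) < \<delta> \<Longrightarrow> y \<in> \<Omega> \<and> norm (F x - F y) < 1"
    by (rule F_near[OF _ zero_less_one]) (rule that)
  have "\<forall>y. dist y x < \<delta> \<longrightarrow> y \<in> \<Omega>" using \<delta>(2) by (simp add: dist_norm norm_minus_commute)
  then show "\<exists>e>0. \<forall>y. dist y x < e \<longrightarrow> y \<in> \<Omega>" using \<delta>(1) by blast
qed

lemma F_continuous: "continuous_on \<Omega> F"
  unfolding continuous_on_iff
proof (intro ballI allI impI)
  fix x and e :: real assume x: "x \<in> \<Omega>" and e: "e > 0"
  obtain \<delta> where \<delta>: "\<delta> > 0" "\<And>y. norm (x - y) < \<delta> \<Longrightarrow> y \<in> \<Omega> \<and> norm (F x - F y) < e"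
    by (rule F_near[OF x e]) (rule that)
  have "\<forall>y\<in>\<Omega>. dist y x < \<delta> \<longrightarrow> dist (F y) (F x) < e" using \<delta>(2) by (simp add: dist_norm norm_minus_commute)
  then show "\<exists>d>0. \<forall>x'\<in>\<Omega>. dist x' x < d \<longrightarrow> dist (F x') (F x) < e" using \<delta>(1) by blast
qed

text \<open>Near \<open>x\<close> both \<open>\<psi> (f (X.pr (g y)))\<close> and
  \<open>g' (F y)\<close> lie over the orbit \<open>f (X.pr y)\<close> and close to the same point
  \<open>w\<close>, around which the projection is injective. So other charts alter \<open>F\<close>
  only by group elements.\<close>

lemma chart_representation:
  assumes x: "x \<in> \<Omega>" and \<phi>: "local_coordinate G (X.pr x) \<phi>" and \<psi>: "local_coordinate G' (f (X.pr x)) \<psi>"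
  obtains g g' \<delta> where "g \<in> G" "g' \<in> G'" "g x = \<phi> (X.pr x)" "g' (F x) = \<psi> (f (X.pr x))" "\<delta> > 0"
    "\<And>y. norm (x - y) < \<delta> \<Longrightarrow> y \<in> \<Omega> \<and> \<psi> (f (X.pr (g y))) = g' (F y)"
proof -
  note \<phi>D = X.local_coordinateD[OF \<phi>] and \<psi>D = Y.local_coordinateD[OF \<psi>]
  note xb = \<Omega>_sub(2)[OF x] and xD = \<Omega>_sub(3)[OF x] and Fxb = \<Omega>_sub(4)[OF x]
  define w where "w = \<psi> (f (X.pr x))"
  have wb: "w \<in> unit_ball" using \<psi>D(2) by (simp add: w_def del: mem_ball_0)
  obtain g where g: "g \<in> G" "\<phi> (X.pr x) = g x"
    using X.pr_eq_iff[OF xb \<phi>D(2)] \<phi>D(3) by metis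
  obtain g' where g': "g' \<in> G'" "w = g' (F x)"
    using Y.pr_eq_iff[OF Fxb wb] \<psi>D(3) F_lift(2)[OF x] unfolding w_def by metis
  obtain r where r: "r > 0" "\<And>u v. u \<in> unit_ball \<Longrightarrow> v \<in> unit_ball \<Longrightarrow> hyp_dist w u < r \<Longrightarrow> hyp_dist w v < r \<Longrightarrow> Y.pr u = Y.pr v \<Longrightarrow> u = v"
    by (rule Y.local_isometry[OF wb]) (rule that)
  obtain \<delta>w where \<delta>w: "\<delta>w > 0" "\<And>u. norm (w - u) < \<delta>w \<Longrightarrow> u \<in> unit_ball \<and> hyp_dist w u < r"
    by (rule hyp_dist_tendsto_0[OF wb r(1)]) (rule that)
  obtain s where s: "s > 0" "\<forall>q\<in>Y.pr ` unit_ball. orbit_dist (f (X.pr x)) q < s \<longrightarrow>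
      \<psi> q \<in> unit_ball \<and> Y.pr (\<psi> q) = q \<and> norm (w - \<psi> q) < \<delta>w"
    using \<psi>D(4)[OF \<delta>w(1)] unfolding w_def by blast
  obtain \<delta>1 where \<delta>1: "\<delta>1 > 0" "\<And>y. norm (x - y) < \<delta>1 \<Longrightarrow>
    y \<in> unit_ball \<and> X.pr y \<in> D \<and> orbit_dist (f (X.pr x)) (f (X.pr y)) < s"
    by (rule f_pr_near[OF xb xD s(1)]) (rule that)
  have "isCont g' (F x)" using Y.G_continuous[OF g'(1)] Fxb open_ball by (simp add: continuous_on_eq_continuous_at)
  then obtain \<eta> where \<eta>: "\<eta> > 0" "\<And>v. dist v (F x) < \<eta> \<Longrightarrow> dist (g' v) (g' (F x)) < \<delta>w"
    using \<delta>w(1) unfolding continuous_at_eps_delta by blast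
  obtain \<delta>2 where \<delta>2: "\<delta>2 > 0" "\<And>y. norm (x - y) < \<delta>2 \<Longrightarrow> y \<in> \<Omega> \<and> norm (F x - F y) < \<eta>"
    by (rule F_near[OF x \<eta>(1)]) (rule that)
  show thesis
  proof (rule that[OF g(1) g'(1) g(2)[symmetric] g'(2)[symmetric, unfolded w_def], of "min \<delta>1 \<delta>2"])
    show "min \<delta>1 \<delta>2 > 0" using \<delta>1 \<delta>2 by simp
    fix y assume y: "norm (x - y) < min \<delta>1 \<delta>2"
    then have y\<Omega>: "y \<in> \<Omega>" "norm (F x - F y) < \<eta>" using \<delta>2(2)[of y] by auto
    have yb: "y \<in> unit_ball" and yD: "X.pr y \<in> D" and yd: "orbit_dist (f (X.pr x)) (f (X.pr y)) < s"
      using \<delta>1(2)[of y] y by auto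
    have u: "\<psi> (f (X.pr y)) \<in> unit_ball" "Y.pr (\<psi> (f (X.pr y))) = f (X.pr y)" "norm (w - \<psi> (f (X.pr y))) < \<delta>w"
      using s(2) f_in[OF yD] yd by blast+
    have "norm (w - g' (F y)) < \<delta>w" using \<eta>(2)[of "F y"] y\<Omega>(2) g'(2) by (simp add: dist_norm norm_minus_commute)
    then have v: "g' (F y) \<in> unit_ball" "hyp_dist w (g' (F y)) < r" using \<delta>w(2) by blast+
    have "Y.pr (g' (F y)) = f (X.pr y)" using Y.pr_G[OF g'(1) \<Omega>_sub(4)[OF y\<Omega>(1)]] F_lift(2)[OF y\<Omega>(1)] by simp
    then have "\<psi> (f (X.pr y)) = g' (F y)" using r(2)[OF u(1) v(1)] \<delta>w(2)[OF u(3)] v(2) u(2) by simp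
    then show "y \<in> \<Omega> \<and> \<psi> (f (X.pr (g y))) = g' (F y)" using y\<Omega>(1) X.pr_G[OF g(1) yb] by simp
  qed
qed

text \<open>Undoing the group elements of \<open>chart_representation\<close> expresses
  \<open>F\<close> near \<open>x\<close> through the coordinate expression that is differentiable by
  assumption.\<close>

lemma F_differentiable:
  assumes x: "x \<in> \<Omega>" and d: "differentiable_in_coordinates G G' f (X.pr x)"
  shows "F differentiable (at x)"
proof -
  obtain \<phi> \<psi> where c: "local_coordinate G (X.pr x) \<phi>" "local_coordinate G' (f (X.pr x)) \<psi>"
    and df: "(\<psi> \<circ> f \<circ> X.pr) differentiable (at (\<phi> (X.pr x)))"
    using d unfolding differentiable_in_coordinates_def by blast
  obtain g g' \<delta> where g: "g \<in> G" "g' \<in> G'" "g x = \<phi> (X.pr x)" "g' (F x) = \<psi> (f (X.pr x))" "\<delta> > 0"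
    "\<And>y. norm (x - y) < \<delta> \<Longrightarrow> y \<in> \<Omega> \<and> \<psi> (f (X.pr (g y))) = g' (F y)"
    by (rule chart_representation[OF x c]) (rule that)
  obtain k' where k': "k' \<in> G'" "\<forall>x\<in>unit_ball. k' (g' x) = x \<and> g' (k' x) = x" using Y.G_inv[OF g(2)] by blast
  have xb: "x \<in> unit_ball" by (rule \<Omega>_sub(2)[OF x])
  have "\<psi> (f (X.pr (g x))) = g' (F x)" using g(6)[of x] g(5) by simp
  moreover have "g' (F x) \<in> unit_ball" by (rule Y.G_ball[OF g(2) \<Omega>_sub(4)[OF x]])
  ultimately have dk: "k' differentiable (at ((\<psi> \<circ> f \<circ> X.pr \<circ> g) x))"
    using Y.G_differentiable[OF k'(1), of "g' (F x)"] by simp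
  have "(\<psi> \<circ> f \<circ> X.pr \<circ> g) differentiable (at x)"
    by (rule differentiable_chain_at[OF X.G_differentiable[OF g(1) xb]]) (use df g(3) in simp)
  from differentiable_chain_at[OF this dk] have "(k' \<circ> (\<psi> \<circ> f \<circ> X.pr \<circ> g)) differentiable (at x)" .
  then obtain E where E: "((k' \<circ> (\<psi> \<circ> f \<circ> X.pr \<circ> g)) has_derivative E) (at x)" unfolding differentiable_def by blast
  have "(F has_derivative E) (at x)"
  proof (rule has_derivative_transform_within_open[OF E open_ball])
    show "x \<in> ball x \<delta>" using g(5) by simp
    fix y assume "y \<in> ball x \<delta>"
    then have y: "y \<in> \<Omega>" "\<psi> (f (X.pr (g y))) = g' (F y)" using g(6)[of y] by (auto simp: dist_norm)
    show "(k' \<circ> (\<psi> \<circ> f \<circ> X.pr \<circ> g)) y = F y" using y(2) k'(2) \<Omega>_sub(4)[OF y(1)] by (simp del: mem_ball_0)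
  qed
  then show ?thesis by (rule differentiableI)
qed

text \<open>The dilatation is computed in charts at \<open>z\<close>, the Jacobian is that of
  \<open>F\<close> at \<open>x\<close>. Passing between them multiplies determinants by powers of
  ratios of conformal factors, as group elements are hyperbolic isometries. Combined with the bound
  \<open>lz / (lw * l)\<close> for \<open>W\<close>, the factors at \<open>z\<close> and
  \<open>\<Phi> z\<close> cancel.\<close>

lemma W_dilatation:
  assumes x: "x \<in> \<Omega>" and d: "differentiable_in_coordinates G G' f (X.pr x)"
    and F': "(F has_derivative F') (at x)" and det: "det (matrix F') \<noteq> 0"
  shows "W (X.pr x) < \<infinity>"
    and "W (X.pr x) ^ CARD('n) * ennreal (\<bar>det (matrix F')\<bar> * conf_factor (F x) ^ CARD('n)) \<le>
      orbit_inner_dilatation G G' f (X.pr x) * ennreal (conf_factor x ^ CARD('n))"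
proof -
  define p where "p = X.pr x"
  \<comment> \<open>These are the very choices made in \<open>orbit_inner_dilatation\<close>; that
    local coordinates exist at these points is read off from differentiability in
    coordinates.\<close>
  define \<phi> \<psi> where "\<phi> = (SOME \<phi>. local_coordinate G p \<phi>)" and "\<psi> = (SOME \<psi>. local_coordinate G' (f p) \<psi>)"
  have c: "local_coordinate G p \<phi>" "local_coordinate G' (f p) \<psi>"
    using d someI_ex[of "local_coordinate G p"] someI_ex[of "local_coordinate G' (f p)"]
    unfolding differentiable_in_coordinates_def p_def[symmetric] \<phi>_def \<psi>_def by blast+
  obtain g g' \<delta> where g: "g \<in> G" "g' \<in> G'" "g x = \<phi> p" "g' (F x) = \<psi> (f p)" "\<delta> > 0"
    "\<And>y. norm (x - y) < \<delta> \<Longrightarrow> y \<in> \<Omega> \<and> \<psi> (f (X.pr (g y))) = g' (F y)"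
    by (rule chart_representation[OF x c[unfolded p_def], folded p_def]) (rule that)
  define z where "z = g x"
  define \<Phi> where "\<Phi> = \<psi> \<circ> f \<circ> X.pr"
  note xb = \<Omega>_sub(2)[OF x] and Fxb = \<Omega>_sub(4)[OF x]
  have zb: "z \<in> unit_ball" unfolding z_def by (rule X.G_ball[OF g(1) xb])
  obtain k where k: "k \<in> G" "\<forall>x\<in>unit_ball. k (g x) = x \<and> g (k x) = x" using X.G_inv[OF g(1)] by blast
  have kz: "k z = x" using k(2) xb by (simp add: z_def del: mem_ball_0)
  obtain kd where kd: "(k has_derivative kd) (at z)" "\<bar>det (matrix kd)\<bar> = (conf_factor z / conf_factor x) ^ CARD('n)"
    by (rule X.G_derivative[OF k(1) zb]) (use kz that in simp)
  obtain gd where gd: "(g' has_derivative gd) (at (F x))"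
    "\<bar>det (matrix gd)\<bar> = (conf_factor (F x) / conf_factor (g' (F x))) ^ CARD('n)"
    by (rule Y.G_derivative[OF g(2) Fxb]) (rule that)
  have "isCont k z" using kd(1) by (rule has_derivative_continuous)
  then obtain \<delta>1 where \<delta>1: "\<delta>1 > 0" "\<And>u. dist u z < \<delta>1 \<Longrightarrow> dist (k u) (k z) < \<delta>"
    using g(5) unfolding continuous_at_eps_delta by blast
  obtain \<delta>2 where \<delta>2: "\<delta>2 > 0" "ball z \<delta>2 \<subseteq> unit_ball" using zb open_ball openE by blast
  define \<delta>0 where "\<delta>0 = min \<delta>1 \<delta>2"
  have \<delta>0: "\<delta>0 > 0" using \<delta>1 \<delta>2 by (simp add: \<delta>0_def)
  have near: "u \<in> unit_ball \<and> k u \<in> \<Omega> \<and> \<Phi> u = g' (F (k u))" if "norm (z - u) < \<delta>0" for u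
  proof -
    have ub: "u \<in> unit_ball" using \<delta>2(2) that by (auto simp: \<delta>0_def dist_norm)
    have "norm (x - k u) < \<delta>" using \<delta>1(2)[of u] that kz by (simp add: \<delta>0_def dist_norm norm_minus_commute)
    from g(6)[OF this] show ?thesis using ub k(2) by (simp add: \<Phi>_def del: mem_ball_0)
  qed
  have \<Phi>z: "\<Phi> z = g' (F x)" using near[of z] \<delta>0 kz by simp
  have wb: "\<Phi> z \<in> unit_ball" unfolding \<Phi>z by (rule Y.G_ball[OF g(2) Fxb])
  have lift: "\<Phi> u \<in> unit_ball \<and> Y.pr (\<Phi> u) = f (X.pr u)" if "norm (z - u) < \<delta>0" for u
  proof -
    note n = near[OF that]
    have kub: "F (k u) \<in> unit_ball" using \<Omega>_sub(4) n by blast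
    have "Y.pr (g' (F (k u))) = f (X.pr (k u))" using Y.pr_G[OF g(2) kub] F_lift(2) n by simp
    also have "X.pr (k u) = X.pr u" using X.pr_G[OF k(1)] n by blast
    finally show ?thesis using n Y.G_ball[OF g(2) kub] by simp
  qed
  define \<Phi>' where "\<Phi>' = gd \<circ> F' \<circ> kd"
  have "((F \<circ> k) has_derivative (F' \<circ> kd)) (at z)"
    by (rule diff_chain_at[OF kd(1)]) (use F' kz in simp)
  moreover have "(g' has_derivative gd) (at ((F \<circ> k) z))" using gd(1) kz by simp
  ultimately have "((g' \<circ> (F \<circ> k)) has_derivative (gd \<circ> (F' \<circ> kd))) (at z)" by (rule diff_chain_at)
  then have "(\<Phi> has_derivative (gd \<circ> (F' \<circ> kd))) (at z)"
  proof (rule has_derivative_transform_within_open[OF _ open_ball])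
    show "z \<in> ball z \<delta>0" using \<delta>0 by simp
    fix u assume "u \<in> ball z \<delta>0"
    then have "norm (z - u) < \<delta>0" by (simp add: dist_norm)
    from near[OF this] show "(g' \<circ> (F \<circ> k)) u = \<Phi> u" by simp
  qed
  then have \<Phi>d: "(\<Phi> has_derivative \<Phi>') (at z)" by (simp add: \<Phi>'_def comp_assoc)
  have lin: "linear kd" "linear F'" "linear gd" "linear \<Phi>'"
    using kd(1) F' gd(1) \<Phi>d has_derivative_linear by blast+
  have "linear (F' \<circ> kd)" by (rule linear_compose[OF lin(1,2)])
  then have "matrix \<Phi>' = matrix gd ** (matrix F' ** matrix kd)"
    unfolding \<Phi>'_def comp_assoc using lin by (simp add: matrix_compose)
  then have detP: "\<bar>det (matrix \<Phi>')\<bar> = \<bar>det (matrix gd)\<bar> * (\<bar>det (matrix F')\<bar> * \<bar>det (matrix kd)\<bar>)"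
    by (simp add: det_mul abs_mult)
  define lx ly lz lw where "lx = conf_factor x" and "ly = conf_factor (F x)" and "lz = conf_factor z" and "lw = conf_factor (\<Phi> z)"
  have pos: "lx > 0" "ly > 0" "lz > 0" "lw > 0"
    using conf_factor_pos xb Fxb zb wb unfolding lx_def ly_def lz_def lw_def by blast+
  have J: "\<bar>det (matrix \<Phi>')\<bar> = (ly / lw) ^ CARD('n) * (\<bar>det (matrix F')\<bar> * (lz / lx) ^ CARD('n))"
    unfolding detP gd(2) kd(2) lx_def ly_def lz_def lw_def \<Phi>z ..
  have J0: "det (matrix \<Phi>') \<noteq> 0" using J det pos by auto
  \<comment> \<open>An injective linear map is bounded below, so this infimum over the unit sphere
    is positive.\<close>
  define l where "l = (INF v\<in>sphere 0 1. norm (\<Phi>' v))"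
  have "inj \<Phi>'" using det_nz_iff_inj[OF lin(4)] J0 by simp
  then obtain B where B: "B > 0" "\<And>v. B * norm v \<le> norm (\<Phi>' v)" using linear_inj_bounded_below_pos[OF lin(4)] by blast
  have bb: "bdd_below ((\<lambda>v. norm (\<Phi>' v)) ` sphere 0 1)" by (rule bdd_belowI[of _ 0]) auto
  have ne: "sphere (0::real^'n) 1 \<noteq> {}" by simp
  have "B \<le> l" unfolding l_def
  proof (rule cINF_greatest[OF ne])
    fix v :: "real^'n" assume "v \<in> sphere 0 1"
    then show "B \<le> norm (\<Phi>' v)" using B(2)[of v] by simp
  qed
  then have l: "l > 0" using B(1) by simp
  have lb: "l * norm v \<le> norm (\<Phi>' v)" for v
  proof (cases "v = 0")
    case False
    have "l \<le> norm (\<Phi>' ((1 / norm v) *\<^sub>R v))" unfolding l_def by (rule cINF_lower[OF bb]) (use False in simp)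
    also have "\<Phi>' ((1 / norm v) *\<^sub>R v) = (1 / norm v) *\<^sub>R \<Phi>' v" by (rule linear_cmul[OF lin(4)])
    finally show ?thesis using False by (simp add: pos_le_divide_eq)
  qed simp
  have prz: "X.pr z = p" unfolding z_def p_def by (rule X.pr_G[OF g(1) xb])
  have pD: "p \<in> D" unfolding p_def by (rule \<Omega>_sub(3)[OF x])
  have Wl: "W p \<le> ennreal (lz / (lw * l))"
    using W_le_derivative[OF zb _ \<delta>0 lift \<Phi>d l lb] pD by (simp add: prz lz_def lw_def)
  then show "W (X.pr x) < \<infinity>" unfolding p_def using ennreal_less_top le_less_trans by fastforce
  have fd: "frechet_derivative \<Phi> (at z) = \<Phi>'" by (rule frechet_derivative_at[OF \<Phi>d, symmetric])
  have "\<Phi> differentiable (at z)" using \<Phi>d by (rule differentiableI)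
  then have K: "orbit_inner_dilatation G G' f p = ennreal (\<bar>det (matrix \<Phi>')\<bar> / l ^ CARD('n))"
    unfolding orbit_inner_dilatation_def Let_def \<phi>_def[symmetric] \<psi>_def[symmetric] \<Phi>_def[symmetric]
    using g(3)[symmetric] J0 by (simp add: inner_dilatation_def Let_def fd l_def z_def[symmetric])
  have "W p ^ CARD('n) * ennreal (\<bar>det (matrix F')\<bar> * ly ^ CARD('n)) \<le>
      ennreal (lz / (lw * l)) ^ CARD('n) * ennreal (\<bar>det (matrix F')\<bar> * ly ^ CARD('n))"
    by (intro mult_right_mono power_mono Wl) auto
  also have "\<dots> = ennreal ((lz / (lw * l)) ^ CARD('n) * (\<bar>det (matrix F')\<bar> * ly ^ CARD('n)))"
    using pos l by (simp add: ennreal_power ennreal_mult)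
  also have "(lz / (lw * l)) ^ CARD('n) * (\<bar>det (matrix F')\<bar> * ly ^ CARD('n)) = \<bar>det (matrix \<Phi>')\<bar> / l ^ CARD('n) * lx ^ CARD('n)"
    unfolding J using pos l by (simp add: power_divide power_mult_distrib)
  also have "ennreal \<dots> = orbit_inner_dilatation G G' f p * ennreal (lx ^ CARD('n))"
    unfolding K by (rule ennreal_mult) (use pos l in simp_all)
  finally show "W (X.pr x) ^ CARD('n) * ennreal (\<bar>det (matrix F')\<bar> * conf_factor (F x) ^ CARD('n)) \<le>
      orbit_inner_dilatation G G' f (X.pr x) * ennreal (conf_factor x ^ CARD('n))"
    unfolding p_def lx_def ly_def .
qed

end

section \<open>Pushing forward an admissible function\<close>

text \<open>Each term is at most the \<open>n\<close>th root of the sum. In this way a supremum over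
  preimages is exchanged for a sum over pieces, without any bound on their number.\<close>

lemma SUP_power_le_suminf:
  fixes a :: "nat \<Rightarrow> ennreal"
  assumes n: "0 < n"
  shows "(SUP j. a j) ^ n \<le> (\<Sum>j. a j ^ n)"
proof (cases "(\<Sum>j. a j ^ n) = \<infinity>")
  case False
  define S where "S = enn2real (\<Sum>j. a j ^ n)"
  have S: "(\<Sum>j. a j ^ n) = ennreal S" "S \<ge> 0" using False by (simp_all add: S_def less_top)
  have "a j \<le> ennreal (root n S)" for j
  proof -
    have "a j ^ n \<le> (\<Sum>j. a j ^ n)"
      using sum_le_suminf[of "\<lambda>j. a j ^ n" "{j}"] by simp
    then have le: "a j ^ n \<le> ennreal S" using S by simp
    show ?thesis
    proof (cases "a j")
      case (real r)
      then have "r ^ n \<le> S" using le S by (simp add: ennreal_power)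
      then have "r \<le> root n S" using real n real_root_le_mono[OF n, of "r ^ n" S] by (simp add: real_root_power_cancel)
      then show ?thesis using real by (simp add: ennreal_leI)
    next
      case top
      then show ?thesis using le n by (simp add: ennreal_top_eq_mult_iff power_eq_top_ennreal top_unique)
    qed
  qed
  then have "(SUP j. a j) \<le> ennreal (root n S)" by (rule SUP_least)
  then have "(SUP j. a j) ^ n \<le> ennreal (root n S) ^ n" by (rule power_mono) simp
  also have "\<dots> = ennreal S" using n S by (simp add: ennreal_power)
  finally show ?thesis using S by simp
qed simp

context polyhedral_group
begin

lemma null_OM_negligible: "N \<in> null_sets OM \<Longrightarrow> negligible {x \<in> P. pr x \<in> N}"
  using null_OM[of N] by (auto simp: sets_orbit_measure dest: null_setsD2)

end

locale luzin_setting = lift_setting G p0 G' p0' D f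
  for G :: "(real^'n \<Rightarrow> real^'n) set" and p0 and G' :: "(real^'n \<Rightarrow> real^'n) set" and p0' D f +
  fixes ND :: "(real^'n) set set" and \<rho> :: "(real^'n) set \<Rightarrow> ennreal"
  assumes f_N: "\<And>N. N \<subseteq> D \<Longrightarrow> N \<in> null_sets (orbit_measure G p0) \<Longrightarrow> f ` N \<in> null_sets (orbit_measure G' p0')"
    and ND: "ND \<in> null_sets (orbit_measure G p0)"
    and f_diff: "\<And>p. p \<in> D \<Longrightarrow> p \<notin> ND \<Longrightarrow> differentiable_in_coordinates G G' f p"
    and \<rho>: "\<rho> \<in> borel_measurable (borel_of (orbit_space G))"
begin

text \<open>The pieces are intersections of small compact neighbourhoods with the relatively closed
  sets where the distance quotient is bounded by \<open>c\<close> at scale \<open>1 / Suc k\<close>.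
  If two points of a piece have equal images, the bound makes their distance zero. Compactness is
  wanted because it makes the inverse of \<open>F\<close> on each piece continuous.\<close>

lemma pieces:
  obtains K :: "nat \<Rightarrow> (real^'n) set" where "\<And>j. compact (K j)" "\<And>j. K j \<subseteq> \<Omega>" "\<And>j. inj_on F (K j)"
    "(\<Union>j. K j) = {x \<in> \<Omega>. W (X.pr x) < \<infinity>}"
proof -
  obtain B :: "(real^'n) set set" where B: "countable B" "topological_basis B" using ex_countable_basis by blast
  define I where "I = {(b, k::nat, c::rat). b \<in> B \<and> closure b \<subseteq> \<Omega> \<and> compact (closure b) \<and> 0 < c \<and>
    (\<forall>x\<in>closure b. \<forall>y\<in>closure b. orbit_dist (X.pr x) (X.pr y) < 1 / Suc k)}"
  define Q where "Q i = (case i of (b, k, c) \<Rightarrow> closure b \<inter> {x \<in> \<Omega>. X.pr x \<in> expansion_set k c})" for i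
  have "I \<subseteq> B \<times> (UNIV :: (nat \<times> rat) set)" by (auto simp: I_def)
  then have cI: "countable I" by (rule countable_subset) (intro countable_SIGMA B(1) countableI_type)
  have Q: "compact (Q i) \<and> Q i \<subseteq> \<Omega> \<and> inj_on F (Q i) \<and> (\<forall>x\<in>Q i. W (X.pr x) < \<infinity>)" if "i \<in> I" for i
  proof -
    obtain b k c where i: "i = (b, k, c)" using prod_cases3 by blast
    have b: "closure b \<subseteq> \<Omega>" "compact (closure b)" "0 < c"
      "\<And>x y. x \<in> closure b \<Longrightarrow> y \<in> closure b \<Longrightarrow> orbit_dist (X.pr x) (X.pr y) < 1 / Suc k"
      using that unfolding i I_def by auto
    have "openin (orbit_space G) (D - expansion_set k c)" by (rule D_minus_expansion_set_open[OF b(3)])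
    then have "open {x \<in> unit_ball. X.pr x \<in> D - expansion_set k c}" unfolding openin_orbit_space by blast
    moreover have "Q i = closure b - {x \<in> unit_ball. X.pr x \<in> D - expansion_set k c}"
      unfolding i Q_def using b(1) \<Omega>_sub(2,3) by auto
    ultimately have "compact (Q i)" using b(2) by (simp add: compact_diff)
    moreover have "inj_on F (Q i)"
    proof (rule inj_onI)
      fix x y assume "x \<in> Q i" "y \<in> Q i" and e: "F x = F y"
      then have xy: "x \<in> closure b" "y \<in> closure b" "x \<in> \<Omega>" "y \<in> \<Omega>" "X.pr x \<in> expansion_set k c" unfolding i Q_def by auto
      have fe: "f (X.pr x) = f (X.pr y)" using F_lift(2)[OF xy(3)] F_lift(2)[OF xy(4)] e by simp
      have D2: "X.pr x \<in> D" "X.pr y \<in> D" using \<Omega>_sub(3) xy by blast+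
      have M: "X.pr x \<in> X.pr ` unit_ball" "X.pr y \<in> X.pr ` unit_ball" using D2 D_sub by blast+
      have "orbit_dist (X.pr x) (X.pr y) \<le> real_of_rat c * orbit_dist (f (X.pr x)) (f (X.pr y))"
        using xy(5) D2(2) b(4)[OF xy(1,2)] unfolding expansion_set_def by blast
      also have "orbit_dist (f (X.pr x)) (f (X.pr y)) = 0"
        using Y.orbit_dist_metric(2)[OF f_in[OF D2(1)] f_in[OF D2(2)]] fe by simp
      finally have "orbit_dist (X.pr x) (X.pr y) = 0" using X.orbit_dist_metric(1)[OF M] by simp
      then have "X.pr x = X.pr y" using X.orbit_dist_metric(2)[OF M] by simp
      then show "x = y" using X.P_inj xy(3,4) \<Omega>_sub(1) by (meson inj_onD subsetD)
    qed
    moreover have "W (X.pr x) < \<infinity>" if "x \<in> Q i" for x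
    proof -
      have "X.pr x \<in> expansion_set k c" using that unfolding i Q_def by auto
      then have "W (X.pr x) \<le> ennreal (real_of_rat c)"
        unfolding W_def using b(3) by (intro INF_lower2[of "(k, c)"]) auto
      then show ?thesis using le_less_trans ennreal_less_top by (metis infinity_ennreal_def)
    qed
    moreover have "Q i \<subseteq> \<Omega>" using b(1) unfolding i Q_def by auto
    ultimately show ?thesis by blast
  qed
  have cover: "\<exists>i\<in>I. x \<in> Q i" if x: "x \<in> \<Omega>" "W (X.pr x) < \<infinity>" for x
  proof -
    obtain k c where "(if 0 < c \<and> X.pr x \<in> expansion_set k c then ennreal (real_of_rat c) else \<infinity>) < \<infinity>"
      using x(2) unfolding W_def[of "X.pr x"] INF_less_iff by auto
    then have kc: "0 < c" "X.pr x \<in> expansion_set k c" by (auto split: if_splits)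
    have xb: "x \<in> unit_ball" by (rule \<Omega>_sub(2)[OF x(1)])
    \<comment> \<open>Half of the scale, so that two points within \<open>e0\<close> of
      \<open>x\<close> are less than \<open>1 / Suc k\<close> apart.\<close>
    define e0 :: real where "e0 = 1 / Suc k / 2"
    have e0: "e0 > 0" "e0 + e0 = 1 / Suc k" unfolding e0_def by (simp, simp only: field_sum_of_halves)
    obtain \<delta>1 where \<delta>1: "\<delta>1 > 0" "\<And>y. norm (x - y) < \<delta>1 \<Longrightarrow> y \<in> unit_ball \<and> hyp_dist x y < e0"
      by (rule hyp_dist_tendsto_0[OF xb e0(1)]) (rule that)
    obtain \<delta>2 where \<delta>2: "\<delta>2 > 0" "ball x \<delta>2 \<subseteq> \<Omega>" using \<Omega>_open x(1) openE by blast
    define \<delta> where "\<delta> = min \<delta>1 \<delta>2 / 2"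
    have \<delta>: "\<delta> > 0" "\<delta> < \<delta>1" "\<delta> < \<delta>2" using \<delta>1(1) \<delta>2(1) by (auto simp: \<delta>_def min_def)
    obtain b where b: "b \<in> B" "x \<in> b" "b \<subseteq> ball x \<delta>"
      using topological_basisE[OF B(2) open_ball, of x x \<delta>] \<delta>(1) by auto
    have "b \<subseteq> cball x \<delta>" using b(3) ball_subset_cball by blast
    then have cb: "closure b \<subseteq> cball x \<delta>" by (simp add: closure_minimal)
    have "compact (closure b)" using compact_Int_closed[OF compact_cball closed_closure, of x \<delta> b] cb by (simp add: inf.absorb2)
    moreover have "closure b \<subseteq> \<Omega>" using cb \<delta>2(2) \<delta>(3) by (auto simp: subset_eq)
    moreover have "orbit_dist (X.pr u) (X.pr v) < 1 / Suc k" if "u \<in> closure b" "v \<in> closure b" for u v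
    proof -
      have "norm (x - u) < \<delta>1" "norm (x - v) < \<delta>1" using cb that \<delta>(2) by (auto simp: dist_norm subset_eq)
      then have u: "u \<in> unit_ball" "hyp_dist x u < e0" and v: "v \<in> unit_ball" "hyp_dist x v < e0" using \<delta>1(2) by blast+
      have "orbit_dist (X.pr u) (X.pr v) \<le> hyp_dist u v" by (rule X.orbit_dist_le[OF u(1) v(1)])
      also have "\<dots> \<le> hyp_dist u x + hyp_dist x v" by (rule hyp_dist_triangle[OF u(1) xb v(1)])
      also have "\<dots> < e0 + e0" using u(2) v(2) hyp_dist_commute[of u x] by simp
      finally show ?thesis using e0(2) by simp
    qed
    ultimately have "(b, k, c) \<in> I" unfolding I_def using b(1) kc(1) by auto
    moreover have "x \<in> Q (b, k, c)" using b(2) closure_subset x(1) kc(2) by (auto simp: Q_def)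
    ultimately show ?thesis by blast
  qed
  \<comment> \<open>The enumeration \<open>from_nat_into\<close> needs a nonempty index set;
    otherwise all pieces are empty.\<close>
  define K where "K j = (if I = {} then {} else Q (from_nat_into I j))" for j
  have KQ: "K j = {} \<or> (\<exists>i\<in>I. K j = Q i)" for j
    by (cases "I = {}") (auto simp: K_def intro!: bexI[of _ "from_nat_into I j"] from_nat_into)
  show thesis
  proof (rule that[of K])
    have "compact (K j) \<and> K j \<subseteq> \<Omega> \<and> inj_on F (K j)" for j
    proof (cases "K j = {}")
      case False
      then obtain i where i: "i \<in> I" "K j = Q i" using KQ[of j] by blast
      show ?thesis unfolding i(2) using Q[OF i(1)] by blast
    qed simp
    then show "compact (K j)" "K j \<subseteq> \<Omega>" "inj_on F (K j)" for j by blast+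
    show "(\<Union>j. K j) = {x \<in> \<Omega>. W (X.pr x) < \<infinity>}"
    proof
      show "(\<Union>j. K j) \<subseteq> {x \<in> \<Omega>. W (X.pr x) < \<infinity>}" using KQ Q by blast
      show "{x \<in> \<Omega>. W (X.pr x) < \<infinity>} \<subseteq> (\<Union>j. K j)"
      proof
        fix x assume "x \<in> {x \<in> \<Omega>. W (X.pr x) < \<infinity>}"
        then obtain i where i: "i \<in> I" "x \<in> Q i" using cover by blast
        then have "I \<noteq> {}" by blast
        moreover obtain j where "from_nat_into I j = i" using from_nat_into_surj[OF cI i(1)] by blast
        ultimately have "x \<in> K j" using i by (simp add: K_def)
        then show "x \<in> (\<Union>j. K j)" by blast
      qed
    qed
  qed
qed

lemma ND_image_negligible: "negligible {y \<in> Y.P. Y.pr y \<in> f ` (D \<inter> ND)}"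
proof -
  have "D \<in> sets X.OM" using X.BO_orbit_measurable[OF openin_borel_of[OF D_open]] by (simp add: sets_orbit_measure)
  then have "D \<inter> ND \<in> null_sets X.OM" using ND by (intro null_set_Int1)
  then have "f ` (D \<inter> ND) \<in> null_sets Y.OM" by (intro f_N) auto
  then show ?thesis by (rule Y.null_OM_negligible)
qed

text \<open>For a point of \<open>D\<close> off the pieces with image in the projected polyhedron
  there are three cases: its orbit misses the open polyhedron, it belongs to \<open>ND\<close>, or
  \<open>W\<close> is infinite at a point of differentiability. In the first two the image is null
  by Lusin's condition; in the third the Jacobian vanishes, as otherwise \<open>W\<close> would be
  finite.\<close>

lemma bad_image_negligible:
  assumes K: "(\<Union>j. K j) = {x \<in> \<Omega>. W (X.pr x) < \<infinity>}"
  shows "negligible {y \<in> Y.P. Y.pr y \<in> f ` (D - X.pr ` (\<Union>j::nat. K j))}"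
proof -
  define S where "S = {x \<in> \<Omega>. \<not> W (X.pr x) < \<infinity> \<and> X.pr x \<notin> ND}"
  have "negligible (F ` S)"
  proof (rule sard_square[where f' = "\<lambda>x. frechet_derivative F (at x)"])
    fix x assume "x \<in> S"
    then have x: "x \<in> \<Omega>" "\<not> W (X.pr x) < \<infinity>" "X.pr x \<notin> ND" by (auto simp: S_def)
    have d: "differentiable_in_coordinates G G' f (X.pr x)" by (rule f_diff[OF \<Omega>_sub(3)[OF x(1)] x(3)])
    have der: "(F has_derivative frechet_derivative F (at x)) (at x)"
      using F_differentiable[OF x(1) d] by (simp add: frechet_derivative_works[symmetric])
    then show "(F has_derivative frechet_derivative F (at x)) (at x within S)" by (rule has_derivative_at_withinI)
    show "det (matrix (frechet_derivative F (at x))) = 0" using W_dilatation(1)[OF x(1) d der] x(2) by blast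
  qed
  moreover have "negligible {y \<in> Y.P. Y.pr y \<in> f ` (D - X.pr ` X.P)}"
    by (intro Y.null_OM_negligible f_N X.off_polyhedron_null D_open) auto
  ultimately have "negligible (F ` S \<union> ({y \<in> Y.P. Y.pr y \<in> f ` (D - X.pr ` X.P)} \<union> {y \<in> Y.P. Y.pr y \<in> f ` (D \<inter> ND)}))"
    using ND_image_negligible by simp
  moreover have "{y \<in> Y.P. Y.pr y \<in> f ` (D - X.pr ` (\<Union>j. K j))} \<subseteq>
      F ` S \<union> ({y \<in> Y.P. Y.pr y \<in> f ` (D - X.pr ` X.P)} \<union> {y \<in> Y.P. Y.pr y \<in> f ` (D \<inter> ND)})"
  proof
    fix y assume "y \<in> {y \<in> Y.P. Y.pr y \<in> f ` (D - X.pr ` (\<Union>j. K j))}"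
    then obtain p where y: "y \<in> Y.P" "Y.pr y = f p" "p \<in> D" "p \<notin> X.pr ` (\<Union>j. K j)" by blast
    show "y \<in> F ` S \<union> ({y \<in> Y.P. Y.pr y \<in> f ` (D - X.pr ` X.P)} \<union> {y \<in> Y.P. Y.pr y \<in> f ` (D \<inter> ND)})"
    proof (cases "p \<in> X.pr ` X.P \<and> p \<notin> ND")
      case True
      then obtain x where x: "x \<in> X.P" "p = X.pr x" by blast
      have "f p \<in> Y.pr ` Y.P" using y(1) y(2)[symmetric] by blast
      then have x\<Omega>: "x \<in> \<Omega>" using x y(3) by (auto simp: \<Omega>_def)
      have "F x = y" using Y.sec_pr[OF y(1)] y(2) x(2) by (simp add: F_def)
      moreover have "x \<notin> (\<Union>j. K j)" using y(4) x(2) by blast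
      then have "\<not> W (X.pr x) < \<infinity>" using K x\<Omega> by blast
      then have "x \<in> S" using x\<Omega> True x(2) by (simp add: S_def)
      ultimately show ?thesis by blast
    next
      case False
      then show ?thesis using y by blast
    qed
  qed
  ultimately show ?thesis by (rule negligible_subset)
qed

end

section \<open>The pushed-forward function and its integral\<close>

context luzin_setting
begin

theorem push_forward:
  obtains \<rho>' where "\<rho>' \<in> borel_measurable Y.BO"
    "\<And>p. p \<in> D \<Longrightarrow> \<rho> p * W p \<le> \<rho>' (f p)"
    "(\<integral>\<^sup>+ q. \<rho>' q ^ CARD('n) \<partial>Y.OM) \<le>
      (\<integral>\<^sup>+ p\<in>D. orbit_inner_dilatation G G' f p * \<rho> p ^ CARD('n) \<partial>X.OM)"
proof -
  let ?n = "CARD('n)"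
  obtain K :: "nat \<Rightarrow> (real^'n) set" where K: "\<And>j. compact (K j)" "\<And>j. K j \<subseteq> \<Omega>" "\<And>j. inj_on F (K j)"
    "(\<Union>j. K j) = {x \<in> \<Omega>. W (X.pr x) < \<infinity>}"
    by (rule pieces) (rule that)
  \<comment> \<open>Disjoint pieces, so that the integrals over them add up to a single
    integral.\<close>
  define C where "C = disjointed K"
  have CK: "C j \<subseteq> K j" for j unfolding C_def by (rule disjointed_subset)
  have CU: "(\<Union>j. C j) = (\<Union>j. K j)" unfolding C_def by (rule UN_disjointed_eq)
  have Cdis: "disjoint_family C" unfolding C_def by (rule disjoint_family_disjointed)
  have Kb: "K j \<in> sets borel" for j using K(1) by (simp add: borel_compact)
  have Cb: "C j \<in> sets borel" for j
    using sets.range_disjointed_sets[of K borel] Kb unfolding C_def by auto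
  define g where "g j = inv_into (K j) F" for j
  have gF: "g j (F x) = x" if "x \<in> K j" for j x unfolding g_def by (rule inv_into_f_f[OF K(3) that])
  have FKc: "compact (F ` K j)" for j
    by (rule compact_continuous_image[OF continuous_on_subset[OF F_continuous K(2)] K(1)])
  have "continuous_on (F ` K j) (g j)" for j
    by (rule continuous_on_inv[OF continuous_on_subset[OF F_continuous K(2)] K(1)]) (simp add: gF)
  then have gm: "g j \<in> borel_measurable (restrict_space borel (F ` K j))" for j
    by (rule borel_measurable_continuous_on_restrict)
  \<comment> \<open>The image is Borel because it is the preimage of \<open>C j\<close> under the
    inverse of \<open>F\<close>, which is continuous on the compact image of
    \<open>K j\<close>.\<close>
  have FC: "F ` C j \<in> sets borel" for j
  proof -
    have "g j -` C j \<inter> space (restrict_space borel (F ` K j)) \<in> sets (restrict_space borel (F ` K j))"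
      by (rule measurable_sets[OF gm Cb])
    moreover have "g j -` C j \<inter> space (restrict_space borel (F ` K j)) = F ` C j"
      using gF CK[of j] by (auto simp: space_restrict_space)
    ultimately show ?thesis using FKc[of j] by (subst (asm) sets_restrict_space_iff) (auto simp: borel_compact)
  qed
  have gmC: "g j \<in> borel_measurable (restrict_space borel (F ` C j))" for j
    by (rule measurable_restrict_mono[OF gm]) (use CK in blast)
  define hh where "hh x = (\<rho> (X.pr x) * W (X.pr x)) * indicator unit_ball x" for x
  have hh: "hh \<in> borel_measurable borel"
  proof -
    have "(\<lambda>p. \<rho> p * W p) \<in> borel_measurable X.BO" using \<rho> W_measurable by measurable
    from measurable_compose[OF X.pr_measurable this]
    show ?thesis unfolding hh_def by (subst (asm) borel_measurable_restrict_space_iff_ennreal) auto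
  qed
  define t where "t j y = (if y \<in> F ` C j then hh (g j y) else 0)" for j y
  have tm: "t j \<in> borel_measurable borel" for j
    unfolding t_def
    by (rule measurable_If_restrict_space_iff[THEN iffD2])
       (use FC[of j] measurable_compose[OF gmC[of j] hh] in auto)
  have "negligible {y \<in> Y.P. Y.pr y \<in> f ` (D - X.pr ` (\<Union>j. K j))}" by (rule bad_image_negligible[OF K(4)])
  \<comment> \<open>A Borel null set around the uncontrolled points. The value infinity there and
    off the projected polyhedron makes \<open>\<rho> p * W p \<le> \<rho>' (f p)\<close> true at
    every point of \<open>D\<close>, as paths require, at no cost for the integral.\<close>
  then obtain E0 where E0: "E0 \<in> null_sets lborel" "{y \<in> Y.P. Y.pr y \<in> f ` (D - X.pr ` (\<Union>j. K j))} \<subseteq> E0"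
    unfolding negligible_iff_null_sets null_sets_completion_iff2 by blast
  have E0b: "E0 \<in> sets borel" using E0(1) by auto
  define R where "R y = (if y \<in> E0 then \<infinity> else (SUP j. t j y))" for y
  have Rm: "R \<in> borel_measurable borel" unfolding R_def using tm E0b by measurable
  define \<rho>' where "\<rho>' q = (if q \<in> Y.pr ` Y.P then R (Y.sec q) else \<infinity>)" for q
  have \<rho>'m: "\<rho>' \<in> borel_measurable Y.BO" unfolding \<rho>'_def by (rule Y.sec_measurable[OF Rm])
  have le: "\<rho> p * W p \<le> \<rho>' (f p)" if p: "p \<in> D" for p
  proof (cases "f p \<in> Y.pr ` Y.P \<and> Y.sec (f p) \<notin> E0")
    case True
    then have y: "Y.sec (f p) \<in> Y.P" "Y.pr (Y.sec (f p)) = f p" using Y.sec_in by blast+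
    have "p \<in> X.pr ` (\<Union>j. K j)" using E0(2) True y p by force
    then obtain j x where x: "x \<in> C j" "p = X.pr x" unfolding CU[symmetric] by blast
    then have x\<Omega>: "x \<in> \<Omega>" using CK K(2) by blast
    have "F x = Y.sec (f p)" using x(2) by (simp add: F_def)
    then have "t j (Y.sec (f p)) = hh x" using x(1) gF[of x j] CK[of j] unfolding t_def by (metis image_eqI subsetD)
    also have "\<dots> = \<rho> p * W p" using \<Omega>_sub(2)[OF x\<Omega>] x(2) by (simp add: hh_def)
    finally have "\<rho> p * W p \<le> (SUP j. t j (Y.sec (f p)))" by (metis SUP_upper UNIV_I)
    then show ?thesis using True by (simp add: \<rho>'_def R_def)
  next
    case False
    then show ?thesis by (auto simp: \<rho>'_def R_def)
  qed
  \<comment> \<open>On this set \<open>F\<close> need not be differentiable; its image is null by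
    Lusin's condition.\<close>
  define N where "N j = {x \<in> C j. X.pr x \<in> ND}" for j
  define A where "A j = C j - N j" for j
  define F' where "F' x = frechet_derivative F (at x)" for x
  have CP: "C j \<subseteq> X.P" for j by (rule order_trans[OF CK order_trans[OF K(2) \<Omega>_sub(1)]])
  have Nneg: "negligible (N j)" for j
    by (rule negligible_subset[OF X.null_OM_negligible[OF ND]]) (use CP[of j] in \<open>auto simp: N_def\<close>)
  have Nl: "N j \<in> sets lebesgue" for j using Nneg by (rule negligible_imp_sets)
  have FNneg: "negligible (F ` N j)" for j
  proof (rule negligible_subset[OF ND_image_negligible])
    show "F ` N j \<subseteq> {y \<in> Y.P. Y.pr y \<in> f ` (D \<inter> ND)}"
    proof
      fix y assume "y \<in> F ` N j"
      then obtain x where x: "x \<in> C j" "X.pr x \<in> ND" "y = F x" by (auto simp: N_def)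
      then have "x \<in> \<Omega>" using CK K(2) by blast
      then show "y \<in> {y \<in> Y.P. Y.pr y \<in> f ` (D \<inter> ND)}" using F_lift[of x] \<Omega>_sub(3)[of x] x by auto
    qed
  qed
  have A\<Omega>: "x \<in> \<Omega>" "W (X.pr x) < \<infinity>" "differentiable_in_coordinates G G' f (X.pr x)" "(F has_derivative F' x) (at x)"
    if "x \<in> A j" for x j
  proof -
    have x: "x \<in> C j" "X.pr x \<notin> ND" using that by (auto simp: A_def N_def)
    show x\<Omega>: "x \<in> \<Omega>" and "W (X.pr x) < \<infinity>" using x(1) CU K(4) by blast+
    show d: "differentiable_in_coordinates G G' f (X.pr x)" by (rule f_diff[OF \<Omega>_sub(3)[OF x\<Omega>] x(2)])
    show "(F has_derivative F' x) (at x)"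
      using F_differentiable[OF x\<Omega> d] by (simp add: frechet_derivative_works[symmetric] F'_def)
  qed
  have Al: "A j \<in> sets lebesgue" for j using Cb[of j] Nl[of j] by (auto simp: A_def)
  have derA: "(F has_derivative F' x) (at x within A j)" if "x \<in> A j" for x j
    by (rule has_derivative_at_withinI[OF A\<Omega>(4)[OF that]])
  \<comment> \<open>Extension by 0 off the open set \<open>\<Omega>\<close>, for the sake of Borel
    measurability only.\<close>
  define F1 where "F1 x = (if x \<in> \<Omega> then F x else 0)" for x
  have F1m: "F1 \<in> borel_measurable borel" unfolding F1_def
    by (rule borel_measurable_continuous_on_if) (use \<Omega>_open F_continuous in auto)
  define h where "h x = hh x ^ ?n * ennreal (conf_factor (F1 x) ^ ?n)" for x
  have hm: "h \<in> borel_measurable borel"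
    unfolding h_def using hh measurable_compose[OF F1m Y.conf_factor_measurable] by measurable
  have piece: "(\<integral>\<^sup>+ y. indicator (F ` C j) y * h (g j y) \<partial>lebesgue) \<le>
      (\<integral>\<^sup>+ x. indicator (A j) x * ennreal \<bar>det (matrix (F' x))\<bar> * h x \<partial>lebesgue)" for j
    unfolding A_def
    by (rule nn_integral_injective_image_le[OF _ Cb FC gmC Nl FNneg _ _ hm])
       (use gF CK derA in \<open>auto simp: N_def A_def\<close>)
  define H where "H x = indicator (\<Union>j. A j) x * (ennreal \<bar>det (matrix (F' x))\<bar> * h x)" for x
  have hl: "h \<in> borel_measurable lebesgue" using measurable_completion[of h lborel borel] hm by simp
  have Hj: "(\<lambda>x. indicator (A j) x * ennreal \<bar>det (matrix (F' x))\<bar> * h x) \<in> borel_measurable lebesgue" for j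
    by (rule borel_measurable_times_ennreal[OF area_inequality(1)[OF Al] hl]) (rule derA)
  have Adis: "disjoint_family A" using Cdis by (fastforce simp: A_def disjoint_family_on_def)
  have Hsum: "H x = (\<Sum>j. indicator (A j) x * ennreal \<bar>det (matrix (F' x))\<bar> * h x)" for x
  proof -
    have "(\<Sum>j. indicator (A j) x :: ennreal) = indicator (\<Union>j. A j) x" by (rule suminf_indicator[OF Adis])
    then show ?thesis unfolding H_def mult.assoc by (simp add: ennreal_suminf_multc)
  qed
  have Hm: "H \<in> borel_measurable lebesgue" unfolding Hsum[abs_def] using Hj by (intro borel_measurable_suminf_order)
  have Hint: "(\<integral>\<^sup>+ x. H x \<partial>lebesgue) = (\<Sum>j. \<integral>\<^sup>+ x. indicator (A j) x * ennreal \<bar>det (matrix (F' x))\<bar> * h x \<partial>lebesgue)"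
    unfolding Hsum using Hj by (intro nn_integral_suminf)
  have upper: "(\<integral>\<^sup>+ q. \<rho>' q ^ ?n \<partial>Y.OM) \<le> (\<integral>\<^sup>+ x. H x \<partial>lebesgue)"
  proof -
    have pm: "(\<lambda>q. \<rho>' q ^ ?n) \<in> borel_measurable Y.BO" using \<rho>'m by measurable
    have "(\<integral>\<^sup>+ q. \<rho>' q ^ ?n \<partial>Y.OM) = (\<integral>\<^sup>+ y. indicator Y.P y * (\<rho>' (Y.pr y) ^ ?n * ennreal (conf_factor y ^ ?n)) \<partial>lebesgue)"
      by (rule Y.nn_integral_OM[OF pm])
    also have "\<dots> \<le> (\<integral>\<^sup>+ y. (\<Sum>j. indicator (F ` C j) y * h (g j y)) \<partial>lebesgue)"
    proof (rule nn_integral_mono_AE)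
      have "E0 \<in> null_sets lebesgue" using E0(1) by (rule null_sets_completionI)
      from AE_not_in[OF this]
      show "AE y in lebesgue. indicator Y.P y * (\<rho>' (Y.pr y) ^ ?n * ennreal (conf_factor y ^ ?n)) \<le> (\<Sum>j. indicator (F ` C j) y * h (g j y))"
      proof eventually_elim
        case (elim y)
        show ?case
        proof (cases "y \<in> Y.P")
          case True
          have "\<rho>' (Y.pr y) = (SUP j. t j y)" using True elim Y.sec_pr[OF True] by (auto simp: \<rho>'_def R_def)
          then have "\<rho>' (Y.pr y) ^ ?n * ennreal (conf_factor y ^ ?n) \<le> (\<Sum>j. t j y ^ ?n) * ennreal (conf_factor y ^ ?n)"
            using SUP_power_le_suminf[of ?n "\<lambda>j. t j y"] by (intro mult_right_mono) auto
          also have "\<dots> = (\<Sum>j. t j y ^ ?n * ennreal (conf_factor y ^ ?n))" by (simp add: ennreal_suminf_multc)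
          also have "(\<lambda>j. t j y ^ ?n * ennreal (conf_factor y ^ ?n)) = (\<lambda>j. indicator (F ` C j) y * h (g j y))"
          proof
            fix j show "t j y ^ ?n * ennreal (conf_factor y ^ ?n) = indicator (F ` C j) y * h (g j y)"
            proof (cases "y \<in> F ` C j")
              case True
              then obtain x where x: "x \<in> C j" "y = F x" by blast
              then have "g j y = x" "x \<in> \<Omega>" using gF CK K(2) by blast+
              then show ?thesis using x(2) True by (simp add: t_def h_def F1_def)
            qed (simp add: t_def)
          qed
          finally show ?thesis using True by simp
        qed simp
      qed
    qed
    also have "\<dots> = (\<Sum>j. \<integral>\<^sup>+ y. indicator (F ` C j) y * h (g j y) \<partial>lebesgue)"
    proof (rule nn_integral_suminf)
      fix j
      have "(\<lambda>y. if y \<in> F ` C j then h (g j y) else 0) \<in> borel_measurable borel"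
        by (rule measurable_If_restrict_space_iff[THEN iffD2])
           (use FC[of j] measurable_compose[OF gmC[of j] hm] in auto)
      moreover have "(\<lambda>y. if y \<in> F ` C j then h (g j y) else 0) = (\<lambda>y. indicator (F ` C j) y * h (g j y))" by auto
      ultimately have "(\<lambda>y. indicator (F ` C j) y * h (g j y)) \<in> borel_measurable lborel" by simp
      then show "(\<lambda>y. indicator (F ` C j) y * h (g j y)) \<in> borel_measurable lebesgue" by (rule measurable_completion)
    qed
    also have "\<dots> \<le> (\<Sum>j. \<integral>\<^sup>+ x. indicator (A j) x * ennreal \<bar>det (matrix (F' x))\<bar> * h x \<partial>lebesgue)"
      by (intro suminf_le piece) auto
    finally show ?thesis unfolding Hint .
  qed
  have lower: "(\<integral>\<^sup>+ x. H x \<partial>lebesgue) \<le> (\<integral>\<^sup>+ p\<in>D. orbit_inner_dilatation G G' f p * \<rho> p ^ ?n \<partial>X.OM)"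
  proof -
    have Hle: "H x \<le> orbit_inner_dilatation G G' f (X.pr x) * \<rho> (X.pr x) ^ ?n * indicator D (X.pr x) * ennreal (conf_factor x ^ ?n)" for x
    proof (cases "x \<in> (\<Union>j. A j)")
      case True
      then obtain j where j: "x \<in> A j" by blast
      note x = A\<Omega>[OF j]
      have D: "X.pr x \<in> D" by (rule \<Omega>_sub(3)[OF x(1)])
      have Hx: "H x = \<rho> (X.pr x) ^ ?n * (W (X.pr x) ^ ?n * ennreal (\<bar>det (matrix (F' x))\<bar> * conf_factor (F x) ^ ?n))"
        using True x(1) \<Omega>_sub(2)[OF x(1)] conf_factor_pos[OF \<Omega>_sub(4)[OF x(1)]]
        by (simp add: H_def h_def hh_def F1_def ennreal_mult power_mult_distrib ac_simps)
      show ?thesis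
      \<comment> \<open>Where the Jacobian vanishes the left side is 0; elsewhere
        \<open>W_dilatation\<close> applies.\<close>
      proof (cases "det (matrix (F' x)) = 0")
        case True then show ?thesis unfolding Hx by simp
      next
        case False
        have "H x \<le> \<rho> (X.pr x) ^ ?n * (orbit_inner_dilatation G G' f (X.pr x) * ennreal (conf_factor x ^ ?n))"
          unfolding Hx by (intro mult_left_mono W_dilatation(2)[OF x(1,3,4) False]) simp
        then show ?thesis using D by (simp add: ac_simps)
      qed
    qed (simp add: H_def)
    \<comment> \<open>The integrand on the right is not known to be measurable, so it cannot be
      pulled back to the ball. Instead \<open>H\<close> is replaced by a Borel function that equals
      it almost everywhere and is never larger, and this one is carried to the orbit space and
      compared there pointwise.\<close>
    obtain Hb where Hb: "Hb \<in> borel_measurable lborel" "AE x in lborel. H x = Hb x"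
      using completion_ex_borel_measurable[OF Hm] by blast
    obtain N1 where N1: "N1 \<in> null_sets lborel" "{x \<in> space lborel. \<not> H x = Hb x} \<subseteq> N1"
      using Hb(2) by (auto elim!: AE_E simp: null_sets_def)
    define Hc where "Hc x = Hb x * indicator (X.P - N1) x" for x
    have Hcm: "Hc \<in> borel_measurable borel"
      unfolding Hc_def using Hb(1) N1(1) X.P_open by (intro borel_measurable_times_ennreal borel_measurable_indicator) auto
    have HcH: "Hc x \<le> H x" for x
    proof (cases "x \<in> N1")
      case False
      then have "H x = Hb x" using N1(2) by auto
      then show ?thesis by (simp add: Hc_def indicator_def)
    qed (simp add: Hc_def)
    have HP: "H x = 0" if "x \<notin> X.P" for x using that A\<Omega>(1) \<Omega>_sub(1) by (auto simp: H_def indicator_def)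
    \<comment> \<open>Divides by the density of the hyperbolic measure, which
      \<open>X.nn_integral_OM\<close> multiplies in again.\<close>
    define q where "q x = Hc x * ennreal (1 / conf_factor x ^ ?n)" for x
    have qm: "q \<in> borel_measurable borel" unfolding q_def using Hcm X.conf_factor_measurable by measurable
    define Ho where "Ho p = (if p \<in> X.pr ` X.P then q (X.sec p) else 0)" for p
    have Hom: "Ho \<in> borel_measurable X.BO" unfolding Ho_def by (rule X.sec_measurable[OF qm])
    have inv: "ennreal (1 / conf_factor x ^ ?n) * ennreal (conf_factor x ^ ?n) = 1" if "x \<in> X.P" for x
      using conf_factor_pos[of x] that X.P_sub by (subst ennreal_mult[symmetric]) auto
    have "(\<integral>\<^sup>+ x. H x \<partial>lebesgue) = (\<integral>\<^sup>+ x. Hc x \<partial>lebesgue)"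
    proof (rule nn_integral_cong_AE)
      have "N1 \<in> null_sets lebesgue" using N1(1) by (rule null_sets_completionI)
      from AE_not_in[OF this] show "AE x in lebesgue. H x = Hc x"
      proof eventually_elim
        case (elim x)
        then have "H x = Hb x" using N1(2) by auto
        then show ?case using elim HP[of x] by (cases "x \<in> X.P") (auto simp: Hc_def)
      qed
    qed
    also have "\<dots> = (\<integral>\<^sup>+ x. indicator X.P x * (Ho (X.pr x) * ennreal (conf_factor x ^ ?n)) \<partial>lebesgue)"
    proof (rule nn_integral_cong)
      fix x
      show "Hc x = indicator X.P x * (Ho (X.pr x) * ennreal (conf_factor x ^ ?n))"
      proof (cases "x \<in> X.P")
        case True
        then have "Ho (X.pr x) = Hc x * ennreal (1 / conf_factor x ^ ?n)" using X.sec_pr by (simp add: Ho_def q_def)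
        then show ?thesis using True inv[OF True] by (simp add: mult.assoc)
      qed (simp add: Hc_def)
    qed
    also have "\<dots> = (\<integral>\<^sup>+ p. Ho p \<partial>X.OM)" by (rule X.nn_integral_OM[OF Hom, symmetric])
    also have "\<dots> \<le> (\<integral>\<^sup>+ p\<in>D. orbit_inner_dilatation G G' f p * \<rho> p ^ ?n \<partial>X.OM)"
    proof (rule nn_integral_mono)
      fix p
      show "Ho p \<le> orbit_inner_dilatation G G' f p * \<rho> p ^ ?n * indicator D p"
      proof (cases "p \<in> X.pr ` X.P")
        case True
        then obtain x where x: "x \<in> X.P" "p = X.pr x" by blast
        let ?B = "orbit_inner_dilatation G G' f p * \<rho> p ^ ?n * indicator D p"
        have "Ho p = Hc x * ennreal (1 / conf_factor x ^ ?n)" using X.sec_pr[OF x(1)] True x(2) by (simp add: Ho_def q_def)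
        also have "\<dots> \<le> (?B * ennreal (conf_factor x ^ ?n)) * ennreal (1 / conf_factor x ^ ?n)"
          using order_trans[OF HcH Hle, of x] unfolding x(2) by (intro mult_right_mono) auto
        also have "\<dots> = ?B * (ennreal (1 / conf_factor x ^ ?n) * ennreal (conf_factor x ^ ?n))" by (simp only: ac_simps)
        also have "\<dots> = ?B" using inv[OF x(1)] by simp
        finally show ?thesis .
      qed (simp add: Ho_def)
    qed
    finally show ?thesis .
  qed
  show thesis by (rule that[OF \<rho>'m le order_trans[OF upper lower]])
qed

end

section \<open>The modulus inequality\<close>

context deck_group
begin

lemma set_metric_orbit: "set_metric (pr ` unit_ball) orbit_dist"
proof unfold_locales
  show "0 \<le> orbit_dist x y" if "x \<in> pr ` unit_ball" "y \<in> pr ` unit_ball" for x y by (rule orbit_dist_metric(1)[OF that])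
  show "orbit_dist x y = 0 \<longleftrightarrow> x = y" if "x \<in> pr ` unit_ball" "y \<in> pr ` unit_ball" for x y by (rule orbit_dist_metric(2)[OF that])
  show "orbit_dist x y = orbit_dist y x" if "x \<in> pr ` unit_ball" "y \<in> pr ` unit_ball" for x y by (rule orbit_dist_metric(3)[OF that])
  show "orbit_dist x z \<le> orbit_dist x y + orbit_dist y z" if "x \<in> pr ` unit_ball" "y \<in> pr ` unit_ball" "z \<in> pr ` unit_ball" for x y z
    by (rule orbit_dist_metric(4)[OF that])
qed

lemma openin_metric_ball:
  assumes p: "p \<in> pr ` unit_ball"
  shows "openin (orbit_space G) {q \<in> pr ` unit_ball. orbit_dist p q < e}"
  unfolding openin_orbit_space_metric
proof (intro conjI ballI)
  show "{q \<in> pr ` unit_ball. orbit_dist p q < e} \<subseteq> pr ` unit_ball" by blast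
  fix q assume "q \<in> {q \<in> pr ` unit_ball. orbit_dist p q < e}"
  then have q: "q \<in> pr ` unit_ball" "orbit_dist p q < e" by auto
  have "s \<in> {q \<in> pr ` unit_ball. orbit_dist p q < e}" if s: "s \<in> pr ` unit_ball" "orbit_dist q s < e - orbit_dist p q" for s
    using orbit_dist_metric(4)[OF p q(1) s(1)] s by simp
  then show "\<exists>r>0. \<forall>s\<in>pr ` unit_ball. orbit_dist q s < r \<longrightarrow> s \<in> {q \<in> pr ` unit_ball. orbit_dist p q < e}"
    using q(2) by (intro exI[of _ "e - orbit_dist p q"]) simp
qed

lemma continuous_map_metric:
  assumes \<gamma>: "continuous_map (top_of_set \<Delta>) (orbit_space G) \<gamma>" and sub: "{a..b} \<subseteq> \<Delta>"
  shows "set_metric.curve_continuous (pr ` unit_ball) orbit_dist a b \<gamma>"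
proof -
  have M: "\<gamma> t \<in> pr ` unit_ball" if "t \<in> \<Delta>" for t
    using continuous_map_funspace[OF \<gamma>] that by (auto simp: topspace_orbit_space Pi_iff)
  have "\<exists>\<delta>>0. \<forall>s\<in>{a..b}. \<bar>s - t\<bar> < \<delta> \<longrightarrow> orbit_dist (\<gamma> t) (\<gamma> s) < e" if t: "t \<in> {a..b}" and e: "e > 0" for t e
  proof -
    have t\<Delta>: "t \<in> \<Delta>" using t sub by blast
    let ?U = "{q \<in> pr ` unit_ball. orbit_dist (\<gamma> t) q < e}"
    have "openin (top_of_set \<Delta>) {s \<in> topspace (top_of_set \<Delta>). \<gamma> s \<in> ?U}"
      by (rule openin_continuous_map_preimage[OF \<gamma> openin_metric_ball[OF M[OF t\<Delta>]]])
    moreover have "orbit_dist (\<gamma> t) (\<gamma> t) = 0" using orbit_dist_metric(2)[OF M[OF t\<Delta>] M[OF t\<Delta>]] by simp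
    then have "t \<in> {s \<in> topspace (top_of_set \<Delta>). \<gamma> s \<in> ?U}" using t\<Delta> M[OF t\<Delta>] e by simp
    ultimately obtain \<delta> where \<delta>: "\<delta> > 0" "ball t \<delta> \<inter> \<Delta> \<subseteq> {s \<in> topspace (top_of_set \<Delta>). \<gamma> s \<in> ?U}"
      unfolding openin_contains_ball by blast
    have "orbit_dist (\<gamma> t) (\<gamma> s) < e" if "s \<in> {a..b}" "\<bar>s - t\<bar> < \<delta>" for s
    proof -
      have "s \<in> ball t \<delta> \<inter> \<Delta>" using that sub by (auto simp: dist_real_def abs_minus_commute)
      then show ?thesis using \<delta>(2) by blast
    qed
    then show ?thesis using \<delta>(1) by blast
  qed
  then show ?thesis unfolding set_metric.curve_continuous_def[OF set_metric_orbit] using M sub by blast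
qed

lemma continuous_map_orbit_near:
  fixes G' :: "(real^'m \<Rightarrow> real^'m) set"
  assumes G': "deck_group G'" and D: "openin (orbit_space G) D"
    and f: "continuous_map (subtopology (orbit_space G) D) (orbit_space G') f" and p: "p \<in> D" and e: "e > 0"
  shows "\<exists>\<delta>>0. \<forall>q\<in>D. orbit_dist p q < \<delta> \<longrightarrow> orbit_dist (f p) (f q) < e"
proof -
  interpret Y: deck_group G' by (rule G')
  have ts: "topspace (subtopology (orbit_space G) D) = D" using openin_subset[OF D] by auto
  have M: "f q \<in> Y.pr ` unit_ball" if "q \<in> D" for q
    using continuous_map_funspace[OF f] that unfolding ts by (auto simp: topspace_orbit_space Pi_iff)
  let ?U = "{q \<in> Y.pr ` unit_ball. orbit_dist (f p) q < e}"
  have "openin (subtopology (orbit_space G) D) {q \<in> topspace (subtopology (orbit_space G) D). f q \<in> ?U}"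
    by (rule openin_continuous_map_preimage[OF f Y.openin_metric_ball[OF M[OF p]]])
  then have o: "openin (orbit_space G) {q \<in> D. f q \<in> ?U}" unfolding ts using D openin_trans_full by blast
  have "orbit_dist (f p) (f p) = 0" using Y.orbit_dist_metric(2)[OF M[OF p] M[OF p]] by simp
  then have pin: "p \<in> {q \<in> D. f q \<in> ?U}" using p M[OF p] e by simp
  obtain r where r: "r > 0" "\<forall>q\<in>pr ` unit_ball. orbit_dist p q < r \<longrightarrow> q \<in> {q \<in> D. f q \<in> ?U}"
    using o[unfolded openin_orbit_space_metric, THEN conjunct2, rule_format, OF pin] by blast
  have "D \<subseteq> pr ` unit_ball" using D by (simp add: openin_orbit_space)
  then show ?thesis using r by blast
qed

text \<open>A path inside a discrete set is locally constant, hence constant on a connected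
  interval. This is how discreteness of \<open>f\<close> enters: a lift stands still whenever its
  image does.\<close>

lemma discrete_fiber_constant:
  assumes \<gamma>: "set_metric.curve_continuous (pr ` unit_ball) orbit_dist u v \<gamma>" and t: "t \<in> {u..v}"
    and D: "\<And>s. s \<in> {u..v} \<Longrightarrow> \<gamma> s \<in> Z" and disc: "\<And>p. p \<in> Z \<Longrightarrow> \<exists>U. openin (orbit_space G) U \<and> U \<inter> Z = {p}"
  shows "\<gamma> t = \<gamma> u"
proof (rule connected_local_const[where A = "{u..v}"])
  note c = \<gamma>[unfolded set_metric.curve_continuous_def[OF set_metric_orbit]]
  show "connected {u..v}" by simp
  show "t \<in> {u..v}" "u \<in> {u..v}" using t by auto
  show "\<forall>a\<in>{u..v}. \<forall>\<^sub>F b in at a within {u..v}. \<gamma> a = \<gamma> b"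
  proof
    fix a assume a: "a \<in> {u..v}"
    obtain U where U: "openin (orbit_space G) U" "U \<inter> Z = {\<gamma> a}" using disc[OF D[OF a]] by blast
    then have "\<gamma> a \<in> U" by blast
    then obtain r where r: "r > 0" "\<forall>q\<in>pr ` unit_ball. orbit_dist (\<gamma> a) q < r \<longrightarrow> q \<in> U"
      using U(1) unfolding openin_orbit_space_metric by blast
    obtain \<delta> where \<delta>: "\<delta> > 0" "\<forall>s\<in>{u..v}. \<bar>s - a\<bar> < \<delta> \<longrightarrow> orbit_dist (\<gamma> a) (\<gamma> s) < r" using c a r(1) by blast
    have "\<gamma> a = \<gamma> b" if "b \<in> {u..v}" "dist b a < \<delta>" for b
    proof -
      have "\<gamma> b \<in> pr ` unit_ball" using c that(1) by blast
      moreover have "orbit_dist (\<gamma> a) (\<gamma> b) < r" using \<delta>(2) that by (simp add: dist_real_def)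
      ultimately have "\<gamma> b \<in> U \<inter> Z" using r(2) D[OF that(1)] by blast
      then show ?thesis using U(2) by blast
    qed
    then show "\<forall>\<^sub>F b in at a within {u..v}. \<gamma> a = \<gamma> b" unfolding eventually_at using \<delta>(1) by blast
  qed
qed

end

lemma curve_integral_mono:
  assumes "\<And>p. \<rho> p \<le> \<sigma> p" shows "curve_integral d \<rho> c \<le> curve_integral d \<sigma> c"
proof -
  obtain \<Delta> \<gamma> where c: "c = (\<Delta>, \<gamma>)" by (cases c)
  have "segment_integral d \<rho> \<gamma> a b \<le> segment_integral d \<sigma> \<gamma> a b" for a b
    unfolding segment_integral_def by (intro nn_integral_mono mult_right_mono assms) simp
  then show ?thesis unfolding curve_integral_def c prod.case by (intro SUP_mono) auto
qed

text \<open>Both integrals are suprema over the same closed subsegments, so it suffices to compare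
  them segment by segment.\<close>

lemma (in luzin_setting) curve_integral_push_forward:
  assumes W\<rho>': "\<And>p. p \<in> D \<Longrightarrow> \<rho> p * W p \<le> \<rho>' (f p)"
    and path: "(\<Delta>, \<gamma>) \<in> paths_in (orbit_space G) D"
    and path': "continuous_map (top_of_set \<Delta>) (orbit_space G') (f \<circ> \<gamma>)"
    and disc: "\<And>p. p \<in> D \<Longrightarrow> \<exists>U. openin (orbit_space G) U \<and> U \<inter> {q \<in> D. f q = f p} = {p}"
    and rect: "locally_rectifiable orbit_dist (\<Delta>, \<gamma>)" "locally_rectifiable orbit_dist (\<Delta>, f \<circ> \<gamma>)"
    and AC: "lift_inverse_abs_continuous orbit_dist orbit_dist \<Delta> \<gamma> (f \<circ> \<gamma>)"
  shows "curve_integral orbit_dist \<rho> (\<Delta>, \<gamma>) \<le> curve_integral orbit_dist \<rho>' (\<Delta>, f \<circ> \<gamma>)"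
proof -
  have \<Delta>: "param_interval \<Delta>" and c: "continuous_map (top_of_set \<Delta>) (orbit_space G) \<gamma>" and D: "\<And>t. t \<in> \<Delta> \<Longrightarrow> \<gamma> t \<in> D"
    using path by (auto simp: paths_in_def)
  have "segment_integral orbit_dist \<rho> \<gamma> a b \<le> segment_integral orbit_dist \<rho>' (f \<circ> \<gamma>) a b"
    if ab: "a \<le> b" "{a..b} \<subseteq> \<Delta>" for a b
  proof -
    have cv: "rectifiable_curve (X.pr ` unit_ball) orbit_dist \<gamma> a b"
      unfolding rectifiable_curve_def rectifiable_curve_axioms_def
      using X.set_metric_orbit ab X.continuous_map_metric[OF c ab(2)] rect(1) by (auto simp: locally_rectifiable_def)
    have cv': "rectifiable_curve (Y.pr ` unit_ball) orbit_dist (f \<circ> \<gamma>) a b"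
      unfolding rectifiable_curve_def rectifiable_curve_axioms_def
      using Y.set_metric_orbit ab Y.continuous_map_metric[OF path' ab(2)] rect(2) by (auto simp: locally_rectifiable_def)
    have M: "\<gamma> ` \<Delta> \<subseteq> X.pr ` unit_ball" "(f \<circ> \<gamma>) ` \<Delta> \<subseteq> Y.pr ` unit_ball"
      using D D_sub f_in by auto
    have light: "\<gamma> t = \<gamma> u"
      if uv: "u \<le> v" "{u..v} \<subseteq> \<Delta>" "\<And>t. t \<in> {u..v} \<Longrightarrow> (f \<circ> \<gamma>) t = (f \<circ> \<gamma>) u" "t \<in> {u..v}" for u v t
    proof (rule X.discrete_fiber_constant[OF X.continuous_map_metric[OF c uv(2)] uv(4), of "{q \<in> D. f q = f (\<gamma> u)}"])
      show "\<gamma> s \<in> {q \<in> D. f q = f (\<gamma> u)}" if "s \<in> {u..v}" for s using uv(2) uv(3)[OF that] D that by auto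
      fix p assume p: "p \<in> {q \<in> D. f q = f (\<gamma> u)}"
      then show "\<exists>U. openin (orbit_space G) U \<and> U \<inter> {q \<in> D. f q = f (\<gamma> u)} = {p}" using disc[of p] by auto
    qed
    obtain g where g: "abs_continuous_on_segment 0 (enn2real (curve_length orbit_dist (f \<circ> \<gamma>) a b)) g"
      "\<And>t. t \<in> {a..b} \<Longrightarrow> g (enn2real (curve_length orbit_dist (f \<circ> \<gamma>) a t)) = enn2real (curve_length orbit_dist \<gamma> a t)"
      by (rule lift_inverse_parametrization[OF X.set_metric_orbit Y.set_metric_orbit \<Delta> ab M rect
            Y.continuous_map_metric[OF path'] light AC]) (assumption | rule that)+
    show ?thesis
    proof (rule nn_integral_lift_le[OF cv cv'])
      show "(f \<circ> \<gamma>) t = f (\<gamma> t)" "\<gamma> t \<in> D" if "t \<in> {a..b}" for t using that ab(2) D by auto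
      show "abs_continuous_on_segment 0 (rectifiable_curve.len orbit_dist (f \<circ> \<gamma>) a b) g"
        using g(1) by (simp add: rectifiable_curve.len_def[OF cv'])
      show "g (rectifiable_curve.len orbit_dist (f \<circ> \<gamma>) a t) = rectifiable_curve.len orbit_dist \<gamma> a t" if "t \<in> {a..b}" for t
        using g(2)[OF that] by (simp add: rectifiable_curve.len_def[OF cv] rectifiable_curve.len_def[OF cv'])
      show "\<exists>\<eta>>0. \<forall>q\<in>D. orbit_dist p q < \<eta> \<longrightarrow> orbit_dist p q \<le> (enn2real (W p) + e) * orbit_dist (f p) (f q)"
        if "p \<in> D" "W p < \<infinity>" "e > 0" for p e by (rule W_near[OF that])
      show "\<rho> p * W p \<le> \<rho>' (f p)" if "p \<in> D" for p by (rule W\<rho>'[OF that])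
      fix c :: "real \<Rightarrow> (real^'n) set"
      assume cD: "\<And>s. c s \<in> D" and cc: "\<And>s e. e > 0 \<Longrightarrow> \<exists>\<eta>>0. \<forall>t. \<bar>t - s\<bar> < \<eta> \<longrightarrow> orbit_dist (c s) (c t) < e"
      have "c \<in> measurable borel X.BO" by (rule X.continuous_curve_measurable) (use cD D_sub cc in blast)+
      then show "(\<lambda>s. W (c s)) \<in> borel_measurable borel \<and> (\<lambda>s. \<rho> (c s)) \<in> borel_measurable borel"
        using measurable_compose[of c borel X.BO] W_measurable \<rho> by blast
    qed
  qed
  then show ?thesis unfolding curve_integral_def prod.case by (intro SUP_mono) auto
qed

theorem corollary1p2:
  fixes G G' :: "(real^'n \<Rightarrow> real^'n) set"
    and p0 p0' :: "real^'n"
    and D D' :: "(real^'n) set set"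
    and f :: "(real^'n) set \<Rightarrow> (real^'n) set"
    and \<Gamma> :: "(real^'n) set curve set"
    and \<rho> :: "(real^'n) set \<Rightarrow> ennreal"
  assumes "2 \<le> CARD('n)"
    and "moebius_group G" and "acts_discontinuously G" and "no_fixed_points G"
    and "moebius_group G'" and "acts_discontinuously G'" and "no_fixed_points G'"
    and "p0 \<in> unit_ball" and "p0' \<in> unit_ball"
    and "domain_in (orbit_space G) D" and "compactin (orbit_space G) (orbit_space G closure_of D)"
    and "domain_in (orbit_space G') D'" and "compactin (orbit_space G') (orbit_space G' closure_of D')"
    and "continuous_map (subtopology (orbit_space G) D) (subtopology (orbit_space G') D') f"
    and "open_map (subtopology (orbit_space G) D) (subtopology (orbit_space G') D') f"
    and "discrete_mapping (orbit_space G) D D' f"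
    and "AE p in orbit_measure G p0. p \<in> D \<longrightarrow> differentiable_in_coordinates G G' f p"
    and "ACP_inverse G D G' p0' f"
    and "luzin_N G p0 D G' p0' f"
    and "luzin_N_inverse G p0 D G' p0' D' f"
    and "\<Gamma> \<subseteq> paths_in (orbit_space G) D"
    and "\<rho> \<in> admissible G \<Gamma>"
  shows "modulus G' p0' (image_family f \<Gamma>) \<le>
    (\<integral>\<^sup>+ p\<in>D. orbit_inner_dilatation G G' f p * \<rho> p ^ CARD('n) \<partial>orbit_measure G p0)"
proof -
  note cont = assms(14) and disc = assms(16) and diff = assms(17) and acp = assms(18) and N = assms(19)
    and \<Gamma> = assms(21)
  interpret X: polyhedral_group G p0 by unfold_locales (use assms in auto)
  interpret Y: polyhedral_group G' p0' by unfold_locales (use assms in auto)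
  have D: "openin (orbit_space G) D" using assms(10) by (simp add: domain_in_def)
  have D': "openin (orbit_space G') D'" using assms(12) by (simp add: domain_in_def)
  have cont': "continuous_map (subtopology (orbit_space G) D) (orbit_space G') f"
    using cont continuous_map_in_subtopology by blast
  have tsD: "topspace (subtopology (orbit_space G) D) = D" using openin_subset[OF D] by auto
  have fD': "f p \<in> D'" if "p \<in> D" for p
    using cont that tsD by (auto simp: continuous_map_in_subtopology image_subset_iff_funcset Pi_iff)
  \<comment> \<open>The exceptional set of the almost everywhere statement need not be measurable,
    so it is enlarged to a null set.\<close>
  obtain ND where ND: "{p \<in> space X.OM. \<not> (p \<in> D \<longrightarrow> differentiable_in_coordinates G G' f p)} \<subseteq> ND" "ND \<in> null_sets X.OM"
    using diff by (auto elim!: AE_E simp: null_sets_def)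
  interpret luzin_setting G p0 G' p0' D f ND \<rho>
  proof
    show "openin (orbit_space G) D" by (rule D)
    show "f p \<in> Y.pr ` unit_ball" if "p \<in> D" for p
      using fD'[OF that] D' by (auto simp: openin_orbit_space)
    show "\<exists>\<delta>>0. \<forall>q\<in>D. orbit_dist p q < \<delta> \<longrightarrow> orbit_dist (f p) (f q) < e" if "p \<in> D" "e > 0" for p e
      by (rule X.continuous_map_orbit_near[OF Y.deck_group_axioms D cont' that])
    show "f ` A \<in> null_sets Y.OM" if "A \<subseteq> D" "A \<in> null_sets X.OM" for A using N that unfolding luzin_N_def by blast
    show "ND \<in> null_sets X.OM" by (rule ND(2))
    show "differentiable_in_coordinates G G' f p" if "p \<in> D" "p \<notin> ND" for p
    proof -
      have "p \<in> space X.OM" using openin_subset[OF D] that(1) by (auto simp: space_orbit_measure topspace_orbit_space)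
      then show ?thesis using ND(1) that by blast
    qed
    show "\<rho> \<in> borel_measurable X.BO" using assms(22) by (simp add: admissible_def)
  qed
  obtain \<rho>' where \<rho>': "\<rho>' \<in> borel_measurable Y.BO" "\<And>p. p \<in> D \<Longrightarrow> \<rho> p * W p \<le> \<rho>' (f p)"
    "(\<integral>\<^sup>+ q. \<rho>' q ^ CARD('n) \<partial>Y.OM) \<le>
      (\<integral>\<^sup>+ p\<in>D. orbit_inner_dilatation G G' f p * \<rho> p ^ CARD('n) \<partial>X.OM)"
    by (rule push_forward) (rule that)
  define \<Gamma>0 where "\<Gamma>0 = {(\<Delta>, \<gamma>') \<in> paths_in (orbit_space G') (f ` D).
        \<not> (locally_rectifiable orbit_dist (\<Delta>, \<gamma>') \<longrightarrow>
            (\<forall>\<gamma>. (\<Delta>, \<gamma>) \<in> paths_in (orbit_space G) D \<and> (\<forall>t\<in>\<Delta>. f (\<gamma> t) = \<gamma>' t) \<longrightarrow>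
              locally_rectifiable orbit_dist (\<Delta>, \<gamma>) \<and>
              lift_inverse_abs_continuous orbit_dist orbit_dist \<Delta> \<gamma> \<gamma>'))}"
  have \<Gamma>0: "modulus G' p0' \<Gamma>0 = 0" using acp unfolding ACP_inverse_def \<Gamma>0_def .
  show ?thesis
  proof (rule ennreal_le_epsilon)
    fix e :: real assume "e > 0"
    then have "modulus G' p0' \<Gamma>0 < ennreal e" using \<Gamma>0 by simp
    then obtain \<rho>0 where \<rho>0: "\<rho>0 \<in> admissible G' \<Gamma>0" "(\<integral>\<^sup>+ q. \<rho>0 q ^ CARD('n) \<partial>Y.OM) < ennreal e"
      unfolding modulus_def INF_less_iff by blast
    have \<rho>0m: "\<rho>0 \<in> borel_measurable Y.BO" using \<rho>0(1) by (simp add: admissible_def)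
    \<comment> \<open>The \<open>n\<close>th power of a maximum is at most the sum of the
      \<open>n\<close>th powers, so no constant factor appears as it would for a sum.\<close>
    define \<sigma> where "\<sigma> q = max (\<rho>' q) (\<rho>0 q)" for q
    have "\<sigma> \<in> admissible G' (image_family f \<Gamma>)"
      unfolding admissible_def
    proof (intro CollectI conjI ballI impI)
      show "\<sigma> \<in> borel_measurable Y.BO" unfolding \<sigma>_def using \<rho>'(1) \<rho>0m by measurable
      fix c' assume "c' \<in> image_family f \<Gamma>" and rect': "locally_rectifiable orbit_dist c'"
      then obtain \<Delta> \<gamma> where c': "c' = (\<Delta>, f \<circ> \<gamma>)" and \<gamma>: "(\<Delta>, \<gamma>) \<in> \<Gamma>" unfolding image_family_def by blast
      have path: "(\<Delta>, \<gamma>) \<in> paths_in (orbit_space G) D" using \<gamma> \<Gamma> by blast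
      then have \<Delta>: "param_interval \<Delta>" and c: "continuous_map (top_of_set \<Delta>) (orbit_space G) \<gamma>" and s: "\<gamma> ` \<Delta> \<subseteq> D"
        by (auto simp: paths_in_def)
      have "continuous_map (top_of_set \<Delta>) (subtopology (orbit_space G) D) \<gamma>"
        using c s by (auto simp: continuous_map_in_subtopology)
      then have cf: "continuous_map (top_of_set \<Delta>) (orbit_space G') (f \<circ> \<gamma>)"
        by (rule continuous_map_compose[OF _ cont'])
      have path': "(\<Delta>, f \<circ> \<gamma>) \<in> paths_in (orbit_space G') (f ` D)"
        unfolding paths_in_def using \<Delta> cf s by auto
      show "1 \<le> curve_integral orbit_dist \<sigma> c'"
      proof (cases "c' \<in> \<Gamma>0")
        case True
        then have "1 \<le> curve_integral orbit_dist \<rho>0 c'" using \<rho>0(1) rect' by (simp add: admissible_def)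
        also have "\<dots> \<le> curve_integral orbit_dist \<sigma> c'" by (rule curve_integral_mono) (simp add: \<sigma>_def)
        finally show ?thesis .
      next
        case False
        then have lifts: "\<forall>\<gamma>1. (\<Delta>, \<gamma>1) \<in> paths_in (orbit_space G) D \<and> (\<forall>t\<in>\<Delta>. f (\<gamma>1 t) = (f \<circ> \<gamma>) t) \<longrightarrow>
              locally_rectifiable orbit_dist (\<Delta>, \<gamma>1) \<and>
              lift_inverse_abs_continuous orbit_dist orbit_dist \<Delta> \<gamma>1 (f \<circ> \<gamma>)"
          using path' rect' unfolding c' \<Gamma>0_def by blast
        \<comment> \<open>The path is itself one of the lifts of its image, and that image is not
          exceptional.\<close>
        have l: "locally_rectifiable orbit_dist (\<Delta>, \<gamma>)" "lift_inverse_abs_continuous orbit_dist orbit_dist \<Delta> \<gamma> (f \<circ> \<gamma>)"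
          using lifts[rule_format, of \<gamma>] path by simp_all
        have "1 \<le> curve_integral orbit_dist \<rho> (\<Delta>, \<gamma>)" using assms(22) \<gamma> l(1) by (auto simp: admissible_def)
        also have "\<dots> \<le> curve_integral orbit_dist \<rho>' (\<Delta>, f \<circ> \<gamma>)"
        proof (rule curve_integral_push_forward[OF \<rho>'(2) path cf _ l(1) rect'[unfolded c'] l(2)])
          fix p assume "p \<in> D"
          then show "\<exists>U. openin (orbit_space G) U \<and> U \<inter> {q \<in> D. f q = f p} = {p}"
            using disc fD' unfolding discrete_mapping_def by blast
        qed
        also have "\<dots> \<le> curve_integral orbit_dist \<sigma> c'" unfolding c' by (rule curve_integral_mono) (simp add: \<sigma>_def)
        finally show ?thesis .
      qed
    qed
    then have "modulus G' p0' (image_family f \<Gamma>) \<le> (\<integral>\<^sup>+ q. \<sigma> q ^ CARD('n) \<partial>Y.OM)"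
      unfolding modulus_def by (rule INF_lower)
    also have "\<dots> \<le> (\<integral>\<^sup>+ q. \<rho>' q ^ CARD('n) + \<rho>0 q ^ CARD('n) \<partial>Y.OM)"
      by (rule nn_integral_mono) (auto simp: \<sigma>_def max_def)
    also have "\<dots> = (\<integral>\<^sup>+ q. \<rho>' q ^ CARD('n) \<partial>Y.OM) + (\<integral>\<^sup>+ q. \<rho>0 q ^ CARD('n) \<partial>Y.OM)"
      by (intro nn_integral_add borel_measurable_power_ennreal)
        (rule Y.borel_measurable_orbit[OF \<rho>'(1)], rule Y.borel_measurable_orbit[OF \<rho>0m])
    also have "\<dots> \<le> (\<integral>\<^sup>+ p\<in>D. orbit_inner_dilatation G G' f p * \<rho> p ^ CARD('n) \<partial>X.OM) + ennreal e"
      using \<rho>'(3) \<rho>0(2) by (intro add_mono) auto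
    finally show "modulus G' p0' (image_family f \<Gamma>) \<le>
        (\<integral>\<^sup>+ p\<in>D. orbit_inner_dilatation G G' f p * \<rho> p ^ CARD('n) \<partial>X.OM) + ennreal e" .
  qed
qed

end
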